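(* Let $F$ be a nondegenerate distribution function on the positive integers with $F(x)=0$ for $x<2$, and suppose there exist $c>0$ and $\tau>3$ such that $1-F(x)\le c\,x^{-(\tau-1)}$ for all $x\ge 0$. Let $D$ have distribution function $F$ and set $\nu=\mathbb{E}[D(D-1)]/\mathbb{E}[D]$. Consider the configuration model on $n$ vertices with i.i.d. degrees with distribution $F$ and i.i.d. exponential edge weights with mean $1$, and let $H_n$ and $W_n$ be, respectively, the number of edges and the total weight of the minimal-weight path between vertices $1$ and $2$, conditioned on vertices $1$ and $2$ being connected. Then: (a) with $\alpha=\nu/(\nu-1)\in(1,\infty)$, $$\frac{H_n-\alpha\log n}{\sqrt{\alpha\log n}}\xrightarrow{d} Z,$$ where $Z$ is a standard normal random variable; (b) there exists a random variable $V$ such that $W_n-\frac{\log n}{\nu-1}\xrightarrow{d} V$.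
   Context: Configuration model: let $D_1,\dots,D_n$ be i.i.d. random variables with distribution function $F$ (if $D_1+\cdots+D_n$ is odd, $D_n$ is replaced by $D_n+1$). Vertex $i\in\{1,\dots,n\}$ is given $D_i$ half-edges (stubs), and the multigraph is obtained by pairing all stubs uniformly at random (self-loops and multiple edges allowed). Each edge independently receives a weight that is exponentially distributed with mean $1$, independent of the graph; the weight of a path is the sum of the weights of its edges. $\xrightarrow{d}$ denotes convergence in distribution as $n\to\infty$. *)

theory Defs
  imports "HOL-Probability.Probability"
begin

definition cdf_pmf :: "nat pmf \<Rightarrow> real \<Rightarrow> real" where
  "cdf_pmf p x = measure_pmf.prob p {k. real k \<le> x}"

text \<open>Stubs (half-edges): stub (i,j) is the j-th half-edge of vertex i, vertices are 1..n.\<close>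
definition stubs :: "nat \<Rightarrow> (nat \<Rightarrow> nat) \<Rightarrow> (nat \<times> nat) set" where
  "stubs n d = {(i, j). i \<in> {1..n} \<and> j < d i}"

definition matchings :: "(nat \<times> nat) set \<Rightarrow> ((nat \<times> nat) \<Rightarrow> (nat \<times> nat)) set" where
  "matchings S = {m. (\<forall>s\<in>S. m s \<in> S \<and> m s \<noteq> s \<and> m (m s) = s) \<and> (\<forall>s. s \<notin> S \<longrightarrow> m s = s)}"

definition fix_parity :: "nat \<Rightarrow> (nat \<Rightarrow> nat) \<Rightarrow> (nat \<Rightarrow> nat)" where
  "fix_parity n d = (if odd (\<Sum>i\<in>{1..n}. d i) then d(n := d n + 1) else d)"

definition config_pmf :: "nat \<Rightarrow> nat pmf \<Rightarrow> ((nat \<Rightarrow> nat) \<times> ((nat \<times> nat) \<Rightarrow> (nat \<times> nat))) pmf" where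
  "config_pmf n p =
     bind_pmf (Pi_pmf {1..n} 0 (\<lambda>_. p)) (\<lambda>d0.
       let d = fix_parity n d0 in
       bind_pmf (pmf_of_set (matchings (stubs n d))) (\<lambda>m. return_pmf (d, m)))"

text \<open>Joint law of the graph and i.i.d. Exp(1) weights indexed by stubs; the edge
  formed by stubs s and m s carries the weight of the smaller of the two stubs,
  so that distinct edges carry independent Exp(1) weights.\<close>
definition weighted_CM ::
  "nat \<Rightarrow> nat pmf \<Rightarrow> (((nat \<Rightarrow> nat) \<times> ((nat \<times> nat) \<Rightarrow> (nat \<times> nat))) \<times> ((nat \<times> nat) \<Rightarrow> real)) measure" where
  "weighted_CM n p = measure_pmf (config_pmf n p) \<Otimes>\<^sub>M
      (\<Pi>\<^sub>M s\<in>(UNIV :: (nat \<times> nat) set). density lborel (exponential_density 1))"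

text \<open>A path from vertex u to vertex v with distinct vertices, given as the list of stubs
  by which its successive edges are left: edge k goes from vertex fst (ss!k) to vertex
  fst (m (ss!k)).\<close>
definition is_path ::
  "nat \<Rightarrow> (nat \<Rightarrow> nat) \<Rightarrow> ((nat \<times> nat) \<Rightarrow> (nat \<times> nat)) \<Rightarrow> nat \<Rightarrow> nat \<Rightarrow> (nat \<times> nat) list \<Rightarrow> bool" where
  "is_path n d m u v ss \<longleftrightarrow>
     ss \<noteq> [] \<and> set ss \<subseteq> stubs n d \<and>
     fst (hd ss) = u \<and> fst (m (last ss)) = v \<and>
     (\<forall>k. Suc k < length ss \<longrightarrow> fst (m (ss ! k)) = fst (ss ! Suc k)) \<and>
     distinct (map fst ss @ [fst (m (last ss))])"

definition paths12 :: "nat \<Rightarrow> (nat \<Rightarrow> nat) \<Rightarrow> ((nat \<times> nat) \<Rightarrow> (nat \<times> nat)) \<Rightarrow> (nat \<times> nat) list set" where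
  "paths12 n d m = {ss. is_path n d m 1 2 ss}"

definition connected12 :: "nat \<Rightarrow> (nat \<Rightarrow> nat) \<times> ((nat \<times> nat) \<Rightarrow> (nat \<times> nat)) \<Rightarrow> bool" where
  "connected12 n g \<longleftrightarrow> paths12 n (fst g) (snd g) \<noteq> {}"

definition edge_key :: "nat \<times> nat \<Rightarrow> nat \<times> nat \<Rightarrow> nat \<times> nat" where
  "edge_key s t = (if fst s < fst t \<or> (fst s = fst t \<and> snd s \<le> snd t) then s else t)"

definition path_weight ::
  "((nat \<times> nat) \<Rightarrow> (nat \<times> nat)) \<Rightarrow> ((nat \<times> nat) \<Rightarrow> real) \<Rightarrow> (nat \<times> nat) list \<Rightarrow> real" where
  "path_weight m w ss = (\<Sum>s\<leftarrow>ss. w (edge_key s (m s)))"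

definition W12 :: "nat \<Rightarrow> ((nat \<Rightarrow> nat) \<times> ((nat \<times> nat) \<Rightarrow> (nat \<times> nat))) \<times> ((nat \<times> nat) \<Rightarrow> real) \<Rightarrow> real" where
  "W12 n x = (let d = fst (fst x); m = snd (fst x); w = snd x in
     Min (path_weight m w ` paths12 n d m))"

text \<open>H_n: number of edges of the minimal-weight path (ties, a null event, are broken
  by taking the fewest edges).\<close>
definition H12 :: "nat \<Rightarrow> ((nat \<Rightarrow> nat) \<times> ((nat \<times> nat) \<Rightarrow> (nat \<times> nat))) \<times> ((nat \<times> nat) \<Rightarrow> real) \<Rightarrow> nat" where
  "H12 n x = (let d = fst (fst x); m = snd (fst x); w = snd x in
     Min {length ss | ss. ss \<in> paths12 n d m \<and> path_weight m w ss = W12 n x})"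

definition conn_event :: "nat \<Rightarrow> nat pmf \<Rightarrow> (((nat \<Rightarrow> nat) \<times> ((nat \<times> nat) \<Rightarrow> (nat \<times> nat))) \<times> ((nat \<times> nat) \<Rightarrow> real)) set" where
  "conn_event n p = {x \<in> space (weighted_CM n p). connected12 n (fst x)}"

end

theory Submission
 imports Defs
begin

text \<open>
 Let \<open>N\<close> be the multigraph seen from vertices 1 and 2, and let the two first-passage clusters grow so
 that always the one with the fewer free stubs moves. By memorylessness, if the smaller cluster has
 \<open>s\<close> and the larger one \<open>b\<close> free stubs, the time to the next event is exponential with rate \<open>s\<close>, and the
 stub that rings is matched to a uniform free stub. The joint transform
 \<open>E[exp(i l W) z^H; connected]\<close> therefore satisfies an exact recursion in which a cluster enters only
 through its number of free stubs, averaged over the generation of the matched stub.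

 The recursion is solved approximately by \<open>E[(1 + c L X / (s b))^\<omega>]\<close>, where \<open>X\<close> is a standard
 exponential variable, \<open>L\<close> the total degree, \<open>c = \<nu> - 1\<close> and \<open>c \<omega> = (c + 1) (z - 1) + i l\<close>; the error
 is small uniformly in \<open>n\<close> when \<open>z\<close> is close to 1 and \<open>\<omega>\<close> is small, and also when \<open>s\<close> and \<open>b\<close> are large.
 For \<open>l = 0\<close> and \<open>z = exp(i u / sqrt(\<alpha> log n))\<close> the transform is thus \<open>n^\<omega> (1 + o(1))\<close> with
 \<open>\<omega> = \<alpha> (z - 1)\<close>, as for a Poisson variable of mean \<open>\<alpha> log n\<close>, which gives the central limit theorem.
 For \<open>z = 1\<close>, finitely many steps of the recursion, whose coefficients converge, lead to large \<open>s\<close> and \<open>b\<close>,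
 so the transform of the centred weight converges; tightness follows from the bound near \<open>l = 0\<close>.
\<close>

text \<open>Origin of the approximate solution: a cluster with s free stubs grows like s e^(ct) and
  meets the other one, of size b, at rate s e^(ct) b / L. The accumulated hazard s b (e^(ct) - 1) /
  (c L) reaches a standard exponential X when e^(ct) = 1 + c L X / (s b). The time contributes
  e^(ilt), the generations, which accumulate at rate c + 1, contribute e^((c + 1) (z - 1) t), and
  the product is the power \<omega> of that quantity. The clusters meet only after about sqrt n
  steps, too many for adding up crude local errors. The error is dominated instead by an explicit
  supersolution of the recursion, whose terms pay for the local errors at small sizes, for the
  collision and for the number of steps. Moving the smaller cluster keeps the other one large
  whenever the total is, which bounds the collision probability from below. Two constraints shape
  the constants: degrees may have little more than two moments, so the one-step error interpolates
  between a linear and a quadratic bound, and all degree sums must be stable under deletion of about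
  n^(3/5) explored vertices.\<close>

section \<open>Paths as lists of edge keys, and how a ringing clock reduces the path problem\<close>

definition key :: "(nat \<times> nat \<Rightarrow> nat \<times> nat) \<Rightarrow> nat \<times> nat \<Rightarrow> nat \<times> nat" where
 "key m s = edge_key s (m s)"

definition vstubs :: "(nat \<Rightarrow> nat) \<Rightarrow> nat set \<Rightarrow> (nat \<times> nat) set" where
 "vstubs d U = {s. fst s \<in> U \<and> snd s < d (fst s)}"

text \<open>A path that leaves by the stub \<open>a\<close> and arrives by the stub
  \<open>b\<close>, with interior vertices in \<open>U\<close> and \<open>ks\<close> the indices of
  its edge weights. Deleting \<open>v\<close> from \<open>U\<close> makes the interior vertices
  distinct. The exit stub \<open>a'\<close> may formally equal the entry stub \<open>m a\<close>;
  for the clusters considered below such a path cannot be completed, since its partner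
  \<open>a\<close> is neither a target nor a stub of an unvisited vertex.\<close>

inductive conn :: "(nat \<times> nat \<Rightarrow> nat \<times> nat) \<Rightarrow> (nat \<Rightarrow> nat) \<Rightarrow> nat set \<Rightarrow> nat \<times> nat \<Rightarrow> nat \<times> nat
  \<Rightarrow> (nat \<times> nat) list \<Rightarrow> bool" for m d where
 edge: "conn m d U a (m a) [key m a]"
| step: "\<lbrakk>v \<in> U; m a \<in> vstubs d {v}; a' \<in> vstubs d {v}; conn m d (U - {v}) a' b ks\<rbrakk>
  \<Longrightarrow> conn m d U a b (key m a # ks)"

text \<open>\<open>A\<close> and \<open>B\<close> are the free stubs of the two clusters, and
  \<open>g\<close>, \<open>h\<close> are their generations: the number of edges already spent
  between the root of the cluster and the stub. The second component is thus the hop count of the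
  full path, explored part included.\<close>

definition pathset where
 "pathset m d U A g B h =
  {(ks, g a + length ks + h b) | a b ks. a \<in> A \<and> b \<in> B \<and> conn m d U a b ks}"

definition costs :: "(nat \<times> nat \<Rightarrow> real) \<Rightarrow> ((nat \<times> nat) list \<times> nat) set \<Rightarrow> (real \<times> nat) set" where
 "costs w P = (\<lambda>(ks, k). (\<Sum>s\<leftarrow>ks. w s, k)) ` P"

text \<open>The value 0 for the empty set builds the indicator of connection into the transform.
  Among paths of minimal weight the smallest hop count is taken, the same tie rule as in
  \<open>H12\<close>.\<close>

definition lexval :: "real \<Rightarrow> complex \<Rightarrow> (real \<times> nat) set \<Rightarrow> complex" where
 "lexval l z X = (if X = {} then 0
  else exp (\<i> * l * Min (fst ` X)) * z ^ Min {k. (Min (fst ` X), k) \<in> X})"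

lemma pathsetI:
 "a \<in> A \<Longrightarrow> b \<in> B \<Longrightarrow> conn m d U a b ks \<Longrightarrow> k = g a + length ks + h b
  \<Longrightarrow> (ks, k) \<in> pathset m d U A g B h"
 unfolding pathset_def by blast

lemma edge_key_commute: "edge_key s t = edge_key t s"
 by (cases s; cases t) (auto simp: edge_key_def)

lemma key_involution: "m (m s) = s \<Longrightarrow> key m (m s) = key m s"
 by (simp add: key_def edge_key_commute)

lemma key_cases: "key m s = s \<or> key m s = m s"
 by (simp add: key_def edge_key_def)

lemma vstubs_mono: "U \<subseteq> W \<Longrightarrow> vstubs d U \<subseteq> vstubs d W"
 by (auto simp: vstubs_def)

lemma vstubs_eq_Sigma: "vstubs d U = Sigma U (\<lambda>v. {..<d v})"
 by (auto simp: vstubs_def)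

lemma finite_vstubs: "finite U \<Longrightarrow> finite (vstubs d U)"
 by (simp add: vstubs_eq_Sigma)

lemma card_vstubs: "finite U \<Longrightarrow> card (vstubs d U) = (\<Sum>v\<in>U. d v)"
 by (simp add: vstubs_eq_Sigma)

lemma vstubs_fst: "s \<in> vstubs d U \<Longrightarrow> s \<in> vstubs d {fst s} \<and> fst s \<in> U"
 by (auto simp: vstubs_def)

lemma vstubs_single_mem: "s \<in> vstubs d {v} \<Longrightarrow> v \<in> U \<Longrightarrow> s \<in> vstubs d U"
 by (auto simp: vstubs_def)

lemma conn_ne: "conn m d U a b ks \<Longrightarrow> \<exists>ks'. ks = key m a # ks'"
 by (auto elim: conn.cases)

lemma conn_mono: "conn m d W a b ks \<Longrightarrow> W \<subseteq> U \<Longrightarrow> conn m d U a b ks"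
proof (induction W a b ks arbitrary: U rule: conn.induct)
 case (edge W a) show ?case by (rule conn.edge[of m d U a])
next
 case (step v W a a' b ks)
 have "conn m d (U - {v}) a' b ks" using step by blast
 then show ?case using step by (intro conn.step[of v]) auto
qed

lemma conn_partner: "conn m d U a b ks \<Longrightarrow> m a = b \<or> m a \<in> vstubs d U"
 by (erule conn.cases) (auto simp: vstubs_def)

lemma conn_key:
 "conn m d W a b ks \<Longrightarrow> k \<in> set ks \<Longrightarrow>
  \<exists>s. k = key m s \<and> s \<in> insert a (vstubs d W) \<and> (m s = b \<or> m s \<in> vstubs d W)"
proof (induction W a b ks rule: conn.induct)
 case (edge W a)
 then have "k = key m a" by simp
 then show ?case by (intro exI[of _ a] conjI disjI1 insertI1 refl)
next
 case (step v W a a' b ks)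
 show ?case
 proof (cases "k = key m a")
  case True
  then show ?thesis
   using vstubs_single_mem[OF step(2,1)] by (intro exI[of _ a] conjI disjI2 insertI1)
 next
  case False
  then have "k \<in> set ks" using step.prems by simp
  from step.IH[OF this] obtain s where s: "k = key m s" "s \<in> insert a' (vstubs d (W - {v}))"
   "m s = b \<or> m s \<in> vstubs d (W - {v})" by (elim exE conjE)
  have i: "a' \<in> vstubs d W" "vstubs d (W - {v}) \<subseteq> vstubs d W"
   using vstubs_single_mem[OF step(3,1)] vstubs_mono[of "W - {v}" W] by auto
  have "s \<in> insert a (vstubs d W)" using s(2) i by blast
  moreover have "m s = b \<or> m s \<in> vstubs d W" using s(3) i by blast
  ultimately show ?thesis using s(1) by (intro exI[of _ s] conjI)
 qed
qed

lemma conn_length: "conn m d W a b ks \<Longrightarrow> finite W \<Longrightarrow> length ks \<le> Suc (card W)"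
proof (induction W a b ks rule: conn.induct)
 case (edge W a) then show ?case by auto
next
 case (step v W a a' b ks)
 have "card W > 0" using step by (auto simp: card_gt_0_iff)
 then show ?case using step by simp
qed

lemma conn_cong:
 "conn m d W a b ks \<Longrightarrow> (\<And>s. s \<in> insert a (vstubs d W) \<Longrightarrow> m s = m' s) \<Longrightarrow> conn m' d W a b ks"
proof (induction W a b ks rule: conn.induct)
 case (edge W a)
 then have "m a = m' a" by auto
 then show ?case using conn.edge[of m' d W a] by (simp add: key_def)
next
 case (step v W a a' b ks)
 have e: "m a = m' a" using step.prems by auto
 have "conn m' d (W - {v}) a' b ks"
  using step by (intro step.IH) (auto simp: vstubs_def)
 then have "conn m' d W a b (key m' a # ks)"
  using step e by (intro conn.step[of v]) auto
 then show ?case using e by (simp add: key_def)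
qed

text \<open>The rules of \<open>conn\<close> extend a path at its near end only; reversal needs an
  extension at the far end.\<close>

lemma conn_snoc:
 "conn m d W a b ks \<Longrightarrow> W = U - {v} \<Longrightarrow> v \<in> U \<Longrightarrow> b \<in> vstubs d {v} \<Longrightarrow> s \<in> vstubs d {v}
  \<Longrightarrow> conn m d U a (m s) (ks @ [key m s])"
proof (induction W a b ks arbitrary: U rule: conn.induct)
 case (edge W a)
 have "conn m d (U - {v}) s (m s) [key m s]" by (rule conn.edge)
 from conn.step[where m=m, OF edge(2,3,4) this] show ?case by simp
next
 case (step v1 W a a' b ks)
 have "conn m d (U - {v1}) a' (m s) (ks @ [key m s])"
  by (rule step.IH) (use step.hyps(1) step.prems in blast)+
 moreover have "v1 \<in> U" using step by blast
 ultimately show ?case using conn.step[where m=m, OF _ step.hyps(2,3)] by simp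
qed

lemma conn_rev:
 "conn m d U a b ks \<Longrightarrow> (\<And>s. s \<in> insert a (vstubs d U) \<Longrightarrow> m (m s) = s) \<Longrightarrow> conn m d U b a (rev ks)"
proof (induction U a b ks rule: conn.induct)
 case (edge U a)
 then have i: "m (m a) = a" by (meson insertI1)
 show ?case using conn.edge[of m d U "m a"] unfolding key_involution[of m a, OF i] i by simp
next
 case (step v U a a' b ks)
 have i: "m (m a) = a" using step.prems by (meson insertI1)
 have sub: "vstubs d (U - {v}) \<subseteq> vstubs d U" "a' \<in> vstubs d U"
  using vstubs_mono[of "U - {v}" U] vstubs_single_mem[OF step(3,1)] by auto
 have "conn m d (U - {v}) b a' (rev ks)"
  by (rule step.IH) (use step.prems sub in blast)
 from conn_snoc[OF this refl step(1) step(3) step(2)]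
 show ?case unfolding key_involution[of m a, OF i] i by simp
qed

text \<open>Interior vertices are distinct, so cutting a path at its visit to \<open>v\<close>
  leaves a tail that never meets \<open>v\<close> again. The tail is what such a path is compared
  with once \<open>v\<close> has joined the cluster.\<close>

lemma conn_avoid:
 "conn m d W c b ks \<Longrightarrow> conn m d (W - {v}) c b ks \<or>
  (\<exists>a' ks1 ks2. a' \<in> vstubs d {v} \<and> conn m d (W - {v}) a' b ks2 \<and> ks = key m c # ks1 @ ks2)"
proof (induction W c b ks rule: conn.induct)
 case (edge W a) show ?case using conn.edge[of m d "W - {v}" a] by (rule disjI1)
next
 case (step v1 W a a' b ks)
 show ?case
 proof (cases "v1 = v")
  case True
  then show ?thesis using step
   by (intro disjI2 exI[of _ a'] exI[of _ "[]"] exI[of _ ks]) simp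
 next
  case False
  have eq: "W - {v1} - {v} = W - {v} - {v1}" by blast
  have v1: "v1 \<in> W - {v}" using False step(1) by blast
  from step.IH show ?thesis
  proof (elim disjE exE conjE)
   assume "conn m d (W - {v1} - {v}) a' b ks"
   then have "conn m d (W - {v}) a b (key m a # ks)"
    unfolding eq by (rule conn.step[where m=m, OF v1 step.hyps(2,3)])
   then show ?thesis by (rule disjI1)
  next
   fix a'' ks1 ks2
   assume h: "a'' \<in> vstubs d {v}" "conn m d (W - {v1} - {v}) a'' b ks2" "ks = key m a' # ks1 @ ks2"
   have "conn m d (W - {v}) a'' b ks2" by (rule conn_mono[OF h(2)]) blast
   then show ?thesis using h
    by (intro disjI2 exI[of _ a''] exI[of _ "key m a' # ks1"] exI[of _ ks2]) simp
  qed
 qed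
qed

lemma finite_pathset:
 assumes "finite A" "finite B" "finite U"
 shows "finite (pathset m d U A g B h)"
proof -
 let ?S = "key m ` (A \<union> vstubs d U)"
 let ?L = "{ks. set ks \<subseteq> ?S \<and> length ks \<le> Suc (card U)}"
 have "pathset m d U A g B h \<subseteq> (\<lambda>(a, b, ks). (ks, g a + length ks + h b)) ` (A \<times> B \<times> ?L)"
 proof
  fix x assume "x \<in> pathset m d U A g B h"
  then obtain a b ks where x: "x = (ks, g a + length ks + h b)" "a \<in> A" "b \<in> B" "conn m d U a b ks"
   by (auto simp: pathset_def)
  have "set ks \<subseteq> ?S" using conn_key[OF x(4)] x(2) by fastforce
  moreover have "length ks \<le> Suc (card U)" using conn_length[OF x(4)] assms by auto
  ultimately show "x \<in> (\<lambda>(a, b, ks). (ks, g a + length ks + h b)) ` (A \<times> B \<times> ?L)"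
   using x by (intro image_eqI[of _ _ "(a, b, ks)"]) auto
 qed
 moreover have "finite ?L"
  using assms by (intro finite_lists_length_le) (auto simp: finite_vstubs)
 ultimately show ?thesis using assms by (meson finite_SigmaI finite_imageI finite_subset)
qed

text \<open>Only lexicographic minimizers count, so a set of paths may be thinned to any subset that
  contains, for each path, one that is at least as good. Both outcomes of a ringing clock are
  reduced to such a thinning.\<close>

lemma lexval_dominated:
 assumes "finite X" "Y \<subseteq> X"
  and dom: "\<And>t k. (t, k) \<in> X \<Longrightarrow> \<exists>(t', k')\<in>Y. t' < t \<or> (t' = t \<and> k' \<le> k)"
 shows "lexval l z X = lexval l z Y"
proof (cases "X = {}")
 case True then show ?thesis using assms by auto
next
 case False
 have neY: "Y \<noteq> {}" using False dom by fastforce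
 have finY: "finite Y" using assms finite_subset by blast
 have M: "Min (fst ` X) = Min (fst ` Y)"
 proof (rule Min_eqI)
  show "finite (fst ` X)" using assms by auto
  have "Min (fst ` Y) \<in> fst ` Y" using Min_in[of "fst ` Y"] finY neY by blast
  then show "Min (fst ` Y) \<in> fst ` X" using assms(2) by blast
  fix t assume "t \<in> fst ` X"
  then obtain k where "(t, k) \<in> X" by auto
  then obtain t' k' where tk: "(t', k') \<in> Y" "t' \<le> t" using dom by fastforce
  have "Min (fst ` Y) \<le> t'" using tk(1) finY by (intro Min_le) force+
  then show "Min (fst ` Y) \<le> t" using tk(2) by simp
 qed
 let ?M = "Min (fst ` Y)"
 let ?A = "{k. (?M, k) \<in> X}" and ?B = "{k. (?M, k) \<in> Y}"
 have finA: "finite ?A"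
  by (rule finite_subset[of _ "snd ` X"]) (use assms in force)+
 have BA: "?B \<subseteq> ?A" using assms by auto
 have finB: "finite ?B" using finA BA finite_subset by blast
 have "?M \<in> fst ` Y" using finY neY by (intro Min_in) auto
 then have neB: "?B \<noteq> {}" by force
 have "Min ?A = Min ?B"
 proof (rule Min_eqI)
  show "finite ?A" by fact
  show "Min ?B \<in> ?A" using Min_in[OF finB neB] BA by auto
  fix k assume "k \<in> ?A"
  then obtain t' k' where tk: "(t', k') \<in> Y" "t' < ?M \<or> (t' = ?M \<and> k' \<le> k)" using dom by fastforce
  have "?M \<le> t'" using tk(1) finY by (intro Min_le) force+
  then have "k' \<in> ?B" "k' \<le> k" using tk by auto
  then show "Min ?B \<le> k" using finB by (meson Min_le order_trans)
 qed
 then show ?thesis using False neY M by (simp add: lexval_def)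
qed

lemma lexval_shift:
 assumes "finite X"
 shows "lexval l z ((\<lambda>(t, k). (x + t, k)) ` X) = exp (\<i> * l * x) * lexval l z X"
proof (cases "X = {}")
 case True then show ?thesis by (simp add: lexval_def)
next
 case False
 let ?Y = "(\<lambda>(t, k). (x + t, k)) ` X"
 have i: "fst ` ?Y = (\<lambda>t. x + t) ` fst ` X" by (force simp: image_image)
 have M: "Min (fst ` ?Y) = x + Min (fst ` X)"
  unfolding i using assms False by (intro mono_Min_commute[symmetric]) (auto intro: monoI)
 have "{k. (Min (fst ` ?Y), k) \<in> ?Y} = {k. (Min (fst ` X), k) \<in> X}"
  unfolding M by force
 then show ?thesis using False M by (simp add: lexval_def exp_add[symmetric] algebra_simps)
qed

lemma lexval_single: "lexval l z {(t, k)} = exp (\<i> * l * t) * z ^ k"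
 by (simp add: lexval_def)

lemma finite_costs: "finite P \<Longrightarrow> finite (costs w P)"
 by (simp add: costs_def)

text \<open>The invariant of the exploration: the free stubs of the clusters and the stubs of the
  unexplored vertices are disjoint, and \<open>m\<close> pairs up their union. Two free stubs of one
  cluster may be paired with each other; \<open>bdry\<close> singles out the others.\<close>

definition fstate where
 "fstate m d U A B \<longleftrightarrow> finite U \<and> finite A \<and> finite B \<and> A \<inter> B = {} \<and> A \<inter> vstubs d U = {} \<and> B \<inter> vstubs d U = {}
  \<and> (\<forall>s \<in> A \<union> B \<union> vstubs d U. m s \<in> A \<union> B \<union> vstubs d U \<and> m s \<noteq> s \<and> m (m s) = s)"

lemma fstate_sym: "fstate m d U A B \<Longrightarrow> fstate m d U B A"
 unfolding fstate_def by (metis Int_commute Un_commute)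

definition bdry where "bdry m A = {a \<in> A. m a \<notin> A}"

text \<open>The key of an edge is one of its own two stubs and \<open>m\<close> is an involution, so
  a key determines its edge.\<close>

lemma key_inj:
 assumes "fstate m d U A B" "a \<in> bdry m A" "s \<in> A \<union> B \<union> vstubs d U" "key m s = key m a"
 shows "s = a \<or> m s = a"
 using assms key_cases[of m s] key_cases[of m a] unfolding fstate_def bdry_def by (metis (lifting) UnCI mem_Collect_eq)

lemma inj_key_bdry: "fstate m d U A B \<Longrightarrow> inj_on (key m) (bdry m A)"
 by (rule inj_onI) (metis (no_types, lifting) UnCI bdry_def key_inj mem_Collect_eq)

text \<open>If the clock \<open>e\<close> rings first among the clocks \<open>K\<close>, at time
  \<open>x\<close>, the weights are recovered in this form from \<open>x\<close> and the residual
  weights \<open>w\<close>.\<close>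

definition shift :: "'k set \<Rightarrow> 'k \<Rightarrow> real \<Rightarrow> ('k \<Rightarrow> real) \<Rightarrow> 'k \<Rightarrow> real" where
 "shift K e x w = (\<lambda>k. if k = e then x else if k \<in> K then x + w k else w k)"

text \<open>Beyond its first edge a path runs between unexplored vertices or into \<open>B\<close>,
  and no such edge is a boundary edge of \<open>A\<close>: by \<open>key_inj\<close> it would have a
  stub in \<open>A\<close>. The shift is therefore invisible there.\<close>

lemma inner_weight:
 assumes st: "fstate m d U A B" and c: "conn m d W c b ks" "W \<subseteq> U" "c \<in> vstubs d U" "b \<in> B"
  and e: "e \<in> key m ` bdry m A"
 shows "(\<Sum>s\<leftarrow>ks. shift (key m ` bdry m A) e x w s) = (\<Sum>s\<leftarrow>ks. w s)"
proof -
 have "k \<notin> key m ` bdry m A" if "k \<in> set ks" for k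
 proof
  note kin = that
  assume "k \<in> key m ` bdry m A"
  then obtain a where a: "a \<in> bdry m A" "k = key m a" by auto
  obtain s where s: "k = key m s" "s \<in> insert c (vstubs d W)" "m s = b \<or> m s \<in> vstubs d W"
   using conn_key[OF c(1) kin] by blast
  have s1: "s \<in> vstubs d U" using s c vstubs_mono[OF c(2)] by auto
  have "s = a \<or> m s = a" using key_inj[OF st a(1), of s] s a s1 by auto
  then show False using s s1 a c vstubs_mono[OF c(2), of d] st unfolding fstate_def bdry_def by auto
 qed
 then have "map (shift (key m ` bdry m A) e x w) ks = map w ks"
  using e by (intro map_cong refl) (metis shift_def)
 then show ?thesis by metis
qed

text \<open>The first edge is a boundary edge other than the one that rang, so it pays
  \<open>x\<close> on top of its residual weight; the rest is covered by
  \<open>inner_weight\<close>, so \<open>x\<close> is paid exactly once.\<close>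

lemma outer_weight:
 assumes st: "fstate m d U A B" and c: "conn m d U c b ks" "c \<in> A" "b \<in> B"
  and a: "a \<in> bdry m A" "c \<noteq> a"
 shows "(\<Sum>s\<leftarrow>ks. shift (key m ` bdry m A) (key m a) x w s) = x + (\<Sum>s\<leftarrow>ks. w s)"
  and "c \<in> bdry m A"
proof -
 have "m c \<notin> A" using conn_partner[OF c(1)] c st unfolding fstate_def by auto
 then show cb: "c \<in> bdry m A" using c by (simp add: bdry_def)
 have ne: "key m c \<noteq> key m a" using inj_onD[OF inj_key_bdry[OF st], of c a] cb a by auto
 have f: "shift (key m ` bdry m A) (key m a) x w (key m c) = x + w (key m c)"
  using ne cb by (auto simp: shift_def)
 from c(1) show "(\<Sum>s\<leftarrow>ks. shift (key m ` bdry m A) (key m a) x w s) = x + (\<Sum>s\<leftarrow>ks. w s)"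
 proof (cases rule: conn.cases)
  case edge then show ?thesis using f by simp
 next
  case (step v a' ks')
  have "(\<Sum>s\<leftarrow>ks'. shift (key m ` bdry m A) (key m a) x w s) = (\<Sum>s\<leftarrow>ks'. w s)"
   by (rule inner_weight[OF st step(5)]) (use step c a in \<open>auto simp: vstubs_def\<close>)
  then show ?thesis using step f by simp
 qed
qed

lemma shift_nonneg: "(\<And>k. w k > 0) \<Longrightarrow> x \<ge> 0 \<Longrightarrow> shift K e x w k \<ge> 0"
 by (simp add: shift_def order_less_imp_le add_nonneg_nonneg)

lemma shift_gt: "(\<And>k. w k > 0) \<Longrightarrow> k \<in> K \<Longrightarrow> k \<noteq> e \<Longrightarrow> shift K e x w k > x"
 by (simp add: shift_def)

text \<open>The edge at \<open>a\<close> costs exactly \<open>x\<close>. A path through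
  \<open>a\<close> can only be this edge, because its far end already lies in \<open>B\<close>; any
  other path starts with a boundary edge of weight strictly above \<open>x\<close>. Positivity of
  the residual weights makes the comparison strict, so no tie arises.\<close>

lemma lexval_hit:
 assumes st: "fstate m d U A B" and a: "a \<in> A" "m a \<in> B" and w: "\<And>k. w k > 0" and x: "x \<ge> 0"
 shows "lexval l z (costs (shift (key m ` bdry m A) (key m a) x w) (pathset m d U A g B h))
  = exp (\<i> * l * x) * z ^ (g a + 1 + h (m a))"
proof -
 let ?w = "shift (key m ` bdry m A) (key m a) x w" and ?k = "g a + 1 + h (m a)"
 let ?P = "pathset m d U A g B h"
 have ab: "a \<in> bdry m A" using a st unfolding fstate_def bdry_def by auto
 have fin: "finite (costs ?w ?P)" using st finite_pathset unfolding fstate_def by (intro finite_costs) auto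
 have "lexval l z (costs ?w ?P) = lexval l z {(x, ?k)}"
 proof (rule lexval_dominated[OF fin])
  have "([key m a], ?k) \<in> ?P" by (rule pathsetI[of a _ "m a"]) (use a conn.edge[of m d U a] in auto)
  then show "{(x, ?k)} \<subseteq> costs ?w ?P" by (force simp: costs_def shift_def)
 next
  fix t k assume "(t, k) \<in> costs ?w ?P"
  then obtain c b ks where c: "c \<in> A" "b \<in> B" "conn m d U c b ks" "t = (\<Sum>s\<leftarrow>ks. ?w s)" "k = g c + length ks + h b"
   by (auto simp: costs_def pathset_def)
  show "\<exists>(t', k')\<in>{(x, ?k)}. t' < t \<or> (t' = t \<and> k' \<le> k)"
  proof (cases "c = a")
   case True
   from c(3) show ?thesis
   proof (cases rule: conn.cases)
    case edge then show ?thesis using True c by (simp add: shift_def)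
   next
    case (step v a' ks')
    then have "m a \<in> vstubs d U" using True by (auto simp: vstubs_def)
    then show ?thesis using a st unfolding fstate_def by auto
   qed
  next
   case False
   have cb: "c \<in> bdry m A" by (rule outer_weight(2)[OF st c(3,1,2) ab False])
   obtain ks' where ks: "ks = key m c # ks'" using conn_ne[OF c(3)] by auto
   have "key m c \<noteq> key m a" using inj_onD[OF inj_key_bdry[OF st], of c a] cb ab False by auto
   then have "?w (key m c) > x" using cb w by (intro shift_gt) auto
   moreover have "(\<Sum>s\<leftarrow>ks'. ?w s) \<ge> 0" by (rule sum_list_nonneg) (auto simp: shift_nonneg[of w x, OF w x])
   ultimately show ?thesis using c ks by auto
  qed
 qed
 then show ?thesis by (simp add: lexval_single)
qed

text \<open>Absorbing \<open>v\<close> loses nothing: paths through \<open>a\<close> become paths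
  from the new stubs of \<open>v\<close>, paths that avoid \<open>v\<close> keep their form, and a
  path that enters \<open>v\<close> through another boundary edge is beaten by its own tail started
  at \<open>v\<close>. All surviving paths cost \<open>x\<close> more than in the reduced problem,
  which is the factor in front.\<close>

lemma lexval_grow:
 fixes g :: "nat \<times> nat \<Rightarrow> nat"
 assumes st: "fstate m d U A B" and a: "a \<in> A" "m a \<in> vstubs d {v}" "v \<in> U" and w: "\<And>k. w k > 0" and x: "x \<ge> 0"
 defines "A' \<equiv> (A - {a}) \<union> (vstubs d {v} - {m a})"
 defines "g' \<equiv> (\<lambda>s. if s \<in> A then g s else g a + 1)"
 shows "lexval l z (costs (shift (key m ` bdry m A) (key m a) x w) (pathset m d U A g B h))
  = exp (\<i> * l * x) * lexval l z (costs w (pathset m d (U - {v}) A' g' B h))"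
proof -
 let ?w = "shift (key m ` bdry m A) (key m a) x w"
 let ?P = "pathset m d U A g B h" and ?P' = "pathset m d (U - {v}) A' g' B h"
 have vU: "vstubs d {v} \<subseteq> vstubs d U" using a by (auto simp: vstubs_def)
 have ab: "a \<in> bdry m A" using a vU st unfolding fstate_def bdry_def by auto
 have keya: "?w (key m a) = x" by (simp add: shift_def)
 have fin: "finite (costs ?w ?P)" using st finite_pathset unfolding fstate_def by (intro finite_costs) auto
 have fin': "finite (costs w ?P')"
  using st finite_pathset[of A' B "U - {v}"] finite_vstubs[of "{v}" d]
  unfolding fstate_def A'_def by (intro finite_costs) auto
 let ?Y = "(\<lambda>(t, k). (x + t, k)) ` costs w ?P'"
 \<comment> \<open>The stub by which \<open>v\<close> was entered cannot start a path into
   \<open>B\<close>, so \<open>A'\<close> may omit it.\<close>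
 have nb: "a' \<noteq> m a" if "conn m d (U - {v}) a' b ks" "b \<in> B" for a' b ks
 proof
  assume "a' = m a"
  then have "m a' = a" using st a unfolding fstate_def by auto
  then show False using conn_partner[OF that(1)] st that a vstubs_mono[of "U - {v}" U d]
   unfolding fstate_def by auto
 qed
 have iw: "(\<Sum>s\<leftarrow>ks. ?w s) = (\<Sum>s\<leftarrow>ks. w s)"
  if "conn m d (U - {v}) a' b ks" "a' \<in> vstubs d {v}" "b \<in> B" for a' b ks
  by (rule inner_weight[OF st that(1)]) (use that vU ab in auto)
 have memY: "(x + (\<Sum>s\<leftarrow>ks. w s), g' c + length ks + h b) \<in> ?Y"
  if "c \<in> A'" "b \<in> B" "conn m d (U - {v}) c b ks" for c b ks
 proof -
  have "(ks, g' c + length ks + h b) \<in> ?P'" using that unfolding pathset_def by blast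
  then have "(\<Sum>s\<leftarrow>ks. w s, g' c + length ks + h b) \<in> costs w ?P'"
   unfolding costs_def by (rule rev_image_eqI) simp
  then show ?thesis by (rule rev_image_eqI) simp
 qed
 have "lexval l z (costs ?w ?P) = lexval l z ?Y"
 proof (rule lexval_dominated[OF fin])
  show "?Y \<subseteq> costs ?w ?P"
  proof
   fix y assume "y \<in> ?Y"
   then obtain c b ks where c: "c \<in> A'" "b \<in> B" "conn m d (U - {v}) c b ks"
    "y = (x + (\<Sum>s\<leftarrow>ks. w s), g' c + length ks + h b)"
    by (auto simp: costs_def pathset_def)
   have cU: "conn m d U c b ks" using conn_mono[OF c(3)] by auto
   have yI: "y \<in> costs ?w ?P" if "(ks', k') \<in> ?P" "(\<Sum>s\<leftarrow>ks'. ?w s) = fst y" "k' = snd y" for ks' k'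
    using that(1) unfolding costs_def by (rule rev_image_eqI) (use that in \<open>simp add: prod_eq_iff\<close>)
   show "y \<in> costs ?w ?P"
   proof (cases "c \<in> A")
    case True
    then have "c \<noteq> a" using c vU st unfolding A'_def fstate_def by auto
    have "(\<Sum>s\<leftarrow>ks. ?w s) = x + (\<Sum>s\<leftarrow>ks. w s)"
     by (rule outer_weight(1)[OF st cU True c(2) ab \<open>c \<noteq> a\<close>])
    moreover have "(ks, g c + length ks + h b) \<in> ?P" using True c(2) cU unfolding pathset_def by blast
    ultimately show ?thesis using c(4) True by (intro yI) (simp_all add: g'_def)
   next
    case False
    then have cv: "c \<in> vstubs d {v}" using c by (auto simp: A'_def)
    have "conn m d U a b (key m a # ks)" by (rule conn.step[OF a(3,2) cv c(3)])
    then have 1: "(key m a # ks, g a + length (key m a # ks) + h b) \<in> ?P"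
     using a(1) c(2) unfolding pathset_def by blast
    have 2: "(\<Sum>s\<leftarrow>key m a # ks. ?w s) = x + (\<Sum>s\<leftarrow>ks. w s)"
     using iw[OF c(3) cv c(2)] keya by simp
    show ?thesis
    proof (rule yI[OF 1])
     show "(\<Sum>s\<leftarrow>key m a # ks. ?w s) = fst y" by (simp only: 2 c(4) fst_conv)
     show "g a + length (key m a # ks) + h b = snd y" using False by (simp add: c(4) g'_def)
    qed
   qed
  qed
 next
  fix t k assume "(t, k) \<in> costs ?w ?P"
  then obtain c b ks where c: "c \<in> A" "b \<in> B" "conn m d U c b ks" "t = (\<Sum>s\<leftarrow>ks. ?w s)" "k = g c + length ks + h b"
   by (auto simp: costs_def pathset_def)
  have newA: "a' \<in> A'" "a' \<notin> A" if "conn m d (U - {v}) a' b ks'" "a' \<in> vstubs d {v}" for a' ks'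
   using that nb[OF that(1) c(2)] vU st unfolding A'_def fstate_def by auto
  show "\<exists>(t', k')\<in>?Y. t' < t \<or> (t' = t \<and> k' \<le> k)"
  proof (cases "c = a")
   case True
   from c(3) show ?thesis
   proof (cases rule: conn.cases)
    case edge then show ?thesis using True c a vU st unfolding fstate_def by auto
   next
    case (step v' a' ks')
    then have v': "v' = v" using True a by (auto simp: vstubs_def)
    have "(x + (\<Sum>s\<leftarrow>ks'. w s), g' a' + length ks' + h b) \<in> ?Y"
     by (rule memY) (use step v' c newA in auto)
    moreover have "t = x + (\<Sum>s\<leftarrow>ks'. w s)" using c step True v' iw[of a' b ks'] keya by simp
    moreover have "g' a' + length ks' + h b = k"
     using newA[of a' ks'] step c True v' by (simp add: g'_def)
    ultimately show ?thesis by (intro bexI[of _ "(t, k)"]) auto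
   qed
  next
   case False
   have cb: "c \<in> bdry m A" and tw: "t = x + (\<Sum>s\<leftarrow>ks. w s)"
    using outer_weight[OF st c(3,1,2) ab False] c by auto
   from conn_avoid[OF c(3), of v] show ?thesis
   proof
    assume "conn m d (U - {v}) c b ks"
    moreover have "c \<in> A'" using c False by (auto simp: A'_def)
    ultimately have "(x + (\<Sum>s\<leftarrow>ks. w s), g' c + length ks + h b) \<in> ?Y" using c(2) by (intro memY)
    moreover have "(x + (\<Sum>s\<leftarrow>ks. w s), g' c + length ks + h b) = (t, k)"
     using tw c(1,5) by (simp add: g'_def)
    ultimately show ?thesis by (intro bexI[of _ "(t, k)"]) auto
   next
    \<comment> \<open>The tail from \<open>v\<close> costs \<open>x\<close> plus its residual
      weight; the full path pays in addition the positive residual weight of its first edge. The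
      tail wins strictly, so hop counts do not have to be compared.\<close>
    assume "\<exists>a' ks1 ks2. a' \<in> vstubs d {v} \<and> conn m d (U - {v}) a' b ks2 \<and> ks = key m c # ks1 @ ks2"
    then obtain a' ks1 ks2 where k: "a' \<in> vstubs d {v}" "conn m d (U - {v}) a' b ks2" "ks = key m c # ks1 @ ks2"
     by blast
    have "(x + (\<Sum>s\<leftarrow>ks2. w s), g' a' + length ks2 + h b) \<in> ?Y"
     by (rule memY) (use k c newA in auto)
    moreover have "(\<Sum>s\<leftarrow>ks1. w s) \<ge> 0" by (rule sum_list_nonneg) (auto simp: less_imp_le[OF w])
    then have "x + (\<Sum>s\<leftarrow>ks2. w s) < t" using tw k w[of "key m c"] by simp
    ultimately show ?thesis
     by (intro bexI[of _ "(x + (\<Sum>s\<leftarrow>ks2. w s), g' a' + length ks2 + h b)"]) auto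
   qed
  qed
 qed
 then show ?thesis using lexval_shift[OF fin'] by simp
qed

lemma pathset_internal:
 assumes "fstate m d U A B" "a \<in> A" "m a \<in> A"
 shows "pathset m d U (A - {a, m a}) g B h = pathset m d U A g B h"
proof -
 have "c \<notin> {a, m a}" if "conn m d U c b ks" "b \<in> B" for c b ks
  using conn_partner[OF that(1)] that assms unfolding fstate_def by auto
 then show ?thesis unfolding pathset_def by blast
qed

lemma pathset_no_bdry:
 assumes "fstate m d U A B" "bdry m A = {}"
 shows "pathset m d U A g B h = {}"
proof -
 have False if "conn m d U c b ks" "b \<in> B" "c \<in> A" for c b ks
 proof -
  have "m c \<in> A" using that(3) assms(2) unfolding bdry_def by blast
  then show False using conn_partner[OF that(1)] that(2) assms(1) unfolding fstate_def by blast
 qed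
 then show ?thesis unfolding pathset_def by blast
qed

text \<open>Reversing paths exchanges the clusters; this gives the freedom to choose which cluster
  moves next.\<close>

lemma costs_pathset_sym:
 assumes "fstate m d U A B"
 shows "costs w (pathset m d U A g B h) = costs w (pathset m d U B h A g)"
proof -
 have "costs w (pathset m d U A g B h) \<subseteq> costs w (pathset m d U B h A g)"
  if "fstate m d U A B" for A B g h
 proof
  fix y assume "y \<in> costs w (pathset m d U A g B h)"
  then obtain a b ks where y: "a \<in> A" "b \<in> B" "conn m d U a b ks" "y = ((\<Sum>s\<leftarrow>ks. w s), g a + length ks + h b)"
   by (auto simp: costs_def pathset_def)
  have "conn m d U b a (rev ks)"
   by (rule conn_rev[OF y(3)]) (use that y in \<open>auto simp: fstate_def\<close>)
  then have "(rev ks, h b + length (rev ks) + g a) \<in> pathset m d U B h A g"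
   by (intro pathsetI[OF y(2,1)]) auto
  then show "y \<in> costs w (pathset m d U B h A g)"
   unfolding costs_def by (rule rev_image_eqI) (simp add: y rev_map[symmetric])
 qed
 then show ?thesis using assms fstate_sym by (metis subset_antisym)
qed

lemma pathset_cong:
 assumes "\<And>s. s \<in> A \<union> vstubs d U \<Longrightarrow> m s = m' s" "\<And>s. s \<in> A \<Longrightarrow> g s = g' s" "\<And>s. s \<in> B \<Longrightarrow> h s = h' s"
 shows "pathset m d U A g B h = pathset m' d U A g' B h'"
proof -
 have "conn m d U a b ks \<longleftrightarrow> conn m' d U a b ks" if "a \<in> A" for a b ks
  using conn_cong[of m d U a b ks m'] conn_cong[of m' d U a b ks m] assms(1) that by (metis UnI1 UnI2 insertE)
 then have "(x = (ks, g a + length ks + h b) \<and> a \<in> A \<and> b \<in> B \<and> conn m d U a b ks) \<longleftrightarrow>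
   (x = (ks, g' a + length ks + h' b) \<and> a \<in> A \<and> b \<in> B \<and> conn m' d U a b ks)" for x a b ks
  using assms(2)[of a] assms(3)[of b] by (cases "a \<in> A \<and> b \<in> B") auto
 then show ?thesis unfolding pathset_def by simp
qed

section \<open>Exponential weights: resampling, memorylessness and the race of clocks\<close>

abbreviation expm :: "real measure" where
 "expm \<equiv> density lborel (exponential_density 1)"

abbreviation PW :: "('k \<Rightarrow> real) measure" where
 "PW \<equiv> PiM UNIV (\<lambda>_. expm)"

lemma prob_space_expm: "prob_space expm"
 by (rule prob_space_exponential_density) simp

lemma prob_space_PW: "prob_space PW"
 by (intro prob_space_PiM prob_space_expm)

lemma space_PW [simp]: "space PW = UNIV"
 by (simp add: space_PiM)

lemma measurable_PW_component [measurable]: "(\<lambda>w. w k) \<in> borel_measurable PW"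
proof -
 have "(\<lambda>w. w k) \<in> measurable PW expm" by (rule measurable_component_singleton) simp
 then show ?thesis by simp
qed

lemma measurable_to_PW: "(\<And>k. (\<lambda>x. f x k) \<in> borel_measurable M) \<Longrightarrow> f \<in> measurable M PW"
 by (rule measurable_PiM_single') auto

lemma expm_integral:
 fixes f :: "real \<Rightarrow> 'b :: {banach, second_countable_topology}"
 assumes [measurable]: "f \<in> borel_measurable borel"
 shows "integral\<^sup>L expm f = (\<integral>x. (exponential_density 1 x) *\<^sub>R f x \<partial>lborel)"
 by (rule integral_density) (auto simp: exponential_density_def)

lemma AE_expm_pos: "AE x in expm. x > 0"
proof -
 have "AE x in lborel. x \<noteq> (0::real)" by (rule AE_lborel_singleton)
 then show ?thesis by (subst AE_density) (auto simp: exponential_density_def)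
qed

lemma AE_PW_pos: "AE w in PW. \<forall>k::'k::countable. w k > 0"
 unfolding AE_all_countable by (intro allI AE_PiM_component prob_space_expm AE_expm_pos) auto

lemma integrable_bounded_measurable:
 fixes f :: "'a \<Rightarrow> 'b :: {banach, second_countable_topology}"
 assumes "prob_space M" "f \<in> borel_measurable M" "\<And>x. norm (f x) \<le> C"
 shows "integrable M f"
proof -
 interpret prob_space M by fact
 show ?thesis using assms by (intro integrable_const_bound[of _ C]) auto
qed

text \<open>The product law is unchanged when one coordinate is replaced by an independent copy;
  this isolates a coordinate without splitting the index set.\<close>

lemma resample:
 fixes f :: "('k \<Rightarrow> real) \<Rightarrow> 'b :: {banach, second_countable_topology}"
 assumes [measurable]: "f \<in> borel_measurable PW" and b: "\<And>w. norm (f w) \<le> C"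
 shows "integral\<^sup>L PW f = (\<integral>w. (\<integral>x. f (w(k := x)) \<partial>expm) \<partial>PW)" (is ?A)
  and "integral\<^sup>L PW f = (\<integral>x. (\<integral>w. f (w(k := x)) \<partial>PW) \<partial>expm)" (is ?B)
  and "(\<lambda>(x, w). f (w(k := x))) \<in> borel_measurable (expm \<Otimes>\<^sub>M PW)" (is ?C)
proof -
 interpret E: prob_space expm by (rule prob_space_expm)
 interpret P: prob_space "PW :: ('k \<Rightarrow> real) measure" by (rule prob_space_PW)
 interpret EP: pair_prob_space expm "PW :: ('k \<Rightarrow> real) measure" ..
 have d: "distr (expm \<Otimes>\<^sub>M PW) PW (\<lambda>(x, w). w(k := x)) = (PW :: ('k \<Rightarrow> real) measure)"
  using distr_pair_PiM_eq_PiM[of UNIV "\<lambda>_. expm" k] prob_space_expm by simp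
 have m: "(\<lambda>(x, w). w(k := x)) \<in> measurable (expm \<Otimes>\<^sub>M PW) (PW :: ('k \<Rightarrow> real) measure)"
 proof (rule measurable_to_PW)
  fix j show "(\<lambda>x. (case x of (x, w) \<Rightarrow> w(k := x)) j) \<in> borel_measurable (expm \<Otimes>\<^sub>M (PW :: ('k \<Rightarrow> real) measure))"
   by (cases "j = k") (auto simp: case_prod_unfold)
 qed
 show m2: ?C
  using measurable_compose[OF m assms(1)] by (simp add: case_prod_unfold)
 have i: "integrable (expm \<Otimes>\<^sub>M PW) (\<lambda>(x, w). f (w(k := x)))"
  by (rule integrable_bounded_measurable[where C=C]) (use m2 b in \<open>auto simp: EP.prob_space_axioms\<close>)
 have "integral\<^sup>L PW f = integral\<^sup>L (distr (expm \<Otimes>\<^sub>M PW) PW (\<lambda>(x, w). w(k := x))) f" by (simp add: d)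
 also have "\<dots> = integral\<^sup>L (expm \<Otimes>\<^sub>M PW) (\<lambda>(x, w). f (w(k := x)))"
  by (subst integral_distr[OF m]) (auto simp: case_prod_unfold)
 finally have e: "integral\<^sup>L PW f = integral\<^sup>L (expm \<Otimes>\<^sub>M PW) (\<lambda>(x, w). f (w(k := x)))" .
 show ?B unfolding e using EP.integral_fst'[OF i] by simp
 then show ?A using EP.Fubini_integral[of "\<lambda>x w. f (w(k := x))"] i by simp
qed

lemma expm_memoryless:
 fixes f :: "real \<Rightarrow> 'b :: {banach, second_countable_topology}"
 assumes [measurable]: "f \<in> borel_measurable borel" and x: "x \<ge> 0"
 shows "(\<integral>y. indicator {x..} y *\<^sub>R f y \<partial>expm) = exp (- x) *\<^sub>R (\<integral>y. f (x + y) \<partial>expm)"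
proof -
 have "(\<integral>y. indicator {x..} y *\<^sub>R f y \<partial>expm)
   = (\<integral>y. exponential_density 1 y *\<^sub>R (indicator {x..} y *\<^sub>R f y) \<partial>lborel)"
  by (rule expm_integral) simp
 also have "\<dots> = (\<integral>y. exponential_density 1 (x + y) *\<^sub>R (indicator {x..} (x + y) *\<^sub>R f (x + y)) \<partial>lborel)"
  using lborel_integral_real_affine[of 1 "\<lambda>y. exponential_density 1 y *\<^sub>R (indicator {x..} y *\<^sub>R f y)" x] by simp
 also have "\<dots> = (\<integral>y. exp (- x) *\<^sub>R (exponential_density 1 y *\<^sub>R f (x + y)) \<partial>lborel)"
  using x by (intro Bochner_Integration.integral_cong)
   (auto simp: exponential_density_def indicator_def exp_add[symmetric] algebra_simps)
 also have "\<dots> = exp (- x) *\<^sub>R (\<integral>y. f (x + y) \<partial>expm)"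
 proof -
  have "(\<integral>y. f (x + y) \<partial>expm) = (\<integral>y. exponential_density 1 y *\<^sub>R f (x + y) \<partial>lborel)"
   by (rule expm_integral) simp
  then show ?thesis by (simp only: integral_scaleR_right)
 qed
 finally show ?thesis .
qed

lemma PW_shift1:
 fixes f :: "('k \<Rightarrow> real) \<Rightarrow> 'b :: {banach, second_countable_topology}"
 assumes [measurable]: "f \<in> borel_measurable PW" and b: "\<And>w. norm (f w) \<le> C" and x: "x \<ge> 0"
 shows "(\<integral>w. indicator {x..} (w j) *\<^sub>R f w \<partial>PW) = exp (- x) *\<^sub>R (\<integral>w. f (w(j := x + w j)) \<partial>PW)"
  and "(\<lambda>w. f (w(j := x + w j))) \<in> borel_measurable PW"
proof -
 have m: "(\<lambda>w. w(j := x + w j)) \<in> measurable PW PW"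
 proof (rule measurable_to_PW)
  fix k show "(\<lambda>w. (w(j := x + w j)) k) \<in> borel_measurable PW" by (cases "j = k") auto
 qed
 show m2: "(\<lambda>w. f (w(j := x + w j))) \<in> borel_measurable PW" using measurable_compose[OF m assms(1)] .
 have C: "0 \<le> C" using b[of undefined] norm_ge_zero order_trans by blast
 have fm: "(\<lambda>y. f (w(j := y))) \<in> borel_measurable borel" for w
 proof -
  have "(\<lambda>y. w(j := y)) \<in> measurable borel PW"
  proof (rule measurable_to_PW)
   fix k show "(\<lambda>y. (w(j := y)) k) \<in> borel_measurable borel" by (cases "j = k") auto
  qed
  from measurable_compose[OF this assms(1)] show ?thesis .
 qed
 have "(\<integral>w. indicator {x..} (w j) *\<^sub>R f w \<partial>PW)
   = (\<integral>w. (\<integral>y. indicator {x..} y *\<^sub>R f (w(j := y)) \<partial>expm) \<partial>PW)"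
  using resample(1)[of "\<lambda>w. indicator {x..} (w j) *\<^sub>R f w" C j] b C by (simp add: indicator_def)
 also have "\<dots> = (\<integral>w. exp (- x) *\<^sub>R (\<integral>y. f (w(j := x + y)) \<partial>expm) \<partial>PW)"
  by (subst expm_memoryless[OF fm x]) simp
 also have "\<dots> = exp (- x) *\<^sub>R (\<integral>w. (\<integral>y. f (w(j := x + y)) \<partial>expm) \<partial>PW)" by simp
 also have "(\<integral>w. (\<integral>y. f (w(j := x + y)) \<partial>expm) \<partial>PW) = (\<integral>w. f (w(j := x + w j)) \<partial>PW)"
  using resample(1)[OF m2, of C j] b by simp
 finally show "(\<integral>w. indicator {x..} (w j) *\<^sub>R f w \<partial>PW) = exp (- x) *\<^sub>R (\<integral>w. f (w(j := x + w j)) \<partial>PW)" .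
qed

text \<open>Memorylessness for finitely many coordinates, by induction on \<open>J\<close>: each
  coordinate forced above \<open>x\<close> costs the factor exp(-x) and is fresh beyond
  \<open>x\<close>.\<close>

lemma PW_shift:
 fixes f :: "('k \<Rightarrow> real) \<Rightarrow> 'b :: {banach, second_countable_topology}"
 assumes "f \<in> borel_measurable PW" and b: "\<And>w. norm (f w) \<le> C" and x: "x \<ge> 0" and fin: "finite J"
 shows "(\<integral>w. (if \<forall>j\<in>J. x \<le> w j then f w else 0) \<partial>PW)
   = exp (- (real (card J) * x)) *\<^sub>R (\<integral>w. f (\<lambda>k. if k \<in> J then x + w k else w k) \<partial>PW)"
 using fin assms(1,2)
proof (induction J arbitrary: f rule: finite_induct)
 case empty then show ?case by simp
next
 case (insert j J)
 note [measurable] = insert.prems(1) insert.hyps(1)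
 have C: "0 \<le> C" using insert.prems(2)[of undefined] norm_ge_zero order_trans by blast
 have "(\<integral>w. (if \<forall>i\<in>insert j J. x \<le> w i then f w else 0) \<partial>PW)
  = (\<integral>w. (if \<forall>i\<in>J. x \<le> w i then indicator {x..} (w j) *\<^sub>R f w else 0) \<partial>PW)"
  by (intro Bochner_Integration.integral_cong) (auto simp: indicator_def)
 also have "\<dots> = (\<integral>w. indicator {x..} (w j) *\<^sub>R (if \<forall>i\<in>J. x \<le> w i then f w else 0) \<partial>PW)"
  by (intro Bochner_Integration.integral_cong) auto
 also have "\<dots> = exp (- x) *\<^sub>R (\<integral>w. (if \<forall>i\<in>J. x \<le> (w(j := x + w j)) i then f (w(j := x + w j)) else 0) \<partial>PW)"
 proof (rule PW_shift1(1)[OF _ _ x, of _ C])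
  show "norm (if \<forall>i\<in>J. x \<le> w i then f w else 0) \<le> C" for w using insert.prems(2) C by auto
  have [measurable]: "Measurable.pred PW (\<lambda>w. \<forall>i\<in>J. x \<le> w i)"
   using insert.hyps(1) by (intro pred_intros_finite) auto
  show "(\<lambda>w. if \<forall>i\<in>J. x \<le> w i then f w else 0) \<in> borel_measurable PW"
   by measurable
 qed
 also have "(\<integral>w. (if \<forall>i\<in>J. x \<le> (w(j := x + w j)) i then f (w(j := x + w j)) else 0) \<partial>PW)
   = (\<integral>w. (if \<forall>i\<in>J. x \<le> w i then f (w(j := x + w j)) else 0) \<partial>PW)"
  using insert.hyps(2) by (intro Bochner_Integration.integral_cong refl if_cong ball_cong) auto
 also have "\<dots> = exp (- (real (card J) * x)) *\<^sub>R
   (\<integral>w. f ((\<lambda>k. if k \<in> J then x + w k else w k)(j := x + (\<lambda>k. if k \<in> J then x + w k else w k) j)) \<partial>PW)"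
  using insert.prems PW_shift1(2)[OF insert.prems x] by (intro insert.IH) auto
 also have "(\<lambda>w::'k\<Rightarrow>real. ((\<lambda>k. if k \<in> J then x + w k else w k)(j := x + (\<lambda>k. if k \<in> J then x + w k else w k) j)))
   = (\<lambda>w k. if k \<in> insert j J then x + w k else w k)"
  using insert.hyps(2) by (auto simp: fun_eq_iff)
 then have "(\<lambda>w. f ((\<lambda>k. if k \<in> J then x + w k else w k)(j := x + (\<lambda>k. if k \<in> J then x + w k else w k) j)))
   = (\<lambda>w. f (\<lambda>k. if k \<in> insert j J then x + w k else w k))" by metis
 finally show ?case using insert.hyps
  by (simp add: exp_add[symmetric] algebra_simps)
qed

text \<open>The identity E v'(X) = E v(X) - v(0) for a standard exponential X. It yields both the
  Laplace transform and the differential equation of \<open>G\<close>.\<close>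

lemma expm_by_parts:
 fixes v v' :: "real \<Rightarrow> complex"
 assumes d: "\<And>x. x > 0 \<Longrightarrow> (v has_vector_derivative v' x) (at x)"
  and c: "\<And>x. x > 0 \<Longrightarrow> isCont v' x" and v0: "isCont v 0"
  and m [measurable]: "v \<in> borel_measurable borel" "v' \<in> borel_measurable borel"
  and b: "\<And>x. x \<ge> 0 \<Longrightarrow> norm (v x) \<le> C" "\<And>x. x \<ge> 0 \<Longrightarrow> norm (v' x) \<le> C"
 shows "(\<integral>x. v' x \<partial>expm) = (\<integral>x. v x \<partial>expm) - v 0"
proof -
 interpret E: prob_space expm by (rule prob_space_expm)
 have AEpos: "AE x in expm. x \<ge> 0" using AE_expm_pos by eventually_elim auto
 have iv: "integrable expm v" "integrable expm v'"
  using AEpos b by (auto intro!: E.integrable_const_bound[of _ C])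
 let ?F = "\<lambda>x. - (exp (- x) *\<^sub>R v x)"
 let ?f = "\<lambda>x. exp (- x) *\<^sub>R (v x - v' x)"
 have eq: "exponential_density 1 x *\<^sub>R (v x - v' x) = indicator {0<..} x *\<^sub>R ?f x" if "x \<noteq> 0" for x
  using that by (auto simp: exponential_density_def indicator_def)
 have ae: "AE x in lborel. exponential_density 1 x *\<^sub>R (v x - v' x) = indicator {0<..} x *\<^sub>R ?f x"
  using AE_lborel_singleton[of "0::real"] by eventually_elim (rule eq)
 have int1: "integrable lborel (\<lambda>x. exponential_density 1 x *\<^sub>R (v x - v' x))"
  using iv by (subst integrable_density[symmetric]) (auto simp: exponential_density_def)
 have int2: "integrable lborel (\<lambda>x. indicator {0<..} x *\<^sub>R ?f x)"
  by (subst integrable_cong_AE[OF _ _ ae, symmetric]) (use int1 in auto)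
 have "(LBINT x=0..\<infinity>. ?f x) = 0 - ?F 0"
 proof (rule interval_integral_FTC_integrable[where F="?F"])
  show "(0::ereal) < \<infinity>" by simp
  fix x assume "0 < ereal x"
  then have x: "x > 0" by simp
  show "(?F has_vector_derivative ?f x) (at x)"
   by (rule has_vector_derivative_eq_rhs)
    (auto intro!: derivative_eq_intros d x simp: algebra_simps)
  show "isCont ?f x"
   using c[OF x] has_vector_derivative_continuous[OF d[OF x]] by (intro continuous_intros) auto
 next
  show "set_integrable lborel (einterval 0 \<infinity>) ?f"
   using int2 by (simp add: set_integrable_def einterval_def greaterThan_def zero_ereal_def)
  have "(?F \<longlongrightarrow> ?F 0) (at_right 0)"
   using v0 by (intro tendsto_intros) (auto simp: isCont_def intro: tendsto_within_subset filterlim_at_split[THEN iffD1, THEN conjunct2])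
  then show "((?F \<circ> real_of_ereal) \<longlongrightarrow> ?F 0) (at_right 0)"
   by (simp add: zero_ereal_def ereal_tendsto_simps)
  have "(?F \<longlongrightarrow> 0) at_top"
  proof (rule Lim_null_comparison)
   show "\<forall>\<^sub>F x in at_top. norm (?F x) \<le> exp (- x) * C"
    using eventually_ge_at_top[of 0] by eventually_elim (auto simp: norm_mult intro!: mult_left_mono b)
   have "((\<lambda>x::real. exp (- x)) \<longlongrightarrow> 0) at_top"
    using filterlim_compose[OF exp_at_bot filterlim_uminus_at_bot_at_top] .
   then show "((\<lambda>x::real. exp (- x) * C) \<longlongrightarrow> 0) at_top" by (rule tendsto_mult_left_zero)
  qed
  then show "((?F \<circ> real_of_ereal) \<longlongrightarrow> 0) (at_left \<infinity>)"
   by (simp add: ereal_tendsto_simps)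
 qed
 then have "(LBINT x:{0<..}. ?f x) = v 0"
  by (simp add: interval_lebesgue_integral_0_infty)
 moreover have "(\<integral>x. v x - v' x \<partial>expm) = (LBINT x:{0<..}. ?f x)"
  unfolding set_lebesgue_integral_def
  by (subst expm_integral) (use ae in \<open>auto intro!: integral_cong_AE\<close>)
 ultimately have "(\<integral>x. v x \<partial>expm) - (\<integral>x. v' x \<partial>expm) = v 0" using iv by simp
 then show ?thesis by (metis add_diff_cancel_left' diff_add_cancel)
qed

lemma expm_laplace:
 fixes s :: complex
 assumes s: "Re s \<ge> 1"
 shows "(\<integral>x. exp (- ((s - 1) * x)) \<partial>expm) = 1 / s"
proof -
 let ?v = "\<lambda>x::real. exp (- ((s - 1) * of_real x))"
 have n: "norm (?v x) \<le> 1" if "x \<ge> 0" for x using that s by (simp add: norm_exp)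
 have "(\<integral>x. - (s - 1) * ?v x \<partial>expm) = (\<integral>x. ?v x \<partial>expm) - ?v 0"
 proof (rule expm_by_parts[where C="1 + norm (s - 1)"])
  fix x :: real
  have "((\<lambda>x. exp (- ((s - 1) * x))) has_field_derivative (- (s - 1) * exp (- ((s - 1) * of_real x)))) (at (of_real x))"
   by (auto intro!: derivative_eq_intros)
  from has_vector_derivative_real_field[OF this]
  show "(?v has_vector_derivative - (s - 1) * ?v x) (at x)" .
  show "isCont (\<lambda>x. - (s - 1) * ?v x) x" by (intro continuous_intros)
  show "isCont ?v 0" by (intro continuous_intros)
  show "?v \<in> borel_measurable borel" "(\<lambda>x. - (s - 1) * ?v x) \<in> borel_measurable borel"
   by (intro borel_measurable_continuous_onI continuous_intros)+
  assume x: "x \<ge> 0"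
  show "norm (?v x) \<le> 1 + norm (s - 1)" using n[OF x] by (simp add: add.commute add_increasing2)
  show "norm (- (s - 1) * ?v x) \<le> 1 + norm (s - 1)"
   using n[OF x] mult_left_le[of "norm (?v x)" "norm (s - 1)"] by (simp add: norm_mult norm_minus_commute)
 qed
 also have "(\<integral>x. - (s - 1) * ?v x \<partial>expm) = - (s - 1) * (\<integral>x. ?v x \<partial>expm)"
  by (rule integral_mult_right_zero)
 finally have "- (s - 1) * I = I - 1" if "I = (\<integral>x. ?v x \<partial>expm)" for I using that by simp
 then have "s * (\<integral>x. ?v x \<partial>expm) = 1" by (simp add: left_diff_distrib)
 moreover have "s \<noteq> 0" using s by auto
 ultimately show ?thesis by (simp add: field_simps)
qed

text \<open>First-step analysis: the minimum of r clocks is exponential with rate r, so its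
  transform is r / (r - i l); each clock wins with probability 1 / r, and the residual weights are
  again independent and exponential. \<open>\<Psi> e\<close> is the problem that remains after the
  clock \<open>e\<close> has rung.\<close>

lemma exponential_race:
 fixes \<Phi> :: "('k::countable \<Rightarrow> real) \<Rightarrow> complex" and \<Psi> :: "'k \<Rightarrow> ('k \<Rightarrow> real) \<Rightarrow> complex"
  and l :: real
 assumes K: "finite K" "K \<noteq> {}"
  and [measurable]: "\<Phi> \<in> borel_measurable PW" and b: "\<And>w. norm (\<Phi> w) \<le> C"
  and [measurable]: "\<And>e. e \<in> K \<Longrightarrow> \<Psi> e \<in> borel_measurable PW"
  and step: "\<And>e x w. e \<in> K \<Longrightarrow> x \<ge> 0 \<Longrightarrow> (\<And>k. w k > 0) \<Longrightarrow> \<Phi> (shift K e x w) = exp (\<i> * l * x) * \<Psi> e w"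
 shows "(real (card K) - \<i> * l) * (\<integral>w. \<Phi> w \<partial>PW) = (\<Sum>e\<in>K. \<integral>w. \<Psi> e w \<partial>PW)"
proof -
 interpret P: prob_space "PW :: ('k \<Rightarrow> real) measure" by (rule prob_space_PW)
 let ?r = "real (card K)"
 have r: "?r \<ge> 1" using K by (simp add: Suc_leI card_gt_0_iff)
 have C: "0 \<le> C" using b[of undefined] norm_ge_zero order_trans by blast
 \<comment> \<open>A tie counts as a win of every tied clock. That ties form a null event is deduced
   below from the total mass.\<close>
 define win where "win e w \<longleftrightarrow> (\<forall>k\<in>K - {e}. w e \<le> w k)" for e and w :: "'k \<Rightarrow> real"
 have [measurable]: "Measurable.pred PW (win e)" for e
 proof -
  have "Measurable.pred PW (\<lambda>w::'k \<Rightarrow> real. w e \<le> w k)" for k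
   using borel_measurable_le[OF measurable_PW_component[of e] measurable_PW_component[of k]]
   unfolding pred_def by simp
  then show ?thesis unfolding win_def using K by (intro pred_intros_finite) auto
 qed
 have sm: "(\<lambda>(x, w). shift K e x w) \<in> measurable (expm \<Otimes>\<^sub>M PW) PW" for e
 proof (rule measurable_to_PW)
  fix k show "(\<lambda>x. (case x of (x, w) \<Rightarrow> shift K e x w) k) \<in> borel_measurable (expm \<Otimes>\<^sub>M PW)"
   by (cases "k = e"; cases "k \<in> K") (auto simp: shift_def case_prod_unfold)
 qed
 have sm1 [measurable]: "(\<lambda>w. shift K e x w) \<in> measurable PW PW" for e x
 proof (rule measurable_to_PW)
  fix k show "(\<lambda>w. shift K e x w k) \<in> borel_measurable PW"
   by (cases "k = e"; cases "k \<in> K") (auto simp: shift_def)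
 qed
 have sm2 [measurable]: "(\<lambda>x. \<integral>w. f (shift K e x w) \<partial>PW) \<in> borel_measurable borel"
  if f: "f \<in> borel_measurable PW" for f :: "('k \<Rightarrow> real) \<Rightarrow> complex" and e
 proof -
  have "(\<lambda>x. \<integral>w. f (shift K e x w) \<partial>PW) \<in> borel_measurable expm"
   using measurable_compose[OF sm f]
   by (intro P.borel_measurable_lebesgue_integral) (auto simp: case_prod_unfold)
  then show ?thesis by simp
 qed
 \<comment> \<open>The winning value x is integrated last: given \<open>w e = x\<close>, the event
   says that the other r - 1 clocks are at least x, and \<open>PW_shift\<close> turns it into the
   factor exp(-(r - 1) x) and shifted weights.\<close>
 have main: "(\<integral>w. (if win e w then f w else 0) \<partial>PW)
  = (\<integral>x. exp (- ((?r - 1) * x)) *\<^sub>R (\<integral>w. f (shift K e x w) \<partial>PW) \<partial>expm)"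
  if e: "e \<in> K" and f [measurable]: "f \<in> borel_measurable PW" and bf: "\<And>w. norm (f w) \<le> D"
  for e and f :: "('k \<Rightarrow> real) \<Rightarrow> complex" and D :: real
 proof -
  have D: "0 \<le> D" using bf[of undefined] norm_ge_zero order_trans by blast
  have "(\<integral>w. (if win e w then f w else 0) \<partial>PW) =
   (\<integral>x. (\<integral>w. (if win e (w(e := x)) then f (w(e := x)) else (0::complex)) \<partial>PW) \<partial>expm)"
   by (rule resample(2)[where C=D]) (use bf D in auto)
  also have "\<dots> = (\<integral>x. exp (- ((?r - 1) * x)) *\<^sub>R (\<integral>w. f (shift K e x w) \<partial>PW) \<partial>expm)"
  proof (rule integral_cong_AE)
   have m: "(\<lambda>w. f (w(e := x))) \<in> borel_measurable PW" for x
   proof (rule measurable_compose[OF _ f], rule measurable_to_PW)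
    fix k show "(\<lambda>w. (w(e := x)) k) \<in> borel_measurable PW" by (cases "e = k") auto
   qed
   have "(\<integral>w. (if win e (w(e := x)) then f (w(e := x)) else 0) \<partial>PW)
    = exp (- ((?r - 1) * x)) *\<^sub>R (\<integral>w. f (shift K e x w) \<partial>PW)" if x: "x \<ge> 0" for x
   proof -
    have "(\<integral>w. (if win e (w(e := x)) then f (w(e := x)) else 0) \<partial>PW)
     = (\<integral>w. (if \<forall>j\<in>K - {e}. x \<le> w j then f (w(e := x)) else 0) \<partial>PW)"
     by (intro Bochner_Integration.integral_cong) (auto simp: win_def)
    also have "\<dots> = exp (- (real (card (K - {e})) * x)) *\<^sub>R
      (\<integral>w. f ((\<lambda>k. if k \<in> K - {e} then x + w k else w k)(e := x)) \<partial>PW)"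
     by (rule PW_shift[OF m _ x, of _ D]) (use bf K in auto)
    also have "(\<lambda>w::'k\<Rightarrow>real. (\<lambda>k. if k \<in> K - {e} then x + w k else w k)(e := x)) = shift K e x"
     by (auto simp: shift_def fun_eq_iff)
    then have "(\<lambda>w::'k\<Rightarrow>real. f ((\<lambda>k. if k \<in> K - {e} then x + w k else w k)(e := x))) = (\<lambda>w. f (shift K e x w))"
     by metis
    also have "real (card (K - {e})) = ?r - 1" using e K r by (simp add: of_nat_diff card_Diff_singleton)
    finally show ?thesis .
   qed
   note nn = this
   show "AE x in expm. (\<integral>w. (if win e (w(e := x)) then f (w(e := x)) else 0) \<partial>PW)
    = exp (- ((?r - 1) * x)) *\<^sub>R (\<integral>w. f (shift K e x w) \<partial>PW)"
    using AE_expm_pos by eventually_elim (rule nn, simp)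
   have m1: "(\<lambda>x. \<integral>w. (if win e (w(e := x)) then f (w(e := x)) else 0) \<partial>PW) \<in> borel_measurable expm"
    using resample(3)[of "\<lambda>w. if win e w then f w else 0" D e] bf D
    by (intro P.borel_measurable_lebesgue_integral) (auto simp: case_prod_unfold)
   then show "(\<lambda>x. \<integral>w. (if win e (w(e := x)) then f (w(e := x)) else 0) \<partial>PW) \<in> borel_measurable expm" .
   show "(\<lambda>x. exp (- ((?r - 1) * x)) *\<^sub>R (\<integral>w. f (shift K e x w) \<partial>PW)) \<in> borel_measurable expm"
    using sm2[OF f, of e] by simp
  qed
  finally show ?thesis .
 qed
 have laplace: "(\<integral>x. exp (- ((?r - 1) * x)) *\<^sub>R (exp (\<i> * l * of_real x) * c) \<partial>expm) = c / (?r - \<i> * l)"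
  for c :: complex and l :: real
 proof -
  have "(\<integral>x. exp (- ((?r - 1) * x)) *\<^sub>R (exp (\<i> * l * of_real x) * c) \<partial>expm)
   = (\<integral>x. exp (- ((?r - \<i> * l - 1) * of_real x)) * c \<partial>expm)"
   by (intro Bochner_Integration.integral_cong)
    (auto simp: scaleR_conv_of_real exp_of_real[symmetric] exp_add[symmetric] algebra_simps)
  also have "\<dots> = c / (?r - \<i> * l)" using expm_laplace[of "?r - \<i> * l"] r by simp
  finally show ?thesis .
 qed
 have one: "(\<Sum>e\<in>K. \<integral>w. (if win e w then 1 else 0 :: complex) \<partial>PW) = 1"
 proof -
  have "(\<integral>w. (if win e w then 1 else 0 :: complex) \<partial>PW) = 1 / ?r" if "e \<in> K" for e
   using main[OF that, of "\<lambda>_. 1" 1] laplace[of 0 1] P.prob_space by simp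
  then show ?thesis using r by simp
 qed
 have int: "integrable PW (\<lambda>w. if win e w then f w else 0)"
  if [measurable]: "f \<in> borel_measurable PW" and "\<And>w. norm (f w) \<le> D" for e and f :: "('k \<Rightarrow> real) \<Rightarrow> complex" and D :: real
 proof -
  have "0 \<le> D" using that(2)[of undefined] norm_ge_zero order_trans by blast
  then show ?thesis
   by (intro integrable_bounded_measurable[OF prob_space_PW, of _ D]) (use that in auto)
 qed
 \<comment> \<open>There is always at least one winner, while the expected number of winners is 1 by
   \<open>one\<close>; hence almost surely exactly one clock wins.\<close>
 have ge1: "(\<Sum>e\<in>K. if win e w then 1 else (0::real)) \<ge> 1" for w
 proof -
  have "Min (w ` K) \<in> w ` K" using K by (intro Min_in) auto
  then obtain e where e: "e \<in> K" "w e = Min (w ` K)" by auto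
  then have "win e w" unfolding win_def using K by auto
  then have "1 = (\<Sum>e\<in>{e}. if win e w then 1 else (0::real))" by simp
  also have "\<dots> \<le> (\<Sum>e\<in>K. if win e w then 1 else (0::real))"
   by (rule sum_mono2) (use e K in auto)
  finally show ?thesis .
 qed
 have intr: "integrable PW (\<lambda>w. if win e w then 1 else (0::real))" for e
  by (rule integrable_bounded_measurable[OF prob_space_PW, of _ 1]) auto
 have ae: "AE w in PW. (\<Sum>e\<in>K. if win e w then 1 else (0::real)) - 1 = 0"
 proof (subst integral_nonneg_eq_0_iff_AE[symmetric])
  show "integrable PW (\<lambda>w. (\<Sum>e\<in>K. if win e w then 1 else (0::real)) - 1)" using intr by auto
  show "AE w in PW. 0 \<le> (\<Sum>e\<in>K. if win e w then 1 else (0::real)) - 1" using ge1 by simp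
  have "complex_of_real (\<integral>w. (\<Sum>e\<in>K. if win e w then 1 else (0::real)) \<partial>PW) = 1"
   using one intr by (simp add: integral_complex_of_real[symmetric] if_distrib[of complex_of_real] of_real_sum
     cong: if_cong del: integral_complex_of_real)
  then have "(\<integral>w. (\<Sum>e\<in>K. if win e w then 1 else (0::real)) \<partial>PW) = 1" by (simp only: of_real_eq_1_iff)
  then show "(\<integral>w. (\<Sum>e\<in>K. if win e w then 1 else (0::real)) - 1 \<partial>PW) = 0"
   using intr P.prob_space by (subst Bochner_Integration.integral_diff) auto
 qed
 have "(\<integral>w. \<Phi> w \<partial>PW) = (\<integral>w. (\<Sum>e\<in>K. if win e w then \<Phi> w else 0) \<partial>PW)"
 proof (rule integral_cong_AE)
  show "AE w in PW. \<Phi> w = (\<Sum>e\<in>K. if win e w then \<Phi> w else 0)"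
   using ae
  proof eventually_elim
   case (elim w)
   have "(\<Sum>e\<in>K. if win e w then \<Phi> w else 0) = (\<Sum>e\<in>K. of_real (if win e w then 1 else 0) * \<Phi> w)"
    by (intro sum.cong) auto
   also have "\<dots> = of_real (\<Sum>e\<in>K. if win e w then 1 else 0) * \<Phi> w" by (simp only: of_real_sum sum_distrib_right)
   also have "(\<Sum>e\<in>K. if win e w then 1 else (0::real)) = 1" using elim by simp
   finally show ?case by simp
  qed
 qed auto
 also have "\<dots> = (\<Sum>e\<in>K. \<integral>w. (if win e w then \<Phi> w else 0) \<partial>PW)"
  by (rule Bochner_Integration.integral_sum) (rule int[OF _ b], simp)
 also have "\<dots> = (\<Sum>e\<in>K. (\<integral>w. \<Psi> e w \<partial>PW) / (?r - \<i> * l))"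
 proof (rule sum.cong[OF refl])
  fix e assume e: "e \<in> K"
  have "(\<integral>w. (if win e w then \<Phi> w else 0) \<partial>PW)
   = (\<integral>x. exp (- ((?r - 1) * x)) *\<^sub>R (\<integral>w. \<Phi> (shift K e x w) \<partial>PW) \<partial>expm)"
   by (rule main[OF e _ b]) simp
  also have "\<dots> = (\<integral>x. exp (- ((?r - 1) * x)) *\<^sub>R (exp (\<i> * l * of_real x) * (\<integral>w. \<Psi> e w \<partial>PW)) \<partial>expm)"
  proof (rule integral_cong_AE)
   show "(\<lambda>x. exp (- ((?r - 1) * x)) *\<^sub>R (\<integral>w. \<Phi> (shift K e x w) \<partial>PW)) \<in> borel_measurable expm"
    using sm2[OF assms(3), of e] by simp
   show "(\<lambda>x. exp (- ((?r - 1) * x)) *\<^sub>R (exp (\<i> * l * of_real x) * (\<integral>w. \<Psi> e w \<partial>PW))) \<in> borel_measurable expm"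
    by simp
   show "AE x in expm. exp (- ((?r - 1) * x)) *\<^sub>R (\<integral>w. \<Phi> (shift K e x w) \<partial>PW)
    = exp (- ((?r - 1) * x)) *\<^sub>R (exp (\<i> * l * of_real x) * (\<integral>w. \<Psi> e w \<partial>PW))"
    using AE_expm_pos
   proof eventually_elim
    case (elim x)
    have "(\<integral>w. \<Phi> (shift K e x w) \<partial>PW) = (\<integral>w. exp (\<i> * l * x) * \<Psi> e w \<partial>PW)"
    proof (rule integral_cong_AE)
     show "(\<lambda>w. exp (\<i> * l * x) * \<Psi> e w) \<in> borel_measurable PW" using e by measurable
     show "AE w in PW. \<Phi> (shift K e x w) = exp (\<i> * l * x) * \<Psi> e w"
      using AE_PW_pos by eventually_elim (use step e elim in auto)
    qed simp
    then show ?case by simp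
   qed
  qed
  also have "\<dots> = (\<integral>w. \<Psi> e w \<partial>PW) / (?r - \<i> * l)" by (rule laplace)
  finally show "(\<integral>w. (if win e w then \<Phi> w else 0) \<partial>PW) = (\<integral>w. \<Psi> e w \<partial>PW) / (?r - \<i> * l)" .
 qed
 also have "\<dots> = (\<Sum>e\<in>K. \<integral>w. \<Psi> e w \<partial>PW) / (?r - \<i> * l)" by (simp add: sum_divide_distrib)
 finally have eq: "(\<integral>w. \<Phi> w \<partial>PW) = (\<Sum>e\<in>K. \<integral>w. \<Psi> e w \<partial>PW) / (?r - \<i> * l)" .
 have "complex_of_real ?r - \<i> * l \<noteq> 0" using r by (auto simp: complex_eq_iff)
 then show ?thesis using eq by (simp add: field_simps)
qed

section \<open>The transform for a fixed matching\<close>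

definition minwt :: "(nat \<times> nat \<Rightarrow> real) \<Rightarrow> ((nat \<times> nat) list \<times> nat) set \<Rightarrow> real" where
 "minwt w P = Min ((\<lambda>p. \<Sum>s\<leftarrow>fst p. w s) ` P)"

definition minhop :: "(nat \<times> nat \<Rightarrow> real) \<Rightarrow> ((nat \<times> nat) list \<times> nat) set \<Rightarrow> nat" where
 "minhop w P = Min (snd ` {p \<in> P. (\<Sum>s\<leftarrow>fst p. w s) = minwt w P})"

lemma lexval_costs:
 "lexval l z (costs w P) = (if P = {} then 0 else exp (\<i> * l * minwt w P) * z ^ minhop w P)"
proof -
 have 1: "fst ` costs w P = (\<lambda>p. \<Sum>s\<leftarrow>fst p. w s) ` P"
  by (simp add: costs_def image_image case_prod_unfold)
 have 2: "{k. (t, k) \<in> costs w P} = snd ` {p \<in> P. (\<Sum>s\<leftarrow>fst p. w s) = t}" for t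
  unfolding costs_def by force
 show ?thesis unfolding lexval_def 1 2 minhop_def minwt_def by (auto simp: costs_def)
qed

lemma measurable_sum_list [measurable]: "(\<lambda>w. \<Sum>s\<leftarrow>ks. w s) \<in> borel_measurable PW"
 by (induction ks) auto

lemma measurable_minwt: "finite P \<Longrightarrow> (\<lambda>w. minwt w P) \<in> borel_measurable PW"
 unfolding minwt_def by (rule borel_measurable_Min) auto

text \<open>The hop count is a function of the set of minimizing paths, which takes finitely many
  values and is cut out by equalities between measurable functions.\<close>

lemma measurable_minhop:
 assumes "finite P"
 shows "(\<lambda>w. minhop w P) \<in> measurable PW (count_space UNIV)"
proof -
 let ?T = "\<lambda>w. {p \<in> P. (\<Sum>s\<leftarrow>fst p. w s) = minwt w P}"
 have "?T \<in> measurable PW (count_space (Pow P))"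
 proof (subst measurable_count_space_eq2)
  show "finite (Pow P)" using assms by simp
  have "?T -` {S} \<inter> space PW \<in> sets PW" if "S \<in> Pow P" for S
  proof -
   have p: "Measurable.pred PW (\<lambda>w. (\<Sum>s\<leftarrow>fst p. w s) = minwt w P)" for p
    using borel_measurable_eq[OF measurable_sum_list[of "fst p"] measurable_minwt[OF assms]]
    unfolding pred_def by simp
   have "?T -` {S} \<inter> space PW = {w \<in> space PW. \<forall>p\<in>P. ((\<Sum>s\<leftarrow>fst p. w s) = minwt w P) = (p \<in> S)}"
    using that by auto
   moreover have "Measurable.pred PW (\<lambda>w. \<forall>p\<in>P. ((\<Sum>s\<leftarrow>fst p. w s) = minwt w P) = (p \<in> S))"
   proof (intro pred_intros_finite assms)
    fix q show "Measurable.pred PW (\<lambda>w. ((\<Sum>s\<leftarrow>fst q. w s) = minwt w P) = (q \<in> S))"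
     using p[of q] by (cases "q \<in> S") auto
   qed
   ultimately show ?thesis unfolding pred_def by simp
  qed
  then show "?T \<in> space PW \<rightarrow> Pow P \<and> (\<forall>S\<in>Pow P. ?T -` {S} \<inter> space PW \<in> sets PW)" by auto
 qed
 from measurable_compose[OF this, of "\<lambda>S. Min (snd ` S)" "count_space UNIV"]
 show ?thesis unfolding minhop_def by simp
qed

lemma measurable_lexval: "finite P \<Longrightarrow> (\<lambda>w. lexval l z (costs w P)) \<in> borel_measurable PW"
 unfolding lexval_costs
 using measurable_minwt[of P] measurable_compose[OF measurable_minhop[of P], of "\<lambda>k. z ^ k" borel]
 by (cases "P = {}") auto

lemma norm_lexval_le: "norm z \<le> 1 \<Longrightarrow> norm (lexval l z X) \<le> 1"
 by (auto simp: lexval_def norm_mult norm_power power_le_one)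

definition Rm where
 "Rm l z m d U A g B h = (\<integral>w. lexval l z (costs w (pathset m d U A g B h)) \<partial>PW)"

lemma Rm_sym: "fstate m d U A B \<Longrightarrow> Rm l z m d U A g B h = Rm l z m d U B h A g"
 unfolding Rm_def
 by (intro Bochner_Integration.integral_cong refl arg_cong[where f="lexval l z"] costs_pathset_sym)

lemma Rm_empty: "A = {} \<or> B = {} \<Longrightarrow> Rm l z m d U A g B h = 0"
 by (auto simp: Rm_def pathset_def costs_def lexval_def)

text \<open>The outcome attached to the stub \<open>a\<close>: the clusters meet, two free stubs of
  one cluster cancel, or a new vertex joins with its remaining stubs one generation further. The
  second case is no actual event, since stubs paired inside a cluster lie on no path; it is there so
  that sums may run over all of \<open>A\<close>.\<close>

definition after where
 "after l z m d U A g B h a =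
  (if m a \<in> B then z ^ (g a + 1 + h (m a))
   else if m a \<in> A then Rm l z m d U (A - {a, m a}) g B h
   else Rm l z m d (U - {fst (m a)}) ((A - {a}) \<union> (vstubs d {fst (m a)} - {m a}))
      (\<lambda>s. if s \<in> A then g s else g a + 1) B h)"

text \<open>The race among the boundary stubs gives the identity with \<open>bdry m A\<close> in
  place of \<open>A\<close>. A stub paired inside \<open>A\<close> contributes the present value
  itself, by \<open>pathset_internal\<close>, so adding these terms raises the coefficient from
  \<open>card (bdry m A)\<close> to \<open>card A\<close>. The result no longer asks which stubs are
  paired internally, which is what makes averaging over matchings possible.\<close>

lemma Rm_step:
 assumes st: "fstate m d U A B" and z: "norm z \<le> 1"
 shows "(of_nat (card A) - \<i> * of_real l) * Rm l z m d U A g B h = (\<Sum>a\<in>A. after l z m d U A g B h a)"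
proof -
 interpret P: prob_space "PW :: (nat \<times> nat \<Rightarrow> real) measure" by (rule prob_space_PW)
 let ?b = "bdry m A" and ?R = "Rm l z m d U A g B h" and ?P = "pathset m d U A g B h"
 have fin: "finite A" "finite B" "finite U" using st by (auto simp: fstate_def)
 have finb: "finite ?b" using fin by (simp add: bdry_def)
 have finP: "finite ?P" using finite_pathset fin by blast
 have int: "after l z m d U A g B h a = ?R" if "a \<in> A - ?b" for a
 proof -
  have "a \<in> A" "m a \<in> A" using that by (auto simp: bdry_def)
  moreover have "m a \<notin> B" using calculation st by (auto simp: fstate_def)
  ultimately show ?thesis using pathset_internal[OF st] by (simp add: after_def Rm_def)
 qed
 have "(of_nat (card ?b) - \<i> * of_real l) * ?R = (\<Sum>a\<in>?b. after l z m d U A g B h a)"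
 proof (cases "?b = {}")
  case True
  then have "?R = 0" using pathset_no_bdry[OF st] by (simp add: Rm_def costs_def lexval_def)
  then show ?thesis using True by simp
 next
  case False
  let ?K = "key m ` ?b"
  define q where "q = inv_into ?b (key m)"
  have q: "q (key m a) = a" if "a \<in> ?b" for a
   using that inj_key_bdry[OF st] by (simp add: q_def)
  define \<Psi> where "\<Psi> = (\<lambda>e w. let a = q e in if m a \<in> B then z ^ (g a + 1 + h (m a)) else
    lexval l z (costs w (pathset m d (U - {fst (m a)}) ((A - {a}) \<union> (vstubs d {fst (m a)} - {m a}))
      (\<lambda>s. if s \<in> A then g s else g a + 1) B h)))"
  have inU: "m a \<in> vstubs d {fst (m a)}" "fst (m a) \<in> U" if "a \<in> ?b" "m a \<notin> B" for a
   using that st by (auto simp: fstate_def bdry_def vstubs_def)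
  have finP': "finite (pathset m d (U - {v}) ((A - {a}) \<union> (vstubs d {v} - S)) g' B h)" for a v g' S
   using fin finite_vstubs[of "{v}" d] by (intro finite_pathset) auto
  have "(real (card ?K) - \<i> * l) * (\<integral>w. lexval l z (costs w ?P) \<partial>PW) = (\<Sum>e\<in>?K. \<integral>w. \<Psi> e w \<partial>PW)"
  proof (rule exponential_race[where C=1])
   show "finite ?K" "?K \<noteq> {}" using finb False by auto
   show "(\<lambda>w. lexval l z (costs w ?P)) \<in> borel_measurable PW" by (rule measurable_lexval[OF finP])
   show "norm (lexval l z (costs w ?P)) \<le> 1" for w by (rule norm_lexval_le[OF z])
   show "\<Psi> e \<in> borel_measurable PW" for e
    unfolding \<Psi>_def Let_def using measurable_lexval[OF finP'] by auto
   fix e and x :: real and w :: "nat \<times> nat \<Rightarrow> real"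
   assume e: "e \<in> ?K" and x: "x \<ge> 0" and w: "\<And>k. w k > 0"
   then obtain a where a: "a \<in> ?b" "e = key m a" by auto
   then have aA: "a \<in> A" by (simp add: bdry_def)
   show "lexval l z (costs (shift ?K e x w) ?P) = exp (\<i> * l * x) * \<Psi> e w"
   proof (cases "m a \<in> B")
    case True
    then show ?thesis using lexval_hit[OF st aA True w x] by (simp add: \<Psi>_def a q[OF a(1)])
   next
    case False
    then show ?thesis
     using lexval_grow[OF st aA inU[OF a(1) False] w x] by (simp add: \<Psi>_def a q[OF a(1)])
   qed
  qed
  also have "(\<Sum>e\<in>?K. \<integral>w. \<Psi> e w \<partial>PW) = (\<Sum>a\<in>?b. \<integral>w. \<Psi> (key m a) w \<partial>PW)"
   by (simp add: sum.reindex[OF inj_key_bdry[OF st]])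
  also have "\<dots> = (\<Sum>a\<in>?b. after l z m d U A g B h a)"
  proof (rule sum.cong[OF refl])
   fix a assume a: "a \<in> ?b"
   then have "m a \<notin> A" by (simp add: bdry_def)
   then show "(\<integral>w. \<Psi> (key m a) w \<partial>PW) = after l z m d U A g B h a"
    using P.prob_space
    by (simp add: \<Psi>_def q[OF a] after_def Rm_def Let_def cong: if_cong)
  qed
  finally show ?thesis using card_image[OF inj_key_bdry[OF st]] by (simp add: Rm_def)
 qed
 moreover have "(\<Sum>a\<in>A. after l z m d U A g B h a) =
   (\<Sum>a\<in>?b. after l z m d U A g B h a) + (\<Sum>a\<in>A - ?b. after l z m d U A g B h a)"
 proof -
  have "?b \<subseteq> A" by (auto simp: bdry_def)
  from sum.subset_diff[OF this fin(1), of "after l z m d U A g B h"] show ?thesis by (simp only: add.commute)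
 qed
 moreover have "(\<Sum>a\<in>A - ?b. after l z m d U A g B h a) = of_nat (card A - card ?b) * ?R"
  using int finb by (simp add: card_Diff_subset bdry_def)
 moreover have "card ?b \<le> card A" using fin by (intro card_mono) (auto simp: bdry_def)
 ultimately show ?thesis by (simp add: of_nat_diff algebra_simps)
qed

subsection \<open>Uniform matchings\<close>

abbreviation match_upd where "match_upd m a b \<equiv> m(a := b, b := a)"

lemma matchings_empty: "matchings {} = {\<lambda>s. s}"
 by (auto simp: matchings_def fun_eq_iff)

lemma match_upd_in:
 assumes "a \<in> S" "b \<in> S" "a \<noteq> b" "m \<in> matchings (S - {a, b})"
 shows "match_upd m a b \<in> matchings S"
 using assms unfolding matchings_def by (auto simp: fun_upd_def)

lemma match_restrict:
 assumes "m \<in> matchings S" "a \<in> S"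
 shows "m(a := a, m a := m a) \<in> matchings (S - {a, m a})" "m a \<in> S - {a}"
  "match_upd (m(a := a, m a := m a)) a (m a) = m"
proof -
 have 1: "m s \<in> S" "m s \<noteq> s" "m (m s) = s" if "s \<in> S" for s using assms that by (auto simp: matchings_def)
 have 2: "m s = s" if "s \<notin> S" for s using assms that unfolding matchings_def by blast
 show "m a \<in> S - {a}" using 1[OF assms(2)] by auto
 show "match_upd (m(a := a, m a := m a)) a (m a) = m" using 1[OF assms(2)] by (auto simp: fun_eq_iff)
 have "m s \<noteq> a" "m s \<noteq> m a" if "s \<in> S" "s \<noteq> a" "s \<noteq> m a" for s using 1 that assms(2) by metis+
 then show "m(a := a, m a := m a) \<in> matchings (S - {a, m a})"
  unfolding matchings_def using 1 2 by (auto simp: fun_upd_def)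
qed

lemma match_upd_restrict:
 assumes "m \<in> matchings (S - {a, b})" "a \<noteq> b"
 shows "(match_upd m a b)(a := a, b := b) = m"
 using assms by (auto simp: matchings_def fun_eq_iff)

lemma finite_matchings: "finite S \<Longrightarrow> finite (matchings S)"
proof (induction "card S" arbitrary: S rule: less_induct)
 case less
 show ?case
 proof (cases "S = {}")
  case True then show ?thesis by (simp add: matchings_empty)
 next
  case False
  then obtain a where a: "a \<in> S" by auto
  have "matchings S \<subseteq> (\<Union>b\<in>S - {a}. (\<lambda>m. match_upd m a b) ` matchings (S - {a, b}))"
  proof
   fix m assume m: "m \<in> matchings S"
   show "m \<in> (\<Union>b\<in>S - {a}. (\<lambda>m. match_upd m a b) ` matchings (S - {a, b}))"
    using match_restrict[OF m a] by (intro UN_I[of "m a"] image_eqI[of _ _ "m(a := a, m a := m a)"]) auto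
  qed
  moreover have "finite (matchings (S - {a, b}))" if "b \<in> S - {a}" for b
   using less.prems a that by (intro less.hyps psubset_card_mono) auto
  ultimately show ?thesis using less.prems by (meson finite_Diff finite_UN_I finite_imageI finite_subset)
 qed
qed

text \<open>A matching of \<open>S\<close> is the partner of \<open>a\<close> together with a
  matching of the remaining stubs. Outside its set a matching is the identity, so the restriction
  resets both stubs to themselves.\<close>

lemma sum_matchings:
 fixes f :: "_ \<Rightarrow> 'b :: comm_monoid_add"
 assumes "finite S" "a \<in> S"
 shows "(\<Sum>m\<in>matchings S. f m) = (\<Sum>b\<in>S - {a}. \<Sum>m\<in>matchings (S - {a, b}). f (match_upd m a b))"
proof -
 have "(\<Sum>b\<in>S - {a}. \<Sum>m\<in>matchings (S - {a, b}). f (match_upd m a b))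
  = (\<Sum>(b, m)\<in>Sigma (S - {a}) (\<lambda>b. matchings (S - {a, b})). f (match_upd m a b))"
  using assms finite_matchings by (intro sum.Sigma) auto
 also have "\<dots> = (\<Sum>m\<in>matchings S. f m)"
 proof (rule sum.reindex_bij_witness[where i="\<lambda>m. (m a, m(a := a, m a := m a))" and j="\<lambda>(b, m). match_upd m a b"])
  fix x assume x: "x \<in> Sigma (S - {a}) (\<lambda>b. matchings (S - {a, b}))"
  obtain b m where bm: "x = (b, m)" by (cases x)
  have m: "b \<in> S" "a \<noteq> b" "m \<in> matchings (S - {a, b})" using x bm by auto
  show "(case x of (b, m) \<Rightarrow> match_upd m a b) \<in> matchings S" using match_upd_in[OF assms(2) m] bm by simp
  have "match_upd m a b a = b" using m by simp
  then show "((case x of (b, m) \<Rightarrow> match_upd m a b) a, (case x of (b, m) \<Rightarrow> match_upd m a b)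
     (a := a, (case x of (b, m) \<Rightarrow> match_upd m a b) a := (case x of (b, m) \<Rightarrow> match_upd m a b) a)) = x"
   using match_upd_restrict[OF m(3,2)] bm by simp
  show "f (case x of (b, m) \<Rightarrow> match_upd m a b) = (case x of (b, m) \<Rightarrow> f (match_upd m a b))" using bm by simp
 next
  fix m assume m: "m \<in> matchings S"
  note r = match_restrict[OF m assms(2)]
  show "(case (m a, m(a := a, m a := m a)) of (b, m) \<Rightarrow> match_upd m a b) = m" using r(3) by simp
  show "(m a, m(a := a, m a := m a)) \<in> Sigma (S - {a}) (\<lambda>b. matchings (S - {a, b}))" using r by auto
 qed
 finally show ?thesis by simp
qed

text \<open>The product is the double factorial (2k - 1)!!; it serves both positivity and the ratio
  of consecutive counts in \<open>mavg_step\<close>.\<close>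

lemma card_matchings_pos:
 "finite S \<Longrightarrow> card S = 2 * k \<Longrightarrow> card (matchings S) = (\<Prod>i<k. 2 * i + 1)"
proof (induction k arbitrary: S)
 case 0 then show ?case by (simp add: matchings_empty)
next
 case (Suc k)
 then have "S \<noteq> {}" by auto
 then obtain a where a: "a \<in> S" by auto
 have c: "card (matchings (S - {a, b})) = (\<Prod>i<k. 2 * i + 1)" if "b \<in> S - {a}" for b
  using Suc.prems a that by (intro Suc.IH) (auto simp: card_Diff_subset)
 have "card (matchings S) = (\<Sum>m\<in>matchings S. 1)" by simp
 also have "\<dots> = (\<Sum>b\<in>S - {a}. \<Sum>m\<in>matchings (S - {a, b}). 1)" by (rule sum_matchings[OF Suc.prems(1) a])
 also have "\<dots> = (\<Sum>b\<in>S - {a}. (\<Prod>i<k. 2 * i + 1))" using c by (intro sum.cong) auto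
 also have "\<dots> = (2 * k + 1) * (\<Prod>i<k. 2 * i + 1)" using Suc.prems a by simp
 finally show ?case by (simp add: mult.commute)
qed

definition mavg :: "(nat \<times> nat) set \<Rightarrow> ((nat \<times> nat \<Rightarrow> nat \<times> nat) \<Rightarrow> complex) \<Rightarrow> complex" where
 "mavg S f = (\<Sum>m\<in>matchings S. f m) / of_nat (card (matchings S))"

text \<open>Deferred decisions: the partner of \<open>a\<close> is uniform among the other stubs,
  and given the partner the rest is again a uniform matching.\<close>

lemma mavg_step:
 assumes "finite S" "even (card S)" "a \<in> S"
 shows "mavg S f = (\<Sum>b\<in>S - {a}. mavg (S - {a, b}) (\<lambda>m. f (match_upd m a b))) / (of_nat (card S) - 1)"
proof -
 obtain k where k: "card S = 2 * k" using assms(2) by (elim evenE)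
 have "card S > 0" using assms by (auto simp: card_gt_0_iff)
 then obtain k' where k': "k = Suc k'" using k by (cases k) auto
 let ?c = "\<Prod>i<k'. 2 * i + (1::nat)"
 have c1: "card (matchings S) = (2 * k' + 1) * ?c"
  using card_matchings_pos[OF assms(1) k] by (simp add: k' mult.commute)
 have c2: "card (matchings (S - {a, b})) = ?c" if "b \<in> S - {a}" for b
  using assms that k k' by (intro card_matchings_pos) (auto simp: card_Diff_subset)
 have "mavg S f = (\<Sum>b\<in>S - {a}. (\<Sum>m\<in>matchings (S - {a, b}). f (match_upd m a b))) / (of_nat (2 * k' + 1) * of_nat ?c)"
  unfolding mavg_def c1 of_nat_mult by (subst sum_matchings[OF assms(1,3)]) simp
 also have "\<dots> = (\<Sum>b\<in>S - {a}. (\<Sum>m\<in>matchings (S - {a, b}). f (match_upd m a b)) / of_nat ?c) / of_nat (2 * k' + 1)"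
  by (simp add: sum_divide_distrib[symmetric] field_simps)
 also have "(\<Sum>b\<in>S - {a}. (\<Sum>m\<in>matchings (S - {a, b}). f (match_upd m a b)) / of_nat ?c) =
  (\<Sum>b\<in>S - {a}. mavg (S - {a, b}) (\<lambda>m. f (match_upd m a b)))"
  using c2 by (intro sum.cong) (auto simp: mavg_def)
 also have "(of_nat (2 * k' + 1) :: complex) = of_nat (card S) - 1" using k k' by simp
 finally show ?thesis .
qed

lemma mavg_const:
 assumes "finite S" "even (card S)"
 shows "mavg S (\<lambda>_. c) = c"
proof -
 obtain k where k: "card S = 2 * k" using assms(2) by (elim evenE)
 have "card (matchings S) > 0" unfolding card_matchings_pos[OF assms(1) k] by (simp add: prod_pos)
 then show ?thesis by (simp add: mavg_def)
qed

lemma mavg_cong: "(\<And>m. m \<in> matchings S \<Longrightarrow> f m = f' m) \<Longrightarrow> mavg S f = mavg S f'"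
 by (simp add: mavg_def)

lemma mavg_sum: "mavg S (\<lambda>m. \<Sum>a\<in>A. f a m) = (\<Sum>a\<in>A. mavg S (f a))"
 unfolding mavg_def by (subst sum.swap) (simp add: sum_divide_distrib)

lemma mavg_divide: "mavg S (\<lambda>m. f m / c) = mavg S f / c"
 unfolding mavg_def by (simp add: sum_divide_distrib[symmetric] field_simps)

subsection \<open>The size recursion\<close>

text \<open>\<open>N\<close> is the fuel of the recursion, with value 0 when it runs out. The first
  quotient is the transform of the waiting time. Among the possible partners of the ringing stub,
  \<open>hi\<close> end the exploration with one last edge, \<open>lo - 1\<close> cancel with it,
  and \<open>d v\<close> lead to the vertex \<open>v\<close>. The quotient in the last term is the
  change of the mean of \<open>z ^ g\<close>: of the new free stubs \<open>lo - 1\<close> are old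
  and \<open>d v - 1\<close> lie one generation further. For \<open>lo = 1\<close> the truncated
  \<open>lo - 2\<close> comes with the factor 0.\<close>

primrec Qf :: "(nat \<Rightarrow> nat) \<Rightarrow> real \<Rightarrow> complex \<Rightarrow> nat \<Rightarrow> nat set \<Rightarrow> nat \<Rightarrow> nat \<Rightarrow> complex" where
 "Qf d l z 0 U s b = 0"
| "Qf d l z (Suc N) U s b = (let lo = min s b; hi = max s b in
  if lo = 0 then 0 else
   of_nat lo / (of_nat lo - \<i> * of_real l) / of_nat (lo + hi + (\<Sum>v\<in>U. d v) - 1) *
   (of_nat hi * z + (of_nat lo - 1) * Qf d l z N U (lo - 2) hi
    + (\<Sum>v\<in>U. of_nat (d v) * ((of_nat lo - 1) + (of_nat (d v) - 1) * z) / of_nat (lo + d v - 2)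
      * Qf d l z N (U - {v}) (lo + d v - 2) hi)))"

lemma Qf_sym: "Qf d l z N U s b = Qf d l z N U b s"
 by (cases N) (simp_all add: min.commute max.commute)

text \<open>By \<open>mavg_Rm\<close> the generations enter the averaged transform through this mean
  alone.\<close>

definition gmean :: "complex \<Rightarrow> (nat \<times> nat) set \<Rightarrow> (nat \<times> nat \<Rightarrow> nat) \<Rightarrow> complex" where
 "gmean z A g = (\<Sum>a\<in>A. z ^ g a) / of_nat (card A)"

definition split_state where
 "split_state d U A B \<longleftrightarrow> finite U \<and> finite A \<and> finite B \<and> A \<inter> B = {} \<and> A \<inter> vstubs d U = {} \<and> B \<inter> vstubs d U = {}"

lemma fstate_matching:
 assumes "split_state d U A B" "m \<in> matchings (A \<union> B \<union> vstubs d U)"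
 shows "fstate m d U A B"
 using assms unfolding split_state_def fstate_def matchings_def by auto

lemma split_state_sym: "split_state d U A B \<Longrightarrow> split_state d U B A"
 by (auto simp: split_state_def)

lemma sum_vstubs: "finite U \<Longrightarrow> (\<Sum>s\<in>vstubs d U. f s) = (\<Sum>v\<in>U. \<Sum>s\<in>vstubs d {v}. f s)"
proof -
 have "vstubs d U = (\<Union>v\<in>U. vstubs d {v})" by (auto simp: vstubs_def)
 then show "finite U \<Longrightarrow> ?thesis"
  by (simp only:) (rule sum.UNION_disjoint, auto simp: finite_vstubs, auto simp: vstubs_def)
qed

text \<open>Averaging over the ringing stub and its partner makes the generations linear: in each of
  the three cases the sum over pairs is a multiple of the sum of \<open>z ^ g a\<close> over
  \<open>A\<close>, which splits off together with \<open>gmean z B h\<close>. What remains is the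
  recursion of \<open>Qf\<close>, which knows the clusters by their sizes only.\<close>

lemma mavg_Rm_step:
 assumes st: "split_state d U A B" and z: "norm z \<le> 1"
  and ev: "even (card (A \<union> B \<union> vstubs d U))" and AB: "card A \<le> card B" "A \<noteq> {}"
  and IH: "\<And>U A B g h. split_state d U A B \<Longrightarrow> even (card (A \<union> B \<union> vstubs d U)) \<Longrightarrow>
   card (A \<union> B \<union> vstubs d U) \<le> N \<Longrightarrow>
   mavg (A \<union> B \<union> vstubs d U) (\<lambda>m. Rm l z m d U A g B h) = gmean z A g * gmean z B h * Qf d l z N U (card A) (card B)"
  and N: "card (A \<union> B \<union> vstubs d U) \<le> Suc N"
 shows "mavg (A \<union> B \<union> vstubs d U) (\<lambda>m. Rm l z m d U A g B h)
  = gmean z A g * gmean z B h * Qf d l z (Suc N) U (card A) (card B)"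
proof -
 let ?F = "A \<union> B \<union> vstubs d U" and ?n = "card A" and ?k = "card B"
 let ?S = "\<Sum>a\<in>A. z ^ g a" and ?MB = "gmean z B h"
 have fin: "finite A" "finite B" "finite U" and finF: "finite ?F" and dis: "A \<inter> B = {}" "A \<inter> vstubs d U = {}" "B \<inter> vstubs d U = {}"
  using st finite_vstubs by (auto simp: split_state_def)
 have n: "?n \<ge> 1" using AB fin by (simp add: Suc_leI card_gt_0_iff)
 then have k: "?k \<ge> 1" using AB by simp
 have cF: "card ?F = ?n + ?k + (\<Sum>v\<in>U. d v)"
  using fin dis card_vstubs[of U d] by (subst card_Un_disjoint) (auto simp: finite_vstubs card_Un_disjoint)
 have c2: "card (?F - {a, b}) = card ?F - 2" if "a \<in> A" "b \<in> ?F - {a}" for a b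
  using that finF by (subst card_Diff_subset) auto
 have evab: "even (card (?F - {a, b}))" "card (?F - {a, b}) \<le> N" if "a \<in> A" "b \<in> ?F - {a}" for a b
  using c2[OF that] ev N n by auto
 define T where "T a b = mavg (?F - {a, b}) (\<lambda>m. after l z (match_upd m a b) d U A g B h a)" for a b
 have nl: "of_nat ?n - \<i> * of_real l \<noteq> 0" using n by (auto simp: complex_eq_iff)
 have "mavg ?F (\<lambda>m. Rm l z m d U A g B h)
  = mavg ?F (\<lambda>m. (\<Sum>a\<in>A. after l z m d U A g B h a) / (of_nat ?n - \<i> * of_real l))"
  using Rm_step[OF fstate_matching[OF st] z] nl
  by (intro mavg_cong) (simp add: field_simps)
 also have "\<dots> = (\<Sum>a\<in>A. mavg ?F (\<lambda>m. after l z m d U A g B h a)) / (of_nat ?n - \<i> * of_real l)"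
  by (simp add: mavg_divide mavg_sum)
 also have "(\<Sum>a\<in>A. mavg ?F (\<lambda>m. after l z m d U A g B h a))
  = (\<Sum>a\<in>A. (\<Sum>b\<in>?F - {a}. T a b) / (of_nat (card ?F) - 1))"
  unfolding T_def by (intro sum.cong refl mavg_step finF ev) auto
 also have "\<dots> = (\<Sum>a\<in>A. \<Sum>b\<in>?F - {a}. T a b) / (of_nat (card ?F) - 1)"
  by (simp add: sum_divide_distrib)
 also have "(\<Sum>a\<in>A. \<Sum>b\<in>?F - {a}. T a b)
  = (\<Sum>a\<in>A. (\<Sum>b\<in>B. T a b) + (\<Sum>b\<in>A - {a}. T a b) + (\<Sum>v\<in>U. \<Sum>b\<in>vstubs d {v}. T a b))"
 proof (rule sum.cong[OF refl])
  fix a assume a: "a \<in> A"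
  have "?F - {a} = B \<union> (A - {a}) \<union> vstubs d U" using a dis by auto
  then show "(\<Sum>b\<in>?F - {a}. T a b) = (\<Sum>b\<in>B. T a b) + (\<Sum>b\<in>A - {a}. T a b) + (\<Sum>v\<in>U. \<Sum>b\<in>vstubs d {v}. T a b)"
   using fin dis finite_vstubs[of U d]
   by (simp only: sum_vstubs[OF fin(3), symmetric]) (subst sum.union_disjoint; (subst sum.union_disjoint)?; auto)
 qed
 also have "\<dots> = (\<Sum>a\<in>A. \<Sum>b\<in>B. T a b) + (\<Sum>a\<in>A. \<Sum>b\<in>A - {a}. T a b) + (\<Sum>v\<in>U. \<Sum>a\<in>A. \<Sum>b\<in>vstubs d {v}. T a b)"
  by (simp add: sum.distrib sum.swap[of _ U A])
 also have "(\<Sum>a\<in>A. \<Sum>b\<in>B. T a b) = of_nat ?k * z * (?S * ?MB)"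
 proof -
  have "T a b = z ^ g a * z * z ^ h b" if "a \<in> A" "b \<in> B" for a b
  proof -
   have "b \<in> ?F - {a}" using that dis by auto
   then have "T a b = mavg (?F - {a, b}) (\<lambda>m. z ^ (g a + 1 + h b))"
    unfolding T_def using that by (intro mavg_cong) (auto simp: after_def)
   also have "\<dots> = z ^ (g a + 1 + h b)" using evab[OF that(1) \<open>b \<in> ?F - {a}\<close>] finF by (intro mavg_const) auto
   finally show ?thesis by (simp add: power_add mult.assoc)
  qed
  then have "(\<Sum>a\<in>A. \<Sum>b\<in>B. T a b) = (\<Sum>a\<in>A. \<Sum>b\<in>B. z ^ g a * z * z ^ h b)" by simp
  also have "\<dots> = ?S * z * (\<Sum>b\<in>B. z ^ h b)"
   by (simp only: sum_product[symmetric] sum_distrib_right[symmetric])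
  finally show ?thesis using k by (simp add: gmean_def field_simps)
 qed
 \<comment> \<open>Every free stub survives the deletion of a random pair equally often, so the mean
   of \<open>z ^ g\<close> is unchanged on average.\<close>
 also have "(\<Sum>a\<in>A. \<Sum>b\<in>A - {a}. T a b) = (of_nat ?n - 1) * Qf d l z N U (?n - 2) ?k * (?S * ?MB)"
 proof -
  have T: "T a b = gmean z (A - {a, b}) g * ?MB * Qf d l z N U (?n - 2) ?k" if "a \<in> A" "b \<in> A - {a}" for a b
  proof -
   have b: "b \<in> ?F - {a}" using that by auto
   have F': "?F - {a, b} = (A - {a, b}) \<union> B \<union> vstubs d U" using that dis by auto
   have "T a b = mavg (?F - {a, b}) (\<lambda>m. Rm l z m d U (A - {a, b}) g B h)"
    unfolding T_def
   proof (rule mavg_cong)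
    fix m
    have "pathset (match_upd m a b) d U (A - {a, b}) g B h = pathset m d U (A - {a, b}) g B h"
     using that dis by (intro pathset_cong) auto
    then show "after l z (match_upd m a b) d U A g B h a = Rm l z m d U (A - {a, b}) g B h"
     using that dis by (auto simp: after_def Rm_def)
   qed
   also have "\<dots> = gmean z (A - {a, b}) g * ?MB * Qf d l z N U (card (A - {a, b})) ?k"
    unfolding F' by (rule IH) (use evab[OF that(1) b] F' st in \<open>auto simp: split_state_def\<close>)
   also have "card (A - {a, b}) = ?n - 2" using that fin by (subst card_Diff_subset) auto
   finally show ?thesis .
  qed
  show ?thesis
  proof (cases "?n \<ge> 3")
   case True
   have "(\<Sum>a\<in>A. \<Sum>b\<in>A - {a}. gmean z (A - {a, b}) g)
    = (\<Sum>a\<in>A. \<Sum>b\<in>A - {a}. (?S - z ^ g a - z ^ g b)) / (of_nat ?n - 2)"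
   proof -
    have "gmean z (A - {a, b}) g = (?S - z ^ g a - z ^ g b) / (of_nat ?n - 2)" if "a \<in> A" "b \<in> A - {a}" for a b
    proof -
     have "card (A - {a, b}) = ?n - 2" using that fin by (subst card_Diff_subset) auto
     moreover have "(\<Sum>x\<in>A - {a, b}. z ^ g x) = ?S - (\<Sum>x\<in>{a, b}. z ^ g x)"
      using that fin by (intro sum_diff) auto
     ultimately show ?thesis using that True by (auto simp: gmean_def of_nat_diff algebra_simps)
    qed
    then show ?thesis by (simp add: sum_divide_distrib)
   qed
   also have "(\<Sum>a\<in>A. \<Sum>b\<in>A - {a}. (?S - z ^ g a - z ^ g b))
    = (\<Sum>a\<in>A. (of_nat ?n - 1) * ?S - (of_nat ?n - 1) * z ^ g a - (?S - z ^ g a))"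
   proof (rule sum.cong[OF refl])
    fix a assume a: "a \<in> A"
    have "(\<Sum>b\<in>A - {a}. z ^ g b) = ?S - z ^ g a" using a fin by (simp add: sum_diff1)
    moreover have "of_nat (card (A - {a})) = (of_nat ?n - 1 :: complex)" using a n fin by (simp add: of_nat_diff)
    moreover have "(\<Sum>b\<in>A - {a}. (?S - z ^ g a - z ^ g b))
      = of_nat (card (A - {a})) * (?S - z ^ g a) - (\<Sum>b\<in>A - {a}. z ^ g b)"
     by (subst sum_subtractf) simp
    ultimately show "(\<Sum>b\<in>A - {a}. (?S - z ^ g a - z ^ g b)) = (of_nat ?n - 1) * ?S - (of_nat ?n - 1) * z ^ g a - (?S - z ^ g a)"
     by (simp only: right_diff_distrib)
   qed
   also have "\<dots> = (of_nat ?n - 1) * (of_nat ?n - 2) * ?S"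
    by (simp add: sum_subtractf sum_distrib_left[symmetric]) (simp add: algebra_simps)
   finally have "(\<Sum>a\<in>A. \<Sum>b\<in>A - {a}. gmean z (A - {a, b}) g) = (of_nat ?n - 1) * ?S"
   proof -
    have "(of_nat ?n - 2 :: complex) \<noteq> 0" using True by (auto simp: complex_eq_iff)
    then show "(\<Sum>a\<in>A. \<Sum>b\<in>A - {a}. gmean z (A - {a, b}) g) = (of_nat ?n - 1) * (of_nat ?n - 2) * ?S / (of_nat ?n - 2) \<Longrightarrow> ?thesis"
     by simp
   qed
   then show ?thesis using T by (simp add: sum_distrib_right[symmetric] mult.assoc)
  next
   \<comment> \<open>With at most two free stubs the cluster is empty after the cancellation, and
     \<open>Qf\<close> vanishes there.\<close>
   case False
   then have "?n - 2 = 0" by simp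
   then have "Qf d l z N U (?n - 2) ?k = 0" by (cases N) simp_all
   then show ?thesis using T by simp
  qed
 qed
 also have "(\<Sum>v\<in>U. \<Sum>a\<in>A. \<Sum>b\<in>vstubs d {v}. T a b)
  = (\<Sum>v\<in>U. of_nat (d v) * ((of_nat ?n - 1) + (of_nat (d v) - 1) * z) / of_nat (?n + d v - 2)
      * Qf d l z N (U - {v}) (?n + d v - 2) ?k) * (?S * ?MB)"
 proof -
  have "(\<Sum>a\<in>A. \<Sum>b\<in>vstubs d {v}. T a b) = of_nat (d v) * ((of_nat ?n - 1) + (of_nat (d v) - 1) * z) / of_nat (?n + d v - 2)
      * Qf d l z N (U - {v}) (?n + d v - 2) ?k * (?S * ?MB)" if v: "v \<in> U" for v
  proof -
   let ?q = "Qf d l z N (U - {v}) (?n + d v - 2) ?k" and ?D = "of_nat (?n + d v - 2) :: complex"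
   have vU: "vstubs d {v} \<subseteq> vstubs d U" using v by (auto simp: vstubs_def)
   have cv: "card (vstubs d {v}) = d v" using card_vstubs[of "{v}" d] by simp
   have T: "T a b = (?S - z ^ g a + (of_nat (d v) - 1) * (z * z ^ g a)) / ?D * ?MB * ?q"
    if a: "a \<in> A" and bv: "b \<in> vstubs d {v}" for a b
   proof -
    let ?A' = "(A - {a}) \<union> (vstubs d {v} - {b})" and ?g' = "\<lambda>s. if s \<in> A then g s else g a + 1"
    have b: "b \<in> ?F - {a}" "b \<notin> A" "b \<notin> B" "fst b = v" using bv a dis vU by (auto simp: vstubs_def)
    have F': "?F - {a, b} = ?A' \<union> B \<union> vstubs d (U - {v})"
     using a bv dis vU by (auto simp: vstubs_def)
    have dis': "(A - {a}) \<inter> (vstubs d {v} - {b}) = {}" using vU dis by auto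
    have st': "split_state d (U - {v}) ?A' B"
     using fin dis vU finite_vstubs[of "{v}" d] vstubs_mono[of "U - {v}" U d] unfolding split_state_def
     by (auto simp: vstubs_def)
    have "T a b = mavg (?F - {a, b}) (\<lambda>m. Rm l z m d (U - {v}) ?A' ?g' B h)"
     unfolding T_def
    proof (rule mavg_cong)
     fix m
     have "pathset (match_upd m a b) d (U - {v}) ?A' ?g' B h = pathset m d (U - {v}) ?A' ?g' B h"
     proof (rule pathset_cong)
      fix s assume "s \<in> ?A' \<union> vstubs d (U - {v})"
      then have "s \<in> ?F - {a, b}" unfolding F' by blast
      then show "match_upd m a b s = m s" by simp
     qed auto
     then show "after l z (match_upd m a b) d U A g B h a = Rm l z m d (U - {v}) ?A' ?g' B h"
      using b by (auto simp: after_def Rm_def)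
    qed
    also have "\<dots> = gmean z ?A' ?g' * ?MB * Qf d l z N (U - {v}) (card ?A') ?k"
     unfolding F' by (rule IH[OF st']) (use evab[OF a b(1)] F' in auto)
    finally have Tab: "T a b = gmean z ?A' ?g' * ?MB * Qf d l z N (U - {v}) (card ?A') ?k" .
    have cA: "card ?A' = ?n + d v - 2"
    proof -
     have "card ?A' = (?n - 1) + (d v - 1)"
      using dis' fin a bv cv finite_vstubs[of "{v}" d] by (subst card_Un_disjoint) auto
     moreover have "d v \<ge> 1" using bv by (auto simp: vstubs_def)
     ultimately show ?thesis using n by simp
    qed
    have "gmean z ?A' ?g' = (?S - z ^ g a + (of_nat (d v) - 1) * (z * z ^ g a)) / ?D"
    proof -
     have "(\<Sum>s\<in>?A'. z ^ ?g' s) = (\<Sum>s\<in>A - {a}. z ^ ?g' s) + (\<Sum>s\<in>vstubs d {v} - {b}. z ^ ?g' s)"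
      using dis' fin finite_vstubs[of "{v}" d] by (intro sum.union_disjoint) auto
     also have "(\<Sum>s\<in>A - {a}. z ^ ?g' s) = ?S - z ^ g a" using a fin by (simp add: sum_diff1)
     also have "(\<Sum>s\<in>vstubs d {v} - {b}. z ^ ?g' s) = (\<Sum>s\<in>vstubs d {v} - {b}. z * z ^ g a)"
      using dis vU by (intro sum.cong) auto
     also have "\<dots> = of_nat (d v - 1) * (z * z ^ g a)" using bv cv finite_vstubs[of "{v}" d] by simp
     also have "of_nat (d v - 1) = (of_nat (d v) - 1 :: complex)" using bv by (auto simp: vstubs_def of_nat_diff)
     finally show ?thesis using cA by (simp add: gmean_def)
    qed
    then show ?thesis using Tab cA by simp
   qed
   have "(\<Sum>a\<in>A. \<Sum>b\<in>vstubs d {v}. T a b) = (\<Sum>a\<in>A. of_nat (d v) * ((?S - z ^ g a + (of_nat (d v) - 1) * (z * z ^ g a)) / ?D * ?MB * ?q))"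
    using T cv by simp
   also have "\<dots> = (\<Sum>a\<in>A. ?S - z ^ g a + (of_nat (d v) - 1) * (z * z ^ g a)) * (of_nat (d v) / ?D * ?MB * ?q)"
    unfolding sum_distrib_right by (intro sum.cong refl) simp
   also have "(\<Sum>a\<in>A. ?S - z ^ g a + (of_nat (d v) - 1) * (z * z ^ g a)) = ((of_nat ?n - 1) + (of_nat (d v) - 1) * z) * ?S"
    by (simp add: sum.distrib sum_subtractf sum_distrib_left[symmetric]) (simp add: algebra_simps)
   finally show ?thesis by (simp add: mult_ac)
  qed
  then show ?thesis by (simp add: sum_distrib_right)
 qed
 finally have "mavg ?F (\<lambda>m. Rm l z m d U A g B h) =
  (of_nat ?k * z + (of_nat ?n - 1) * Qf d l z N U (?n - 2) ?k
    + (\<Sum>v\<in>U. of_nat (d v) * ((of_nat ?n - 1) + (of_nat (d v) - 1) * z) / of_nat (?n + d v - 2)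
      * Qf d l z N (U - {v}) (?n + d v - 2) ?k)) * (?S * ?MB)
   / (of_nat (card ?F) - 1) / (of_nat ?n - \<i> * of_real l)"
  by (simp only: distrib_right mult.assoc)
 moreover have "?S = of_nat ?n * gmean z A g" using n by (simp add: gmean_def)
 moreover have "of_nat (card ?F) - 1 = (of_nat (?n + ?k + (\<Sum>v\<in>U. d v) - 1) :: complex)"
  using n by (simp add: cF of_nat_diff)
 ultimately show ?thesis using AB n by (simp add: Let_def min_absorb1 max_absorb2 mult_ac)
qed

text \<open>Each step uses up at least two stubs, so fuel equal to the number of stubs suffices. If
  \<open>A\<close> is the larger cluster, \<open>Rm_sym\<close> exchanges the roles, so that the
  smaller one always moves.\<close>

theorem mavg_Rm:
 assumes "norm z \<le> 1"
 shows "split_state d U A B \<Longrightarrow> even (card (A \<union> B \<union> vstubs d U)) \<Longrightarrow> card (A \<union> B \<union> vstubs d U) \<le> N \<Longrightarrow>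
  mavg (A \<union> B \<union> vstubs d U) (\<lambda>m. Rm l z m d U A g B h) = gmean z A g * gmean z B h * Qf d l z N U (card A) (card B)"
proof (induction N arbitrary: U A B g h)
 case 0
 then have "A = {}" by (auto simp: split_state_def finite_vstubs)
 then show ?case using Rm_empty[of A B] by (simp add: mavg_def)
next
 case (Suc N)
 note st = Suc.prems(1)
 show ?case
 proof (cases "A = {} \<or> B = {}")
  case True
  then have "Qf d l z (Suc N) U (card A) (card B) = 0" by auto
  then show ?thesis using Rm_empty[OF True] by (simp add: mavg_def)
 next
  case False
  show ?thesis
  proof (cases "card A \<le> card B")
   case True
   then show ?thesis using False Suc assms by (intro mavg_Rm_step) auto
  next
   case c: False
   have F: "A \<union> B \<union> vstubs d U = B \<union> A \<union> vstubs d U" by auto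
   have "mavg (A \<union> B \<union> vstubs d U) (\<lambda>m. Rm l z m d U A g B h) = mavg (A \<union> B \<union> vstubs d U) (\<lambda>m. Rm l z m d U B h A g)"
    using Rm_sym[OF fstate_matching[OF st]] by (intro mavg_cong) auto
   also have "\<dots> = gmean z B h * gmean z A g * Qf d l z (Suc N) U (card B) (card A)"
    unfolding F using c False Suc.prems Suc.IH assms split_state_sym[OF st]
    by (intro mavg_Rm_step) (auto simp: F)
   finally show ?thesis using Qf_sym[of d l z "Suc N" U "card A"] by (simp only: mult.commute mult.left_commute mult.assoc)
  qed
 qed
qed

section \<open>From the paths of the model to the recursion\<close>

definition linked where
 "linked m ss \<longleftrightarrow> (\<forall>k. Suc k < length ss \<longrightarrow> fst (m (ss ! k)) = fst (ss ! Suc k))"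

lemma linked_Cons2: "linked m (a # b # ss) \<longleftrightarrow> fst (m a) = fst b \<and> linked m (b # ss)"
 unfolding linked_def by (auto simp: nth_Cons split: nat.splits)

lemma linked_single: "linked m [a]"
 by (simp add: linked_def)

lemma linked_imp_conn:
 "set ss \<subseteq> vstubs d U \<Longrightarrow> linked m (a # ss) \<Longrightarrow> distinct (map fst ss) \<Longrightarrow>
  (\<And>s. s \<in> set (a # ss) \<Longrightarrow> snd (m s) < d (fst (m s))) \<Longrightarrow>
  conn m d U a (m (last (a # ss))) (map (key m) (a # ss))"
proof (induction ss arbitrary: a U)
 case Nil
 then show ?case using conn.edge[of m d U a] by simp
next
 case (Cons b ss)
 have b: "fst b \<in> U" "snd b < d (fst b)" using Cons.prems(1) by (auto simp: vstubs_def)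
 have "conn m d (U - {fst b}) b (m (last (b # ss))) (map (key m) (b # ss))"
 proof (rule Cons.IH)
  show "set ss \<subseteq> vstubs d (U - {fst b})"
  proof
   fix s assume s: "s \<in> set ss"
   have "fst s \<in> fst ` set ss" "fst b \<notin> fst ` set ss" using Cons.prems(3) imageI[OF s, of fst] by simp_all
   then have "fst s \<noteq> fst b" by metis
   then show "s \<in> vstubs d (U - {fst b})" using s Cons.prems(1) by (auto simp: vstubs_def)
  qed
  show "linked m (b # ss)" using Cons.prems(2) by (simp add: linked_Cons2)
 qed (use Cons.prems in auto)
 moreover have "m a \<in> vstubs d {fst b}"
  using Cons.prems(2) Cons.prems(4)[of a] by (simp add: linked_Cons2 vstubs_def)
 moreover have "b \<in> vstubs d {fst b}" using b by (simp add: vstubs_def)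
 ultimately show ?case using conn.step[where m=m, OF b(1)] by simp
qed

lemma conn_imp_linked:
 "conn m d U a b ks \<Longrightarrow> \<exists>ss. set ss \<subseteq> vstubs d U \<and> linked m (a # ss) \<and> distinct (map fst ss)
  \<and> b = m (last (a # ss)) \<and> ks = map (key m) (a # ss)"
proof (induction U a b ks rule: conn.induct)
 case (edge U a)
 show ?case by (intro exI[of _ "[]"]) (simp add: linked_single)
next
 case (step v U a a' b ks)
 then obtain ss where ss: "set ss \<subseteq> vstubs d (U - {v})" "linked m (a' # ss)" "distinct (map fst ss)"
  "b = m (last (a' # ss))" "ks = map (key m) (a' # ss)" by auto
 have "fst a' = v" "fst (m a) = v" "a' \<in> vstubs d U" using step by (auto simp: vstubs_def)
 moreover have "v \<notin> fst ` set ss" "set ss \<subseteq> vstubs d U" using ss(1) by (auto simp: vstubs_def)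
 ultimately show ?case using ss by (intro exI[of _ "a' # ss"]) (auto simp: linked_Cons2)
qed

lemma stubs_eq_vstubs: "stubs n d = vstubs d {1..n}"
 by (auto simp: stubs_def vstubs_def)

definition Pth where
 "Pth n g = (\<lambda>ss. (map (key (snd g)) ss, length ss)) ` paths12 n (fst g) (snd g)"

lemma finite_paths12: "finite (paths12 n d m)"
proof (rule finite_subset)
 have "distinct ss" if "distinct (map fst ss @ [x])" for ss :: "(nat \<times> nat) list" and x
  using that by (simp add: distinct_map)
 then show "paths12 n d m \<subseteq> {ss. set ss \<subseteq> stubs n d \<and> distinct ss}"
  by (auto simp: paths12_def is_path_def)
 show "finite {ss. set ss \<subseteq> stubs n d \<and> distinct ss}"
  by (rule finite_subset_distinct) (simp add: stubs_eq_vstubs finite_vstubs)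
qed

lemma finite_Pth: "finite (Pth n g)"
 by (simp add: Pth_def finite_paths12)

lemma path_weight_key: "path_weight m w ss = (\<Sum>s\<leftarrow>map (key m) ss. w s)"
 by (simp add: path_weight_def key_def comp_def)

lemma W12_minwt: "W12 n (g, w) = minwt w (Pth n g)"
 by (simp add: W12_def minwt_def Pth_def image_image path_weight_key Let_def)

lemma H12_minhop: "H12 n (g, w) = minhop w (Pth n g)"
proof -
 have "{length ss |ss. ss \<in> paths12 n (fst g) (snd g) \<and> path_weight (snd g) w ss = W12 n (g, w)}
  = snd ` {p \<in> Pth n g. (\<Sum>s\<leftarrow>fst p. w s) = minwt w (Pth n g)}"
  by (force simp: Pth_def path_weight_key W12_minwt)
 then show ?thesis by (simp add: H12_def minhop_def Let_def)
qed

lemma connected12_Pth: "connected12 n g \<longleftrightarrow> Pth n g \<noteq> {}"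
 by (simp add: connected12_def Pth_def)

text \<open>The exploration starts with the stubs of vertices 1 and 2 as free stubs of generation 0.
  A path between them visits neither vertex in its interior, which leaves
  \<open>{3..n}\<close>.\<close>

lemma Pth_eq_pathset:
 assumes m: "m \<in> matchings (stubs n d)" and n: "n \<ge> 2"
 shows "Pth n (d, m) = pathset m d {3..n} (vstubs d {1}) (\<lambda>_. 0) (vstubs d {2}) (\<lambda>_. 0)"
proof -
 have mS: "m s \<in> stubs n d" if "s \<in> stubs n d" for s using m that by (auto simp: matchings_def)
 have sub: "vstubs d {3..n} \<subseteq> stubs n d" "vstubs d {1} \<subseteq> stubs n d"
  using n by (auto simp: stubs_eq_vstubs vstubs_def)
 show ?thesis
 proof (intro set_eqI iffI)
  fix x assume "x \<in> Pth n (d, m)"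
  then obtain ss where ss: "is_path n d m 1 2 ss" "x = (map (key m) ss, length ss)"
   by (auto simp: Pth_def paths12_def)
  then obtain a r where ar: "ss = a # r" by (cases ss) (auto simp: is_path_def)
  have p: "set ss \<subseteq> stubs n d" "fst a = 1" "fst (m (last ss)) = 2" "linked m ss"
   "distinct (map fst ss @ [fst (m (last ss))])"
   using ss(1) unfolding is_path_def linked_def ar list.sel by blast+
  have r12: "1 \<notin> fst ` set r" "2 \<notin> fst ` set r" using p(2,3,5) unfolding ar by simp_all
  have "set r \<subseteq> vstubs d {3..n}"
  proof
   fix s assume s: "s \<in> set r"
   then have "s \<in> stubs n d" using p ar by auto
   moreover have "fst s \<in> fst ` set r" using s by (rule imageI)
   moreover note r12
   ultimately have "s \<in> stubs n d" "fst s \<noteq> 1" "fst s \<noteq> 2" by metis+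
   then show "s \<in> vstubs d {3..n}" by (auto simp: stubs_eq_vstubs vstubs_def)
  qed
  then have "conn m d {3..n} a (m (last (a # r))) (map (key m) (a # r))"
  proof (rule linked_imp_conn)
   fix s assume "s \<in> set (a # r)"
   then have "s \<in> stubs n d" using p(1) ar by blast
   then have "m s \<in> stubs n d" by (rule mS)
   then show "snd (m s) < d (fst (m s))" by (auto simp: stubs_eq_vstubs vstubs_def)
  qed (use p ar in auto)
  moreover have "a \<in> vstubs d {1}" using p ar by (auto simp: stubs_eq_vstubs vstubs_def)
  moreover have "m (last (a # r)) \<in> stubs n d" 
   by (rule mS) (use p(1) ar last_in_set[of "a # r"] in blast)
  then have "m (last (a # r)) \<in> vstubs d {2}" using p(3) ar by (auto simp: stubs_eq_vstubs vstubs_def)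
  ultimately show "x \<in> pathset m d {3..n} (vstubs d {1}) (\<lambda>_. 0) (vstubs d {2}) (\<lambda>_. 0)"
   unfolding ss(2) ar by (intro pathsetI) auto
 next
  fix x assume "x \<in> pathset m d {3..n} (vstubs d {1}) (\<lambda>_. 0) (vstubs d {2}) (\<lambda>_. 0)"
  then obtain a b ks where x: "x = (ks, length ks)" "a \<in> vstubs d {1}" "b \<in> vstubs d {2}" "conn m d {3..n} a b ks"
   by (auto simp: pathset_def)
  obtain ss where ss: "set ss \<subseteq> vstubs d {3..n}" "linked m (a # ss)" "distinct (map fst ss)"
  "b = m (last (a # ss))" "ks = map (key m) (a # ss)" using conn_imp_linked[OF x(4)] by blast
  have "fst ` set ss \<subseteq> {3..n}" using ss(1) by (auto simp: vstubs_def)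
  then have "distinct (map fst (a # ss) @ [fst (m (last (a # ss)))])"
   using ss x by (auto simp: vstubs_def)
  moreover have "set (a # ss) \<subseteq> stubs n d" using sub ss x by auto
  ultimately have "is_path n d m 1 2 (a # ss)"
   using ss x by (auto simp: is_path_def linked_def vstubs_def)
  then have "a # ss \<in> paths12 n (fst (d, m)) (snd (d, m))" by (simp add: paths12_def)
  then show "x \<in> Pth n (d, m)" unfolding Pth_def by (rule rev_image_eqI) (simp add: ss x(1))
 qed
qed

lemma weighted_CM_PW: "weighted_CM n p = measure_pmf (config_pmf n p) \<Otimes>\<^sub>M PW"
 by (simp add: weighted_CM_def)

lemma prob_space_weighted_CM: "prob_space (weighted_CM n p)"
proof -
 interpret P: prob_space "PW :: (nat \<times> nat \<Rightarrow> real) measure" by (rule prob_space_PW)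
 interpret M: prob_space "measure_pmf (config_pmf n p)" by (rule prob_space_measure_pmf)
 interpret MP: pair_prob_space "measure_pmf (config_pmf n p)" "PW :: (nat \<times> nat \<Rightarrow> real) measure" ..
 show ?thesis unfolding weighted_CM_PW by (rule MP.prob_space_axioms)
qed

lemma space_weighted_CM [simp]: "space (weighted_CM n p) = UNIV"
 by (simp add: weighted_CM_PW space_pair_measure)

text \<open>The graph enters through the finite set \<open>Pth\<close> alone, which ranges over a
  countable collection; joint measurability thus reduces to measurability in the weights for a fixed
  path set.\<close>

lemma measurable_via_Pth:
 assumes "\<And>P. finite P \<Longrightarrow> (\<lambda>w. f P w) \<in> measurable PW N"
 shows "(\<lambda>x. f (Pth n (fst x)) (snd x)) \<in> measurable (weighted_CM n p) N"
proof -
 let ?C = "Collect finite :: ((nat \<times> nat) list \<times> nat) set set"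
 have 1: "(\<lambda>(P, w). f P w) \<in> measurable (count_space ?C \<Otimes>\<^sub>M PW) N"
  using assms by (intro measurable_pair_measure_countable1) (auto intro: countable_Collect_finite)
 have "Pth n \<in> measurable (measure_pmf (config_pmf n p)) (count_space ?C)"
  by (simp add: finite_Pth Pi_iff)
 then have 2: "(\<lambda>x. (Pth n (fst x), snd x)) \<in> measurable (weighted_CM n p) (count_space ?C \<Otimes>\<^sub>M PW)"
  unfolding weighted_CM_PW by (intro measurable_Pair measurable_compose[OF measurable_fst] measurable_snd)
 from measurable_compose[OF 2 1] show ?thesis by simp
qed

lemma measurable_W12: "W12 n \<in> borel_measurable (weighted_CM n p)"
proof -
 have "W12 n = (\<lambda>x. minwt (snd x) (Pth n (fst x)))" by (auto simp: W12_minwt[symmetric])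
 then show ?thesis using measurable_via_Pth[OF measurable_minwt] by simp
qed

lemma measurable_H12: "H12 n \<in> measurable (weighted_CM n p) (count_space UNIV)"
proof -
 have "H12 n = (\<lambda>x. minhop (snd x) (Pth n (fst x)))" by (auto simp: H12_minhop[symmetric])
 then show ?thesis using measurable_via_Pth[OF measurable_minhop] by simp
qed

lemma conn_event_eq: "conn_event n p = {x. Pth n (fst x) \<noteq> {}}"
 by (simp add: conn_event_def connected12_Pth)

lemma sets_conn_event [measurable]: "conn_event n p \<in> sets (weighted_CM n p)"
proof -
 have "Measurable.pred (weighted_CM n p) (\<lambda>x. Pth n (fst x) \<noteq> {})"
  by (rule measurable_via_Pth[where f="\<lambda>P w. P \<noteq> {}"]) simp
 then show ?thesis unfolding conn_event_eq pred_def by simp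
qed

lemma norm_integral_le:
 fixes f :: "'a \<Rightarrow> 'b :: {banach, second_countable_topology}"
 assumes "prob_space M" and b: "\<And>x. norm (f x) \<le> C"
 shows "norm (integral\<^sup>L M f) \<le> C"
proof (cases "integrable M f")
 case True
 interpret prob_space M by fact
 have "norm (integral\<^sup>L M f) \<le> (\<integral>x. norm (f x) \<partial>M)" by (rule integral_norm_bound)
 also have "\<dots> \<le> C" using True b by (intro integral_le_const) auto
 finally show ?thesis .
next
 case False
 then show ?thesis using b[of undefined] norm_ge_zero order_trans by (metis not_integrable_integral_eq norm_zero)
qed

lemma integral_bind_pmf_bounded:
 fixes f :: "'a \<Rightarrow> complex"
 assumes b: "\<And>x. norm (f x) \<le> C"
 shows "(\<integral>x. f x \<partial>measure_pmf (bind_pmf p k)) = (\<integral>y. (\<integral>x. f x \<partial>measure_pmf (k y)) \<partial>measure_pmf p)"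
proof -
 have real: "(\<integral>x. g x \<partial>measure_pmf (bind_pmf p k)) = (\<integral>y. (\<integral>x. g x \<partial>measure_pmf (k y)) \<partial>measure_pmf p)"
  if "\<And>x. \<bar>g x\<bar> \<le> C" for g :: "'a \<Rightarrow> real"
  unfolding measure_pmf_bind
  by (rule integral_bind[where K="count_space UNIV" and B=C and B'=1])
   (use that measure_pmf_in_subprob_space in \<open>auto simp: measure_pmf.emeasure_space_1 measure_pmf.finite_measure_axioms\<close>)
 have i: "integrable (measure_pmf q) f" for q
  by (rule integrable_bounded_measurable[OF prob_space_measure_pmf _ b]) simp
 have ii: "integrable (measure_pmf p) (\<lambda>y. \<integral>x. f x \<partial>measure_pmf (k y))"
  by (rule integrable_bounded_measurable[OF prob_space_measure_pmf _ norm_integral_le[OF prob_space_measure_pmf b]]) simp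
 have r: "\<bar>Re (f x)\<bar> \<le> C" "\<bar>Im (f x)\<bar> \<le> C" for x
  using b[of x] abs_Re_le_cmod[of "f x"] abs_Im_le_cmod[of "f x"] by linarith+
 show ?thesis
  using i ii real[of "\<lambda>x. Re (f x)", OF r(1)] real[of "\<lambda>x. Im (f x)", OF r(2)]
  by (simp add: complex_eq_iff)
qed

definition Qn :: "real \<Rightarrow> complex \<Rightarrow> nat \<Rightarrow> (nat \<Rightarrow> nat) \<Rightarrow> complex" where
 "Qn l z n d = Qf d l z (\<Sum>v\<in>{1..n}. d v) {3..n} (d 1) (d 2)"

lemma sum_fix_parity: "n \<ge> 1 \<Longrightarrow> even (\<Sum>i\<in>{1..n}. fix_parity n d i)"
proof -
 assume n: "n \<ge> 1"
 have "(\<Sum>i\<in>{1..n}. (d(n := d n + 1)) i) = Suc (\<Sum>i\<in>{1..n}. d i)"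
  using n sum.remove[of "{1..n}" n d] sum.remove[of "{1..n}" n "d(n := d n + 1)"] by simp
 then show ?thesis by (auto simp: fix_parity_def)
qed

text \<open>The weights and the matching are integrated out and only the degrees remain. The parity
  correction makes the number of stubs even, so that matchings exist; positive root degrees make the
  initial means of \<open>z ^ g\<close> equal to 1.\<close>

theorem expectation_lexval:
 assumes n: "n \<ge> 3" and z: "norm z \<le> 1" and supp: "0 \<notin> set_pmf p"
 shows "(\<integral>x. lexval l z (costs (snd x) (Pth n (fst x))) \<partial>weighted_CM n p)
  = (\<integral>d. Qn l z n (fix_parity n d) \<partial>measure_pmf (Pi_pmf {1..n} 0 (\<lambda>_. p)))"
proof -
 interpret P: prob_space "PW :: (nat \<times> nat \<Rightarrow> real) measure" by (rule prob_space_PW)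
 interpret M: prob_space "measure_pmf (config_pmf n p)" by (rule prob_space_measure_pmf)
 interpret MP: pair_prob_space "measure_pmf (config_pmf n p)" "PW :: (nat \<times> nat \<Rightarrow> real) measure" ..
 let ?f = "\<lambda>g w. lexval l z (costs w (Pth n g))"
 have mf: "(\<lambda>x. ?f (fst x) (snd x)) \<in> borel_measurable (weighted_CM n p)"
  by (rule measurable_via_Pth[OF measurable_lexval])
 have "integrable (weighted_CM n p) (\<lambda>x. ?f (fst x) (snd x))"
  by (rule integrable_bounded_measurable[OF prob_space_weighted_CM mf norm_lexval_le[OF z]])
 then have "(\<integral>x. ?f (fst x) (snd x) \<partial>weighted_CM n p) = (\<integral>g. (\<integral>w. ?f g w \<partial>PW) \<partial>measure_pmf (config_pmf n p))"
  unfolding weighted_CM_PW using MP.integral_fst'[of "\<lambda>x. ?f (fst x) (snd x)"] by simp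
 also have "\<dots> = (\<integral>d. (\<integral>g. (\<integral>w. ?f g w \<partial>PW) \<partial>measure_pmf
    (bind_pmf (pmf_of_set (matchings (stubs n (fix_parity n d)))) (\<lambda>m. return_pmf (fix_parity n d, m))))
    \<partial>measure_pmf (Pi_pmf {1..n} 0 (\<lambda>_. p)))"
  unfolding config_pmf_def Let_def
 proof (rule integral_bind_pmf_bounded)
  fix g show "norm (\<integral>w. ?f g w \<partial>PW) \<le> 1"
   by (rule norm_integral_le[OF prob_space_PW norm_lexval_le[OF z]])
 qed
 also have "\<dots> = (\<integral>d. Qn l z n (fix_parity n d) \<partial>measure_pmf (Pi_pmf {1..n} 0 (\<lambda>_. p)))"
 proof (rule integral_cong_AE)
  show "AE d0 in measure_pmf (Pi_pmf {1..n} 0 (\<lambda>_. p)).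
   (\<integral>g. (\<integral>w. ?f g w \<partial>PW) \<partial>measure_pmf
    (bind_pmf (pmf_of_set (matchings (stubs n (fix_parity n d0)))) (\<lambda>m. return_pmf (fix_parity n d0, m))))
   = Qn l z n (fix_parity n d0)"
  proof (subst AE_measure_pmf_iff, rule ballI)
   fix d0 assume d0: "d0 \<in> set_pmf (Pi_pmf {1..n} 0 (\<lambda>_. p))"
   define d where "d = fix_parity n d0"
   have pos: "d0 v \<noteq> 0" if "v \<in> {1..n}" for v
    using d0 that supp by (auto simp: set_Pi_pmf PiE_dflt_def)
   have d1: "d 1 \<ge> 1" "d 2 \<ge> 1" using n pos[of 1] pos[of 2] by (auto simp: d_def fix_parity_def)
   let ?S = "stubs n d"
   have finS: "finite ?S" by (simp add: stubs_eq_vstubs finite_vstubs)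
   have cS: "card ?S = (\<Sum>v\<in>{1..n}. d v)" by (simp add: stubs_eq_vstubs card_vstubs)
   have ev: "even (card ?S)" unfolding cS unfolding d_def by (rule sum_fix_parity) (use n in simp)
   then obtain k where "card ?S = 2 * k" by (elim evenE)
   then have "card (matchings ?S) = (\<Prod>i<k. 2 * i + 1)" using card_matchings_pos[OF finS] by simp
   also have "\<dots> > 0" by (simp add: prod_pos)
   finally have ne: "matchings ?S \<noteq> {}" by auto
   let ?A = "vstubs d {1}" and ?B = "vstubs d {2}" and ?U = "{3..n}"
   have S: "?S = ?A \<union> ?B \<union> vstubs d ?U" using n by (auto simp: stubs_eq_vstubs vstubs_def)
   have st: "split_state d ?U ?A ?B" by (auto simp: split_state_def finite_vstubs) (auto simp: vstubs_def)
   have "(\<integral>g. (\<integral>w. ?f g w \<partial>PW) \<partial>measure_pmf (bind_pmf (pmf_of_set (matchings ?S)) (\<lambda>m. return_pmf (d, m))))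
    = (\<integral>m. (\<integral>w. ?f (d, m) w \<partial>PW) \<partial>measure_pmf (pmf_of_set (matchings ?S)))"
    using integral_map_pmf[of "\<lambda>m. (d, m)" "pmf_of_set (matchings ?S)" "\<lambda>g. \<integral>w. ?f g w \<partial>PW"]
    by (simp add: map_pmf_def)
   also have "\<dots> = (\<Sum>m\<in>matchings ?S. pmf (pmf_of_set (matchings ?S)) m *\<^sub>R (\<integral>w. ?f (d, m) w \<partial>PW))"
    using ne finite_matchings[OF finS] by (intro integral_measure_pmf) auto
   also have "\<dots> = mavg ?S (\<lambda>m. \<integral>w. ?f (d, m) w \<partial>PW)"
    using ne finite_matchings[OF finS] unfolding mavg_def sum_divide_distrib
    by (intro sum.cong) (auto simp: scaleR_conv_of_real field_simps)
   also have "\<dots> = mavg ?S (\<lambda>m. Rm l z m d ?U ?A (\<lambda>_. 0) ?B (\<lambda>_. 0))"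
    using n by (intro mavg_cong) (simp add: Pth_eq_pathset Rm_def)
   also have "\<dots> = gmean z ?A (\<lambda>_. 0) * gmean z ?B (\<lambda>_. 0) * Qf d l z (\<Sum>v\<in>{1..n}. d v) ?U (card ?A) (card ?B)"
    unfolding S by (rule mavg_Rm[OF z st]) (use ev cS S in auto)
   also have "\<dots> = Qn l z n d"
    using d1 by (simp add: gmean_def Qn_def card_vstubs)
   finally show "(\<integral>g. (\<integral>w. ?f g w \<partial>PW) \<partial>measure_pmf
    (bind_pmf (pmf_of_set (matchings (stubs n (fix_parity n d0)))) (\<lambda>m. return_pmf (fix_parity n d0, m))))
    = Qn l z n (fix_parity n d0)" by (simp add: d_def)
  qed
 qed auto
 finally show ?thesis .
qed

section \<open>Characteristic functions under conditioning on connection\<close>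

lemma integral_uniform_measure:
 fixes f :: "'a \<Rightarrow> complex"
 assumes "prob_space M" and [measurable]: "E \<in> sets M" "f \<in> borel_measurable M" and pos: "measure M E > 0"
 shows "(\<integral>x. f x \<partial>uniform_measure M E) = (\<integral>x. indicator E x *\<^sub>R f x \<partial>M) / measure M E"
proof -
 interpret prob_space M by fact
 have "indicator E x / emeasure M E = ennreal (indicator E x / measure M E)" for x
  using pos by (auto simp: emeasure_eq_measure indicator_def divide_ennreal[symmetric])
 then have u: "uniform_measure M E = density M (\<lambda>x. ennreal (indicator E x / measure M E))"
  by (simp add: uniform_measure_def)
 have "(\<integral>x. f x \<partial>uniform_measure M E) = (\<integral>x. (indicator E x / measure M E) *\<^sub>R f x \<partial>M)"
  unfolding u by (rule integral_density) auto
 also have "\<dots> = (\<integral>x. (indicator E x *\<^sub>R f x) / measure M E \<partial>M)"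
  by (intro Bochner_Integration.integral_cong) (auto simp: indicator_def scaleR_conv_of_real)
 also have "\<dots> = (\<integral>x. indicator E x *\<^sub>R f x \<partial>M) / measure M E" by simp
 finally show ?thesis .
qed

definition condM where "condM n p = uniform_measure (weighted_CM n p) (conn_event n p)"

text \<open>\<open>lexval\<close> vanishes off the connection event, so the unconditioned transform
  divided by the probability of that event is the conditioned one. The factor \<open>c\<close>
  carries the centring.\<close>

lemma char_cond:
 assumes pos: "measure (weighted_CM n p) (conn_event n p) > 0"
  and X: "X \<in> borel_measurable (weighted_CM n p)"
  and e: "\<And>x. Pth n (fst x) \<noteq> {} \<Longrightarrow> iexp (t * X x) = c * (exp (\<i> * l * W12 n x) * z ^ H12 n x)"
 shows "char (distr (condM n p) borel X) t
  = c * (\<integral>x. lexval l z (costs (snd x) (Pth n (fst x))) \<partial>weighted_CM n p) / measure (weighted_CM n p) (conn_event n p)"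
proof -
 have Xu: "X \<in> borel_measurable (condM n p)" using X by (simp add: condM_def uniform_measure_def)
 have "char (distr (condM n p) borel X) t = (\<integral>x. iexp (t * X x) \<partial>condM n p)"
  unfolding char_def by (subst integral_distr[OF Xu]) auto
 also have "\<dots> = (\<integral>x. indicator (conn_event n p) x *\<^sub>R iexp (t * X x) \<partial>weighted_CM n p) / measure (weighted_CM n p) (conn_event n p)"
  unfolding condM_def by (rule integral_uniform_measure[OF prob_space_weighted_CM _ _ pos]) (use X in measurable)
 also have "(\<integral>x. indicator (conn_event n p) x *\<^sub>R iexp (t * X x) \<partial>weighted_CM n p)
   = (\<integral>x. c * lexval l z (costs (snd x) (Pth n (fst x))) \<partial>weighted_CM n p)"
 proof (rule Bochner_Integration.integral_cong[OF refl])
  fix x :: "((nat \<Rightarrow> nat) \<times> (nat \<times> nat \<Rightarrow> nat \<times> nat)) \<times> (nat \<times> nat \<Rightarrow> real)"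
  obtain g w where "x = (g, w)" by (cases x)
  then show "indicator (conn_event n p) x *\<^sub>R iexp (t * X x) = c * lexval l z (costs (snd x) (Pth n (fst x)))"
   using e[of x] by (auto simp: lexval_costs W12_minwt H12_minhop conn_event_eq)
 qed
 finally show ?thesis by simp
qed

text \<open>At l = 0 and z = 1 the transform is the indicator itself, so the asymptotics of the
  transform also yield the probability of connection.\<close>

lemma prob_conn:
 "complex_of_real (measure (weighted_CM n p) (conn_event n p))
  = (\<integral>x. lexval 0 1 (costs (snd x) (Pth n (fst x))) \<partial>weighted_CM n p)"
proof -
 have "(\<integral>x. lexval 0 1 (costs (snd x) (Pth n (fst x))) \<partial>weighted_CM n p)
  = (\<integral>x. complex_of_real (indicator (conn_event n p) x) \<partial>weighted_CM n p)"
  by (intro Bochner_Integration.integral_cong) (auto simp: lexval_costs conn_event_eq indicator_def)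
 also have "\<dots> = complex_of_real (measure (weighted_CM n p) (conn_event n p))"
  by (subst integral_complex_of_real) simp
 finally show ?thesis by simp
qed

lemma real_distribution_cond:
 assumes pos: "measure (weighted_CM n p) (conn_event n p) > 0"
  and X: "X \<in> borel_measurable (weighted_CM n p)"
 shows "real_distribution (distr (condM n p) borel X)"
proof -
 interpret W: prob_space "weighted_CM n p" by (rule prob_space_weighted_CM)
 have "emeasure (weighted_CM n p) (conn_event n p) \<noteq> 0" using pos by (simp add: W.emeasure_eq_measure)
 then interpret C: prob_space "condM n p"
  unfolding condM_def by (intro prob_space_uniform_measure) (auto simp: W.emeasure_eq_measure)
 have Xu: "X \<in> borel_measurable (condM n p)" using X by (simp add: condM_def uniform_measure_def)
 interpret D: prob_space "distr (condM n p) borel X" by (rule C.prob_space_distr[OF Xu])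
 show ?thesis by unfold_locales auto
qed

section \<open>The approximate solution \<open>G\<close> and its differential equation\<close>

lemma cmod_exp_diff_le:
 assumes "Re x \<le> 0" "Re y \<le> 0"
 shows "cmod (exp x - exp y) \<le> cmod (x - y)"
proof -
 have "cmod (exp x - exp y) \<le> 1 * cmod (x - y)"
 proof (rule field_differentiable_bound[where S="{w. Re w \<le> 0}" and f'=exp])
  show "convex {w. Re w \<le> 0}" by (rule convex_halfspace_Re_le)
  show "(exp has_field_derivative exp w) (at w within {w. Re w \<le> 0})" for w
   using DERIV_exp has_field_derivative_at_within by blast
 qed (use assms in auto)
 then show ?thesis by simp
qed

lemma cmod_exp_1_le:
 assumes "Re w \<le> 0"
 shows "cmod (exp w - 1 - w) \<le> (cmod w)\<^sup>2"
proof -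
 let ?S = "{u. Re u \<le> 0} \<inter> cball 0 (cmod w)"
 have "cmod ((exp w - w) - (exp 0 - 0)) \<le> cmod w * cmod (w - 0)"
 proof (rule field_differentiable_bound[where S="?S" and f'="\<lambda>u. exp u - 1"])
  show "convex ?S" by (intro convex_Int convex_halfspace_Re_le convex_cball)
  show "((\<lambda>u. exp u - u) has_field_derivative exp u - 1) (at u within ?S)" for u
   by (auto intro!: derivative_eq_intros)
  show "cmod (exp u - 1) \<le> cmod w" if "u \<in> ?S" for u
   using cmod_exp_diff_le[of u 0] that by auto
 qed (use assms in auto)
 then show ?thesis by (simp add: power2_eq_square algebra_simps)
qed

text \<open>The power (1 + y / s)^\<omega>, written with the real logarithm so that no branch has to
  be chosen.\<close>

definition V :: "complex \<Rightarrow> real \<Rightarrow> real \<Rightarrow> complex" where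
 "V \<omega> y s = exp (\<omega> * of_real (ln (1 + y / s)))"

text \<open>The derivative of \<open>V\<close> in \<open>s\<close>.\<close>

definition V1 :: "complex \<Rightarrow> real \<Rightarrow> real \<Rightarrow> complex" where
 "V1 \<omega> y s = \<omega> * of_real (1 / (s + y) - 1 / s) * V \<omega> y s"

lemma norm_V: "Re \<omega> \<le> 0 \<Longrightarrow> y \<ge> 0 \<Longrightarrow> s > 0 \<Longrightarrow> cmod (V \<omega> y s) \<le> 1"
 by (simp add: V_def norm_exp mult_nonpos_nonneg)

lemma norm_V1:
 assumes "Re \<omega> \<le> 0" "y \<ge> 0" "s > 0"
 shows "cmod (V1 \<omega> y s) \<le> cmod \<omega> / s"
proof -
 have "\<bar>1 / (s + y) - 1 / s\<bar> \<le> 1 / s" using assms by (simp add: abs_le_iff frac_le)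
 then have "cmod \<omega> * \<bar>1 / (s + y) - 1 / s\<bar> * cmod (V \<omega> y s) \<le> cmod \<omega> * (1 / s) * 1"
  using norm_V[OF assms] assms by (intro mult_mono) auto
 then show ?thesis by (simp only: V1_def norm_mult norm_of_real) simp
qed

text \<open>The ratio of 1 + y / s to 1 + y / (s + \<delta>) equals the ratio of 1 + \<delta> / s to
  1 + \<delta> / (s + y). In the second form the bounds are uniform in y, which is later replaced by
  an unbounded exponential variable.\<close>

lemma V_log_diff:
 fixes s y \<delta> :: real
 assumes "s > 0" "y \<ge> 0" "\<delta> \<ge> 0"
 defines "\<Delta> \<equiv> ln (1 + y / s) - ln (1 + y / (s + \<delta>))"
 shows "0 \<le> \<Delta>" "\<Delta> \<le> \<delta> / s" "\<bar>\<Delta> - \<delta> * (1 / s - 1 / (s + y))\<bar> \<le> (\<delta> / s)\<^sup>2"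
proof -
 have e: "\<Delta> = ln (1 + \<delta> / s) - ln (1 + \<delta> / (s + y))"
 proof -
  have "ln (1 + u / v) = ln (v + u) - ln v" if "v > 0" "u \<ge> 0" for u v :: real
  proof -
   have "1 + u / v = (v + u) / v" using that by (simp add: field_simps)
   then show ?thesis using that by (simp add: ln_div)
  qed
  then have "ln (1 + y / s) = ln (s + y) - ln s" "ln (1 + y / (s + \<delta>)) = ln (s + \<delta> + y) - ln (s + \<delta>)"
   "ln (1 + \<delta> / s) = ln (s + \<delta>) - ln s" "ln (1 + \<delta> / (s + y)) = ln (s + y + \<delta>) - ln (s + y)"
   using assms by auto
  then show ?thesis unfolding \<Delta>_def by (simp add: ac_simps)
 qed
 have le: "\<delta> / (s + y) \<le> \<delta> / s" using assms by (simp add: frac_le)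
 have nn: "0 \<le> \<delta> / (s + y)" "0 \<le> \<delta> / s" using assms by auto
 show "0 \<le> \<Delta>" unfolding e using le nn by simp
 have l: "ln (1 + t) \<le> t" "t - t\<^sup>2 \<le> ln (1 + t)" if "t \<ge> 0" for t :: real
 proof -
  show "ln (1 + t) \<le> t" using that by (rule ln_add_one_self_le_self)
  show "t - t\<^sup>2 \<le> ln (1 + t)"
  proof (cases "t \<le> 1")
   case True then show ?thesis using that ln_one_plus_pos_lower_bound[of t] by simp
  next
   case False
   then have "t * 1 \<le> t * t" by (intro mult_left_mono) auto
   moreover have "0 \<le> ln (1 + t)" using that by simp
   ultimately show ?thesis by (simp add: power2_eq_square)
  qed
 qed
 show "\<Delta> \<le> \<delta> / s" unfolding e using l[OF nn(2)] ln_ge_zero[of "1 + \<delta> / (s + y)"] nn(1) by linarith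
 have "(\<delta> / (s + y))\<^sup>2 \<le> (\<delta> / s)\<^sup>2" using le nn by (intro power_mono)
 moreover have "\<delta> * (1 / s - 1 / (s + y)) = \<delta> / s - \<delta> / (s + y)" by (simp add: right_diff_distrib)
 ultimately show "\<bar>\<Delta> - \<delta> * (1 / s - 1 / (s + y))\<bar> \<le> (\<delta> / s)\<^sup>2"
  unfolding e using l[OF nn(1)] l[OF nn(2)] by linarith
qed

lemma V_lipschitz:
 assumes "Re \<omega> \<le> 0" "y \<ge> 0" "s > 0" "\<delta> \<ge> 0"
 shows "cmod (V \<omega> y (s + \<delta>) - V \<omega> y s) \<le> cmod \<omega> * (\<delta> / s)"
proof -
 let ?a = "ln (1 + y / s)" and ?b = "ln (1 + y / (s + \<delta>))"
 have "cmod (V \<omega> y (s + \<delta>) - V \<omega> y s) \<le> cmod (\<omega> * of_real ?b - \<omega> * of_real ?a)"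
  unfolding V_def using assms by (intro cmod_exp_diff_le) (auto simp: mult_nonpos_nonneg)
 also have "\<dots> = cmod \<omega> * \<bar>?b - ?a\<bar>"
  by (simp only: right_diff_distrib[symmetric] of_real_diff[symmetric] norm_mult norm_of_real)
 also have "\<dots> \<le> cmod \<omega> * (\<delta> / s)"
  using V_log_diff[of s y \<delta>] assms by (intro mult_left_mono) auto
 finally show ?thesis .
qed

text \<open>With u the value at s + \<delta> and w the exponent gained on the way back, the value at
  s is u e^w. The remainder splits into the second-order error of exp, the replacement of u by the
  value at s in the linear term, and the linearization of the logarithm.\<close>

lemma V_taylor:
 assumes w: "Re \<omega> \<le> 0" and a: "y \<ge> 0" "s > 0" "\<delta> \<ge> 0"
 shows "cmod (V \<omega> y (s + \<delta>) - V \<omega> y s - of_real \<delta> * V1 \<omega> y s) \<le> cmod \<omega> * (1 + 2 * cmod \<omega>) * (\<delta> / s)\<^sup>2"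
proof -
 define D where "D = ln (1 + y / s) - ln (1 + y / (s + \<delta>))"
 note D = V_log_diff[OF a(2,1,3), folded D_def]
 let ?u = "V \<omega> y (s + \<delta>)" and ?v = "V \<omega> y s" and ?w = "\<omega> * of_real D" and ?e = "D - \<delta> * (1 / s - 1 / (s + y))"
 have v: "?v = ?u * exp ?w"
  unfolding V_def D_def by (simp add: exp_add[symmetric] algebra_simps)
 have Re: "Re ?w \<le> 0" using w D(1) by (simp add: mult_nonpos_nonneg)
 have nu: "cmod ?u \<le> 1" using norm_V[of \<omega> y "s + \<delta>"] w a by simp
 have nv: "cmod ?v \<le> 1" using norm_V w a by simp
 have nw: "cmod ?w \<le> cmod \<omega> * (\<delta> / s)" 
  using D(1) mult_left_mono[OF D(2), of "cmod \<omega>"] by (simp add: norm_mult)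
 have d: "of_real \<delta> * V1 \<omega> y s = - \<omega> * of_real (\<delta> * (1 / s - 1 / (s + y))) * ?v"
  unfolding V1_def by (simp add: algebra_simps)
 have "?u - ?v - of_real \<delta> * V1 \<omega> y s = - ?u * (exp ?w - 1 - ?w) + ?w * (?v - ?u) - \<omega> * of_real ?e * ?v"
  unfolding d unfolding v by (simp add: algebra_simps)
 also have "cmod \<dots> \<le> cmod (?u * (exp ?w - 1 - ?w)) + cmod (?w * (?v - ?u)) + cmod (\<omega> * of_real ?e * ?v)"
 proof -
  have "cmod (- A + B - C) \<le> cmod A + cmod B + cmod C" for A B C :: complex
   using norm_triangle_ineq4[of "- A + B" C] norm_triangle_ineq[of "- A" B] by simp
  then show ?thesis unfolding mult_minus_left by blast
 qed
 also have "cmod (?u * (exp ?w - 1 - ?w)) \<le> 1 * (cmod \<omega> * (\<delta> / s))\<^sup>2"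
  unfolding norm_mult using cmod_exp_1_le[OF Re] nu nw
  by (intro mult_mono order_trans[OF cmod_exp_1_le[OF Re]] power_mono) (auto simp: norm_mult)
 also have "cmod (?w * (?v - ?u)) \<le> (cmod \<omega> * (\<delta> / s)) * (cmod \<omega> * (\<delta> / s))"
  unfolding norm_mult[of ?w] using nw V_lipschitz[OF w a] a
  by (intro mult_mono) (auto simp: norm_minus_commute)
 also have "cmod (\<omega> * of_real ?e * ?v) \<le> cmod \<omega> * (\<delta> / s)\<^sup>2 * 1"
  unfolding norm_mult norm_of_real using D(3) nv by (intro mult_mono) auto
 finally show ?thesis by (simp add: power2_eq_square algebra_simps)
qed

text \<open>The expectation of (1 + \<kappa> X / s)^\<omega>. The absolute value keeps the integrand
  bounded on the whole line, although \<open>expm\<close> charges only positive reals.\<close>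

definition G :: "complex \<Rightarrow> real \<Rightarrow> real \<Rightarrow> complex" where
 "G \<omega> \<kappa> s = (\<integral>x. V \<omega> (\<kappa> * \<bar>x\<bar>) s \<partial>expm)"

definition G1 :: "complex \<Rightarrow> real \<Rightarrow> real \<Rightarrow> complex" where
 "G1 \<omega> \<kappa> s = (\<integral>x. V1 \<omega> (\<kappa> * \<bar>x\<bar>) s \<partial>expm)"

lemma measurable_V [measurable]: "(\<lambda>x. V \<omega> (\<kappa> * \<bar>x\<bar>) s) \<in> borel_measurable borel"
 unfolding V_def by measurable

lemma measurable_V1 [measurable]: "(\<lambda>x. V1 \<omega> (\<kappa> * \<bar>x\<bar>) s) \<in> borel_measurable borel"
 unfolding V1_def by measurable

lemma integrable_V:
 "Re \<omega> \<le> 0 \<Longrightarrow> \<kappa> \<ge> 0 \<Longrightarrow> s > 0 \<Longrightarrow> integrable expm (\<lambda>x. V \<omega> (\<kappa> * \<bar>x\<bar>) s)"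
 by (rule integrable_bounded_measurable[OF prob_space_expm, where C=1]) (auto simp: norm_V)

lemma integrable_V1:
 "Re \<omega> \<le> 0 \<Longrightarrow> \<kappa> \<ge> 0 \<Longrightarrow> s > 0 \<Longrightarrow> integrable expm (\<lambda>x. V1 \<omega> (\<kappa> * \<bar>x\<bar>) s)"
 by (rule integrable_bounded_measurable[OF prob_space_expm, where C="cmod \<omega> / s"]) (auto simp: norm_V1)

lemma norm_G: "Re \<omega> \<le> 0 \<Longrightarrow> \<kappa> \<ge> 0 \<Longrightarrow> s > 0 \<Longrightarrow> cmod (G \<omega> \<kappa> s) \<le> 1"
 unfolding G_def by (rule norm_integral_le[OF prob_space_expm]) (simp add: norm_V)

lemma norm_G1: "Re \<omega> \<le> 0 \<Longrightarrow> \<kappa> \<ge> 0 \<Longrightarrow> s > 0 \<Longrightarrow> cmod (G1 \<omega> \<kappa> s) \<le> cmod \<omega> / s"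
 unfolding G1_def by (rule norm_integral_le[OF prob_space_expm]) (simp add: norm_V1)

text \<open>With \<kappa> = c L / b the value depends on s and b through their product, as the
  symmetry of the recursion demands.\<close>

lemma G_swap: "b > 0 \<Longrightarrow> s > 0 \<Longrightarrow> G \<omega> (k / b) s = G \<omega> (k / s) b"
 unfolding G_def V_def by (simp add: field_simps)

lemma G_lipschitz:
 assumes "Re \<omega> \<le> 0" "\<kappa> \<ge> 0" "s > 0" "\<delta> \<ge> 0"
 shows "cmod (G \<omega> \<kappa> (s + \<delta>) - G \<omega> \<kappa> s) \<le> cmod \<omega> * (\<delta> / s)"
proof -
 have "G \<omega> \<kappa> (s + \<delta>) - G \<omega> \<kappa> s = (\<integral>x. V \<omega> (\<kappa> * \<bar>x\<bar>) (s + \<delta>) - V \<omega> (\<kappa> * \<bar>x\<bar>) s \<partial>expm)"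
  unfolding G_def using assms by (intro Bochner_Integration.integral_diff[symmetric] integrable_V) auto
 also have "cmod \<dots> \<le> cmod \<omega> * (\<delta> / s)"
  using assms by (intro norm_integral_le[OF prob_space_expm] V_lipschitz) auto
 finally show ?thesis .
qed

lemma G_taylor:
 assumes "Re \<omega> \<le> 0" "\<kappa> \<ge> 0" "s > 0" "\<delta> \<ge> 0"
 shows "cmod (G \<omega> \<kappa> (s + \<delta>) - G \<omega> \<kappa> s - of_real \<delta> * G1 \<omega> \<kappa> s) \<le> cmod \<omega> * (1 + 2 * cmod \<omega>) * (\<delta> / s)\<^sup>2"
proof -
 have "G \<omega> \<kappa> (s + \<delta>) - G \<omega> \<kappa> s - of_real \<delta> * G1 \<omega> \<kappa> s
  = (\<integral>x. V \<omega> (\<kappa> * \<bar>x\<bar>) (s + \<delta>) - V \<omega> (\<kappa> * \<bar>x\<bar>) s - of_real \<delta> * V1 \<omega> (\<kappa> * \<bar>x\<bar>) s \<partial>expm)"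
  unfolding G_def G1_def using assms integrable_V[of \<omega> \<kappa> "s + \<delta>"] integrable_V[of \<omega> \<kappa> s] integrable_V1[of \<omega> \<kappa> s]
  by (simp add: Bochner_Integration.integral_diff)
 also have "cmod \<dots> \<le> cmod \<omega> * (1 + 2 * cmod \<omega>) * (\<delta> / s)\<^sup>2"
  using assms by (intro norm_integral_le[OF prob_space_expm] V_taylor) auto
 finally show ?thesis .
qed

text \<open>Integration by parts in the exponential variable. With \<kappa> = c L / b this is the
  continuum limit of the recursion: collision with probability b / L, mean growth c per step, and a
  term of order 1 / s that collects the effects of z and l.\<close>

lemma G_ode:
 assumes w: "Re \<omega> \<le> 0" and k: "\<kappa> \<ge> 0" and s: "s > 0"
 shows "of_real \<kappa> * G1 \<omega> \<kappa> s + of_real \<kappa> * \<omega> / of_real s * G \<omega> \<kappa> s = G \<omega> \<kappa> s - 1"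
proof -
 let ?v = "\<lambda>x. exp (\<omega> * of_real (ln (1 + \<kappa> * x / s)))"
 let ?v' = "\<lambda>x. \<omega> * of_real (\<kappa> / (s + \<kappa> * x)) * ?v x"
 have pos: "1 + \<kappa> * x / s > 0" "s + \<kappa> * x > 0" if "x \<ge> 0" for x
  using that k s by (auto intro: add_pos_nonneg)
 have ae: "AE x in expm. x \<ge> 0" using AE_expm_pos by eventually_elim auto
 have "(\<integral>x. ?v' x \<partial>expm) = (\<integral>x. ?v x \<partial>expm) - ?v 0"
 proof (rule expm_by_parts[where C="1 + cmod \<omega> * (\<kappa> / s)"])
  fix x :: real assume x: "x > 0"
  have "((\<lambda>x. ln (1 + \<kappa> * x / s)) has_real_derivative \<kappa> / (s + \<kappa> * x)) (at x)"
   using pos[of x] x s by (auto intro!: derivative_eq_intros simp: field_simps)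
  then have 1: "((\<lambda>x. \<omega> * of_real (ln (1 + \<kappa> * x / s))) has_vector_derivative \<omega> * of_real (\<kappa> / (s + \<kappa> * x))) (at x)"
   by (intro has_vector_derivative_mult_right has_vector_derivative_of_real)
    (simp add: has_real_derivative_iff_has_vector_derivative)
  show "(?v has_vector_derivative ?v' x) (at x)"
   using field_vector_diff_chain_at[OF 1 DERIV_exp] by (simp add: o_def)
  show "isCont ?v' x" using pos[of x] x s by (intro continuous_intros) auto
 next
  show "isCont ?v 0" using s by (intro continuous_intros) auto
  show "?v \<in> borel_measurable borel" "?v' \<in> borel_measurable borel" by measurable
  fix x :: real assume x: "x \<ge> 0"
  have n: "cmod (?v x) \<le> 1" using norm_V[OF w, of "\<kappa> * x" s] x k s by (simp add: V_def)
  have "0 \<le> cmod \<omega> * (\<kappa> / s)" using k s by simp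
  then show "cmod (?v x) \<le> 1 + cmod \<omega> * (\<kappa> / s)" using n by linarith
  have "cmod (?v' x) \<le> cmod \<omega> * (\<kappa> / s) * 1"
   unfolding norm_mult norm_of_real using n k s x pos[of x]
   by (intro mult_mono) (auto simp: abs_of_nonneg frac_le)
  then show "cmod (?v' x) \<le> 1 + cmod \<omega> * (\<kappa> / s)" by simp
 qed
 moreover have "(\<integral>x. ?v x \<partial>expm) = G \<omega> \<kappa> s"
  unfolding G_def V_def by (rule integral_cong_AE) (use ae in auto)
 moreover have "(\<integral>x. ?v' x \<partial>expm) = (\<integral>x. of_real \<kappa> * V1 \<omega> (\<kappa> * \<bar>x\<bar>) s + of_real \<kappa> * \<omega> / of_real s * V \<omega> (\<kappa> * \<bar>x\<bar>) s \<partial>expm)"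
 proof (rule integral_cong_AE)
  show "AE x in expm. ?v' x = of_real \<kappa> * V1 \<omega> (\<kappa> * \<bar>x\<bar>) s + of_real \<kappa> * \<omega> / of_real s * V \<omega> (\<kappa> * \<bar>x\<bar>) s"
   using ae
  proof eventually_elim
   case (elim x)
   have "of_real \<kappa> * V1 \<omega> (\<kappa> * \<bar>x\<bar>) s + of_real \<kappa> * \<omega> / of_real s * V \<omega> (\<kappa> * \<bar>x\<bar>) s
    = \<omega> * of_real (\<kappa> * (1 / (s + \<kappa> * x) - 1 / s) + \<kappa> / s) * ?v x"
    using elim by (simp add: V1_def V_def algebra_simps)
   also have "\<kappa> * (1 / (s + \<kappa> * x) - 1 / s) + \<kappa> / s = \<kappa> / (s + \<kappa> * x)" by (simp add: right_diff_distrib)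
   finally show ?case by simp
  qed
 qed auto
 moreover have "\<dots> = of_real \<kappa> * G1 \<omega> \<kappa> s + of_real \<kappa> * \<omega> / of_real s * G \<omega> \<kappa> s"
  unfolding G_def G1_def using integrable_V[OF w k s] integrable_V1[OF w k s] by simp
 ultimately show ?thesis by simp
qed

text \<open>Absorption of a vertex of degree \<open>d\<close> is expanded into a growth term and a
  generation term. With t = d / s the remainder is bounded by a multiple of t and by a multiple of
  t^2, hence of t^(1 + \<eta>). Summed against \<open>d\<close> this asks only for a moment of order
  2 + \<eta>.\<close>

lemma G_step_error:
 fixes d s :: nat and z :: complex
 assumes w: "Re \<omega> \<le> 0" and k: "\<kappa> \<ge> 0" and s: "s \<ge> 1" and d: "d \<ge> 2" and \<eta>: "0 < \<eta>" "\<eta> \<le> 1"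
 defines "a \<equiv> ((of_nat s - 1) + (of_nat d - 1) * z) / of_nat (s + d - 2)"
 defines "g \<equiv> \<lambda>s::nat. G \<omega> \<kappa> (real s)"
 shows "cmod (a * g (s + d - 2) - g s - of_real (real d - 2) * G1 \<omega> \<kappa> (real s) - (of_nat d - 1) * (z - 1) / of_nat s * g s)
  \<le> 2 * (cmod \<omega> + cmod (z - 1)) * (1 + 2 * cmod \<omega>) * (real d / real s) powr (1 + \<eta>)"
proof -
 let ?\<delta> = "real d - 2" and ?t = "real d / real s" and ?O = "cmod \<omega>" and ?Z = "cmod (z - 1)"
 let ?g = "g s" and ?h = "g (s + d - 2)"
 have sd: "real (s + d - 2) = real s + ?\<delta>" using d by (simp add: of_nat_diff)
 have \<delta>: "?\<delta> \<ge> 0" and s0: "real s > 0" using d s by auto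
 have t: "?\<delta> / real s \<le> ?t" "0 \<le> ?\<delta> / real s" "?t > 0" using d s0 by (auto simp: divide_right_mono)
 have ng: "cmod ?g \<le> 1" "cmod ?h \<le> 1" unfolding g_def using norm_G[OF w k] s0 \<delta> by (auto simp: sd)
 have lip: "cmod (?h - ?g) \<le> ?O * (?\<delta> / real s)"
  unfolding g_def sd by (rule G_lipschitz[OF w k s0 \<delta>])
 let ?e1 = "?h - ?g - of_real ?\<delta> * G1 \<omega> \<kappa> (real s)"
 let ?e2 = "(z - 1) * (of_nat d - 1) * (?h / of_nat (s + d - 2) - ?g / of_nat s)"
 have a: "a = 1 + (of_nat d - 1) * (z - 1) / of_nat (s + d - 2)"
 proof -
  have ne: "(of_nat (s + d - 2) :: complex) \<noteq> 0" using s d unfolding of_nat_eq_0_iff by simp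
  have e: "(of_nat (s + d - 2) :: complex) = (of_nat s - 1) + (of_nat d - 1)" using d by (simp add: of_nat_diff)
  have "a = ((of_nat s - 1) + (of_nat d - 1) + (of_nat d - 1) * (z - 1)) / of_nat (s + d - 2)"
   unfolding a_def by (simp add: algebra_simps)
  also have "\<dots> = 1 + (of_nat d - 1) * (z - 1) / of_nat (s + d - 2)"
   unfolding e[symmetric] add_divide_distrib by (simp only: divide_self[OF ne])
  finally show ?thesis .
 qed
 have split: "a * ?h - ?g - of_real ?\<delta> * G1 \<omega> \<kappa> (real s) - (of_nat d - 1) * (z - 1) / of_nat s * ?g = ?e1 + ?e2"
 proof -
  have "(1 + P * Z / N) * h - x - D - P * Z / S * x = (h - x - D) + Z * P * (h / N - x / S)"
   for P Z N h x D S :: complex by (simp add: divide_inverse algebra_simps)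
  then show ?thesis unfolding a .
 qed
 have d1: "cmod (of_nat d - 1) \<le> real d"
 proof -
  have "(of_nat d - 1 :: complex) = of_nat (d - 1)" using d by (simp add: of_nat_diff)
  then show ?thesis by (simp only: norm_of_nat of_nat_le_iff diff_le_self)
 qed
 have e1a: "cmod ?e1 \<le> ?O * (1 + 2 * ?O) * ?t\<^sup>2"
 proof -
  have "cmod ?e1 \<le> ?O * (1 + 2 * ?O) * (?\<delta> / real s)\<^sup>2"
   unfolding g_def sd by (rule G_taylor[OF w k s0 \<delta>])
  also have "\<dots> \<le> ?O * (1 + 2 * ?O) * ?t\<^sup>2" using t by (intro mult_left_mono power_mono) auto
  finally show ?thesis .
 qed
 have e1b: "cmod ?e1 \<le> 2 * ?O * ?t"
 proof -
  have "cmod ?e1 \<le> cmod (?h - ?g) + \<bar>?\<delta>\<bar> * cmod (G1 \<omega> \<kappa> (real s))"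
   using norm_triangle_ineq4[of "?h - ?g" "of_real ?\<delta> * G1 \<omega> \<kappa> (real s)"] by (simp only: norm_mult norm_of_real)
  also have "\<dots> \<le> ?O * (?\<delta> / real s) + ?\<delta> * (?O / real s)"
   using lip norm_G1[OF w k s0] \<delta> by (intro add_mono mult_mono) auto
  also have "\<dots> = 2 * ?O * (?\<delta> / real s)" by simp
  also have "\<dots> \<le> 2 * ?O * ?t" using t by (intro mult_left_mono) auto
  finally show ?thesis .
 qed
 have nsd: "real s \<le> real (s + d - 2)" using d by simp
 have q: "cmod (?h / of_nat (s + d - 2) - ?g / of_nat s) \<le> (1 + ?O) * (?\<delta> / real s) / real s"
 proof -
  have "?h / of_nat (s + d - 2) - ?g / of_nat s = (?h - ?g) / of_nat (s + d - 2) - ?g * of_real (?\<delta> / (real s * real (s + d - 2)))"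
  proof -
   have c: "(of_nat (s + d - 2) :: complex) = of_nat s + of_real ?\<delta>" using d by (simp add: of_nat_diff)
   have "(of_nat (s + d - 2) :: complex) \<noteq> 0" "(of_nat s :: complex) \<noteq> 0"
    using s d unfolding of_nat_eq_0_iff by auto
   moreover have "h / N - x / S = (h - x) / N - x * (D / (S * N))"
    if "N = S + D" "N \<noteq> 0" "S \<noteq> 0" for h N x S D :: complex
   proof -
    have "D = N - S" using that(1) by simp
    then have "D / (S * N) = N / (S * N) - S / (S * N)" by (simp only: diff_divide_distrib)
    also have "\<dots> = 1 / S - 1 / N" using that(2,3) by simp
    finally show ?thesis by (simp only:) (simp add: diff_divide_distrib right_diff_distrib)
   qed
   ultimately show ?thesis unfolding of_real_divide of_real_mult of_real_of_nat_eq
    using c by blast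
  qed
  also have "cmod \<dots> \<le> cmod ((?h - ?g) / of_nat (s + d - 2)) + cmod (?g * of_real (?\<delta> / (real s * real (s + d - 2))))"
   by (rule norm_triangle_ineq4)
  also have "cmod ((?h - ?g) / of_nat (s + d - 2)) \<le> ?O * (?\<delta> / real s) / real s"
   unfolding norm_divide norm_of_nat using lip nsd s0 by (intro frac_le) auto
  also have "cmod (?g * of_real (?\<delta> / (real s * real (s + d - 2)))) \<le> 1 * (?\<delta> / (real s * real s))"
   unfolding norm_mult norm_of_real using ng \<delta> nsd s0 by (intro mult_mono) (auto simp: abs_of_nonneg intro!: frac_le mult_left_mono)
  finally show ?thesis by (simp add: divide_inverse algebra_simps)
 qed
 have e2a: "cmod ?e2 \<le> ?Z * (1 + ?O) * ?t\<^sup>2"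
 proof -
  have "cmod ?e2 \<le> ?Z * real d * ((1 + ?O) * ?t / real s)"
   unfolding norm_mult using d1 q t s0
   by (intro mult_mono order_trans[OF q] divide_right_mono) (auto intro!: mult_left_mono)
  then show ?thesis by (simp add: power2_eq_square field_simps)
 qed
 have e2b: "cmod ?e2 \<le> 2 * ?Z * ?t"
 proof -
  have "cmod (?h / of_nat (s + d - 2) - ?g / of_nat s) \<le> cmod (?h / of_nat (s + d - 2)) + cmod (?g / of_nat s)"
   by (rule norm_triangle_ineq4)
  also have "\<dots> \<le> 1 / real s + 1 / real s"
   unfolding norm_divide norm_of_nat using ng nsd s0 by (intro add_mono frac_le) auto
  finally have "cmod ?e2 \<le> ?Z * real d * (2 / real s)"
   unfolding norm_mult using d1 by (intro mult_mono) auto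
  then show ?thesis by (simp add: field_simps)
 qed
 have main: "cmod (?e1 + ?e2) \<le> 2 * (?O + ?Z) * (1 + 2 * ?O) * min ?t (?t\<^sup>2)"
 proof (cases "?t \<le> ?t\<^sup>2")
  case True
  have "cmod (?e1 + ?e2) \<le> 2 * ?O * ?t + 2 * ?Z * ?t" using e1b e2b norm_triangle_ineq[of ?e1 ?e2] by linarith
  also have "\<dots> = 2 * (?O + ?Z) * 1 * ?t" by (simp add: algebra_simps)
  also have "\<dots> \<le> 2 * (?O + ?Z) * (1 + 2 * ?O) * ?t" using t by (intro mult_right_mono mult_left_mono) auto
  finally show ?thesis using True by (simp add: min_absorb1)
 next
  case False
  have "cmod (?e1 + ?e2) \<le> ?O * (1 + 2 * ?O) * ?t\<^sup>2 + ?Z * (1 + ?O) * ?t\<^sup>2"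
   using e1a e2a norm_triangle_ineq[of ?e1 ?e2] by linarith
  also have "\<dots> \<le> ?O * (1 + 2 * ?O) * ?t\<^sup>2 + ?Z * (1 + 2 * ?O) * ?t\<^sup>2"
   by (intro add_left_mono mult_right_mono mult_left_mono) auto
  also have "\<dots> = (?O + ?Z) * (1 + 2 * ?O) * ?t\<^sup>2" by (simp add: algebra_simps)
  also have "\<dots> \<le> (2 * ((?O + ?Z) * (1 + 2 * ?O))) * ?t\<^sup>2" by (intro mult_right_mono) auto
  finally have "cmod (?e1 + ?e2) \<le> (2 * ((?O + ?Z) * (1 + 2 * ?O))) * ?t\<^sup>2" .
  moreover have "min ?t (?t\<^sup>2) = ?t\<^sup>2" using False by simp
  ultimately show ?thesis by (simp only: mult.assoc)
 qed
 have "min ?t (?t\<^sup>2) \<le> ?t powr (1 + \<eta>)"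
 proof (cases "?t \<ge> 1")
  case True
  have "?t powr 1 \<le> ?t powr (1 + \<eta>)" using True \<eta> by (intro powr_mono) auto
  then show ?thesis using t by simp
 next
  case False
  have "?t powr 2 \<le> ?t powr (1 + \<eta>)" using False \<eta> t by (intro powr_mono') auto
  then show ?thesis using t by simp
 qed
 then have "2 * (?O + ?Z) * (1 + 2 * ?O) * min ?t (?t\<^sup>2) \<le> 2 * (?O + ?Z) * (1 + 2 * ?O) * ?t powr (1 + \<eta>)"
  by (intro mult_left_mono) auto
 then show ?thesis unfolding split using main by linarith
qed

text \<open>The coefficients are dominated by a probability distribution: collision, cancellation
  and absorption together make up at most all possible partners, and the waiting-time factor has
  modulus at most 1. Degrees at least 2 keep the generation quotient well defined and of modulus at
  most 1.\<close>

lemma norm_Qf: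
 assumes z: "cmod z \<le> 1" and d: "\<And>v. v \<in> U \<Longrightarrow> d v \<ge> 2"
 shows "cmod (Qf d l z N U s b) \<le> 1"
 using d
proof (induction N arbitrary: U s b)
 case 0 then show ?case by simp
next
 case (Suc N)
 define lo hi where "lo = min s b" and "hi = max s b"
 let ?D = "\<Sum>v\<in>U. d v"
 show ?case
 proof (cases "lo = 0")
  case True then show ?thesis by (simp add: Let_def lo_def hi_def)
 next
  case False
  then have lo: "lo \<ge> 1" "hi \<ge> 1" by (auto simp: lo_def hi_def)
  let ?X = "of_nat hi * z + (of_nat lo - 1) * Qf d l z N U (lo - 2) hi
    + (\<Sum>v\<in>U. of_nat (d v) * ((of_nat lo - 1) + (of_nat (d v) - 1) * z) / of_nat (lo + d v - 2)
      * Qf d l z N (U - {v}) (lo + d v - 2) hi)"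
  have t: "cmod (of_nat (d v) * ((of_nat lo - 1) + (of_nat (d v) - 1) * z) / of_nat (lo + d v - 2)
      * Qf d l z N (U - {v}) (lo + d v - 2) hi) \<le> real (d v)" if v: "v \<in> U" for v
  proof -
   have dv: "d v \<ge> 2" using Suc.prems v by auto
   have "cmod ((of_nat lo - 1) + (of_nat (d v) - 1) * z) \<le> cmod (of_nat (lo - 1)) + cmod (of_nat (d v - 1) * z)"
    using lo dv norm_triangle_ineq[of "of_nat (lo - 1)" "of_nat (d v - 1) * z"] by (simp add: of_nat_diff)
   also have "\<dots> \<le> real (lo - 1) + real (d v - 1) * 1"
    unfolding norm_mult norm_of_nat using z by (intro add_left_mono mult_left_mono) auto
   also have "\<dots> = real (lo + d v - 2)" using lo dv by (simp add: of_nat_diff)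
   finally have le: "cmod ((of_nat lo - 1) + (of_nat (d v) - 1) * z) \<le> real (lo + d v - 2)" .
   have "0 < real (lo + d v - 2)" using lo dv by simp
   from divide_le_eq_1_pos[OF this] le
   have "cmod ((of_nat lo - 1) + (of_nat (d v) - 1) * z) / real (lo + d v - 2) \<le> 1" by blast
   moreover have "cmod (Qf d l z N (U - {v}) (lo + d v - 2) hi) \<le> 1"
    using Suc.prems by (intro Suc.IH) auto
   ultimately have "real (d v) * (cmod ((of_nat lo - 1) + (of_nat (d v) - 1) * z) / real (lo + d v - 2))
    * cmod (Qf d l z N (U - {v}) (lo + d v - 2) hi) \<le> real (d v) * 1 * 1"
    by (intro mult_mono) auto
   then show ?thesis by (simp only: norm_mult norm_divide norm_of_nat times_divide_eq_right mult_1_right)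
  qed
  have "cmod ?X \<le> cmod (of_nat hi * z) + cmod ((of_nat lo - 1) * Qf d l z N U (lo - 2) hi) + (\<Sum>v\<in>U. real (d v))"
   by (intro norm_triangle_mono norm_sum[THEN order_trans] sum_mono t) auto
  also have "cmod (of_nat hi * z) \<le> real hi" using z by (simp add: norm_mult mult_left_le)
  also have "cmod ((of_nat lo - 1) * Qf d l z N U (lo - 2) hi) \<le> real (lo - 1) * 1"
  proof -
   have "(of_nat lo - 1 :: complex) = of_nat (lo - 1)" using lo by (simp add: of_nat_diff)
   then show ?thesis using Suc.IH[of U "lo - 2" hi] Suc.prems
    by (simp only: norm_mult norm_of_nat) (intro mult_left_mono, auto)
  qed
  also have "real hi + real (lo - 1) * 1 + (\<Sum>v\<in>U. real (d v)) = real (lo + hi + ?D - 1)"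
   using lo by (simp add: of_nat_diff)
  finally have X: "cmod ?X \<le> real (lo + hi + ?D - 1)" by simp
  have "lo + hi + ?D - 1 > 0" using lo by simp
  then have p: "real (lo + hi + ?D - 1) > 0" by (simp only: of_nat_0_less_iff)
  have le: "real lo \<le> cmod (of_nat lo - \<i> * of_real l)"
   using abs_Re_le_cmod[of "of_nat lo - \<i> * of_real l"] by simp
  then have r: "real lo / cmod (of_nat lo - \<i> * of_real l) \<le> 1" using lo by (simp add: divide_le_eq_1)
  have "cmod (Qf d l z (Suc N) U s b) = real lo / cmod (of_nat lo - \<i> * of_real l) * (cmod ?X / real (lo + hi + ?D - 1))"
   using False by (simp only: Qf.simps Let_def lo_def[symmetric] hi_def[symmetric] if_False
     norm_mult norm_divide norm_of_nat) (simp only: times_divide_eq_left times_divide_eq_right)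
  also have "\<dots> \<le> 1"
   using r divide_le_eq_1_pos[OF p, of "cmod ?X"] X p by (intro mult_le_one divide_nonneg_nonneg norm_ge_zero of_nat_0_le_iff) blast+
  finally show ?thesis .
 qed
qed

section \<open>Error bound for a single degree sequence by a supersolution\<close>

text \<open>Deterministic conditions on one degree sequence. \<open>H1\<close>, \<open>H1b\<close>
  and \<open>H1c\<close> are asked for after deletion of up to N + 2 vertices, the two roots and one
  vertex per step. \<open>N\<close> is the horizon beyond which a trivial bound takes over,
  \<open>\<epsilon>\<close> the relative error of the degree sums, \<open>q\<close> the share of
  stubs at vertices of degree at least 3, and \<open>Kd\<close> bounds the moment of order 2 +
  \<eta>. \<open>H5\<close> keeps the error of a cancellation below 2 / N; its factor is 2 + 4 Om +
  4 C (Om + 2) with the \<open>C\<close> defined below.\<close>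

locale expl =
 fixes d :: "nat \<Rightarrow> nat" and W :: "nat set" and l :: real and z \<omega> :: complex
  and c \<eta> Kd q \<epsilon> N Om :: real
 assumes finW: "finite W" and d2: "\<And>v. v \<in> W \<Longrightarrow> d v \<ge> 2"
  and c: "c > 0" and Rew: "Re \<omega> \<le> 0" and z1: "cmod z \<le> 1"
  and cw: "of_real c * \<omega> = of_real (c + 1) * (z - 1) + \<i> * of_real l"
  and Om: "cmod \<omega> \<le> Om" and \<eta>: "0 < \<eta>" "\<eta> \<le> 1" and q: "0 < q" "q \<le> 1" and N: "N \<ge> 1"
  and Kd: "(\<Sum>v\<in>W. real (d v) * real (d v) powr (1 + \<eta>)) \<le> Kd * real (\<Sum>v\<in>W. d v)" "Kd \<ge> 0"
  and H1: "\<And>U. U \<subseteq> W \<Longrightarrow> real (card (W - U)) \<le> N + 2 \<Longrightarrow>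
    \<bar>(\<Sum>v\<in>U. real (d v) * (real (d v) - 2)) - c * real (\<Sum>v\<in>W. d v)\<bar> \<le> \<epsilon> * real (\<Sum>v\<in>W. d v)"
  and H1b: "\<And>U. U \<subseteq> W \<Longrightarrow> real (card (W - U)) \<le> N + 2 \<Longrightarrow> real (\<Sum>v\<in>W - U. d v) \<le> \<epsilon> * real (\<Sum>v\<in>W. d v)"
  and H1c: "\<And>U. U \<subseteq> W \<Longrightarrow> real (card (W - U)) \<le> N + 2 \<Longrightarrow>
    (\<Sum>v | v \<in> U \<and> d v \<ge> 3. real (d v)) \<ge> q * real (\<Sum>v\<in>W. d v)"
  and H3: "\<epsilon> * real (\<Sum>v\<in>W. d v) powr \<eta> \<le> 1" "0 \<le> \<epsilon>" "\<epsilon> \<le> q / 16"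
  and H5: "N * (2 + 4 * Om + 4 * (4 * (4 * (1 + 2 * Om) * Kd + 4 + 2 * c) / (q * \<eta>)) * (Om + 2)) \<le> real (\<Sum>v\<in>W. d v)"
begin

definition L where "L = real (\<Sum>v\<in>W. d v)"
text \<open>The distance from the trivial parameters \<omega> = 0 and z = 1, for which
  \<open>g\<close> is constantly 1.\<close>

definition kap where "kap = cmod \<omega> + cmod (z - 1)"
definition E0 where "E0 = 4 * (1 + 2 * Om) * Kd + 4 + 2 * c"
text \<open>Chosen so that q C \<eta> / 4 equals \<open>E0\<close>: the decrease of C s^(-\<eta>) at
  vertices of degree at least 3 then pays exactly for the local error E0 s^(-(1 + \<eta>)).\<close>

definition C where "C = 4 * E0 / (q * \<eta>)"
text \<open>Plays the role of a bound on the expected number of steps until the clusters meet, as a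
  function of their total size. Up to 2 sqrt L it drops by 12 / q whenever the total grows by one,
  and growth has probability at least q; beyond that it is constant and a collision probability of
  order 1 / sqrt L takes over.\<close>

definition T where "T x = 12 / q * (3 * sqrt L - min x (2 * sqrt L))" for x
text \<open>The supersolution. Its parts absorb the local error at small sizes, the error at the
  collision, where \<open>g\<close> is compared with z, and the steps: \<open>k\<close> counts those
  already made, so that the bound is at least 2 once \<open>k\<close> reaches
  \<open>N\<close>.\<close>

definition Err where
 "Err k s b = C * kap * (s powr (- \<eta>) + b powr (- \<eta>)) + (cmod (z - 1) + 2 * \<epsilon>) + 2 / N * (k + T (s + b))"
definition g where "g s b = G \<omega> (c * L / b) s"

lemma Om0: "Om \<ge> 0" using Om norm_ge_zero order_trans by blast

lemma E0: "E0 \<ge> 4" using Om0 Kd c by (simp add: E0_def)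

lemma C0: "C \<ge> 0" using E0 q \<eta> by (simp add: C_def)

lemma kap: "0 \<le> kap" "kap \<le> Om + 2"
proof -
 have "cmod (z - 1) \<le> 2" using norm_triangle_ineq4[of z 1] z1 by simp
 then show "0 \<le> kap" "kap \<le> Om + 2" using Om by (auto simp: kap_def)
qed

lemma L1: "L \<ge> 1"
proof -
 have "4 * C * (Om + 2) \<ge> 0" using C0 Om0 by simp
 then have "1 * 1 \<le> N * (2 + 4 * Om + 4 * C * (Om + 2))" using N Om0 by (intro mult_mono) auto
 also have "\<dots> \<le> L" using H5 by (simp add: L_def C_def E0_def)
 finally show ?thesis by simp
qed

lemma T_nonneg: "T x \<ge> 12 / q * sqrt L"
proof -
 have "sqrt L \<le> 3 * sqrt L - min x (2 * sqrt L)" using L1 by simp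
 then show ?thesis unfolding T_def using q by (intro mult_left_mono) auto
qed

lemma T_mono: "x \<le> y \<Longrightarrow> T y \<le> T x"
 unfolding T_def using q by (intro mult_left_mono) auto

lemma T_nn: "T x \<ge> 0"
proof -
 have "0 \<le> 12 / q * sqrt L" using q L1 by simp
 then show ?thesis using T_nonneg[of x] by linarith
qed

lemma Err_nonneg: "k \<ge> 0 \<Longrightarrow> Err k s b \<ge> 0"
 unfolding Err_def using C0 kap T_nn N H3 by (intro add_nonneg_nonneg mult_nonneg_nonneg) auto

lemma Err_sym: "Err k s b = Err k b s"
 by (simp add: Err_def add.commute)

lemma g_sym: "s > 0 \<Longrightarrow> b > 0 \<Longrightarrow> g s b = g b s"
 unfolding g_def by (rule G_swap)

lemma g_norm: "s > 0 \<Longrightarrow> b > 0 \<Longrightarrow> cmod (g s b) \<le> 1"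
 unfolding g_def using Rew c L1 by (intro norm_G) auto

text \<open>Consistency of \<open>g\<close> with one step of the recursion. The sum over the
  vertices is expanded by \<open>G_step_error\<close>; the main terms cancel by
  \<open>G_ode\<close>, because the sum of d (d - 2) over unexplored vertices is close to c L. What
  is left is proportional to the collision probability or of order s^(-(1 + \<eta>)).\<close>

lemma step_main:
 fixes s b :: nat
 assumes U: "U \<subseteq> W" "real (card (W - U)) \<le> N + 2" and s: "s \<ge> 1" "b \<ge> 1"
  and sb: "s + b \<le> (\<Sum>v\<in>W - U. d v)"
 defines "\<rho> \<equiv> 1 / real (s + b + (\<Sum>v\<in>U. d v) - 1)"
 defines "a \<equiv> \<lambda>v. ((of_nat s - 1) + (of_nat (d v) - 1) * z) / of_nat (s + d v - 2)"
 shows "1 / L \<le> \<rho>" "\<rho> \<le> 2 / L" "real s * \<rho> \<le> 2 * \<epsilon>"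
  and "\<rho> * (real b + (real s - 1) + (\<Sum>v\<in>U. real (d v))) = 1"
  and "cmod (of_real \<rho> * of_nat b * (z - g s b) + of_real \<rho> * (\<Sum>v\<in>U. of_nat (d v) * (a v * g (s + d v - 2) b - g s b))
    + \<i> * of_real l * g s b / of_nat s)
   \<le> \<rho> * real b * (cmod (z - 1) + 2 * \<epsilon>) + kap * E0 * real s powr (- (1 + \<eta>))"
proof -
 let ?DU = "\<Sum>v\<in>U. real (d v)" and ?X = "\<Sum>v\<in>W - U. real (d v)"
 define Fm where "Fm = real (s + b + (\<Sum>v\<in>U. d v) - 1)"
 have \<rho>_Fm: "\<rho> = 1 / Fm" by (simp add: \<rho>_def Fm_def)
 have finU: "finite U" using U finW finite_subset by blast
 have LX: "L = ?DU + ?X" unfolding L_def using sum.subset_diff[OF U(1) finW, of "\<lambda>v. real (d v)"] by simp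
 have X: "?X \<le> \<epsilon> * L" using H1b[OF U] by (simp add: L_def)
 \<comment> \<open>Free stubs sit at explored vertices, so the clusters hold at most the share
   \<epsilon> of all stubs.\<close>
 have sbX: "real s + real b \<le> ?X" using sb by (metis of_nat_add of_nat_le_iff of_nat_sum)
 have F1: "Fm = real b + (real s - 1) + ?DU" unfolding Fm_def using s by (simp add: of_nat_diff)
 have eps: "\<epsilon> \<le> 1 / 16" using H3 q by simp
 have L: "L \<ge> 1" by (rule L1)
 have eL: "\<epsilon> * L \<le> L / 16" using mult_right_mono[OF eps, of L] L by simp
 have s1: "real s \<ge> 1" "real b \<ge> 1" using s by auto
 have F1b: "?DU \<le> Fm" "Fm \<le> L" "L / 2 \<le> Fm" "Fm > 0"
  unfolding F1 using LX X sbX s1 eL L by linarith+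
 show r1: "1 / L \<le> \<rho>" unfolding \<rho>_Fm using F1b L by (intro divide_left_mono) auto
 have "\<rho> \<le> 1 / (L / 2)" unfolding \<rho>_Fm using F1b L by (intro divide_left_mono) auto
 then show r2: "\<rho> \<le> 2 / L" by simp
 have r0: "\<rho> \<ge> 0" using r1 L by (meson order_trans divide_nonneg_nonneg zero_le_one)
 have reL: "\<rho> * (\<epsilon> * L) \<le> 2 * \<epsilon>"
 proof -
  have "\<rho> * (\<epsilon> * L) \<le> 2 / L * (\<epsilon> * L)" using r2 H3 L by (intro mult_right_mono) auto
  then show ?thesis using L by simp
 qed
 have "real s * \<rho> \<le> \<epsilon> * L * \<rho>" using sbX X s r0 by (intro mult_right_mono) auto
 then show "real s * \<rho> \<le> 2 * \<epsilon>" using reL by (simp add: mult.commute)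
 have rF: "\<rho> * Fm = 1" unfolding \<rho>_Fm using F1b by simp
 then show "\<rho> * (real b + (real s - 1) + ?DU) = 1" by (simp only: F1)
 define \<kappa> where "\<kappa> = c * L / real b"
 have k0: "\<kappa> \<ge> 0" "\<kappa> > 0" using c L s by (auto simp: \<kappa>_def)
 have s0: "real s > 0" using s by simp
 define H where "H = G1 \<omega> \<kappa> (real s)"
 let ?g = "g s b"
 have gk: "g x b = G \<omega> \<kappa> x" for x by (simp add: g_def \<kappa>_def)
 have nH: "cmod H \<le> cmod \<omega> / real s" unfolding H_def by (rule norm_G1[OF Rew k0(1) s0])
 have ng: "cmod ?g \<le> 1" using s by (intro g_norm) auto
 define r where "r v = a v * g (s + d v - 2) b - ?g - of_real (real (d v) - 2) * H - (of_nat (d v) - 1) * (z - 1) / of_nat s * ?g" for v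
 let ?p = "real s powr (- (1 + \<eta>))"
 have nr: "cmod (r v) \<le> 2 * kap * (1 + 2 * Om) * (real (d v) powr (1 + \<eta>) * ?p)" if v: "v \<in> U" for v
 proof -
  have dv: "d v \<ge> 2" using d2 v U by auto
  have "cmod (r v) \<le> 2 * (cmod \<omega> + cmod (z - 1)) * (1 + 2 * cmod \<omega>) * (real (d v) / real s) powr (1 + \<eta>)"
   unfolding r_def a_def H_def gk by (rule G_step_error[OF Rew k0(1) s(1) dv \<eta>])
  also have "\<dots> \<le> 2 * kap * (1 + 2 * Om) * (real (d v) / real s) powr (1 + \<eta>)"
   unfolding kap_def using Om by (intro mult_right_mono mult_left_mono) auto
  also have "(real (d v) / real s) powr (1 + \<eta>) = real (d v) powr (1 + \<eta>) * ?p"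
   using s0 by (simp add: powr_divide powr_minus_divide del: minus_add_distrib)
  finally show ?thesis .
 qed
 define A where "A = (\<Sum>v\<in>U. real (d v) * (real (d v) - 2))"
 have Ac: "\<bar>A - c * L\<bar> \<le> \<epsilon> * L" using H1[OF U] by (simp add: A_def L_def)
 have rL: "0 \<le> \<rho> * L - 1" "\<rho> * L - 1 \<le> 2 * \<epsilon>"
 proof -
  show "0 \<le> \<rho> * L - 1" using r1 L by (simp add: field_simps)
  have "\<rho> * L - 1 = \<rho> * (L - Fm)" using rF by (simp add: right_diff_distrib)
  also have "\<dots> \<le> \<rho> * (\<epsilon> * L)" using F1b LX X r0 by (intro mult_left_mono) auto
  finally show "\<rho> * L - 1 \<le> 2 * \<epsilon>" using reL by simp
 qed
 have e1: "\<bar>\<rho> * A - c\<bar> \<le> 2 * (1 + c) * \<epsilon>"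
 proof -
  have "\<rho> * A - c = \<rho> * (A - c * L) + c * (\<rho> * L - 1)" by (simp add: algebra_simps)
  also have "\<bar>\<dots>\<bar> \<le> \<rho> * \<bar>A - c * L\<bar> + c * \<bar>\<rho> * L - 1\<bar>"
   using r0 c abs_triangle_ineq[of "\<rho> * (A - c * L)" "c * (\<rho> * L - 1)"] by (simp add: abs_mult)
  also have "\<dots> \<le> \<rho> * (\<epsilon> * L) + c * (2 * \<epsilon>)"
   using Ac r0 c rL by (intro add_mono mult_left_mono) auto
  also have "\<dots> \<le> 2 * \<epsilon> + c * (2 * \<epsilon>)" using reL by simp
  finally show ?thesis by (simp add: algebra_simps)
 qed
 have e2: "\<bar>\<rho> * (A + ?DU) - (c + 1)\<bar> \<le> 2 * (1 + c) * \<epsilon> + 2 * \<epsilon>"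
 proof -
  have "1 - \<rho> * ?DU = \<rho> * (Fm - ?DU)" using rF by (simp add: right_diff_distrib)
  moreover have "0 \<le> \<rho> * (Fm - ?DU)" using F1b r0 by simp
  moreover have "\<rho> * (Fm - ?DU) \<le> \<rho> * (\<epsilon> * L)" using F1 sbX X r0 by (intro mult_left_mono) auto
  moreover have "\<rho> * (A + ?DU) - (c + 1) = (\<rho> * A - c) - (1 - \<rho> * ?DU)" by (simp add: algebra_simps)
  ultimately show ?thesis using e1 reL by linarith
 qed
 have Asum: "complex_of_real A = (\<Sum>v\<in>U. of_nat (d v) * of_real (real (d v) - 2))"
  "complex_of_real (A + ?DU) = (\<Sum>v\<in>U. of_nat (d v) * (of_nat (d v) - 1))"
 proof -
  show "complex_of_real A = (\<Sum>v\<in>U. of_nat (d v) * of_real (real (d v) - 2))"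
   unfolding A_def by simp
  have "A + ?DU = (\<Sum>v\<in>U. real (d v) * (real (d v) - 1))"
   unfolding A_def sum.distrib[symmetric] by (intro sum.cong refl) (simp add: algebra_simps)
  then show "complex_of_real (A + ?DU) = (\<Sum>v\<in>U. of_nat (d v) * (of_nat (d v) - 1))" by simp
 qed
 \<comment> \<open>\<open>G_ode\<close> multiplied by b / L; the relation \<open>cw\<close> between
   \<omega>, z and l enters here.\<close>
 have ode: "of_nat b / of_real L * (1 - ?g) + of_real c * H + (of_real (c + 1) * (z - 1) + \<i> * of_real l) / of_nat s * ?g = 0"
 proof -
  have o: "of_real \<kappa> * H + of_real \<kappa> * \<omega> / of_real (real s) * ?g = ?g - 1"
   unfolding H_def gk by (rule G_ode[OF Rew k0(1) s0])
  have bk: "of_nat b / of_real L * of_real \<kappa> = (of_real c :: complex)"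
   unfolding \<kappa>_def using s L by (simp add: field_simps)
  have p1: "of_nat b / of_real L * (of_real \<kappa> * H + of_real \<kappa> * \<omega> / of_real (real s) * ?g) = of_nat b / of_real L * (?g - 1)"
   unfolding o ..
  have p2: "of_nat b / of_real L * (of_real \<kappa> * H + of_real \<kappa> * \<omega> / of_real (real s) * ?g)
   = (of_nat b / of_real L * of_real \<kappa>) * H + (of_nat b / of_real L * of_real \<kappa>) * \<omega> / of_nat s * ?g"
   by (simp add: distrib_left mult.assoc)
  have "of_real c * H + of_real c * \<omega> / of_nat s * ?g = of_nat b / of_real L * (?g - 1)"
   by (rule trans[OF p2[unfolded bk, symmetric] p1])
  then show ?thesis unfolding cw by (simp add: algebra_simps)
 qed
 have sumr: "(\<Sum>v\<in>U. of_nat (d v) * (a v * g (s + d v - 2) b - ?g))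
  = (\<Sum>v\<in>U. of_nat (d v) * r v) + of_real A * H + of_real (A + ?DU) * ((z - 1) / of_nat s * ?g)"
  unfolding Asum sum_distrib_right sum.distrib[symmetric] r_def by (intro sum.cong refl) (simp add: algebra_simps)
 have "of_real \<rho> * of_nat b * (z - ?g) + of_real \<rho> * (\<Sum>v\<in>U. of_nat (d v) * (a v * g (s + d v - 2) b - ?g)) + \<i> * of_real l * ?g / of_nat s
  = of_real \<rho> * of_nat b * (z - 1) + of_real (\<rho> - 1 / L) * of_nat b * (1 - ?g)
   + of_real \<rho> * (\<Sum>v\<in>U. of_nat (d v) * r v) + of_real (\<rho> * A - c) * H
   + of_real (\<rho> * (A + ?DU) - (c + 1)) * ((z - 1) / of_nat s * ?g)
   + (of_nat b / of_real L * (1 - ?g) + of_real c * H + (of_real (c + 1) * (z - 1) + \<i> * of_real l) / of_nat s * ?g)"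
  unfolding sumr by (simp add: divide_inverse algebra_simps)
 also have "\<dots> = of_real \<rho> * of_nat b * (z - 1) + of_real (\<rho> - 1 / L) * of_nat b * (1 - ?g)
   + of_real \<rho> * (\<Sum>v\<in>U. of_nat (d v) * r v) + of_real (\<rho> * A - c) * H
   + of_real (\<rho> * (A + ?DU) - (c + 1)) * ((z - 1) / of_nat s * ?g)" unfolding ode by simp
 also have "cmod \<dots> \<le> \<rho> * real b * cmod (z - 1) + \<rho> * real b * (2 * \<epsilon>)
   + kap * (4 * (1 + 2 * Om) * Kd) * ?p + 2 * (1 + c) * \<epsilon> * (cmod \<omega> / real s)
   + (2 * (1 + c) * \<epsilon> + 2 * \<epsilon>) * (cmod (z - 1) / real s)"
 proof (intro norm_triangle_mono)
  show "cmod (of_real \<rho> * of_nat b * (z - 1)) \<le> \<rho> * real b * cmod (z - 1)"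
   using r0 by (simp add: norm_mult)
  show "cmod (of_real (\<rho> - 1 / L) * of_nat b * (1 - ?g)) \<le> \<rho> * real b * (2 * \<epsilon>)"
  proof -
   have "\<rho> - 1 / L = \<rho> * (1 - Fm / L)" using rF L by (simp add: right_diff_distrib)
   also have "\<dots> \<le> \<rho> * \<epsilon>"
   proof (intro mult_left_mono r0)
    have "L - Fm \<le> \<epsilon> * L" using F1b LX X by linarith
    then show "1 - Fm / L \<le> \<epsilon>" using L by (simp add: field_simps)
   qed
   finally have 1: "\<bar>\<rho> - 1 / L\<bar> \<le> \<rho> * \<epsilon>" using r1 by simp
   have 2: "cmod (1 - ?g) \<le> 2" using ng norm_triangle_ineq4[of 1 ?g] by simp
   have "\<bar>\<rho> - 1 / L\<bar> * real b * cmod (1 - ?g) \<le> \<rho> * \<epsilon> * real b * 2"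
    using 1 2 r0 H3 by (intro mult_mono) auto
   then show ?thesis by (simp only: norm_mult norm_of_real norm_of_nat) (simp add: ac_simps)
  qed
  show "cmod (of_real \<rho> * (\<Sum>v\<in>U. of_nat (d v) * r v)) \<le> kap * (4 * (1 + 2 * Om) * Kd) * ?p"
  proof -
   have "cmod (\<Sum>v\<in>U. of_nat (d v) * r v) \<le> (\<Sum>v\<in>U. real (d v) * (2 * kap * (1 + 2 * Om) * (real (d v) powr (1 + \<eta>) * ?p)))"
    unfolding norm_mult[symmetric] by (intro norm_sum[THEN order_trans] sum_mono) (simp only: norm_mult norm_of_nat, intro mult_left_mono nr, auto)
   also have "\<dots> = 2 * kap * (1 + 2 * Om) * ?p * (\<Sum>v\<in>U. real (d v) * real (d v) powr (1 + \<eta>))"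
    by (simp only: sum_distrib_left) (intro sum.cong refl, simp only: ac_simps)
   also have "\<dots> \<le> 2 * kap * (1 + 2 * Om) * ?p * (Kd * L)"
   proof (intro mult_left_mono)
    have "(\<Sum>v\<in>U. real (d v) * real (d v) powr (1 + \<eta>)) \<le> (\<Sum>v\<in>W. real (d v) * real (d v) powr (1 + \<eta>))"
     using U finW by (intro sum_mono2) auto
    then show "(\<Sum>v\<in>U. real (d v) * real (d v) powr (1 + \<eta>)) \<le> Kd * L" using Kd(1) by (simp add: L_def)
   qed (use kap Om0 in auto)
   finally have S: "cmod (\<Sum>v\<in>U. of_nat (d v) * r v) \<le> 2 * kap * (1 + 2 * Om) * ?p * (Kd * L)" .
   have "cmod (of_real \<rho> * (\<Sum>v\<in>U. of_nat (d v) * r v)) \<le> 2 / L * (2 * kap * (1 + 2 * Om) * ?p * (Kd * L))"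
    unfolding norm_mult norm_of_real using S r0 r2 L by (intro mult_mono) auto
   also have "2 / L * (2 * kap * (1 + 2 * Om) * ?p * (Kd * L)) = kap * (4 * (1 + 2 * Om) * Kd) * ?p"
    using L by (simp add: field_simps)
   finally show ?thesis .
  qed
  show "cmod (of_real (\<rho> * A - c) * H) \<le> 2 * (1 + c) * \<epsilon> * (cmod \<omega> / real s)"
   unfolding norm_mult norm_of_real using e1 nH H3 c by (intro mult_mono) auto
  show "cmod (of_real (\<rho> * (A + ?DU) - (c + 1)) * ((z - 1) / of_nat s * ?g)) \<le> (2 * (1 + c) * \<epsilon> + 2 * \<epsilon>) * (cmod (z - 1) / real s)"
  proof -
   have "cmod ((z - 1) / of_nat s * ?g) \<le> cmod (z - 1) / real s * 1"
    unfolding norm_mult norm_divide norm_of_nat using ng by (intro mult_left_mono) auto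
   then show ?thesis unfolding norm_mult[of "of_real _"] norm_of_real using e2 H3 c by (intro mult_mono) auto
  qed
 qed
 finally have fa: "cmod (of_real \<rho> * of_nat b * (z - ?g) + of_real \<rho> * (\<Sum>v\<in>U. of_nat (d v) * (a v * g (s + d v - 2) b - ?g))
    + \<i> * of_real l * ?g / of_nat s) \<le> \<rho> * real b * cmod (z - 1) + \<rho> * real b * (2 * \<epsilon>)
   + kap * (4 * (1 + 2 * Om) * Kd) * ?p + 2 * (1 + c) * \<epsilon> * (cmod \<omega> / real s)
   + (2 * (1 + c) * \<epsilon> + 2 * \<epsilon>) * (cmod (z - 1) / real s)" .
 \<comment> \<open>A leftover of order \<epsilon> / s is traded for s^(-(1 + \<eta>)) by means of
   \<epsilon> L^\<eta> <= 1.\<close>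
 have fb: "2 * (1 + c) * \<epsilon> * (cmod \<omega> / real s) + (2 * (1 + c) * \<epsilon> + 2 * \<epsilon>) * (cmod (z - 1) / real s) \<le> kap * (4 + 2 * c) * ?p"
 proof -
  have "s \<le> L" using sbX X eL L s by linarith
  then have "real s powr \<eta> \<le> L powr \<eta>" using \<eta> by (intro powr_mono2) auto
  then have "\<epsilon> * real s powr \<eta> \<le> 1" using H3 mult_left_mono[of "real s powr \<eta>" "L powr \<eta>" \<epsilon>] by (simp add: L_def)
  then have "\<epsilon> * real s powr \<eta> * ?p \<le> ?p" by (intro mult_left_le_one_le) (use H3 in auto)
  moreover have "real s powr \<eta> * ?p = 1 / real s" using s0 by (simp add: powr_add[symmetric] powr_minus_divide)
  ultimately have es: "\<epsilon> / real s \<le> ?p" by (simp add: mult.assoc)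
  have "2 * (1 + c) * \<epsilon> * (cmod \<omega> / real s) + (2 * (1 + c) * \<epsilon> + 2 * \<epsilon>) * (cmod (z - 1) / real s)
   \<le> (4 + 2 * c) * \<epsilon> * (cmod \<omega> / real s) + (4 + 2 * c) * \<epsilon> * (cmod (z - 1) / real s)"
   using H3 c s0 by (intro add_mono mult_right_mono) (auto simp: algebra_simps)
  also have "\<dots> = kap * (4 + 2 * c) * (\<epsilon> / real s)" by (simp add: kap_def divide_inverse algebra_simps)
  also have "\<dots> \<le> kap * (4 + 2 * c) * ?p" using es kap c by (intro mult_left_mono) auto
  finally show ?thesis .
 qed
 have fc: "kap * E0 * ?p = kap * (4 * (1 + 2 * Om) * Kd) * ?p + kap * (4 + 2 * c) * ?p"
  by (simp add: E0_def algebra_simps)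
 show "cmod (of_real \<rho> * of_nat b * (z - ?g) + of_real \<rho> * (\<Sum>v\<in>U. of_nat (d v) * (a v * g (s + d v - 2) b - ?g))
    + \<i> * of_real l * ?g / of_nat s)
   \<le> \<rho> * real b * (cmod (z - 1) + 2 * \<epsilon>) + kap * E0 * ?p"
  using fa fb fc unfolding distrib_left[of "\<rho> * real b"] by linarith
qed

text \<open>The decrease of s^(-\<eta>) when the cluster grows by one stub. The factor 1/4 comes
  from ln (1 + x) >= x / 2 and exp (- u) <= 1 - u / 2 on the unit interval.\<close>

lemma powr_gain:
 fixes s :: real
 assumes "s \<ge> 1"
 shows "s powr (- \<eta>) - (s + 1) powr (- \<eta>) \<ge> \<eta> / 4 * s powr (- (1 + \<eta>))"
proof -
 let ?x = "1 / s"
 have x: "0 < ?x" "?x \<le> 1" using assms by auto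
 have lb: "ln (1 + x) \<ge> x / 2" if x: "0 < x" "x \<le> 1" for x :: real
 proof -
  have "ln (1 / (1 + x)) \<le> 1 / (1 + x) - 1" using x by (intro ln_le_minus_one) auto
  moreover have "ln (1 / (1 + x)) = - ln (1 + x)" using x by (simp add: ln_div)
  moreover have "1 - 1 / (1 + x) = x / (1 + x)" using x by (simp add: field_simps)
  moreover have "x / 2 \<le> x / (1 + x)" using x by (intro divide_left_mono) auto
  ultimately show ?thesis by linarith
 qed
 note l = lb[OF x]
 let ?u = "\<eta> * ?x / 2"
 have u: "0 \<le> ?u" "?u \<le> 1" using \<eta> x mult_mono[of \<eta> 1 ?x 1] by auto
 have "(s + 1) powr (- \<eta>) = s powr (- \<eta>) * (1 + ?x) powr (- \<eta>)"
 proof -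
  have "s + 1 = s * (1 + ?x)" using assms by (simp add: distrib_left)
  moreover have "0 \<le> s" "0 \<le> 1 + ?x" using assms x by linarith+
  ultimately show ?thesis by (metis powr_mult)
 qed
 also have "(1 + ?x) powr (- \<eta>) = exp (- (\<eta> * ln (1 + ?x)))"
 proof -
  have "1 + ?x \<noteq> 0" using x by linarith
  then show ?thesis by (simp only: powr_def if_False mult_minus_left)
 qed
 also have "exp (- (\<eta> * ln (1 + ?x))) \<le> exp (- ?u)"
 proof -
  have "?u \<le> \<eta> * ln (1 + ?x)" using mult_left_mono[OF l, of \<eta>] \<eta> by (simp only: times_divide_eq_right less_imp_le)
  then show ?thesis by (simp only: exp_le_cancel_iff neg_le_iff_le)
 qed
 also have "exp (- ?u) \<le> 1 - ?u / 2"
 proof -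
  have "exp (- ?u) = 1 / exp ?u" by (simp add: exp_minus inverse_eq_divide)
  also have "\<dots> \<le> 1 / (1 + ?u)" using exp_ge_add_one_self[of ?u] u by (intro divide_left_mono) auto
  also have "\<dots> \<le> 1 - ?u / 2"
  proof -
   have "1 \<le> (1 - ?u / 2) * (1 + ?u)" using u mult_left_le[of ?u ?u] by (simp add: algebra_simps)
   then show ?thesis using u by (simp add: pos_divide_le_eq)
  qed
  finally show ?thesis .
 qed
 finally have "(s + 1) powr (- \<eta>) \<le> s powr (- \<eta>) * (1 - ?u / 2)" by (simp add: mult_left_mono)
 moreover have "s powr (- (1 + \<eta>)) = s powr (- \<eta>) * ?x"
  using assms by (simp add: powr_add powr_minus_divide powr_diff)
 ultimately show ?thesis by (simp add: algebra_simps)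
qed

text \<open>Cancellation of two free stubs increases s^(-\<eta>). Weighted with the s - 1 choices of
  the partner the increase stays bounded, so after division by the number of stubs it is
  negligible.\<close>

lemma powr_loss:
 fixes s :: real
 assumes "s \<ge> 3"
 shows "(s - 1) * ((s - 2) powr (- \<eta>) - s powr (- \<eta>)) \<le> 4"
proof -
 let ?r = "s / (s - 2)"
 have r: "?r \<ge> 1" using assms by (simp add: field_simps)
 have "(s - 2) powr (- \<eta>) = s powr (- \<eta>) * ?r powr \<eta>"
  using assms by (simp add: powr_divide powr_minus field_simps)
 also have "\<dots> \<le> s powr (- \<eta>) * ?r powr 1" using r \<eta> by (intro mult_left_mono powr_mono) auto
 also have "?r powr 1 = 1 + 2 / (s - 2)" using assms by (simp add: field_simps)
 finally have "(s - 2) powr (- \<eta>) - s powr (- \<eta>) \<le> s powr (- \<eta>) * (2 / (s - 2))"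
  by (simp add: distrib_left)
 also have "\<dots> \<le> 1 * (2 / (s - 2))"
  using assms \<eta> powr_mono[of "- \<eta>" 0 s] by (intro mult_right_mono) auto
 finally have "(s - 1) * ((s - 2) powr (- \<eta>) - s powr (- \<eta>)) \<le> (s - 1) * (2 / (s - 2))"
  using assms by (intro mult_left_mono) auto
 also have "\<dots> \<le> 4" using assms by (simp add: field_simps)
 finally show ?thesis .
qed

text \<open>\<open>Err\<close> is a supersolution: one step of the recursion applied to it leaves
  room for the local error of \<open>g\<close>. The induction runs on the fuel while
  \<open>k\<close> counts the steps made, and \<open>M + k \<ge> N\<close> ensures that the trivial
  bound 2 applies when the fuel is used up. The condition on \<open>s + b\<close> records that all
  free stubs sit at explored vertices.\<close>

theorem Qf_approx:
 "real (M + k) \<ge> N \<Longrightarrow> U \<subseteq> W \<Longrightarrow> card (W - U) \<le> k + 2 \<Longrightarrow> s \<ge> 1 \<Longrightarrow> b \<ge> 1 \<Longrightarrow> s + b \<le> (\<Sum>v\<in>W - U. d v)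
  \<Longrightarrow> cmod (Qf d l z M U s b - g (real s) (real b)) \<le> Err (real k) (real s) (real b)"
proof (induction M arbitrary: k U s b)
 case 0
 have "Err (real k) (real s) (real b) \<ge> 2 / N * (real k + T (real s + real b))"
  unfolding Err_def using C0 kap H3 by (intro add_increasing add_nonneg_nonneg mult_nonneg_nonneg) auto
 moreover have "2 / N * (real k + T (real s + real b)) \<ge> 2 / N * N"
  using 0 T_nn N by (intro mult_left_mono add_increasing2) auto
 ultimately have "Err (real k) (real s) (real b) \<ge> 2" using N by simp
 moreover have "cmod (g (real s) (real b)) \<le> 1" using 0 by (intro g_norm) auto
 ultimately show ?case by simp
next
 case (Suc M)
 have wlog: "cmod (Qf d l z (Suc M) U s b - g (real s) (real b)) \<le> Err (real k) (real s) (real b)"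
  if "s \<le> b" and U: "U \<subseteq> W" and k: "card (W - U) \<le> k + 2" and s: "s \<ge> 1" "b \<ge> 1" and sb: "s + b \<le> (\<Sum>v\<in>W - U. d v)"
  for s b
 \<comment> \<open>Past the horizon the last part of \<open>Err\<close> is at least 2, while
   \<open>Qf\<close> and \<open>g\<close> have modulus at most 1.\<close>
 proof (cases "real k \<ge> N")
  case True
  have "Err (real k) (real s) (real b) \<ge> 2 / N * (real k + T (real s + real b))"
   unfolding Err_def using C0 kap H3 by (intro add_increasing add_nonneg_nonneg mult_nonneg_nonneg) auto
  moreover have "2 / N * (real k + T (real s + real b)) \<ge> 2 / N * N"
   using True T_nn N by (intro mult_left_mono add_increasing2) auto
  ultimately have "Err (real k) (real s) (real b) \<ge> 2" using N by simp
  moreover have "cmod (g (real s) (real b)) \<le> 1" using s by (intro g_norm) auto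
  moreover have "cmod (Qf d l z (Suc M) U s b) \<le> 1" using d2 U by (intro norm_Qf z1) auto
  ultimately show ?thesis using norm_triangle_ineq4[of "Qf d l z (Suc M) U s b" "g (real s) (real b)"] by linarith
 next
  case kN: False
  have cU: "real (card (W - U)) \<le> N + 2" using kN k by (simp add: of_nat_le_iff[where 'a=real, symmetric] del: of_nat_le_iff)
  define \<rho> where "\<rho> = 1 / real (s + b + (\<Sum>v\<in>U. d v) - 1)"
  define a where "a v = ((of_nat s - 1) + (of_nat (d v) - 1) * z) / (of_nat (s + d v - 2) :: complex)" for v
  note main = step_main[OF U cU s sb, folded \<rho>_def a_def]
  have L: "L \<ge> 1" by (rule L1)
  have r0: "\<rho> \<ge> 0" using main(1) L by (meson order_trans divide_nonneg_nonneg zero_le_one)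
  have finU: "finite U" using U finW finite_subset by blast
  let ?g = "g (real s) (real b)" and ?E = "Err (real (Suc k)) (real s) (real b)"
  let ?Q2 = "Qf d l z M U (s - 2) b" and ?x = "real s + real b"
  define Qv where "Qv v = Qf d l z M (U - {v}) (s + d v - 2) b" for v
  define gv where "gv v = g (real (s + d v - 2)) (real b)" for v
  define Ev where "Ev v = Err (real (Suc k)) (real (s + d v - 2)) (real b)" for v
  let ?S1 = "\<Sum>v\<in>U. of_nat (d v) * a v * Qv v"
  let ?DU = "\<Sum>v\<in>U. real (d v)"
  have one: "of_real \<rho> * (of_nat b + (of_nat s - 1) + (\<Sum>v\<in>U. of_nat (d v))) = (1::complex)"
  proof -
   have "of_real (\<rho> * (real b + (real s - 1) + ?DU)) = (1::complex)" unfolding main(4) by simp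
   then show ?thesis by simp
  qed
  have Qeq: "Qf d l z (Suc M) U s b = of_nat s / (of_nat s - \<i> * of_real l) * (of_real \<rho> * (of_nat b * z + (of_nat s - 1) * ?Q2 + ?S1))"
  proof -
   have "min s b = s" "max s b = b" using that(1) by auto
   then show ?thesis using s unfolding Qf.simps Let_def \<rho>_def a_def Qv_def by simp
  qed
  have sl: "of_nat s - \<i> * of_real l \<noteq> 0" using s by (auto simp: complex_eq_iff)
  have sn: "(of_nat s :: complex) \<noteq> 0" using s by simp
  \<comment> \<open>Writes \<open>g\<close> with the prefactor of the recursion, so that the waiting
    time turns into the term i l g / s of \<open>step_main\<close>.\<close>
  have geq: "?g = of_nat s / (of_nat s - \<i> * of_real l) * (?g - \<i> * of_real l * ?g / of_nat s)"
  proof -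
   have "?g - \<i> * of_real l * ?g / of_nat s = (of_nat s - \<i> * of_real l) / of_nat s * ?g"
    using sn by (simp add: diff_divide_distrib left_diff_distrib)
   then show ?thesis using sl sn by simp
  qed
  have "cmod (Qf d l z (Suc M) U s b - ?g) =
   cmod (of_nat s / (of_nat s - \<i> * of_real l)) *
   cmod (of_real \<rho> * (of_nat b * z + (of_nat s - 1) * ?Q2 + ?S1) - (?g - \<i> * of_real l * ?g / of_nat s))"
   by (subst geq) (simp only: Qeq right_diff_distrib[symmetric] norm_mult)
  also have "\<dots> \<le> 1 * cmod (of_real \<rho> * (of_nat b * z + (of_nat s - 1) * ?Q2 + ?S1) - (?g - \<i> * of_real l * ?g / of_nat s))"
  proof (rule mult_right_mono)
   have "real s \<le> cmod (of_nat s - \<i> * of_real l)" using abs_Re_le_cmod[of "of_nat s - \<i> * of_real l"] by simp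
   then show "cmod (of_nat s / (of_nat s - \<i> * of_real l)) \<le> 1" using s by (simp add: norm_divide divide_le_eq_1)
  qed simp
  also have "of_real \<rho> * (of_nat b * z + (of_nat s - 1) * ?Q2 + ?S1) - (?g - \<i> * of_real l * ?g / of_nat s)
   = (of_real \<rho> * of_nat b * (z - ?g) + of_real \<rho> * (\<Sum>v\<in>U. of_nat (d v) * (a v * gv v - ?g)) + \<i> * of_real l * ?g / of_nat s)
    + of_real \<rho> * ((of_nat s - 1) * (?Q2 - ?g)) + of_real \<rho> * (\<Sum>v\<in>U. of_nat (d v) * (a v * (Qv v - gv v)))"
  proof -
   have S: "?S1 = (\<Sum>v\<in>U. of_nat (d v) * (a v * gv v - ?g)) + (\<Sum>v\<in>U. of_nat (d v) * (a v * (Qv v - gv v))) + (\<Sum>v\<in>U. of_nat (d v)) * ?g"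
    unfolding sum_distrib_right sum.distrib[symmetric] by (intro sum.cong refl) (simp add: algebra_simps)
   have "?g = of_real \<rho> * (of_nat b + (of_nat s - 1) + (\<Sum>v\<in>U. of_nat (d v))) * ?g" unfolding one by simp
   then have "of_real \<rho> * (of_nat b * z + (of_nat s - 1) * ?Q2 + ?S1) - ?g
    = of_real \<rho> * (of_nat b * z + (of_nat s - 1) * ?Q2 + ?S1) - of_real \<rho> * (of_nat b + (of_nat s - 1) + (\<Sum>v\<in>U. of_nat (d v))) * ?g"
    by simp
   then show ?thesis unfolding S by (simp add: algebra_simps)
  qed
  also have "cmod \<dots> \<le> (\<rho> * real b * (cmod (z - 1) + 2 * \<epsilon>) + kap * E0 * real s powr (- (1 + \<eta>)))
    + \<rho> * ((real s - 1) * cmod (?Q2 - ?g)) + \<rho> * (\<Sum>v\<in>U. real (d v) * Ev v)"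
  proof (rule norm_triangle_mono, rule norm_triangle_mono)
   show "cmod (of_real \<rho> * of_nat b * (z - ?g) + of_real \<rho> * (\<Sum>v\<in>U. of_nat (d v) * (a v * gv v - ?g)) + \<i> * of_real l * ?g / of_nat s)
    \<le> \<rho> * real b * (cmod (z - 1) + 2 * \<epsilon>) + kap * E0 * real s powr (- (1 + \<eta>))"
    using main(5) unfolding gv_def by simp
   have "(of_nat s - 1 :: complex) = of_nat (s - 1)" "real s - 1 = real (s - 1)" using s by (simp_all add: of_nat_diff)
   then show "cmod (of_real \<rho> * ((of_nat s - 1) * (?Q2 - ?g))) \<le> \<rho> * ((real s - 1) * cmod (?Q2 - ?g))"
    using r0 by (simp only: norm_mult norm_of_real norm_of_nat abs_of_nonneg order_refl)
   show "cmod (of_real \<rho> * (\<Sum>v\<in>U. of_nat (d v) * (a v * (Qv v - gv v)))) \<le> \<rho> * (\<Sum>v\<in>U. real (d v) * Ev v)"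
   proof -
    have "cmod (of_nat (d v) * (a v * (Qv v - gv v))) \<le> real (d v) * Ev v" if v: "v \<in> U" for v
    proof -
     have dv: "d v \<ge> 2" using d2 v U by auto
     have "cmod ((of_nat s - 1) + (of_nat (d v) - 1) * z) \<le> cmod (of_nat (s - 1)) + cmod (of_nat (d v - 1) * z)"
      using s dv norm_triangle_ineq[of "of_nat (s - 1)" "of_nat (d v - 1) * z"] by (simp add: of_nat_diff)
     also have "\<dots> \<le> real (s - 1) + real (d v - 1) * 1"
      unfolding norm_mult norm_of_nat using z1 by (intro add_left_mono mult_left_mono) auto
     also have "\<dots> = real (s + d v - 2)" using s dv by (simp add: of_nat_diff)
     finally have le: "cmod ((of_nat s - 1) + (of_nat (d v) - 1) * z) \<le> real (s + d v - 2)" .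
     have "0 < real (s + d v - 2)" using s dv by simp
     from divide_le_eq_1_pos[OF this] le have av: "cmod (a v) \<le> 1"
      unfolding a_def norm_divide norm_of_nat by blast
     have Wv: "W - (U - {v}) = insert v (W - U)" using v U by auto
     have "cmod (Qv v - gv v) \<le> Ev v"
      unfolding Qv_def gv_def Ev_def
     proof (rule Suc.IH)
      show "N \<le> real (M + Suc k)" using Suc.prems(1) by simp
      show "U - {v} \<subseteq> W" using U by auto
      show "card (W - (U - {v})) \<le> Suc k + 2" unfolding Wv using k v finW by simp
      show "1 \<le> s + d v - 2" "1 \<le> b" using s dv by auto
      show "s + d v - 2 + b \<le> (\<Sum>v\<in>W - (U - {v}). d v)"
       unfolding Wv using sb v finW dv by simp
     qed
     then have "cmod (a v) * cmod (Qv v - gv v) \<le> 1 * Ev v" using av by (intro mult_mono) auto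
     then show ?thesis unfolding norm_mult norm_of_nat by (intro mult_left_mono) auto
    qed
    then have "cmod (\<Sum>v\<in>U. of_nat (d v) * (a v * (Qv v - gv v))) \<le> (\<Sum>v\<in>U. real (d v) * Ev v)"
     by (intro norm_sum[THEN order_trans] sum_mono)
    then show ?thesis using r0 unfolding norm_mult norm_of_real by (simp add: mult_left_mono)
   qed
  qed
  \<comment> \<open>Cancellation: the induction hypothesis at s - 2 costs the increase of
    s^(-\<eta>) and of \<open>T\<close>, and the Lipschitz bound compares the two values of
    \<open>g\<close>. For s <= 2 the coefficient s - 1 is at most 1 and the trivial bound 2
    suffices.\<close>
  also have "\<rho> * ((real s - 1) * cmod (?Q2 - ?g)) \<le> \<rho> * ((real s - 1) * ?E) + \<rho> * (2 + 4 * Om + 4 * (C * kap)) + 2 / N * (48 * \<epsilon> / q)"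
  proof -
   have s3: "(real s - 1) * cmod (?Q2 - ?g) \<le> (real s - 1) * ?E + (2 + 4 * Om + 4 * (C * kap)) + (real s - 1) * (2 / N * (24 / q))"
   proof (cases "s \<ge> 3")
    case True
    have "cmod (Qf d l z M U (s - 2) b - g (real (s - 2)) (real b)) \<le> Err (real (Suc k)) (real (s - 2)) (real b)"
    proof (rule Suc.IH)
     show "N \<le> real (M + Suc k)" using Suc.prems(1) by simp
     show "card (W - U) \<le> Suc k + 2" "1 \<le> s - 2" "s - 2 + b \<le> (\<Sum>v\<in>W - U. d v)" using True k sb by auto
    qed (use U s in auto)
    moreover have rs: "real (s - 2) = real s - 2" using True by (simp add: of_nat_diff)
    moreover have "cmod (g (real s) (real b) - g (real s - 2) (real b)) \<le> cmod \<omega> * (2 / (real s - 2))"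
     using G_lipschitz[OF Rew, of "c * L / real b" "real s - 2" 2] c L True s by (simp add: g_def)
    ultimately have q1: "cmod (?Q2 - ?g) \<le> Err (real (Suc k)) (real s - 2) (real b) + cmod \<omega> * (2 / (real s - 2))"
     using norm_triangle_ineq4[of "?Q2 - g (real s - 2) (real b)" "?g - g (real s - 2) (real b)"] by simp
    have "T (real s - 2 + real b) - T ?x = 12 / q * (min ?x (2 * sqrt L) - min (real s - 2 + real b) (2 * sqrt L))"
     unfolding T_def by (simp add: right_diff_distrib)
    also have "\<dots> \<le> 12 / q * 2" using q by (intro mult_left_mono) auto
    finally have T2: "T (real s - 2 + real b) \<le> T ?x + 24 / q" by simp
    have "Err (real (Suc k)) (real s - 2) (real b) \<le> ?E + C * kap * ((real s - 2) powr (- \<eta>) - real s powr (- \<eta>)) + 2 / N * (24 / q)"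
    proof -
     have "2 / N * T (real s - 2 + real b) \<le> 2 / N * (T ?x + 24 / q)" using T2 N by (intro mult_left_mono) auto
     then show ?thesis unfolding Err_def distrib_left right_diff_distrib by linarith
    qed
    then have "(real s - 1) * cmod (?Q2 - ?g) \<le> (real s - 1) * (?E + C * kap * ((real s - 2) powr (- \<eta>) - real s powr (- \<eta>)) + 2 / N * (24 / q) + cmod \<omega> * (2 / (real s - 2)))"
     using q1 s by (intro mult_left_mono) auto
    also have "\<dots> = (real s - 1) * ?E + C * kap * ((real s - 1) * ((real s - 2) powr (- \<eta>) - real s powr (- \<eta>))) + (real s - 1) * (2 / N * (24 / q)) + cmod \<omega> * ((real s - 1) * (2 / (real s - 2)))"
     by (simp only: distrib_left ac_simps)
    also have "C * kap * ((real s - 1) * ((real s - 2) powr (- \<eta>) - real s powr (- \<eta>))) \<le> C * kap * 4"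
     using powr_loss[of "real s"] True C0 kap by (intro mult_left_mono) auto
    also have "cmod \<omega> * ((real s - 1) * (2 / (real s - 2))) \<le> Om * 4"
     using True Om Om0 by (intro mult_mono) (auto simp: field_simps)
    finally show ?thesis by (simp add: algebra_simps)
   next
    case False
    then have s2: "real s - 1 \<le> 1" "real s - 1 \<ge> 0" using s by auto
    have "cmod ?Q2 \<le> 1" "cmod ?g \<le> 1" using d2 U s by (auto intro!: norm_Qf z1 g_norm)
    then have "cmod (?Q2 - ?g) \<le> 2" using norm_triangle_ineq4[of ?Q2 ?g] by linarith
    then have "(real s - 1) * cmod (?Q2 - ?g) \<le> 1 * 2" using s2 by (intro mult_mono) auto
    moreover have "(real s - 1) * ?E \<ge> 0" "(real s - 1) * (2 / N * (24 / q)) \<ge> 0" "4 * (C * kap) \<ge> 0"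
     using s2 Err_nonneg N q C0 kap by (auto intro!: mult_nonneg_nonneg)
    ultimately show ?thesis using Om0 by linarith
   qed
   have "\<rho> * ((real s - 1) * (2 / N * (24 / q))) \<le> 2 / N * (48 * \<epsilon> / q)"
   proof -
    have "\<rho> * (real s - 1) \<le> 2 * \<epsilon>" using main(3) r0 by (simp add: right_diff_distrib mult.commute)
    then have "\<rho> * (real s - 1) * (2 / N * (24 / q)) \<le> 2 * \<epsilon> * (2 / N * (24 / q))" using N q by (intro mult_right_mono) auto
    then show ?thesis by (simp add: mult.assoc)
   qed
   then show ?thesis using mult_left_mono[OF s3 r0] by (simp add: distrib_left)
  qed
  \<comment> \<open>Absorption: \<open>Err\<close> decreases in the cluster size, with a definite
    gain at vertices of degree at least 3, which carry at least the share \<open>q\<close> of the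
    stubs.\<close>
  also have "\<rho> * (\<Sum>v\<in>U. real (d v) * Ev v) \<le> \<rho> * (?DU * ?E)
    - q * (C * kap * (\<eta> / 4 * real s powr (- (1 + \<eta>))) + 2 / N * (T ?x - T (?x + 1)))"
  proof -
   define gain where "gain = C * kap * (\<eta> / 4 * real s powr (- (1 + \<eta>))) + 2 / N * (T ?x - T (?x + 1))"
   have gain0: "gain \<ge> 0" unfolding gain_def using C0 kap \<eta> N T_mono[of ?x "?x + 1"] by (intro add_nonneg_nonneg mult_nonneg_nonneg) auto
   have Ev: "Ev v \<le> ?E - (if d v \<ge> 3 then gain else 0)" if v: "v \<in> U" for v
   proof -
    have dv: "d v \<ge> 2" using d2 v U by auto
    then have rs: "real (s + d v - 2) = real s + (real (d v) - 2)" by (simp add: of_nat_diff)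
    have mono: "Err (real (Suc k)) y (real b) \<le> Err (real (Suc k)) x (real b)" if "x \<le> y" "x > 0" for x y
     unfolding Err_def using that C0 kap N T_mono[of "x + real b" "y + real b"] \<eta>
     by (intro add_mono mult_left_mono order_refl powr_mono2') auto
    show ?thesis
    proof (cases "d v \<ge> 3")
     case True
     have "Ev v \<le> Err (real (Suc k)) (real s + 1) (real b)" unfolding Ev_def rs using True s by (intro mono) auto
     also have "\<dots> = ?E - C * kap * (real s powr (- \<eta>) - (real s + 1) powr (- \<eta>)) - 2 / N * (T ?x - T (?x + 1))"
      unfolding Err_def by (simp add: algebra_simps)
     also have "\<dots> \<le> ?E - gain"
     proof -
      have "C * kap * (\<eta> / 4 * real s powr (- (1 + \<eta>))) \<le> C * kap * (real s powr (- \<eta>) - (real s + 1) powr (- \<eta>))"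
       using powr_gain[of "real s"] s C0 kap by (intro mult_left_mono) auto
      then show ?thesis unfolding gain_def by linarith
     qed
     finally show ?thesis using True by simp
    next
     case False
     have "Ev v \<le> ?E" unfolding Ev_def rs using dv s by (intro mono) auto
     then show ?thesis using False by simp
    qed
   qed
   have "(\<Sum>v\<in>U. real (d v) * Ev v) \<le> (\<Sum>v\<in>U. real (d v) * (?E - (if d v \<ge> 3 then gain else 0)))"
    using Ev by (intro sum_mono mult_left_mono) auto
   also have "\<dots> = ?DU * ?E - (\<Sum>v\<in>U. if d v \<ge> 3 then real (d v) else 0) * gain"
    unfolding sum_distrib_right sum_subtractf[symmetric] by (intro sum.cong refl) (simp add: right_diff_distrib)
   also have "(\<Sum>v\<in>U. if d v \<ge> 3 then real (d v) else 0) = (\<Sum>v | v \<in> U \<and> d v \<ge> 3. real (d v))"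
    using finU by (simp add: sum.inter_filter)
   finally have "\<rho> * (\<Sum>v\<in>U. real (d v) * Ev v) \<le> \<rho> * (?DU * ?E - (\<Sum>v | v \<in> U \<and> d v \<ge> 3. real (d v)) * gain)"
    using r0 by (intro mult_left_mono)
   moreover have "q * gain \<le> \<rho> * ((\<Sum>v | v \<in> U \<and> d v \<ge> 3. real (d v)) * gain)"
   proof -
    have "1 / L * (q * L) \<le> \<rho> * (\<Sum>v | v \<in> U \<and> d v \<ge> 3. real (d v))"
     using main(1) H1c[OF U cU] q L r0 by (intro mult_mono) (auto simp: L_def)
    then have "q \<le> \<rho> * (\<Sum>v | v \<in> U \<and> d v \<ge> 3. real (d v))" using L by simp
    then show ?thesis using mult_right_mono[OF _ gain0] by (simp only: mult.assoc[symmetric])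
   qed
   ultimately show ?thesis unfolding gain_def by (simp add: right_diff_distrib)
  qed
  also have "(\<rho> * real b * (cmod (z - 1) + 2 * \<epsilon>) + kap * E0 * real s powr (- (1 + \<eta>)))
    + (\<rho> * ((real s - 1) * ?E) + \<rho> * (2 + 4 * Om + 4 * (C * kap)) + 2 / N * (48 * \<epsilon> / q))
    + (\<rho> * (?DU * ?E) - q * (C * kap * (\<eta> / 4 * real s powr (- (1 + \<eta>))) + 2 / N * (T ?x - T (?x + 1))))
   \<le> Err (real k) (real s) (real b)"
  proof -
   have Ceq: "q * (C * kap * (\<eta> / 4 * real s powr (- (1 + \<eta>)))) = kap * E0 * real s powr (- (1 + \<eta>))"
    using q \<eta> by (simp add: C_def)
   have E: "\<rho> * ((real s - 1) * ?E) + \<rho> * (?DU * ?E) = ?E - \<rho> * real b * ?E"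
   proof -
    have "\<rho> * ((real s - 1) * ?E) + \<rho> * (?DU * ?E) = (\<rho> * (real b + (real s - 1) + ?DU)) * ?E - \<rho> * real b * ?E"
     by (simp add: algebra_simps)
    then show ?thesis unfolding main(4) by simp
   qed
   have ES: "?E = Err (real k) (real s) (real b) + 2 / N" unfolding Err_def by (simp add: algebra_simps add_divide_distrib)
   have Elow: "(cmod (z - 1) + 2 * \<epsilon>) + 2 / N * T ?x \<le> ?E"
   proof -
    have "0 \<le> C * kap * (real s powr (- \<eta>) + real b powr (- \<eta>))" using C0 kap by simp
    moreover have "2 / N * T ?x \<le> 2 / N * (real (Suc k) + T ?x)" using N by (intro mult_left_mono) auto
    ultimately show ?thesis unfolding Err_def by linarith
   qed
   have rb: "\<rho> * real b * (cmod (z - 1) + 2 * \<epsilon>) + \<rho> * real b * (2 / N * T ?x) \<le> \<rho> * real b * ?E"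
    using mult_left_mono[OF Elow, of "\<rho> * real b"] r0 by (simp add: distrib_left)
   have small: "\<rho> * (2 + 4 * Om + 4 * (C * kap)) \<le> 2 / N"
   proof -
    have "C * kap \<le> C * (Om + 2)" using C0 kap by (intro mult_left_mono) auto
    then have "\<rho> * (2 + 4 * Om + 4 * (C * kap)) \<le> 2 / L * (2 + 4 * Om + 4 * C * (Om + 2))"
     using main(2) L r0 Om0 C0 kap by (intro mult_mono) auto
    also have "\<dots> \<le> 2 / N"
    proof -
     have "N * (2 + 4 * Om + 4 * C * (Om + 2)) \<le> L" using H5 by (simp add: L_def C_def E0_def)
     then show ?thesis using L N by (simp add: field_simps)
    qed
    finally show ?thesis .
   qed
   \<comment> \<open>The 5 is the cost of one step in units of 2 / N: 1 for the increment of
     \<open>k\<close>, 1 for the cancellation error, and at most 3 for the increase of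
     \<open>T\<close> under cancellation, since \<epsilon> <= q / 16.\<close>
   have Tgain: "5 \<le> q * (T ?x - T (?x + 1)) + \<rho> * real b * T ?x"
   proof (cases "?x + 1 \<le> 2 * sqrt L")
    case True
    have "T ?x - T (?x + 1) = 12 / q" unfolding T_def using True by (simp add: algebra_simps add_divide_distrib diff_divide_distrib)
    moreover have "\<rho> * real b * T ?x \<ge> 0" using r0 T_nn by simp
    ultimately show ?thesis using q by simp
   next
    \<comment> \<open>The total exceeds 2 sqrt L - 1 and the smaller cluster moves, so the other one
      has at least sqrt L / 2 free stubs. The collision probability times \<open>T\<close> is then
      at least 6 / q.\<close>
    case False
    have sL: "sqrt L \<ge> 1" using L by simp
    have "real s \<le> real b" using that(1) by simp
    then have bR: "real b \<ge> sqrt L / 2" using False sL by linarith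
    have "1 / L * (sqrt L / 2) * (12 / q * sqrt L) \<le> \<rho> * real b * T ?x"
     using main(1) bR T_nonneg[of ?x] L r0 q by (intro mult_mono) auto
    moreover have "1 / L * (sqrt L / 2) * (12 / q * sqrt L) = 6 / q"
    proof -
     have "sqrt L * sqrt L = L" using L by simp
     have "a * (r / 2) * (12 * e * r) = (r * r) * a * (6 * e)" for a e r :: real by simp
     from this[of "1 / L" "sqrt L" "1 / q"]
     have "1 / L * (sqrt L / 2) * (12 * (1 / q) * sqrt L) = L * (1 / L) * (6 * (1 / q))"
      unfolding \<open>sqrt L * sqrt L = L\<close> .
     moreover have "12 / q = 12 * (1 / q)" "6 / q = 6 * (1 / q)" by simp_all
     moreover have "L * (1 / L) = 1" using L by simp
     ultimately show ?thesis by (simp only: mult_1_left)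
    qed
    moreover have "6 / q \<ge> 5" using q by (simp add: field_simps)
    moreover have "q * (T ?x - T (?x + 1)) \<ge> 0" using q T_mono[of ?x "?x + 1"] by simp
    ultimately show ?thesis by linarith
   qed
   have "48 * \<epsilon> / q \<le> 3" using H3 q by (simp add: field_simps)
   then have "1 + 1 + 48 * \<epsilon> / q \<le> q * (T ?x - T (?x + 1)) + \<rho> * real b * T ?x" using Tgain by linarith
   then have "2 / N * (1 + 1 + 48 * \<epsilon> / q) \<le> 2 / N * (q * (T ?x - T (?x + 1)) + \<rho> * real b * T ?x)"
    using N by (intro mult_left_mono) auto
   then have fin: "2 / N + 2 / N + 2 / N * (48 * \<epsilon> / q) \<le> q * (2 / N * (T ?x - T (?x + 1))) + \<rho> * real b * (2 / N * T ?x)"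
    by (simp add: distrib_left ac_simps)
   show ?thesis using fin small rb E ES Ceq unfolding distrib_left[of q] by linarith
  qed
  finally show ?thesis by simp
 qed
 show ?case
 proof (cases "s \<le> b")
  case True
  then show ?thesis using Suc.prems by (intro wlog) auto
 next
  case False
  have "cmod (Qf d l z (Suc M) U b s - g (real b) (real s)) \<le> Err (real k) (real b) (real s)"
   using False Suc.prems by (intro wlog) (auto simp: add.commute)
  then show ?thesis using Qf_sym[of d l z "Suc M" U s b] g_sym[of "real s" "real b"] Err_sym[of "real k" "real s"] Suc.prems
   by simp
 qed
qed

end

section \<open>Degree moments and a law of large numbers with a rate\<close>

text \<open>Dyadic summation: between 2^j and 2^(j + 1) the r-th power is at most 2^(r (j + 1)), the
  tail beyond 2^j is of order 2^(-j (\<tau> - 1)), and the product is geometric because r < \<tau> -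
  1.\<close>

lemma finite_moment:
 fixes p :: "nat pmf"
 assumes c: "c > 0" and tail: "\<And>x. x > 0 \<Longrightarrow> 1 - cdf_pmf p x \<le> c * x powr (-(\<tau> - 1))"
  and r: "0 \<le> r" "r < \<tau> - 1"
 shows "integrable (measure_pmf p) (\<lambda>k. real k powr r)"
proof -
 let ?a = "\<tau> - 1"
 have P: "measure_pmf.prob p {k. 2 ^ j \<le> k} \<le> (1 + c * 2 powr ?a) * (2 powr (- ?a)) ^ j" for j :: nat
 proof (cases j)
  case 0
  have "measure_pmf.prob p {k. 2 ^ j \<le> k} \<le> 1" by simp
  then show ?thesis using 0 c by (simp add: add_increasing2)
 next
  \<comment> \<open>The tail bound concerns strict excess, so it is used at \<open>2 ^ i\<close>
    instead of \<open>2 ^ j\<close>; this costs the factor \<open>2 powr ?a\<close>.\<close>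
  case (Suc i)
  have "{k. 2 ^ j \<le> k} \<subseteq> - {k. real k \<le> 2 ^ i}"
  proof
   fix k :: nat assume "k \<in> {k. 2 ^ j \<le> k}"
   then have "2 ^ i < k" using Suc by (simp add: le_less_trans[of _ "2 ^ i" ] less_le_trans[of "2 ^ i" "2 * 2 ^ i"])
   then have "real (2 ^ i) < real k" by (simp only: of_nat_less_iff)
   then show "k \<in> - {k. real k \<le> 2 ^ i}" by simp
  qed
  then have "measure_pmf.prob p {k. 2 ^ j \<le> k} \<le> measure_pmf.prob p (- {k. real k \<le> 2 ^ i})"
   by (intro measure_pmf.finite_measure_mono) auto
  also have "\<dots> = 1 - cdf_pmf p (2 ^ i)"
   using measure_pmf.prob_compl[of "{k. real k \<le> 2 ^ i}" p] by (simp add: cdf_pmf_def Compl_eq_Diff_UNIV)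
  also have "\<dots> \<le> c * (2 ^ i) powr (- ?a)" by (rule tail) simp
  also have "\<dots> = c * 2 powr ?a * (2 powr (- ?a)) ^ j"
   by (simp add: Suc powr_realpow[symmetric] powr_powr powr_add[symmetric] algebra_simps)
  also have "\<dots> \<le> (1 + c * 2 powr ?a) * (2 powr (- ?a)) ^ j" by (intro mult_right_mono) auto
  finally show ?thesis .
 qed
 let ?u = "\<lambda>j. (2 powr r) ^ Suc j"
 have bound: "ennreal (real k powr r) \<le> (\<Sum>j. ennreal (?u j) * indicator {k. 2 ^ j \<le> k} k)" for k :: nat
 proof (cases "k = 0")
  case True then show ?thesis by simp
 next
  case False
  define j where "j = nat \<lfloor>log 2 (real k)\<rfloor>"
  have k: "real k \<ge> 1" using False by simp
  have l: "real j \<le> log 2 (real k)" "log 2 (real k) \<le> real (Suc j)"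
   using k unfolding j_def by (auto simp: of_nat_nat intro: less_imp_le) linarith
  have "2 ^ j \<le> real k" using l(1) k by (simp add: le_log_iff powr_realpow)
  then have "2 ^ j \<le> k" by (metis of_nat_le_iff of_nat_numeral of_nat_power)
  have "real k \<le> 2 powr real (Suc j)" using l(2) k by (simp add: log_le_iff)
  then have "real k powr r \<le> (2 powr real (Suc j)) powr r" using r k by (intro powr_mono2) auto
  also have "\<dots> = ?u j" by (simp only: powr_powr powr_realpow[symmetric] powr_gt_zero mult.commute)
  finally have "ennreal (real k powr r) \<le> ennreal (?u j) * indicator {k. 2 ^ j \<le> k} k"
   using \<open>2 ^ j \<le> k\<close> by (simp add: ennreal_leI)
  also have "\<dots> = (\<Sum>i\<in>{j}. ennreal (?u i) * indicator {k. 2 ^ i \<le> k} k)"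
   by (simp only: sum.insert finite.emptyI empty_iff sum.empty add_0_right not_False_eq_True)
  also have "\<dots> \<le> (\<Sum>j. ennreal (?u j) * indicator {k. 2 ^ j \<le> k} k)" by (intro sum_le_suminf) auto
  finally show ?thesis .
 qed
 let ?K = "2 powr r * (1 + c * 2 powr ?a)" and ?q = "2 powr (r - ?a)"
 have q: "?q < 1" using powr_less_mono[of "r - ?a" 0 2] r by simp
 have "(\<integral>\<^sup>+k. ennreal (norm (real k powr r)) \<partial>measure_pmf p) \<le> (\<integral>\<^sup>+k. (\<Sum>j. ennreal (?u j) * indicator {k. 2 ^ j \<le> k} k) \<partial>measure_pmf p)"
  using bound by (intro nn_integral_mono) simp
 also have "\<dots> = (\<Sum>j. \<integral>\<^sup>+k. ennreal (?u j) * indicator {k. 2 ^ j \<le> k} k \<partial>measure_pmf p)"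
  by (rule nn_integral_suminf) auto
 also have "\<dots> = (\<Sum>j. ennreal (?u j * measure_pmf.prob p {k. 2 ^ j \<le> k}))"
  by (simp add: nn_integral_cmult measure_pmf.emeasure_eq_measure ennreal_mult)
 also have "\<dots> \<le> (\<Sum>j. ennreal (?K * ?q ^ j))"
 proof (intro suminf_le ennreal_leI)
  fix j
  have "?u j * measure_pmf.prob p {k. 2 ^ j \<le> k} \<le> ?u j * ((1 + c * 2 powr ?a) * (2 powr (- ?a)) ^ j)"
   using P[of j] by (intro mult_left_mono) auto
  also have "\<dots> = ?K * ?q ^ j" by (simp add: powr_diff powr_minus_divide power_divide)
  finally show "?u j * measure_pmf.prob p {k. 2 ^ j \<le> k} \<le> ?K * ?q ^ j" .
 qed auto
 also have "\<dots> = ennreal (\<Sum>j. ?K * ?q ^ j)"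
  using q c by (intro suminf_ennreal2 summable_mult summable_geometric) auto
 also have "\<dots> < \<infinity>" by simp
 finally show ?thesis by (intro integrableI_bounded) auto
qed

abbreviation degs :: "nat pmf \<Rightarrow> nat \<Rightarrow> (nat \<Rightarrow> nat) pmf" where
 "degs p n \<equiv> Pi_pmf {1..n} 0 (\<lambda>_. p)"

lemma degs_expectation1:
 fixes f :: "nat \<Rightarrow> 'b :: {banach, second_countable_topology}"
 assumes "i \<in> {1..n}"
 shows "(\<integral>d. f (d i) \<partial>measure_pmf (degs p n)) = (\<integral>k. f k \<partial>measure_pmf p)"
  and "integrable (measure_pmf (degs p n)) (\<lambda>d. f (d i)) \<longleftrightarrow> integrable (measure_pmf p) f"
proof -
 have e: "map_pmf (\<lambda>d. d i) (degs p n) = p" using assms by (simp add: Pi_pmf_component)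
 show "(\<integral>d. f (d i) \<partial>measure_pmf (degs p n)) = (\<integral>k. f k \<partial>measure_pmf p)"
  using integral_map_pmf[of "\<lambda>d. d i" "degs p n" f, unfolded e] by (rule sym)
 show "integrable (measure_pmf (degs p n)) (\<lambda>d. f (d i)) \<longleftrightarrow> integrable (measure_pmf p) f"
  using integrable_map_pmf_eq[of "\<lambda>d. d i" "degs p n" f, unfolded e] by (rule sym)
qed

lemma degs_prob1: "i \<in> {1..n} \<Longrightarrow> measure_pmf.prob (degs p n) {d. P (d i)} = measure_pmf.prob p {k. P k}"
proof -
 assume "i \<in> {1..n}"
 then have "map_pmf (\<lambda>d. d i) (degs p n) = p" by (simp add: Pi_pmf_component)
 then have "measure_pmf.prob p {k. P k} = measure_pmf.prob (map_pmf (\<lambda>d. d i) (degs p n)) {k. P k}" by simp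
 also have "\<dots> = measure_pmf.prob (degs p n) {d. P (d i)}" by (simp add: vimage_def)
 finally show ?thesis by simp
qed

lemma degs_second_moment:
 fixes g :: "nat \<Rightarrow> real" and p :: "nat pmf"
 assumes g0: "\<And>k. g k \<ge> 0" and gb: "\<And>k. g k \<le> B"
 defines "m \<equiv> \<integral>k. g k \<partial>measure_pmf p"
 shows "(\<integral>d. ((\<Sum>i\<in>{1..n}. g (d i)) - n * m)\<^sup>2 \<partial>measure_pmf (degs p n)) \<le> n * (\<integral>k. (g k)\<^sup>2 \<partial>measure_pmf p)"
proof -
 have B: "B \<ge> 0" using g0[of 0] gb[of 0] by linarith
 let ?E = "\<lambda>h. \<integral>d. h d \<partial>measure_pmf (degs p n)"
 have int: "integrable (measure_pmf M) h" if "\<And>x. \<bar>h x\<bar> \<le> C" for M :: "'x pmf" and h :: "'x \<Rightarrow> real" and C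
  by (rule integrable_bounded_measurable[OF prob_space_measure_pmf, of _ _ C]) (use that in auto)
 have g2: "\<bar>g k * g k'\<bar> \<le> B * B" for k k' using g0 gb B by (simp add: abs_mult mult_mono)
 have ij: "?E (\<lambda>d. g (d i) * g (d j)) = m * m" if "i \<in> {1..n}" "j \<in> {1..n}" "i \<noteq> j" for i j
 proof -
  let ?f = "\<lambda>x k. if x = i \<or> x = j then g k else 1"
  have pr: "(\<Prod>x\<in>{1..n}. if x = i \<or> x = j then h x else 1) = h i * h j" for h :: "nat \<Rightarrow> real"
  proof -
   have "(\<Prod>x\<in>{1..n}. if x = i \<or> x = j then h x else 1) = (\<Prod>x\<in>{i, j}. if x = i \<or> x = j then h x else 1)"
    using that by (intro prod.mono_neutral_right) auto
   then show ?thesis using that by simp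
  qed
  have "?E (\<lambda>d. \<Prod>x\<in>{1..n}. ?f x (d x)) = (\<Prod>x\<in>{1..n}. \<integral>k. ?f x k \<partial>measure_pmf p)"
  proof (rule expectation_prod_Pi_pmf)
   show "integrable (measure_pmf p) (?f x)" for x
    using g0 gb B by (intro int[of _ "B + 1"]) (auto simp: add_increasing2)
  qed (use g0 in auto)
  also have "(\<lambda>x. \<integral>k. ?f x k \<partial>measure_pmf p) = (\<lambda>x. if x = i \<or> x = j then m else 1)"
   by (auto simp: m_def)
  also have "(\<Prod>x\<in>{1..n}. if x = i \<or> x = j then m else 1) = m * m" using pr[of "\<lambda>_. m"] by simp
  finally show ?thesis using pr[of "\<lambda>x. g (d x)" for d] by simp
 qed
 have ii: "?E (\<lambda>d. g (d i) * g (d i)) = (\<integral>k. (g k)\<^sup>2 \<partial>measure_pmf p)" if "i \<in> {1..n}" for i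
  using degs_expectation1(1)[OF that, where f="\<lambda>k. (g k)\<^sup>2" and p=p] by (simp add: power2_eq_square)
 let ?v = "\<integral>k. (g k)\<^sup>2 \<partial>measure_pmf p"
 have S: "?E (\<lambda>d. \<Sum>i\<in>{1..n}. g (d i)) = n * m"
 proof -
  have "?E (\<lambda>d. \<Sum>i\<in>{1..n}. g (d i)) = (\<Sum>i\<in>{1..n}. ?E (\<lambda>d. g (d i)))"
   using g0 gb B by (intro Bochner_Integration.integral_sum int[of _ B]) auto
  also have "\<dots> = (\<Sum>i\<in>{1..n}. m)" unfolding m_def using degs_expectation1(1)[where f=g and n=n and p=p] by (intro sum.cong) auto
  finally show ?thesis by simp
 qed
 have S2: "?E (\<lambda>d. (\<Sum>i\<in>{1..n}. g (d i))\<^sup>2) = n * ?v + (n * n - n) * (m * m)"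
 proof -
  have "?E (\<lambda>d. (\<Sum>i\<in>{1..n}. g (d i))\<^sup>2) = ?E (\<lambda>d. \<Sum>i\<in>{1..n}. \<Sum>j\<in>{1..n}. g (d i) * g (d j))"
   by (simp add: power2_eq_square sum_product)
  also have "\<dots> = (\<Sum>i\<in>{1..n}. \<Sum>j\<in>{1..n}. ?E (\<lambda>d. g (d i) * g (d j)))"
   by (subst Bochner_Integration.integral_sum; (intro Bochner_Integration.integrable_sum)?; (intro int[of _ "B * B"] g2)?)
    (subst Bochner_Integration.integral_sum; (intro int[of _ "B * B"] g2)?; simp)
  also have "\<dots> = (\<Sum>i\<in>{1..n}. \<Sum>j\<in>{1..n}. (if i = j then ?v - m * m else 0) + m * m)"
   using ij ii by (intro sum.cong refl) auto
  also have "\<dots> = (\<Sum>i\<in>{1..n}. (?v - m * m) + n * (m * m))"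
   by (intro sum.cong refl) (simp add: sum.distrib)
  also have "\<dots> = n * ?v + (n * n - n) * (m * m)"
   by (simp add: algebra_simps)
  finally show ?thesis .
 qed
 have SB: "\<bar>\<Sum>i\<in>{1..n}. g (d i)\<bar> \<le> n * B" for d
  using sum_bounded_above[of "{1..n}" "\<lambda>i. g (d i)" B] gb g0 by (simp add: abs_of_nonneg sum_nonneg)
 have i1: "integrable (measure_pmf (degs p n)) (\<lambda>d. \<Sum>i\<in>{1..n}. g (d i))" by (rule int[OF SB])
 have i2: "integrable (measure_pmf (degs p n)) (\<lambda>d. (\<Sum>i\<in>{1..n}. g (d i))\<^sup>2)"
 proof (rule int[of _ "(n * B)\<^sup>2"])
  fix d show "\<bar>(\<Sum>i\<in>{1..n}. g (d i))\<^sup>2\<bar> \<le> (n * B)\<^sup>2" using SB[of d] power_mono[OF SB[of d], of 2] by simp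
 qed
 have "?E (\<lambda>d. ((\<Sum>i\<in>{1..n}. g (d i)) - n * m)\<^sup>2)
  = ?E (\<lambda>d. (\<Sum>i\<in>{1..n}. g (d i))\<^sup>2 - 2 * (n * m) * (\<Sum>i\<in>{1..n}. g (d i)) + (n * m)\<^sup>2)"
  by (intro Bochner_Integration.integral_cong refl) (simp add: power2_eq_square algebra_simps)
 also have "\<dots> = n * ?v + (n * n - n) * (m * m) - 2 * (n * m) * (n * m) + (n * m)\<^sup>2"
  using i1 i2 S S2 by simp
 also have "\<dots> = n * ?v - n * (m * m)" by (simp add: power2_eq_square algebra_simps)
 also have "\<dots> \<le> n * ?v" by simp
 finally show ?thesis .
qed

text \<open>A moment M of order 1 + \<gamma> gives a polynomial rate by truncation at n: some value
  exceeds n with probability at most M n^(-\<gamma>), the bias of the sum is at most M n^(1 -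
  \<gamma>), and Chebyshev at n^(1 - \<gamma> / 8) / 2 leaves 4 M n^(-3 \<gamma> / 4). A rate is
  called for because \<open>expl\<close> multiplies the relative error by a power of the total
  degree.\<close>

lemma degs_wlln:
 fixes f :: "nat \<Rightarrow> real"
 assumes f0: "\<And>k. f k \<ge> 0" and int: "integrable (measure_pmf p) (\<lambda>k. f k powr (1 + \<gamma>))" and \<gamma>: "0 < \<gamma>" "\<gamma> \<le> 1"
 shows "(\<lambda>n. measure_pmf.prob (degs p n)
  {d. \<bar>(\<Sum>i\<in>{1..n}. f (d i)) - n * (\<integral>k. f k \<partial>measure_pmf p)\<bar> > real n powr (1 - \<gamma> / 8)}) \<longlonglongrightarrow> 0"
proof -
 define M where "M = (\<integral>k. f k powr (1 + \<gamma>) \<partial>measure_pmf p)"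
 have M0: "M \<ge> 0" by (simp add: M_def)
 define \<mu> where "\<mu> = (\<integral>k. f k \<partial>measure_pmf p)"
 have fint: "integrable (measure_pmf p) f"
 proof (rule Bochner_Integration.integrable_bound[of _ "\<lambda>k. 1 + f k powr (1 + \<gamma>)"])
  show "integrable (measure_pmf p) (\<lambda>k. 1 + f k powr (1 + \<gamma>))" using int by simp
  have "f k \<le> 1 + f k powr (1 + \<gamma>)" for k
  proof (cases "f k \<le> 1")
   case True then show ?thesis by (simp add: add_increasing2)
  next
   case False
   then have "f k powr 1 \<le> f k powr (1 + \<gamma>)" using \<gamma> by (intro powr_mono) auto
   then show ?thesis using False by simp
  qed
  then show "AE k in measure_pmf p. norm (f k) \<le> norm (1 + f k powr (1 + \<gamma>))"
   using f0 by (intro always_eventually allI) (simp add: abs_of_nonneg add_nonneg_nonneg)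
 qed simp
 have key: "measure_pmf.prob (degs p n) {d. \<bar>(\<Sum>i\<in>{1..n}. f (d i)) - n * \<mu>\<bar> > real n powr (1 - \<gamma> / 8)}
   \<le> M * real n powr (- \<gamma>) + 4 * M * real n powr (- (3 * \<gamma> / 4))"
  if n: "n \<ge> 1" and big: "real n powr (1 - \<gamma> / 8) \<ge> 2 * M * real n powr (1 - \<gamma>)" for n
 proof -
  let ?P = "measure_pmf.prob (degs p n)"
  define g where "g k = (if f k \<le> n then f k else 0)" for k
  define m where "m = (\<integral>k. g k \<partial>measure_pmf p)"
  have n0: "real n \<ge> 1" using n by simp
  have g: "0 \<le> g k" "g k \<le> n" for k using f0 by (auto simp: g_def)
  have gint: "integrable (measure_pmf p) g" "integrable (measure_pmf p) (\<lambda>k. (g k)\<^sup>2)"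
  proof -
   show "integrable (measure_pmf p) g"
    by (rule integrable_bounded_measurable[OF prob_space_measure_pmf, of _ _ "real n"]) (use g in auto)
   show "integrable (measure_pmf p) (\<lambda>k. (g k)\<^sup>2)"
    by (rule integrable_bounded_measurable[OF prob_space_measure_pmf, of _ _ "(real n)\<^sup>2"]) (use g in \<open>auto intro: power_mono\<close>)
  qed
  have tail: "real n * (real n powr (- \<gamma>)) = real n powr (1 - \<gamma>)" using n0 by (simp add: powr_diff powr_minus field_simps)
  have bias: "\<bar>\<mu> - m\<bar> \<le> real n powr (- \<gamma>) * M"
  proof -
   have le: "f k - g k \<le> real n powr (- \<gamma>) * f k powr (1 + \<gamma>)" for k
   proof (cases "f k \<le> n")
    case False
    then have fk: "f k > 0" "real n \<le> f k" using n0 by auto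
    have "real n powr \<gamma> \<le> f k powr \<gamma>" using fk \<gamma> by (intro powr_mono2) auto
    then have "1 \<le> real n powr (- \<gamma>) * f k powr \<gamma>" using n0 by (simp add: powr_minus field_simps)
    then have "f k * 1 \<le> f k * (real n powr (- \<gamma>) * f k powr \<gamma>)" using fk by (intro mult_left_mono) auto
    then show ?thesis using False fk by (simp add: g_def powr_add ac_simps)
   qed (simp add: g_def)
   have "\<mu> - m = (\<integral>k. f k - g k \<partial>measure_pmf p)" unfolding \<mu>_def m_def using fint gint by simp
   moreover have "(\<integral>k. f k - g k \<partial>measure_pmf p) \<le> (\<integral>k. real n powr (- \<gamma>) * f k powr (1 + \<gamma>) \<partial>measure_pmf p)"
    using fint gint int le by (intro integral_mono) auto
   moreover have "0 \<le> (\<integral>k. f k - g k \<partial>measure_pmf p)" using f0 by (intro integral_nonneg_AE) (auto simp: g_def)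
   ultimately show ?thesis using int by (simp add: M_def)
  qed
  have var: "(\<integral>k. (g k)\<^sup>2 \<partial>measure_pmf p) \<le> real n powr (1 - \<gamma>) * M"
  proof -
   have "(g k)\<^sup>2 \<le> real n powr (1 - \<gamma>) * f k powr (1 + \<gamma>)" for k
   proof (cases "f k \<le> n \<and> f k > 0")
    case True
    have "(g k)\<^sup>2 = f k powr (1 - \<gamma>) * f k powr (1 + \<gamma>)" using True by (simp add: g_def powr_add[symmetric])
    also have "\<dots> \<le> real n powr (1 - \<gamma>) * f k powr (1 + \<gamma>)" using True \<gamma> by (intro mult_right_mono powr_mono2) auto
    finally show ?thesis .
   next
    case False
    then have "g k = 0" using f0[of k] by (auto simp: g_def)
    then show ?thesis by simp
   qed
   then have "(\<integral>k. (g k)\<^sup>2 \<partial>measure_pmf p) \<le> (\<integral>k. real n powr (1 - \<gamma>) * f k powr (1 + \<gamma>) \<partial>measure_pmf p)"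
    using gint int by (intro integral_mono) auto
   then show ?thesis using int by (simp add: M_def)
  qed
  let ?b = "real n powr (1 - \<gamma> / 8) / 2"
  have b0: "?b > 0" using n0 by simp
  have "?P {d. \<bar>(\<Sum>i\<in>{1..n}. f (d i)) - n * \<mu>\<bar> > real n powr (1 - \<gamma> / 8)}
   \<le> ?P ((\<Union>i\<in>{1..n}. {d. f (d i) > n}) \<union> {d. \<bar>(\<Sum>i\<in>{1..n}. g (d i)) - n * m\<bar> \<ge> ?b})"
  proof (intro measure_pmf.finite_measure_mono subsetI)
   fix d assume d: "d \<in> {d. \<bar>(\<Sum>i\<in>{1..n}. f (d i)) - n * \<mu>\<bar> > real n powr (1 - \<gamma> / 8)}"
   show "d \<in> (\<Union>i\<in>{1..n}. {d. f (d i) > n}) \<union> {d. \<bar>(\<Sum>i\<in>{1..n}. g (d i)) - n * m\<bar> \<ge> ?b}"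
   proof (cases "\<exists>i\<in>{1..n}. f (d i) > n")
    case False
    then have "(\<Sum>i\<in>{1..n}. f (d i)) = (\<Sum>i\<in>{1..n}. g (d i))" by (intro sum.cong) (auto simp: g_def not_less)
    moreover have "n * \<bar>\<mu> - m\<bar> \<le> ?b"
    proof -
     have "n * \<bar>\<mu> - m\<bar> \<le> n * (real n powr (- \<gamma>) * M)" using bias by (intro mult_left_mono) auto
     also have "\<dots> = M * real n powr (1 - \<gamma>)" using tail by (simp add: ac_simps)
     finally show ?thesis using big by simp
    qed
    moreover have "\<bar>n * \<mu> - n * m\<bar> = n * \<bar>\<mu> - m\<bar>" by (simp add: right_diff_distrib[symmetric] abs_mult)
    moreover have "\<bar>(\<Sum>i\<in>{1..n}. f (d i)) - n * \<mu>\<bar> > real n powr (1 - \<gamma> / 8)" using d by simp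
    ultimately have "\<bar>(\<Sum>i\<in>{1..n}. g (d i)) - n * m\<bar> \<ge> ?b" by linarith
    then show ?thesis by blast
   qed auto
  qed auto
  also have "\<dots> \<le> ?P (\<Union>i\<in>{1..n}. {d. f (d i) > n}) + ?P {d. \<bar>(\<Sum>i\<in>{1..n}. g (d i)) - n * m\<bar> \<ge> ?b}"
   by (rule measure_Un_le) auto
  also have "?P (\<Union>i\<in>{1..n}. {d. f (d i) > n}) \<le> (\<Sum>i\<in>{1..n}. ?P {d. f (d i) > n})"
   by (rule measure_pmf.finite_measure_subadditive_finite) auto
  also have "\<dots> = n * measure_pmf.prob p {k. f k > n}" using degs_prob1[of _ n p "\<lambda>k. f k > n"] by simp
  also have "\<dots> \<le> n * (real n powr (- (1 + \<gamma>)) * M)"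
  proof (intro mult_left_mono)
   have "measure_pmf.prob p {k. f k > n} = (\<integral>k. indicator {k. f k > n} k \<partial>measure_pmf p)" by simp
   also have "\<dots> \<le> (\<integral>k. real n powr (- (1 + \<gamma>)) * f k powr (1 + \<gamma>) \<partial>measure_pmf p)"
   proof (intro integral_mono)
    fix k
    show "indicator {k. f k > n} k \<le> real n powr (- (1 + \<gamma>)) * f k powr (1 + \<gamma>)"
    proof (cases "f k > n")
     case True
     then have "real n powr (1 + \<gamma>) \<le> f k powr (1 + \<gamma>)" using n0 \<gamma> by (intro powr_mono2) auto
     then have "real n powr (- (1 + \<gamma>)) * real n powr (1 + \<gamma>) \<le> real n powr (- (1 + \<gamma>)) * f k powr (1 + \<gamma>)"
      by (intro mult_left_mono) auto
     then show ?thesis using True n0 by (simp add: powr_add[symmetric])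
    qed simp
    show "integrable (measure_pmf p) (\<lambda>k. indicator {k. f k > n} k :: real)"
     by (rule integrable_bounded_measurable[OF prob_space_measure_pmf, of _ _ 1]) (auto simp: indicator_def)
    show "integrable (measure_pmf p) (\<lambda>k. real n powr (- (1 + \<gamma>)) * f k powr (1 + \<gamma>))" using int by simp
   qed
   finally show "measure_pmf.prob p {k. f k > n} \<le> real n powr (- (1 + \<gamma>)) * M" using int by (simp add: M_def)
  qed simp
  also have "n * (real n powr (- (1 + \<gamma>)) * M) = M * real n powr (- \<gamma>)"
  proof -
   have "real n powr (- \<gamma>) = real n powr (1 + - (1 + \<gamma>))" by simp
   also have "\<dots> = real n * real n powr (- (1 + \<gamma>))" using n0 by (simp only: powr_add) simp
   finally show ?thesis by simp
  qed
  also have "?P {d. \<bar>(\<Sum>i\<in>{1..n}. g (d i)) - n * m\<bar> \<ge> ?b} \<le> (\<integral>d. ((\<Sum>i\<in>{1..n}. g (d i)) - n * m)\<^sup>2 \<partial>measure_pmf (degs p n)) / ?b\<^sup>2"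
  proof -
   let ?h = "\<lambda>d. ((\<Sum>i\<in>{1..n}. g (d i)) - n * m)\<^sup>2"
   have hint: "integrable (measure_pmf (degs p n)) ?h"
   proof (rule integrable_bounded_measurable[OF prob_space_measure_pmf, of _ _ "(real n * real n + \<bar>real n * m\<bar>)\<^sup>2"])
    fix d
    have "\<bar>(\<Sum>i\<in>{1..n}. g (d i))\<bar> \<le> real n * real n"
     using sum_bounded_above[of "{1..n}" "\<lambda>i. g (d i)" "real n"] g by (simp add: abs_of_nonneg sum_nonneg)
    then have "\<bar>(\<Sum>i\<in>{1..n}. g (d i)) - n * m\<bar> \<le> real n * real n + \<bar>real n * m\<bar>" by linarith
    from power_mono[OF this, of 2] show "norm (?h d) \<le> (real n * real n + \<bar>real n * m\<bar>)\<^sup>2" by simp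
   qed simp
   have "?b\<^sup>2 * ?P {d. \<bar>(\<Sum>i\<in>{1..n}. g (d i)) - n * m\<bar> \<ge> ?b} = (\<integral>d. ?b\<^sup>2 * indicator {d. \<bar>(\<Sum>i\<in>{1..n}. g (d i)) - n * m\<bar> \<ge> ?b} d \<partial>measure_pmf (degs p n))"
    by simp
   also have "\<dots> \<le> (\<integral>d. ?h d \<partial>measure_pmf (degs p n))"
   proof (intro integral_mono hint)
    fix d
    show "?b\<^sup>2 * indicator {d. \<bar>(\<Sum>i\<in>{1..n}. g (d i)) - n * m\<bar> \<ge> ?b} d \<le> ?h d"
    proof (cases "\<bar>(\<Sum>i\<in>{1..n}. g (d i)) - n * m\<bar> \<ge> ?b")
     case True
     from power_mono[OF this, of 2] b0 show ?thesis using True by simp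
    qed simp
    show "integrable (measure_pmf (degs p n)) (\<lambda>d. ?b\<^sup>2 * indicator {d. \<bar>(\<Sum>i\<in>{1..n}. g (d i)) - n * m\<bar> \<ge> ?b} d)"
     by (rule integrable_bounded_measurable[OF prob_space_measure_pmf, of _ _ "?b\<^sup>2"]) (auto simp: indicator_def)
   qed
   finally show ?thesis using b0 by (simp add: field_simps)
  qed
  also have "\<dots> \<le> (n * (real n powr (1 - \<gamma>) * M)) / ?b\<^sup>2"
  proof (intro divide_right_mono)
   have "(\<integral>d. ((\<Sum>i\<in>{1..n}. g (d i)) - n * m)\<^sup>2 \<partial>measure_pmf (degs p n)) \<le> n * (\<integral>k. (g k)\<^sup>2 \<partial>measure_pmf p)"
    unfolding m_def by (rule degs_second_moment[OF g])
   also have "\<dots> \<le> n * (real n powr (1 - \<gamma>) * M)" using var by (intro mult_left_mono) auto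
   finally show "(\<integral>d. ((\<Sum>i\<in>{1..n}. g (d i)) - n * m)\<^sup>2 \<partial>measure_pmf (degs p n)) \<le> n * (real n powr (1 - \<gamma>) * M)" .
  qed simp
  also have "(n * (real n powr (1 - \<gamma>) * M)) / ?b\<^sup>2 = 4 * M * real n powr (- (3 * \<gamma> / 4))"
  proof -
   have 1: "?b\<^sup>2 = real n powr (2 - \<gamma> / 4) / 4"
    using n0 by (simp add: power_divide power2_eq_square powr_add[symmetric])
   have 2: "real n * real n powr (1 - \<gamma>) = real n powr (2 - \<gamma>)"
    using n0 powr_add[of "real n" 1 "1 - \<gamma>"] by simp
   have 3: "real n powr (2 - \<gamma>) / real n powr (2 - \<gamma> / 4) = real n powr (- (3 * \<gamma> / 4))"
    by (subst powr_diff[symmetric]) (simp add: field_simps)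
   show ?thesis unfolding 1 3[symmetric] 2[symmetric] by simp
  qed
  finally show ?thesis by simp
 qed
 have lim0: "(\<lambda>n. real n powr (- a)) \<longlonglongrightarrow> 0" if "a > 0" for a :: real
  using that by (intro tendsto_neg_powr filterlim_real_sequentially) auto
 have "(\<lambda>n. 2 * M * real n powr (- (7 * \<gamma> / 8))) \<longlonglongrightarrow> 2 * M * 0" using \<gamma> by (intro tendsto_mult tendsto_const lim0) auto
 then have ev1: "eventually (\<lambda>n. 2 * M * real n powr (- (7 * \<gamma> / 8)) < 1) sequentially"
  by (rule order_tendstoD) simp
 have ev: "eventually (\<lambda>n. n \<ge> 1 \<and> real n powr (1 - \<gamma> / 8) \<ge> 2 * M * real n powr (1 - \<gamma>)) sequentially"
  using ev1 eventually_ge_at_top[of 1]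
 proof eventually_elim
  case (elim n)
  have "2 * M * real n powr (- (7 * \<gamma> / 8)) * real n powr (1 - \<gamma> / 8) \<le> 1 * real n powr (1 - \<gamma> / 8)"
   using elim by (intro mult_right_mono) auto
  moreover have e: "- (7 * \<gamma> / 8) + (1 - \<gamma> / 8) = 1 - \<gamma>" by linarith
  have "real n powr (- (7 * \<gamma> / 8)) * real n powr (1 - \<gamma> / 8) = real n powr (1 - \<gamma>)"
   by (subst powr_add[symmetric]) (simp only: e)
  ultimately show ?case using elim by (simp add: mult.assoc)
 qed
 have lim: "(\<lambda>n. M * real n powr (- \<gamma>) + 4 * M * real n powr (- (3 * \<gamma> / 4))) \<longlonglongrightarrow> M * 0 + 4 * M * 0"
  using \<gamma> by (intro tendsto_intros lim0) auto
 show ?thesis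
 proof (rule tendsto_sandwich[OF _ _ tendsto_const])
  show "eventually (\<lambda>n. 0 \<le> measure_pmf.prob (degs p n) {d. \<bar>(\<Sum>i\<in>{1..n}. f (d i)) - n * (\<integral>k. f k \<partial>measure_pmf p)\<bar> > real n powr (1 - \<gamma> / 8)}) sequentially"
   by simp
  show "eventually (\<lambda>n. measure_pmf.prob (degs p n) {d. \<bar>(\<Sum>i\<in>{1..n}. f (d i)) - n * (\<integral>k. f k \<partial>measure_pmf p)\<bar> > real n powr (1 - \<gamma> / 8)}
   \<le> M * real n powr (- \<gamma>) + 4 * M * real n powr (- (3 * \<gamma> / 4))) sequentially"
   using ev by eventually_elim (use key in \<open>auto simp: \<mu>_def\<close>)
  show "(\<lambda>n. M * real n powr (- \<gamma>) + 4 * M * real n powr (- (3 * \<gamma> / 4))) \<longlonglongrightarrow> 0" using lim by simp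
 qed
qed

lemma eventually_powr_le:
 fixes a b C :: real
 assumes "a < b"
 shows "eventually (\<lambda>n. C * real n powr a \<le> real n powr b) sequentially"
proof -
 have "(\<lambda>n. C * real n powr (- (b - a))) \<longlonglongrightarrow> C * 0"
  using assms by (intro tendsto_intros tendsto_neg_powr filterlim_real_sequentially) auto
 then have "eventually (\<lambda>n. C * real n powr (- (b - a)) < 1) sequentially" by (rule order_tendstoD) simp
 then show ?thesis using eventually_ge_at_top[of 1]
 proof eventually_elim
  case (elim n)
  have e: "- (b - a) + b = a" by simp
  have "C * real n powr (- (b - a)) * real n powr b \<le> 1 * real n powr b"
   using elim by (intro mult_right_mono) auto
  then show ?case by (simp only: mult.assoc powr_add[symmetric] e mult_1_left)
 qed
qed

lemma powr_minus_mult_self: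
 fixes x a :: real
 assumes "x > 0"
 shows "x powr (- a) * x = x powr (1 - a)"
proof -
 have "x powr (- a) * x powr 1 = x powr (- a + 1)" by (simp only: powr_add)
 then show ?thesis using assms by (simp add: add.commute)
qed

section \<open>Good degree sequences and the uniform approximation\<close>

locale fpp =
 fixes p :: "nat pmf" and \<mu> m2 \<eta> Kg :: real
 assumes \<mu>: "\<mu> > 0" and m2: "m2 > 2 * \<mu>" and \<eta>: "0 < \<eta>" "\<eta> \<le> 1 / 4" and Kg: "Kg \<ge> 1"
begin

text \<open>This is \<nu> - 1, the size-biased mean of D - 2: the mean growth of a cluster when a
  vertex is absorbed.\<close>

definition cc where "cc = (m2 - 2 * \<mu>) / \<mu>"

definition deg_sum :: "nat \<Rightarrow> (nat \<Rightarrow> nat) \<Rightarrow> real" where "deg_sum n d = real (\<Sum>v\<in>{1..n}. d v)"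

text \<open>The deterministic content of the degree assumptions at size n. The sums of d and d^2
  come with a polynomial rate; an upper bound is enough for the order 2 + \<eta>, and a lower bound
  for the stubs at vertices of degree at least 3.\<close>

definition dgood where
 "dgood n d \<longleftrightarrow> (\<forall>v\<in>{1..n}. d v \<ge> 2) \<and> \<bar>deg_sum n d - \<mu> * n\<bar> \<le> Kg * real n powr (1 - \<eta> / 8)
  \<and> \<bar>(\<Sum>v\<in>{1..n}. (real (d v))\<^sup>2) - m2 * n\<bar> \<le> Kg * real n powr (1 - \<eta> / 8)
  \<and> (\<Sum>v\<in>{1..n}. real (d v) powr (2 + \<eta>)) \<le> Kg * n
  \<and> (\<Sum>v | v \<in> {1..n} \<and> d v \<ge> 3. real (d v)) \<ge> n / Kg"

lemma cc: "cc > 0" using \<mu> m2 by (simp add: cc_def)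

lemma dgood_L:
 "eventually (\<lambda>n. \<forall>d. dgood n d \<longrightarrow> \<mu> / 2 * n \<le> deg_sum n d \<and> deg_sum n d \<le> 2 * \<mu> * n) sequentially"
proof -
 have "eventually (\<lambda>n. 2 * Kg / \<mu> * real n powr (1 - \<eta> / 8) \<le> real n powr 1) sequentially"
  using \<eta> by (intro eventually_powr_le) auto
 then show ?thesis
 proof (rule eventually_mono, intro allI impI)
  fix n :: nat and d
  assume n: "2 * Kg / \<mu> * real n powr (1 - \<eta> / 8) \<le> real n powr 1" and d: "dgood n d"
  have "Kg * real n powr (1 - \<eta> / 8) \<le> \<mu> / 2 * n" using n \<mu> by (simp add: field_simps)
  moreover have "\<bar>deg_sum n d - \<mu> * n\<bar> \<le> Kg * real n powr (1 - \<eta> / 8)" using d by (simp add: dgood_def)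
  moreover have "0 \<le> \<mu> * n" using \<mu> by simp
  ultimately show "\<mu> / 2 * n \<le> deg_sum n d \<and> deg_sum n d \<le> 2 * \<mu> * n" by (simp only: mult.assoc) linarith
 qed
qed

text \<open>The explored vertices might be those of largest degree, so an arbitrary set is bounded:
  degrees below n^(1/10) contribute at most n^(1/5) to each of about n^(3/5) terms, and above that
  level the moment of order 2 + \<eta> gains a factor n^(-\<eta> / 10).\<close>

lemma sum_squares_small:
 assumes d: "dgood n d" and R: "R \<subseteq> {1..n}" "real (card R) \<le> real n powr (3/5) + 2" and n: "n \<ge> 1"
 shows "(\<Sum>v\<in>R. (real (d v))\<^sup>2) \<le> (3 + Kg) * real n powr (1 - \<eta> / 10)"
proof -
 have n1: "real n \<ge> 1" using n by simp
 let ?x = "real n powr (1/10)"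
 have x: "?x \<ge> 1" using n1 by (simp add: ge_one_powr_ge_zero)
 have finR: "finite R" using R finite_subset by blast
 have pt: "(real (d v))\<^sup>2 \<le> ?x\<^sup>2 + ?x powr (- \<eta>) * real (d v) powr (2 + \<eta>)" for v
 proof (cases "real (d v) \<le> ?x")
  case True
  then have "(real (d v))\<^sup>2 \<le> ?x\<^sup>2" by (intro power_mono) auto
  then show ?thesis by (simp add: add_increasing2)
 next
  case False
  then have dv: "real (d v) > 0" using x by linarith
  have "?x powr \<eta> \<le> real (d v) powr \<eta>" using False \<eta> x by (intro powr_mono2) auto
  then have "?x powr (- \<eta>) * ?x powr \<eta> \<le> ?x powr (- \<eta>) * real (d v) powr \<eta>" by (intro mult_left_mono) auto
  moreover have "?x powr (- \<eta>) * ?x powr \<eta> = 1" using n1 by (simp add: powr_minus)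
  ultimately have "1 \<le> ?x powr (- \<eta>) * real (d v) powr \<eta>" by linarith
  then have "(real (d v))\<^sup>2 * 1 \<le> (real (d v))\<^sup>2 * (?x powr (- \<eta>) * real (d v) powr \<eta>)" by (intro mult_left_mono) auto
  moreover have "real (d v) powr (2 + \<eta>) = (real (d v))\<^sup>2 * real (d v) powr \<eta>" using dv by (simp add: powr_add)
  ultimately show ?thesis by (simp add: ac_simps add_increasing)
 qed
 have "(\<Sum>v\<in>R. (real (d v))\<^sup>2) \<le> (\<Sum>v\<in>R. ?x\<^sup>2 + ?x powr (- \<eta>) * real (d v) powr (2 + \<eta>))" by (intro sum_mono pt)
 also have "\<dots> = card R * ?x\<^sup>2 + ?x powr (- \<eta>) * (\<Sum>v\<in>R. real (d v) powr (2 + \<eta>))"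
  by (simp add: sum.distrib sum_distrib_left)
 also have "\<dots> \<le> 3 * real n powr (1 - \<eta> / 10) + real n powr (- (\<eta> / 10)) * (Kg * n)"
 proof (rule add_mono)
  have "2 \<le> 2 * real n powr (3/5)" using n1 by (simp add: ge_one_powr_ge_zero)
  then have "real (card R) \<le> 3 * real n powr (3/5)" using R by linarith
  moreover have "?x\<^sup>2 = real n powr (1/5)" using n1 by (simp add: power2_eq_square powr_add[symmetric])
  ultimately have "card R * ?x\<^sup>2 \<le> 3 * real n powr (3/5) * real n powr (1/5)" by (simp add: mult_right_mono)
  also have "\<dots> = 3 * real n powr (4/5)" by (simp add: powr_add[symmetric])
  also have "\<dots> \<le> 3 * real n powr (1 - \<eta> / 10)" using n1 \<eta> by (intro mult_left_mono powr_mono) auto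
  finally show "card R * ?x\<^sup>2 \<le> 3 * real n powr (1 - \<eta> / 10)" .
  have "(\<Sum>v\<in>R. real (d v) powr (2 + \<eta>)) \<le> (\<Sum>v\<in>{1..n}. real (d v) powr (2 + \<eta>))"
   using R by (intro sum_mono2) auto
  also have "\<dots> \<le> Kg * n" using d by (simp add: dgood_def)
  finally have "(\<Sum>v\<in>R. real (d v) powr (2 + \<eta>)) \<le> Kg * n" .
  then show "?x powr (- \<eta>) * (\<Sum>v\<in>R. real (d v) powr (2 + \<eta>)) \<le> real n powr (- (\<eta> / 10)) * (Kg * n)"
   using n1 by (intro mult_mono) (auto simp: powr_powr sum_nonneg)
 qed
 also have "real n powr (- (\<eta> / 10)) * (Kg * n) = Kg * real n powr (1 - \<eta> / 10)"
  using powr_minus_mult_self[of "real n" "\<eta> / 10"] n1 by simp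
 finally show ?thesis by (simp add: algebra_simps)
qed

text \<open>The horizon n^(3/5) lies above the collision scale sqrt n, so that T / N tends to 0, and
  below n, so that the exploration does not disturb the degree sums. The relative error n^(-\<eta> /
  20) dominates those of \<open>dgood\<close> and \<open>sum_squares_small\<close>, and the exponent
  \<eta> / 40 in the supersolution leaves room for \<open>H3\<close>. \<open>C\<close> is the same
  for all \<open>k\<close>, which counts extra vertices already explored.\<close>

theorem Qf_approx_uniform:
 assumes Om0: "Om \<ge> 0"
 shows "\<exists>C\<ge>0. \<forall>k. \<exists>r. r \<longlonglongrightarrow> 0 \<and> eventually (\<lambda>n. \<forall>d. dgood n d \<longrightarrow>
  (\<forall>l z \<omega> U s b M. cmod z \<le> 1 \<longrightarrow> Re \<omega> \<le> 0 \<longrightarrow> of_real cc * \<omega> = of_real (cc + 1) * (z - 1) + \<i> * of_real l \<longrightarrow>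
   cmod \<omega> \<le> Om \<longrightarrow> U \<subseteq> {1..n} \<longrightarrow> card ({1..n} - U) \<le> k + 2 \<longrightarrow> s \<ge> 1 \<longrightarrow> b \<ge> 1 \<longrightarrow>
   s + b \<le> (\<Sum>v\<in>{1..n} - U. d v) \<longrightarrow> M \<ge> n \<longrightarrow>
   cmod (Qf d l z M U s b - G \<omega> (cc * deg_sum n d / real b) (real s))
    \<le> C * (cmod \<omega> + cmod (z - 1)) * (real s powr (- (\<eta> / 40)) + real b powr (- (\<eta> / 40))) + cmod (z - 1) + r n)) sequentially"
proof -
 \<comment> \<open>After the exploration vertices of degree at least 3 still carry n / (2 Kg) stubs,
   out of a total of at most 2 \<mu> n.\<close>
 define q where "q = min 1 (1 / (4 * Kg * \<mu>))"
 have q: "0 < q" "q \<le> 1" "q * (4 * Kg * \<mu>) \<le> 1"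
  using Kg \<mu> by (auto simp: q_def min_def field_simps)
 define Kd where "Kd = 2 * Kg / \<mu>"
 have Kd: "Kd \<ge> 0" using Kg \<mu> by (simp add: Kd_def)
 define e where "e = \<eta> / 40"
 have e: "0 < e" "e \<le> 1" "e \<le> \<eta>" using \<eta> by (auto simp: e_def)
 define C where "C = 4 * (4 * (1 + 2 * Om) * Kd + 4 + 2 * cc) / (q * e)"
 have C: "C \<ge> 0" using Om0 Kd cc q e by (simp add: C_def)
 define H5c where "H5c = 2 + 4 * Om + 4 * C * (Om + 2)"
 define K' where "K' = (3 + cc) * Kg + 3 + Kg"
 have K': "K' \<ge> 0" using cc Kg by (simp add: K'_def)
 show ?thesis
 proof (intro exI[of _ C] conjI allI C)
  fix k :: nat
  define r where "r n = 2 * real n powr (- (\<eta> / 20)) + 2 / real n powr (3/5) * (k + 36 / q * sqrt (2 * \<mu> * n))" for n :: nat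
  have lim0: "(\<lambda>n. real n powr (- a)) \<longlonglongrightarrow> 0" if "a > 0" for a :: real
   using that by (intro tendsto_neg_powr filterlim_real_sequentially) auto
  have r0: "r \<longlonglongrightarrow> 0"
  proof -
   have "(\<lambda>n. 2 * real n powr (- (\<eta> / 20)) + 2 * k * real n powr (- (3/5)) + 72 / q * sqrt (2 * \<mu>) * real n powr (- (1/10)))
    \<longlonglongrightarrow> 0"
    using \<eta> by (intro tendsto_add_zero tendsto_mult_right_zero lim0) auto
   moreover have "eventually (\<lambda>n. 2 * real n powr (- (\<eta> / 20)) + 2 * k * real n powr (- (3/5)) + 72 / q * sqrt (2 * \<mu>) * real n powr (- (1/10)) = r n) sequentially"
    using eventually_ge_at_top[of 1]
   proof eventually_elim
    case (elim n)
    have "sqrt (2 * \<mu> * n) = sqrt (2 * \<mu>) * real n powr (1/2)" using elim by (simp add: real_sqrt_mult powr_half_sqrt)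
    moreover have "real n powr (- (1/10)) = real n powr (1/2) / real n powr (3/5)" by (simp add: powr_diff[symmetric])
    moreover have "real n powr (- (3/5)) = 1 / real n powr (3/5)" by (simp only: powr_minus_divide)
    moreover have "x + 2 * k * (1 / B) + 72 / q * S * (A / B) = x + 2 / B * (k + 36 / q * (S * A))"
     if "B \<noteq> 0" for x A B S :: real using that q(1) by (simp add: field_simps)
    moreover have "real n powr (3/5) \<noteq> 0" using elim by simp
    ultimately show ?case unfolding r_def by presburger
   qed
   ultimately show ?thesis by (simp add: Lim_transform_eventually)
  qed
  have ev: "eventually (\<lambda>n. n \<ge> 1 \<and> 2 * K' / \<mu> * real n powr (1 - \<eta> / 10) \<le> real n powr (1 - \<eta> / 20)
   \<and> 2 * Kg * K' * real n powr (1 - \<eta> / 10) \<le> real n powr 1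
   \<and> (2 * \<mu>) powr e * real n powr (- (\<eta> / 40)) \<le> real n powr 0
   \<and> 16 / q * real n powr (- (\<eta> / 20)) \<le> real n powr 0
   \<and> 2 * H5c / \<mu> * real n powr (3/5) \<le> real n powr 1
   \<and> (\<forall>d. dgood n d \<longrightarrow> \<mu> / 2 * n \<le> deg_sum n d \<and> deg_sum n d \<le> 2 * \<mu> * n)) sequentially"
  proof -
   have ex: "1 - \<eta> / 10 < 1 - \<eta> / 20" "1 - \<eta> / 10 < 1" "- (\<eta> / 40) < 0" "- (\<eta> / 20) < 0" "(3/5 :: real) < 1"
    using \<eta> by auto
   show ?thesis
    using eventually_ge_at_top[of "1::nat"] eventually_powr_le[OF ex(1), of "2 * K' / \<mu>"]
     eventually_powr_le[OF ex(2), of "2 * Kg * K'"] eventually_powr_le[OF ex(3), of "(2 * \<mu>) powr e"]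
     eventually_powr_le[OF ex(4), of "16 / q"] eventually_powr_le[OF ex(5), of "2 * H5c / \<mu>"] dgood_L
    by eventually_elim (intro conjI)
  qed
  show "\<exists>r. r \<longlonglongrightarrow> 0 \<and> eventually (\<lambda>n. \<forall>d. dgood n d \<longrightarrow>
  (\<forall>l z \<omega> U s b M. cmod z \<le> 1 \<longrightarrow> Re \<omega> \<le> 0 \<longrightarrow> of_real cc * \<omega> = of_real (cc + 1) * (z - 1) + \<i> * of_real l \<longrightarrow>
   cmod \<omega> \<le> Om \<longrightarrow> U \<subseteq> {1..n} \<longrightarrow> card ({1..n} - U) \<le> k + 2 \<longrightarrow> s \<ge> 1 \<longrightarrow> b \<ge> 1 \<longrightarrow>
   s + b \<le> (\<Sum>v\<in>{1..n} - U. d v) \<longrightarrow> M \<ge> n \<longrightarrow>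
   cmod (Qf d l z M U s b - G \<omega> (cc * deg_sum n d / real b) (real s))
    \<le> C * (cmod \<omega> + cmod (z - 1)) * (real s powr (- (\<eta> / 40)) + real b powr (- (\<eta> / 40))) + cmod (z - 1) + r n)) sequentially"
  proof (intro exI[of _ r] conjI r0 eventually_mono[OF ev] allI impI)
   fix n d l z \<omega> U s b M
   assume E: "n \<ge> 1 \<and> 2 * K' / \<mu> * real n powr (1 - \<eta> / 10) \<le> real n powr (1 - \<eta> / 20)
   \<and> 2 * Kg * K' * real n powr (1 - \<eta> / 10) \<le> real n powr 1
   \<and> (2 * \<mu>) powr e * real n powr (- (\<eta> / 40)) \<le> real n powr 0
   \<and> 16 / q * real n powr (- (\<eta> / 20)) \<le> real n powr 0
   \<and> 2 * H5c / \<mu> * real n powr (3/5) \<le> real n powr 1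
   \<and> (\<forall>d. dgood n d \<longrightarrow> \<mu> / 2 * n \<le> deg_sum n d \<and> deg_sum n d \<le> 2 * \<mu> * n)"
   assume d: "dgood n d" and z: "cmod z \<le> 1" and w: "Re \<omega> \<le> 0" "of_real cc * \<omega> = of_real (cc + 1) * (z - 1) + \<i> * of_real l"
    "cmod \<omega> \<le> Om" and U: "U \<subseteq> {1..n}" "card ({1..n} - U) \<le> k + 2" and s: "1 \<le> s" "1 \<le> b" "s + b \<le> (\<Sum>v\<in>{1..n} - U. d v)"
    and M: "n \<le> M"
   have n1: "real n \<ge> 1" using E by simp
   define L where "L = deg_sum n d"
   have L: "\<mu> / 2 * n \<le> L" "L \<le> 2 * \<mu> * n" using E d by (auto simp: L_def)
   have L0: "L > 0" using L(1) n1 \<mu> by (smt (verit) mult_pos_pos half_gt_zero)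
   let ?N = "real n powr (3/5)" and ?eps = "real n powr (- (\<eta> / 20))" and ?X = "real n powr (1 - \<eta> / 10)"
   have sqs: "(\<Sum>v\<in>{1..n} - U. (real (d v))\<^sup>2) \<le> (3 + Kg) * ?X" if "real (card ({1..n} - U)) \<le> ?N + 2" for U
    using E that by (intro sum_squares_small[OF d]) auto
   have n8: "real n powr (1 - \<eta> / 8) \<le> ?X" using n1 \<eta> by (intro powr_mono) auto
   have KX: "K' * ?X \<le> ?eps * L"
   proof -
    have "K' * ?X \<le> \<mu> / 2 * real n powr (1 - \<eta> / 20)" using E \<mu> by (simp add: field_simps)
    also have "real n powr (1 - \<eta> / 20) = ?eps * n" using powr_minus_mult_self[of "real n" "\<eta> / 20"] n1 by simp
    also have "\<mu> / 2 * (?eps * n) = ?eps * (\<mu> / 2 * n)" by simp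
    also have "\<dots> \<le> ?eps * L" using L by (intro mult_left_mono) auto
    finally show ?thesis .
   qed
   have dle: "real (d v) \<le> (real (d v))\<^sup>2" if "v \<in> {1..n}" for v
   proof -
    have "d v \<ge> 2" using d that by (auto simp: dgood_def)
    then have "real (d v) * 1 \<le> real (d v) * real (d v)" by (intro mult_left_mono) auto
    then show ?thesis by (simp add: power2_eq_square)
   qed
   have small: "(\<Sum>v\<in>{1..n} - U. real (d v)) \<le> (3 + Kg) * ?X" if "real (card ({1..n} - U)) \<le> ?N + 2" for U
   proof -
    have "(\<Sum>v\<in>{1..n} - U. real (d v)) \<le> (\<Sum>v\<in>{1..n} - U. (real (d v))\<^sup>2)" by (intro sum_mono dle) auto
    then show ?thesis using sqs[OF that] by simp
   qed
   have K3: "(3 + Kg) * ?X \<le> K' * ?X" using cc Kg by (intro mult_right_mono) (auto simp: K'_def)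
   interpret X: expl d "{1..n}" l z \<omega> cc e Kd q ?eps ?N Om
   proof
    show "finite {1..n}" by simp
    show "2 \<le> d v" if "v \<in> {1..n}" for v using d that by (auto simp: dgood_def)
    show "cc > 0" by (rule cc)
    show "1 \<le> ?N" using n1 by (simp add: ge_one_powr_ge_zero)
    show "(\<Sum>v\<in>{1..n}. real (d v) * real (d v) powr (1 + e)) \<le> Kd * real (\<Sum>v\<in>{1..n}. d v)"
    proof -
     have "(\<Sum>v\<in>{1..n}. real (d v) * real (d v) powr (1 + e)) \<le> (\<Sum>v\<in>{1..n}. real (d v) powr (2 + \<eta>))"
     proof (rule sum_mono)
      fix v assume "v \<in> {1..n}"
      then have dv: "real (d v) \<ge> 2" using d by (auto simp: dgood_def)
      have "real (d v) * real (d v) powr (1 + e) = real (d v) powr (1 + (1 + e))"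
       using dv by (subst powr_add) simp
      also have "\<dots> \<le> real (d v) powr (2 + \<eta>)" using dv e by (intro powr_mono) auto
      finally show "real (d v) * real (d v) powr (1 + e) \<le> real (d v) powr (2 + \<eta>)" .
     qed
     also have "\<dots> \<le> Kg * n" using d by (simp add: dgood_def)
     also have "\<dots> = Kd * (\<mu> / 2 * n)" using \<mu> by (simp add: Kd_def)
     also have "\<dots> \<le> Kd * L" using L Kd by (intro mult_left_mono) auto
     finally show ?thesis by (simp add: L_def deg_sum_def)
    qed
    fix U assume U: "U \<subseteq> {1..n}" "real (card ({1..n} - U)) \<le> ?N + 2"
    show "\<bar>(\<Sum>v\<in>U. real (d v) * (real (d v) - 2)) - cc * real (\<Sum>v\<in>{1..n}. d v)\<bar> \<le> ?eps * real (\<Sum>v\<in>{1..n}. d v)"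
    proof -
     let ?S = "\<lambda>A. \<Sum>v\<in>A. real (d v) * (real (d v) - 2)"
     have "?S {1..n} = ?S U + ?S ({1..n} - U)" using sum.subset_diff[OF U(1), of "\<lambda>v. real (d v) * (real (d v) - 2)"] by simp
     moreover have "0 \<le> ?S ({1..n} - U)" using d by (intro sum_nonneg mult_nonneg_nonneg) (auto simp: dgood_def)
     moreover have "?S ({1..n} - U) \<le> (\<Sum>v\<in>{1..n} - U. (real (d v))\<^sup>2)"
      by (intro sum_mono) (auto simp: power2_eq_square algebra_simps)
     moreover have "?S {1..n} = (\<Sum>v\<in>{1..n}. (real (d v))\<^sup>2) - 2 * L"
      by (simp add: L_def deg_sum_def power2_eq_square algebra_simps sum_subtractf sum_distrib_left)
     moreover have "m2 * n = (2 + cc) * (\<mu> * n)" using \<mu> by (simp add: cc_def field_simps)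
     moreover have "\<bar>(\<Sum>v\<in>{1..n}. (real (d v))\<^sup>2) - m2 * n\<bar> \<le> Kg * ?X" "\<bar>L - \<mu> * n\<bar> \<le> Kg * ?X"
     proof -
      have kX: "Kg * real n powr (1 - \<eta> / 8) \<le> Kg * ?X" using n8 Kg by (intro mult_left_mono) auto
      show "\<bar>(\<Sum>v\<in>{1..n}. (real (d v))\<^sup>2) - m2 * n\<bar> \<le> Kg * ?X"
       using d unfolding dgood_def by (intro order_trans[OF _ kX]) blast
      show "\<bar>L - \<mu> * n\<bar> \<le> Kg * ?X"
       using d unfolding dgood_def L_def by (intro order_trans[OF _ kX]) blast
     qed
     moreover from this(2) have "(2 + cc) * \<bar>L - \<mu> * n\<bar> \<le> (2 + cc) * (Kg * ?X)" using cc by (intro mult_left_mono) auto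
     moreover have "\<bar>(2 + cc) * L - (2 + cc) * (\<mu> * n)\<bar> = (2 + cc) * \<bar>L - \<mu> * n\<bar>" using cc by (simp add: right_diff_distrib[symmetric] abs_mult)
     moreover have "K' * ?X = Kg * ?X + (2 + cc) * (Kg * ?X) + (3 + Kg) * ?X" by (simp add: K'_def algebra_simps)
     moreover have "(2 + cc) * L = 2 * L + cc * L" by (simp add: algebra_simps)
     ultimately have "\<bar>?S U - cc * L\<bar> \<le> K' * ?X" using sqs[OF U(2)] by linarith
     then have "\<bar>?S U - cc * L\<bar> \<le> ?eps * L" using KX by linarith
     then show ?thesis unfolding L_def deg_sum_def .
    qed
    show "real (\<Sum>v\<in>{1..n} - U. d v) \<le> ?eps * real (\<Sum>v\<in>{1..n}. d v)"
    proof -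
     have "(\<Sum>v\<in>{1..n} - U. real (d v)) \<le> ?eps * L" using small[OF U(2)] K3 KX by linarith
     then show ?thesis unfolding L_def deg_sum_def of_nat_sum .
    qed
    show "q * real (\<Sum>v\<in>{1..n}. d v) \<le> (\<Sum>v | v \<in> U \<and> 3 \<le> d v. real (d v))"
    proof -
     have fin: "finite U" using U finite_subset by blast
     have "(\<Sum>v | v \<in> {1..n} \<and> 3 \<le> d v. real (d v)) \<le> (\<Sum>v\<in>{v. v \<in> U \<and> 3 \<le> d v} \<union> ({1..n} - U). real (d v))"
      using fin by (intro sum_mono2) auto
     also have "\<dots> = (\<Sum>v | v \<in> U \<and> 3 \<le> d v. real (d v)) + (\<Sum>v\<in>{1..n} - U. real (d v))"
      using fin by (intro sum.union_disjoint) auto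
     finally have "n / Kg \<le> (\<Sum>v | v \<in> U \<and> 3 \<le> d v. real (d v)) + (3 + Kg) * ?X"
      using d small[OF U(2)] by (auto simp: dgood_def)
     moreover have "K' * ?X \<le> n / (2 * Kg)"
     proof -
      have "2 * Kg * K' * ?X \<le> real n" using E n1 by simp
      then have "(K' * ?X) * (2 * Kg) \<le> real n" by (simp only: ac_simps)
      then show ?thesis using Kg by (intro pos_le_divide_eq[THEN iffD2]) auto
     qed
     moreover have "n / Kg = n / (2 * Kg) + n / (2 * Kg)" by simp
     moreover have "q * L \<le> n / (2 * Kg)"
     proof -
      have "q * L \<le> q * (2 * \<mu> * n)" using L q by (intro mult_left_mono) auto
      also have "\<dots> = q * (4 * Kg * \<mu>) * (n / (2 * Kg))" using Kg by simp
      also have "\<dots> \<le> 1 * (n / (2 * Kg))" using q Kg by (intro mult_right_mono) auto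
      finally show ?thesis by simp
     qed
     ultimately have "q * L \<le> (\<Sum>v | v \<in> U \<and> 3 \<le> d v. real (d v))" using K3 by linarith
     then show ?thesis unfolding L_def deg_sum_def .
    qed
   next
    show "?eps * real (\<Sum>v\<in>{1..n}. d v) powr e \<le> 1"
    proof -
     have "?eps * L powr e \<le> ?eps * (2 * \<mu> * n) powr e" using L L0 e by (intro mult_left_mono powr_mono2) auto
     also have "\<dots> = (2 * \<mu>) powr e * (?eps * real n powr e)" using \<mu> by (simp add: powr_mult)
     also have "?eps * real n powr e = real n powr (- (\<eta> / 40))" by (simp add: powr_add[symmetric] e_def)
     also have "(2 * \<mu>) powr e * real n powr (- (\<eta> / 40)) \<le> 1" using E n1 by simp
     finally show ?thesis by (simp add: L_def deg_sum_def)
    qed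
    show "?eps \<le> q / 16" using E q n1 by (simp add: field_simps)
    have "?N * H5c \<le> L"
    proof -
     have "?N * H5c \<le> \<mu> / 2 * n" using E \<mu> n1 by (simp add: field_simps)
     then show ?thesis using L by simp
    qed
    then show "?N * (2 + 4 * Om + 4 * (4 * (4 * (1 + 2 * Om) * Kd + 4 + 2 * cc) / (q * e)) * (Om + 2)) \<le> real (\<Sum>v\<in>{1..n}. d v)"
     by (simp add: H5c_def C_def L_def deg_sum_def)
   qed (use z w e q Kd in auto)
   have "?N \<le> real n powr 1" using n1 by (intro powr_mono) auto
   then have "?N \<le> real (M + k)" using M n1 by simp
   from X.Qf_approx[OF this U s]
   have *: "cmod (Qf d l z M U s b - X.g (real s) (real b)) \<le> X.Err (real k) (real s) (real b)" .
   have XL: "X.L = L" unfolding X.L_def L_def deg_sum_def ..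
   have XC: "X.C = C" unfolding X.C_def X.E0_def C_def ..
   have "X.T (real s + real b) \<le> 12 / q * (3 * sqrt L)"
    unfolding X.T_def XL using q L0 by (intro mult_left_mono) auto
   also have "\<dots> \<le> 12 / q * (3 * sqrt (2 * \<mu> * n))" using L q by (intro mult_left_mono) auto
   finally have "2 / ?N * (k + X.T (real s + real b)) \<le> 2 / ?N * (k + 36 / q * sqrt (2 * \<mu> * n))"
    by (intro mult_left_mono) auto
   then have "X.Err (real k) (real s) (real b) \<le> C * (cmod \<omega> + cmod (z - 1)) * (real s powr (- (\<eta> / 40)) + real b powr (- (\<eta> / 40))) + cmod (z - 1) + r n"
    unfolding X.Err_def XC X.kap_def r_def unfolding e_def by linarith
   with * show "cmod (Qf d l z M U s b - G \<omega> (cc * deg_sum n d / real b) (real s))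
    \<le> C * (cmod \<omega> + cmod (z - 1)) * (real s powr (- (\<eta> / 40)) + real b powr (- (\<eta> / 40))) + cmod (z - 1) + r n"
    unfolding X.g_def XL by (simp add: L_def)
  qed
 qed
qed

end

section \<open>Asymptotics of \<open>G\<close> for large total degree\<close>

lemma integrable_expm_powr:
 assumes "a > -1"
 shows "integrable expm (\<lambda>x. \<bar>x\<bar> powr a)"
proof (rule integrableI_bounded)
 have "(\<integral>\<^sup>+x. ennreal (norm (\<bar>x\<bar> powr a)) \<partial>expm) = (\<integral>\<^sup>+x. ennreal (exponential_density 1 x) * ennreal (\<bar>x\<bar> powr a) \<partial>lborel)"
  by (subst nn_integral_density) auto
 also have "\<dots> = (\<integral>\<^sup>+t. ennreal (indicator {0..} t * t powr ((a + 1) - 1) / exp t) \<partial>lborel)"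
  by (intro nn_integral_cong) (auto simp: exponential_density_def indicator_def ennreal_mult[symmetric] exp_minus field_simps)
 also have "\<dots> = ennreal (Gamma (a + 1))" using assms by (subst Gamma_conv_nn_integral_real) auto
 finally show "(\<integral>\<^sup>+x. ennreal (norm (\<bar>x\<bar> powr a)) \<partial>expm) < \<infinity>" by simp
qed simp

lemma integrable_expm_abs: "integrable expm (\<lambda>x. \<bar>x\<bar>)"
proof -
 have "integrable expm (\<lambda>x. \<bar>x\<bar> powr 1)" by (rule integrable_expm_powr) simp
 moreover have "(\<lambda>x::real. \<bar>x\<bar> powr 1) = (\<lambda>x. \<bar>x\<bar>)" by auto
 ultimately show ?thesis by simp
qed

text \<open>Replaces the logarithm by powers with exponent above -1, which are integrable against
  the exponential law.\<close>

lemma abs_ln_le: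
 fixes x :: real
 assumes "x > 0"
 shows "\<bar>ln x\<bar> \<le> x + 2 * x powr (-1/2)"
proof -
 have "ln x \<le> x" using ln_le_minus_one[OF assms] by simp
 moreover have "- ln x = 2 * ln (x powr (-1/2))" using assms by (simp add: ln_powr)
 moreover have "ln (x powr (-1/2)) \<le> x powr (-1/2)" using ln_le_minus_one[of "x powr (-1/2)"] assms by simp
 ultimately show ?thesis using powr_ge_zero[of x "-1/2"] assms by linarith
qed

lemma norm_integral_diff_le:
 fixes f h :: "real \<Rightarrow> complex"
 assumes f: "f \<in> borel_measurable borel" "\<And>x. cmod (f x) \<le> B" and h: "h \<in> borel_measurable borel" "\<And>x. cmod (h x) \<le> B"
  and g: "integrable expm g" and le: "\<And>x. x > 0 \<Longrightarrow> cmod (f x - h x) \<le> g x"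
 shows "cmod ((\<integral>x. f x \<partial>expm) - (\<integral>x. h x \<partial>expm)) \<le> (\<integral>x. g x \<partial>expm)"
proof -
 have i: "integrable expm f" "integrable expm h"
  using f h by (auto intro!: integrable_bounded_measurable[OF prob_space_expm])
 then have "(\<integral>x. f x \<partial>expm) - (\<integral>x. h x \<partial>expm) = (\<integral>x. f x - h x \<partial>expm)" by simp
 also have "cmod \<dots> \<le> (\<integral>x. cmod (f x - h x) \<partial>expm)" by (rule integral_norm_bound)
 also have "\<dots> \<le> (\<integral>x. g x \<partial>expm)"
 proof (rule integral_mono_AE)
  show "integrable expm (\<lambda>x. cmod (f x - h x))" using i by auto
  show "AE x in expm. cmod (f x - h x) \<le> g x" using AE_expm_pos by eventually_elim (rule le)
 qed (rule g)
 finally show ?thesis .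
qed

text \<open>The constant of \<open>G_near_power\<close>: \<open>u\<close> and \<open>v\<close> are
  the upper and lower bounds of c L / n, and the bracket bounds the logarithm of the exponential
  variable.\<close>

definition JJ :: "real \<Rightarrow> real \<Rightarrow> real" where
 "JJ u v = (\<integral>x. u * \<bar>x\<bar> + \<bar>ln v\<bar> + (\<bar>x\<bar> + 2 * \<bar>x\<bar> powr (-1/2)) \<partial>expm)"

text \<open>On the left half-plane exp is Lipschitz, so logarithms are compared: that of 1 + c L X /
  (s b) differs from ln n by an amount controlled by X, ln X, s and b. The bound is linear in
  \<omega>, hence useful for small \<omega>.\<close>

lemma G_near_power:
 assumes w: "Re \<omega> \<le> 0" and c: "c > 0" and n: "n \<ge> (1::real)" and s: "s \<ge> 1" "b \<ge> 1"
  and L: "a1 * n \<le> L" "L \<le> a2 * n" and a: "a1 > 0" "a2 > 0"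
 shows "cmod (G \<omega> (c * L / b) s - exp (\<omega> * of_real (ln n))) \<le> cmod \<omega> * (JJ (c * a2) (c * a1) + s + b)"
proof -
 interpret E: prob_space expm by (rule prob_space_expm)
 let ?k = "c * L / b"
 let ?g = "\<lambda>x. cmod \<omega> * ((c * a2 * \<bar>x\<bar> + \<bar>ln (c * a1)\<bar> + (\<bar>x\<bar> + 2 * \<bar>x\<bar> powr (-1/2))) + (s + b))"
 have L0: "L > 0" using L(1) a n by (smt (verit) mult_pos_pos)
 have i: "integrable expm (\<lambda>x. c * a2 * \<bar>x\<bar> + \<bar>ln (c * a1)\<bar> + (\<bar>x\<bar> + 2 * \<bar>x\<bar> powr (-1/2)))"
  using integrable_expm_abs integrable_expm_powr[of "-1/2"] by simp
 have "cmod ((\<integral>x. V \<omega> (?k * \<bar>x\<bar>) s \<partial>expm) - (\<integral>x. exp (\<omega> * of_real (ln n)) \<partial>expm)) \<le> (\<integral>x. ?g x \<partial>expm)"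
 proof (rule norm_integral_diff_le)
  show "cmod (V \<omega> (?k * \<bar>x\<bar>) s) \<le> 1" for x using w c s L0 by (intro norm_V) auto
  show "cmod (exp (\<omega> * of_real (ln n))) \<le> 1" using w n by (simp add: norm_exp mult_nonpos_nonneg)
  show "integrable expm ?g" using i by simp
  fix x :: real assume x: "x > 0"
  let ?y = "1 + ?k * \<bar>x\<bar> / s"
  have y1: "?k * x / s = c * L * x / (b * s)" by simp
  have bs: "b * s \<ge> 1" using s mult_mono[of 1 b 1 s] by simp
  have up: "ln ?y \<le> ln n + c * a2 * x"
  proof -
   have "c * L * x / (b * s) \<le> c * L * x / 1" using bs c L0 x by (intro divide_left_mono) auto
   also have "\<dots> \<le> c * (a2 * n) * x" using L c x by (simp add: mult_left_mono mult_right_mono)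
   finally have "?y \<le> n * (1 + c * a2 * x)" using n x y1 by (simp add: algebra_simps)
   moreover have "0 < ?y" using c L0 s x by (auto intro!: add_pos_nonneg)
   ultimately have "ln ?y \<le> ln (n * (1 + c * a2 * x))" by simp
   also have "\<dots> = ln n + ln (1 + c * a2 * x)" using n c a x by (intro ln_mult_pos) (auto intro!: add_pos_nonneg)
   also have "ln (1 + c * a2 * x) \<le> c * a2 * x" using c a x by (intro ln_add_one_self_le_self) auto
   finally show ?thesis by simp
  qed
  have low: "ln n - \<bar>ln (c * a1)\<bar> - \<bar>ln x\<bar> - s - b \<le> ln ?y"
  proof -
   have "c * (a1 * n) * x / (b * s) \<le> c * L * x / (b * s)"
    using L c x bs s by (intro divide_right_mono mult_right_mono mult_left_mono) auto
   then have "(c * a1) * n * x / (b * s) \<le> ?y" using y1 x by (simp add: ac_simps)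
   then have "ln ((c * a1) * n * x / (b * s)) \<le> ln ?y" using c a n x s by (intro ln_mono) auto
   moreover have "ln ((c * a1) * n * x / (b * s)) = ln (c * a1) + ln n + ln x - (ln b + ln s)"
    using c a n x s by (simp add: ln_div ln_mult_pos)
   moreover have "ln b \<le> b" "ln s \<le> s" using s ln_le_minus_one[of b] ln_le_minus_one[of s] by auto
   ultimately show ?thesis by linarith
  qed
  have "cmod (V \<omega> (?k * \<bar>x\<bar>) s - exp (\<omega> * of_real (ln n))) \<le> cmod (\<omega> * of_real (ln ?y) - \<omega> * of_real (ln n))"
   unfolding V_def using w n c L0 s by (intro cmod_exp_diff_le) (auto simp: mult_nonpos_nonneg)
  also have "\<dots> = cmod \<omega> * \<bar>ln ?y - ln n\<bar>"
   by (simp only: right_diff_distrib[symmetric] of_real_diff[symmetric] norm_mult norm_of_real)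
  also have "\<dots> \<le> ?g x"
  proof (intro mult_left_mono)
   have "0 \<le> c * a2 * x" using c a x by simp
   then show "\<bar>ln ?y - ln n\<bar> \<le> (c * a2 * \<bar>x\<bar> + \<bar>ln (c * a1)\<bar> + (\<bar>x\<bar> + 2 * \<bar>x\<bar> powr (-1/2))) + (s + b)"
    using up low abs_ln_le[OF x] x s by (simp only: abs_of_pos)
  qed simp
  finally show "cmod (V \<omega> (?k * \<bar>x\<bar>) s - exp (\<omega> * of_real (ln n))) \<le> ?g x" .
 qed measurable
 also have "(\<integral>x. ?g x \<partial>expm) = cmod \<omega> * (JJ (c * a2) (c * a1) + (s + b))"
 proof -
  have split: "(\<integral>x. a * (f x + e) \<partial>expm) = a * ((\<integral>x. f x \<partial>expm) + e)" if "integrable expm f" for f :: "real \<Rightarrow> real" and a e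
   using that E.prob_space by simp
  show ?thesis unfolding JJ_def by (rule split[OF i])
 qed
 finally show ?thesis using E.prob_space by (simp add: G_def add.assoc)
qed

text \<open>The expectation of (k X)^\<omega>, which is what remains of \<open>G\<close> when the
  summand 1 is dropped and n^\<omega> is divided out.\<close>

definition Psi0 :: "complex \<Rightarrow> real \<Rightarrow> complex" where
 "Psi0 \<omega> k = (\<integral>x. exp (\<omega> * of_real (ln (k * \<bar>x\<bar>))) \<partial>expm)"

lemma norm_Psi0: "Re \<omega> = 0 \<Longrightarrow> cmod (Psi0 \<omega> k) \<le> 1"
 unfolding Psi0_def by (rule norm_integral_le[OF prob_space_expm]) (simp add: norm_exp)

text \<open>With y = c L x / (s b), the difference ln (1 + y) - ln n splits into the logarithm in
  \<open>Psi0\<close>, the error ln (L / (n \<mu>)) and ln (1 + 1 / y). The last one is at most 2 /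
  sqrt y, which is integrable near x = 0, whereas 1 / y is not.\<close>

lemma G_limit:
 assumes w: "Re \<omega> = 0" and c: "c > 0" and n: "n \<ge> (1::real)" and s: "s \<ge> 1" "b \<ge> 1" and L: "L > 0" and \<mu>: "\<mu> > 0"
 shows "cmod (exp (- \<omega> * of_real (ln n)) * G \<omega> (c * L / b) s - Psi0 \<omega> (c * \<mu> / (s * b)))
  \<le> cmod \<omega> * (\<bar>ln (L / (n * \<mu>))\<bar> + 2 * sqrt (s * b / (c * L)) * (\<integral>x. \<bar>x\<bar> powr (-1/2) \<partial>expm))"
proof -
 interpret E: prob_space expm by (rule prob_space_expm)
 let ?k = "c * L / b"
 let ?g = "\<lambda>x. cmod \<omega> * (\<bar>ln (L / (n * \<mu>))\<bar> + 2 * sqrt (s * b / (c * L)) * \<bar>x\<bar> powr (-1/2))"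
 have i: "integrable expm (\<lambda>x. \<bar>x\<bar> powr (-1/2))" by (rule integrable_expm_powr) simp
 have "cmod ((\<integral>x. exp (- \<omega> * of_real (ln n)) * V \<omega> (?k * \<bar>x\<bar>) s \<partial>expm) - (\<integral>x. exp (\<omega> * of_real (ln (c * \<mu> / (s * b) * \<bar>x\<bar>))) \<partial>expm))
   \<le> (\<integral>x. ?g x \<partial>expm)"
 proof (rule norm_integral_diff_le)
  show "cmod (exp (- \<omega> * of_real (ln n)) * V \<omega> (?k * \<bar>x\<bar>) s) \<le> 1" for x
   unfolding norm_mult V_def norm_exp using w by simp
  show "cmod (exp (\<omega> * of_real (ln (c * \<mu> / (s * b) * \<bar>x\<bar>)))) \<le> 1" for x using w by (simp add: norm_exp)
  show "integrable expm ?g" using i by simp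
  fix x :: real assume x: "x > 0"
  let ?y = "c * L * x / (b * s)"
  have y: "?y > 0" using c L s x by simp
  have e: "exp (- \<omega> * of_real (ln n)) * V \<omega> (?k * \<bar>x\<bar>) s = exp (\<omega> * of_real (ln (1 + ?y) - ln n))"
   unfolding V_def exp_add[symmetric] using x by (simp add: algebra_simps)
  have "cmod (exp (\<omega> * of_real (ln (1 + ?y) - ln n)) - exp (\<omega> * of_real (ln (c * \<mu> / (s * b) * \<bar>x\<bar>))))
   \<le> cmod (\<omega> * of_real (ln (1 + ?y) - ln n) - \<omega> * of_real (ln (c * \<mu> / (s * b) * \<bar>x\<bar>)))"
   using w by (intro cmod_exp_diff_le) auto
  also have "\<dots> = cmod \<omega> * \<bar>ln (1 + ?y) - ln n - ln (c * \<mu> / (s * b) * \<bar>x\<bar>)\<bar>"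
   by (simp only: right_diff_distrib[symmetric] of_real_diff[symmetric] norm_mult norm_of_real)
  also have "ln (1 + ?y) - ln n - ln (c * \<mu> / (s * b) * \<bar>x\<bar>) = ln (L / (n * \<mu>)) + ln (1 + 1 / ?y)"
  proof -
   have "1 + u = u * (1 + 1 / u)" if "u > 0" for u :: real using that by (simp add: field_simps)
   from this[OF y] have "ln (1 + ?y) = ln (?y * (1 + 1 / ?y))" by (rule arg_cong)
   also have "\<dots> = ln ?y + ln (1 + 1 / ?y)"
    using y by (intro ln_mult_pos add_pos_pos zero_less_one y) (rule iffD2[OF zero_less_divide_1_iff])
   finally have 1: "ln (1 + ?y) = ln ?y + ln (1 + 1 / ?y)" .
   have 2: "ln ?y = ln c + ln L + ln x - (ln b + ln s)" using c L x s by (simp add: ln_div ln_mult_pos)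
   have 3: "ln (c * \<mu> / (s * b) * \<bar>x\<bar>) = ln c + ln \<mu> - (ln s + ln b) + ln x"
    using c \<mu> s x by (simp add: ln_div ln_mult_pos)
   have 4: "ln (L / (n * \<mu>)) = ln L - (ln n + ln \<mu>)" using L n \<mu> by (simp add: ln_div ln_mult_pos)
   show ?thesis unfolding 1 2 3 4 by simp
  qed
  also have "cmod \<omega> * \<bar>ln (L / (n * \<mu>)) + ln (1 + 1 / ?y)\<bar> \<le> ?g x"
  proof (intro mult_left_mono)
   let ?u = "1 / ?y"
   have u: "?u > 0" using y by (rule iffD2[OF zero_less_divide_1_iff])
   have "ln (1 + u) \<le> 2 * sqrt u" if "u > 0" for u :: real
   proof -
    have "ln (1 + u) \<le> ln ((1 + sqrt u)\<^sup>2)"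
     using that by (intro ln_mono) (auto simp: power2_eq_square algebra_simps)
    also have "\<dots> = 2 * ln (1 + sqrt u)" using that by (subst ln_realpow) (auto intro!: add_pos_nonneg)
    also have "\<dots> \<le> 2 * sqrt u" using ln_add_one_self_le_self[of "sqrt u"] that by simp
    finally show ?thesis .
   qed
   from this[OF u] have "ln (1 + ?u) \<le> 2 * sqrt ?u" .
   also have "sqrt ?u = sqrt (s * b / (c * L)) * x powr (-1/2)"
    using x by (simp add: real_sqrt_divide real_sqrt_mult powr_minus_divide powr_half_sqrt ac_simps)
   finally have "ln (1 + ?u) \<le> 2 * sqrt (s * b / (c * L)) * x powr (-1/2)" by simp
   moreover have "0 \<le> ln (1 + ?u)" using u by (intro ln_ge_zero) linarith
   ultimately show "\<bar>ln (L / (n * \<mu>)) + ln (1 + 1 / ?y)\<bar> \<le> \<bar>ln (L / (n * \<mu>))\<bar> + 2 * sqrt (s * b / (c * L)) * \<bar>x\<bar> powr (-1/2)"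
    using x by (simp only: abs_of_pos)
  qed simp
  finally show "cmod (exp (- \<omega> * of_real (ln n)) * V \<omega> (?k * \<bar>x\<bar>) s - exp (\<omega> * of_real (ln (c * \<mu> / (s * b) * \<bar>x\<bar>)))) \<le> ?g x"
   unfolding e .
 qed measurable
 then show ?thesis using i E.prob_space unfolding G_def Psi0_def by simp
qed

lemma card_fix_parity_diff:
 assumes "n \<ge> 1"
 shows "\<bar>(\<Sum>v\<in>{1..n}. f (fix_parity n d v)) - (\<Sum>v\<in>{1..n}. f (d v))\<bar> \<le> \<bar>f (d n + 1) - f (d n) :: real\<bar>"
proof -
 have "(\<Sum>v\<in>{1..n}. f ((d(n := d n + 1)) v)) - (\<Sum>v\<in>{1..n}. f (d v)) = f (d n + 1) - f (d n)"
  using assms sum.remove[of "{1..n}" n "\<lambda>v. f (d v)"] sum.remove[of "{1..n}" n "\<lambda>v. f ((d(n := d n + 1)) v)"] by simp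
 then show ?thesis by (auto simp: fix_parity_def)
qed

lemma fix_parity_ge: "d v \<le> fix_parity n d v" "fix_parity n d v \<le> d v + 1"
 by (auto simp: fix_parity_def)

section \<open>Random degrees are good with high probability\<close>

text \<open>The moment of order (2 + \<eta>)(1 + \<eta>) is the moment of order 1 + \<eta> of D^(2 +
  \<eta>), as \<open>degs_wlln\<close> requires. The lower bounds on \<open>Kg\<close> are tailored
  to \<open>dgood_whp\<close>.\<close>

locale fpp_prob = fpp +
 assumes supp: "set_pmf p \<subseteq> {2..}"
  and mom: "integrable (measure_pmf p) (\<lambda>k. real k powr ((2 + \<eta>) * (1 + \<eta>)))"
  and mean: "\<mu> = (\<integral>k. real k \<partial>measure_pmf p)" and m2_eq: "m2 = (\<integral>k. (real k)\<^sup>2 \<partial>measure_pmf p)"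
  and Kg1: "Kg \<ge> 8 * ((\<integral>k. real k powr (2 + \<eta>) \<partial>measure_pmf p) + 1)"
  and Kg2: "Kg \<ge> 2 + 2 * sqrt (m2 + 1)"
  and Kg3: "Kg * (\<integral>k. (if k \<ge> 3 then real k else 0) \<partial>measure_pmf p) \<ge> 2"
begin

lemma mom_le:
 assumes "0 \<le> r" "r \<le> (2 + \<eta>) * (1 + \<eta>)"
 shows "integrable (measure_pmf p) (\<lambda>k. real k powr r)"
proof (rule Bochner_Integration.integrable_bound[of _ "\<lambda>k. 1 + real k powr ((2 + \<eta>) * (1 + \<eta>))"])
 show "integrable (measure_pmf p) (\<lambda>k. 1 + real k powr ((2 + \<eta>) * (1 + \<eta>)))" using mom by simp
 have "real k powr r \<le> 1 + real k powr ((2 + \<eta>) * (1 + \<eta>))" for k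
 proof (cases "k = 0")
  case False
  then have "real k powr r \<le> real k powr ((2 + \<eta>) * (1 + \<eta>))" using assms by (intro powr_mono) auto
  then show ?thesis by simp
 qed simp
 then show "AE k in measure_pmf p. norm (real k powr r) \<le> norm (1 + real k powr ((2 + \<eta>) * (1 + \<eta>)))"
  by (intro always_eventually allI) simp
qed simp

lemma exponents: "1 + \<eta> \<le> (2 + \<eta>) * (1 + \<eta>)" "2 * (1 + \<eta>) \<le> (2 + \<eta>) * (1 + \<eta>)" "0 \<le> 1 + \<eta>"
 "(2 + \<eta>) \<le> (2 + \<eta>) * (1 + \<eta>)" "2 \<le> (2 + \<eta>) * (1 + \<eta>)" "1 \<le> (2 + \<eta>) * (1 + \<eta>)"
 using \<eta> by (auto simp: algebra_simps)

definition wbad where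
 "wbad f n = {d. \<bar>(\<Sum>i\<in>{1..n}. f (d i)) - n * (\<integral>k. f k \<partial>measure_pmf p)\<bar> > real n powr (1 - \<eta> / 8)}"

lemma wbad_lim:
 assumes "\<And>k. f k \<ge> 0" "\<And>k. f k \<le> real k powr (2 + \<eta>)"
 shows "(\<lambda>n. measure_pmf.prob (degs p n) (wbad f n)) \<longlonglongrightarrow> 0"
 unfolding wbad_def
proof (rule degs_wlln)
 show "integrable (measure_pmf p) (\<lambda>k. f k powr (1 + \<eta>))"
 proof (rule Bochner_Integration.integrable_bound[OF mom])
  have "f k powr (1 + \<eta>) \<le> real k powr ((2 + \<eta>) * (1 + \<eta>))" for k
   unfolding powr_powr[symmetric] using assms \<eta> by (intro powr_mono2) auto
  then show "AE k in measure_pmf p. norm (f k powr (1 + \<eta>)) \<le> norm (real k powr ((2 + \<eta>) * (1 + \<eta>)))" by simp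
 qed simp
qed (use assms \<eta> in auto)

lemma nat_le_powr: "1 \<le> r \<Longrightarrow> real k \<le> real k powr r"
 by (cases "k = 0") (use powr_mono[of 1 r "real k"] in auto)

lemma sq_le_powr: "(real k)\<^sup>2 \<le> real k powr (2 + \<eta>)"
 by (cases "k = 0") (use powr_mono[of 2 "2 + \<eta>" "real k"] \<eta> in auto)

text \<open>Four laws of large numbers; the rest is deterministic. The parity correction raises one
  degree by one. This at most doubles it, at the cost of a factor 2^(2 + \<eta>) <= 8 in the moment,
  and changes its square by 2 d + 1, which is of order sqrt n by the bound on the sum of squares.
  These are the origins of the constants in \<open>Kg\<close>.\<close>

lemma dgood_whp: "(\<lambda>n. measure_pmf.prob (degs p n) {d. \<not> dgood n (fix_parity n d)}) \<longlonglongrightarrow> 0"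
proof -
 let ?f1 = "\<lambda>k. real k" and ?f2 = "\<lambda>k. (real k)\<^sup>2" and ?f3 = "\<lambda>k. real k powr (2 + \<eta>)" and ?f4 = "\<lambda>k. if k \<ge> 3 then real k else 0"
 let ?P = "\<lambda>n. measure_pmf.prob (degs p n)"
 define m4 where "m4 = (\<integral>k. ?f4 k \<partial>measure_pmf p)"
 have m4: "Kg * m4 \<ge> 2" using Kg3 by (simp add: m4_def)
 have m40: "m4 > 0" using m4 Kg by (smt (verit) mult_nonneg_nonpos)
 have lims: "(\<lambda>n. ?P n (wbad ?f1 n)) \<longlonglongrightarrow> 0" "(\<lambda>n. ?P n (wbad ?f2 n)) \<longlonglongrightarrow> 0"
  "(\<lambda>n. ?P n (wbad ?f3 n)) \<longlonglongrightarrow> 0" "(\<lambda>n. ?P n (wbad ?f4 n)) \<longlonglongrightarrow> 0"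
  by (rule wbad_lim; use \<eta> nat_le_powr[of "2 + \<eta>"] sq_le_powr in auto)+
 have ev: "eventually (\<lambda>n. n \<ge> 1 \<and> 2 / m4 * real n powr (1 - \<eta> / 8) \<le> real n powr 1) sequentially"
  using \<eta> by (intro eventually_conj eventually_ge_at_top eventually_powr_le) auto
 have det: "dgood n (fix_parity n d)"
  if n: "n \<ge> 1" "2 / m4 * real n powr (1 - \<eta> / 8) \<le> real n powr 1" and d2: "\<forall>v\<in>{1..n}. d v \<ge> 2"
   and nb: "d \<notin> wbad ?f1 n" "d \<notin> wbad ?f2 n" "d \<notin> wbad ?f3 n" "d \<notin> wbad ?f4 n" for n d
 proof -
  let ?d = "fix_parity n d" and ?X = "real n powr (1 - \<eta> / 8)"
  have n1: "real n \<ge> 1" using n by simp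
  have X1: "?X \<ge> 1" using n1 \<eta> by (intro ge_one_powr_ge_zero) auto
  have Xn: "?X \<le> n" using n1 \<eta> powr_mono[of "1 - \<eta> / 8" 1 "real n"] by simp
  have b1: "\<bar>(\<Sum>v\<in>{1..n}. real (d v)) - n * \<mu>\<bar> \<le> ?X" using nb(1) by (simp add: wbad_def mean)
  have b2: "\<bar>(\<Sum>v\<in>{1..n}. (real (d v))\<^sup>2) - n * m2\<bar> \<le> ?X" using nb(2) by (simp add: wbad_def m2_eq)
  have b3: "(\<Sum>v\<in>{1..n}. real (d v) powr (2 + \<eta>)) \<le> n * (\<integral>k. ?f3 k \<partial>measure_pmf p) + ?X" using nb(3) by (auto simp: wbad_def)
  have b4: "(\<Sum>v\<in>{1..n}. ?f4 (d v)) \<ge> n * m4 - ?X" using nb(4) by (auto simp: wbad_def m4_def)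
  have "dgood n ?d" unfolding dgood_def
  proof (intro conjI)
   show "\<forall>v\<in>{1..n}. 2 \<le> ?d v" using d2 fix_parity_ge(1) order_trans by blast
   have "\<bar>(\<Sum>v\<in>{1..n}. real (?d v)) - (\<Sum>v\<in>{1..n}. real (d v))\<bar> \<le> 1"
    using card_fix_parity_diff[OF n(1), of real d] by simp
   moreover have "2 * ?X \<le> Kg * ?X" using Kg2 m2 \<mu> X1 by (intro mult_right_mono) (auto intro: order_trans[rotated])
   moreover have "deg_sum n ?d = (\<Sum>v\<in>{1..n}. real (?d v))" by (simp add: deg_sum_def)
   moreover have "\<mu> * n = n * \<mu>" by simp
   ultimately show "\<bar>deg_sum n ?d - \<mu> * n\<bar> \<le> Kg * ?X" using b1 X1 by linarith
   have dn: "real (d n) \<le> sqrt (m2 + 1) * sqrt n"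
   proof -
    have "(real (d n))\<^sup>2 \<le> (\<Sum>v\<in>{1..n}. (real (d v))\<^sup>2)" using n by (intro member_le_sum) auto
    also have "\<dots> \<le> (m2 + 1) * n" using b2 Xn by (simp add: algebra_simps)
    finally have "real (d n) \<le> sqrt ((m2 + 1) * n)" by (rule real_le_rsqrt)
    then show ?thesis by (simp add: real_sqrt_mult)
   qed
   have sn: "sqrt n \<le> ?X" "1 \<le> sqrt n"
    using n1 \<eta> powr_mono[of "1/2" "1 - \<eta> / 8" "real n"] by (auto simp: powr_half_sqrt)
   have "\<bar>(\<Sum>v\<in>{1..n}. (real (?d v))\<^sup>2) - (\<Sum>v\<in>{1..n}. (real (d v))\<^sup>2)\<bar> \<le> 2 * real (d n) + 1"
    using card_fix_parity_diff[OF n(1), of "\<lambda>k. (real k)\<^sup>2" d] by (simp add: power2_eq_square algebra_simps)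
   also have "\<dots> \<le> 2 * (sqrt (m2 + 1) * ?X) + ?X"
   proof -
    have "sqrt (m2 + 1) * sqrt n \<le> sqrt (m2 + 1) * ?X" using m2 \<mu> by (intro mult_left_mono[OF sn(1)]) simp
    then show ?thesis using dn X1 by linarith
   qed
   finally have "\<bar>(\<Sum>v\<in>{1..n}. (real (?d v))\<^sup>2) - (\<Sum>v\<in>{1..n}. (real (d v))\<^sup>2)\<bar> \<le> 2 * (sqrt (m2 + 1) * ?X) + ?X" .
   moreover have "(2 + 2 * sqrt (m2 + 1)) * ?X \<le> Kg * ?X" using Kg2 by (intro mult_right_mono) auto
   moreover have "(2 + 2 * sqrt (m2 + 1)) * ?X = 2 * ?X + 2 * (sqrt (m2 + 1) * ?X)" by (simp add: algebra_simps)
   moreover have "m2 * n = n * m2" by simp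
   ultimately show "\<bar>(\<Sum>v\<in>{1..n}. (real (?d v))\<^sup>2) - m2 * n\<bar> \<le> Kg * ?X" using b2 by linarith
   show "(\<Sum>v\<in>{1..n}. real (?d v) powr (2 + \<eta>)) \<le> Kg * n"
   proof -
    have "real (?d v) powr (2 + \<eta>) \<le> 8 * real (d v) powr (2 + \<eta>)" if "v \<in> {1..n}" for v
    proof -
     have "d v \<ge> 2" using d2 that by auto
     then have "real (?d v) \<le> 2 * real (d v)" using fix_parity_ge(2)[of n d v] by linarith
     then have "real (?d v) powr (2 + \<eta>) \<le> (2 * real (d v)) powr (2 + \<eta>)" using \<eta> by (intro powr_mono2) auto
     also have "\<dots> = 2 powr (2 + \<eta>) * real (d v) powr (2 + \<eta>)" by (simp add: powr_mult)
     also have "\<dots> \<le> 2 powr 3 * real (d v) powr (2 + \<eta>)" using \<eta> by (intro mult_right_mono powr_mono) auto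
     finally show ?thesis by simp
    qed
    then have "(\<Sum>v\<in>{1..n}. real (?d v) powr (2 + \<eta>)) \<le> (\<Sum>v\<in>{1..n}. 8 * real (d v) powr (2 + \<eta>))" by (rule sum_mono)
    also have "\<dots> \<le> 8 * (n * (\<integral>k. ?f3 k \<partial>measure_pmf p) + n)" using b3 Xn by (simp add: sum_distrib_left[symmetric])
    also have "\<dots> = 8 * ((\<integral>k. ?f3 k \<partial>measure_pmf p) + 1) * n" by (simp add: algebra_simps)
    also have "\<dots> \<le> Kg * n" using Kg1 by (intro mult_right_mono) auto
    finally show ?thesis .
   qed
   show "n / Kg \<le> (\<Sum>v | v \<in> {1..n} \<and> 3 \<le> ?d v. real (?d v))"
   proof -
    have "?X \<le> m4 / 2 * n" using n(2) m40 n1 by (simp add: field_simps)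
    moreover have "n * m4 = m4 / 2 * n + m4 / 2 * n" by simp
    moreover have "1 / Kg \<le> m4 / 2" using m4 Kg by (simp add: field_simps)
    then have "1 / Kg * n \<le> m4 / 2 * n" by (intro mult_right_mono) auto
    ultimately have "n / Kg \<le> (\<Sum>v\<in>{1..n}. ?f4 (d v))" using b4 by (simp only: times_divide_eq_left mult_1_left)
    also have "\<dots> \<le> (\<Sum>v\<in>{1..n}. ?f4 (?d v))"
     using fix_parity_ge(1)[of d _ n] by (intro sum_mono) (auto intro: order_trans)
    also have "\<dots> = (\<Sum>v | v \<in> {1..n} \<and> 3 \<le> ?d v. real (?d v))"
     by (rule sum.inter_filter[symmetric]) simp
    finally show ?thesis .
   qed
  qed
  then show ?thesis .
 qed
 have bound: "?P n {d. \<not> dgood n (fix_parity n d)} \<le> ?P n (wbad ?f1 n) + ?P n (wbad ?f2 n) + ?P n (wbad ?f3 n) + ?P n (wbad ?f4 n)"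
  if n: "n \<ge> 1" "2 / m4 * real n powr (1 - \<eta> / 8) \<le> real n powr 1" for n
 proof -
  have "?P n {d. \<not> dgood n (fix_parity n d)} = ?P n ({d. \<not> dgood n (fix_parity n d)} \<inter> set_pmf (degs p n))"
   by (simp add: measure_Int_set_pmf)
  also have "\<dots> \<le> ?P n (wbad ?f1 n \<union> wbad ?f2 n \<union> wbad ?f3 n \<union> wbad ?f4 n)"
  proof (intro measure_pmf.finite_measure_mono subsetI)
   fix d assume d: "d \<in> {d. \<not> dgood n (fix_parity n d)} \<inter> set_pmf (degs p n)"
   then have "d v \<in> set_pmf p" if "v \<in> {1..n}" for v
    using that set_Pi_pmf[of "{1..n}" 0 "\<lambda>_. p"] by (auto simp: PiE_dflt_def)
   then have "\<forall>v\<in>{1..n}. d v \<ge> 2" using supp by (metis atLeast_iff subsetD)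
   then show "d \<in> wbad ?f1 n \<union> wbad ?f2 n \<union> wbad ?f3 n \<union> wbad ?f4 n" using det[OF n] d by blast
  qed simp
  also have "\<dots> \<le> ?P n (wbad ?f1 n) + ?P n (wbad ?f2 n) + ?P n (wbad ?f3 n) + ?P n (wbad ?f4 n)"
   by (intro measure_Un_le[THEN order_trans] add_mono order_refl) auto
  finally show ?thesis .
 qed
 show ?thesis
 proof (rule tendsto_sandwich[OF _ _ tendsto_const])
  show "eventually (\<lambda>n. 0 \<le> ?P n {d. \<not> dgood n (fix_parity n d)}) sequentially" by simp
  show "eventually (\<lambda>n. ?P n {d. \<not> dgood n (fix_parity n d)} \<le> ?P n (wbad ?f1 n) + ?P n (wbad ?f2 n) + ?P n (wbad ?f3 n) + ?P n (wbad ?f4 n)) sequentially"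
   using ev by eventually_elim (rule bound, auto)
  show "(\<lambda>n. ?P n (wbad ?f1 n) + ?P n (wbad ?f2 n) + ?P n (wbad ?f3 n) + ?P n (wbad ?f4 n)) \<longlonglongrightarrow> 0"
   by (intro tendsto_add_zero lims)
 qed
qed

text \<open>One parameter is both the range of degrees and the precision, so the condition gets
  stronger with \<open>J\<close> and finitely many requirements merge into one.\<close>

definition fgood :: "nat \<Rightarrow> nat \<Rightarrow> (nat \<Rightarrow> nat) \<Rightarrow> bool" where
 "fgood J n d \<longleftrightarrow> (\<forall>i\<le>J. \<bar>real (card {v \<in> {1..n}. d v = i}) - pmf p i * n\<bar> \<le> n / (real J + 1))"

lemma fgood_mono: "fgood J' n d \<Longrightarrow> J \<le> J' \<Longrightarrow> fgood J n d"
proof -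
 assume a: "fgood J' n d" "J \<le> J'"
 have "n / (real J' + 1) \<le> n / (real J + 1)" using a(2) by (intro divide_left_mono) auto
 then show ?thesis using a unfolding fgood_def by (meson order_trans)
qed

lemma fgood_whp: "(\<lambda>n. measure_pmf.prob (degs p n) {d. \<not> fgood J n (fix_parity n d)}) \<longlonglongrightarrow> 0"
proof -
 \<comment> \<open>Degree 0 is excluded to keep the function below k^(2 + \<eta>) at k = 0; it has
   probability 0 under \<open>p\<close>.\<close>
 let ?f = "\<lambda>i k. if k = i \<and> k \<noteq> 0 then 1 else (0::real)"
 let ?P = "\<lambda>n. measure_pmf.prob (degs p n)"
 have p0: "pmf p 0 = 0" using supp by (auto simp: set_pmf_eq)
 have mean_f: "(\<integral>k. ?f i k \<partial>measure_pmf p) = pmf p i" for i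
 proof (cases "i = 0")
  case False
  then have "(\<integral>k. ?f i k \<partial>measure_pmf p) = (\<integral>k. indicator {i} k \<partial>measure_pmf p)"
   by (intro Bochner_Integration.integral_cong) (auto simp: indicator_def)
  then show ?thesis by (simp add: measure_pmf_single)
 qed (use p0 in \<open>auto intro!: integral_eq_zero_AE\<close>)
 have lim: "(\<lambda>n. ?P n (wbad (?f i) n)) \<longlonglongrightarrow> 0" for i
 proof (rule wbad_lim)
  fix k show "?f i k \<le> real k powr (2 + \<eta>)"
   using ge_one_powr_ge_zero[of "real k" "2 + \<eta>"] \<eta> by auto
 qed auto
 have ev: "eventually (\<lambda>n. n \<ge> 1 \<and> 2 * (J + 1) * real n powr (1 - \<eta> / 8) \<le> real n powr 1) sequentially"
  using \<eta> by (intro eventually_conj eventually_ge_at_top eventually_powr_le) auto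
 have bound: "?P n {d. \<not> fgood J n (fix_parity n d)} \<le> (\<Sum>i\<le>J. ?P n (wbad (?f i) n))"
  if n: "n \<ge> 1" "2 * (J + 1) * real n powr (1 - \<eta> / 8) \<le> real n powr 1" for n
 proof -
  have "?P n {d. \<not> fgood J n (fix_parity n d)} = ?P n ({d. \<not> fgood J n (fix_parity n d)} \<inter> set_pmf (degs p n))"
   by (simp add: measure_Int_set_pmf)
  also have "\<dots> \<le> ?P n (\<Union>i\<in>{..J}. wbad (?f i) n)"
  proof (intro measure_pmf.finite_measure_mono subsetI)
   fix d assume d: "d \<in> {d. \<not> fgood J n (fix_parity n d)} \<inter> set_pmf (degs p n)"
   have X1: "real n powr (1 - \<eta> / 8) \<ge> 1" using n \<eta> by (intro ge_one_powr_ge_zero) auto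
   from d have "\<not> fgood J n (fix_parity n d)" by simp
   then have "\<exists>i\<le>J. \<not> \<bar>real (card {v \<in> {1..n}. fix_parity n d v = i}) - pmf p i * n\<bar> \<le> n / (real J + 1)"
    by (simp only: fgood_def not_all not_imp simp_thms)
   then obtain i where i: "i \<le> J" "\<not> \<bar>real (card {v \<in> {1..n}. fix_parity n d v = i}) - pmf p i * n\<bar> \<le> n / (real J + 1)"
    by (elim exE conjE)
   have dv: "d v \<noteq> 0" if "v \<in> {1..n}" for v
   proof -
    have "d v \<in> set_pmf p" using d that set_Pi_pmf[of "{1..n}" 0 "\<lambda>_. p"] by (auto simp: PiE_dflt_def)
    then show ?thesis using supp by auto
   qed
   have cardf: "real (card {v \<in> {1..n}. h v = i}) = (\<Sum>v\<in>{1..n}. if h v = i then 1 else 0)" for h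
    by (simp add: sum.If_cases Int_def)
   have e1: "\<bar>(\<Sum>v\<in>{1..n}. if fix_parity n d v = i then 1 else (0::real)) - (\<Sum>v\<in>{1..n}. if d v = i then 1 else 0)\<bar> \<le> 1"
    using card_fix_parity_diff[OF n(1), of "\<lambda>k. if k = i then 1 else (0::real)" d] by (auto split: if_splits)
   have e2: "(\<Sum>v\<in>{1..n}. if d v = i then 1 else (0::real)) = (\<Sum>v\<in>{1..n}. ?f i (d v))"
    using dv by (intro sum.cong) auto
   have "2 * real n powr (1 - \<eta> / 8) \<le> n / (real J + 1)" using n by (simp add: field_simps)
   then have "\<bar>(\<Sum>v\<in>{1..n}. ?f i (d v)) - n * pmf p i\<bar> > real n powr (1 - \<eta> / 8)"
    using i(2) e1 X1 unfolding cardf e2 mult.commute[of "pmf p i"] by linarith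
   then have "d \<in> wbad (?f i) n" unfolding wbad_def mean_f by simp
   then show "d \<in> (\<Union>i\<in>{..J}. wbad (?f i) n)" using i by auto
  qed simp
  also have "\<dots> \<le> (\<Sum>i\<in>{..J}. ?P n (wbad (?f i) n))" by (rule measure_pmf.finite_measure_subadditive_finite) auto
  finally show ?thesis .
 qed
 show ?thesis
 proof (rule tendsto_sandwich[OF _ _ tendsto_const])
  show "eventually (\<lambda>n. 0 \<le> ?P n {d. \<not> fgood J n (fix_parity n d)}) sequentially" by simp
  show "eventually (\<lambda>n. ?P n {d. \<not> fgood J n (fix_parity n d)} \<le> (\<Sum>i\<le>J. ?P n (wbad (?f i) n))) sequentially"
   using ev by eventually_elim (rule bound, auto)
  show "(\<lambda>n. \<Sum>i\<le>J. ?P n (wbad (?f i) n)) \<longlonglongrightarrow> 0" by (intro tendsto_null_sum lim)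
 qed
qed

end

section \<open>Parameters near the trivial ones: hop count and tightness\<close>

text \<open>The exponent of the characteristic function of a centred Poisson variable with mean S^2,
  divided by S. The third-order Taylor remainder is |u|^3 / (6 S).\<close>

lemma square_iexp_limit:
 fixes S :: "nat \<Rightarrow> real"
 assumes S: "filterlim S at_top sequentially"
 shows "(\<lambda>n. of_real ((S n)\<^sup>2) * (iexp (u / S n) - 1) - \<i> * of_real (u * S n)) \<longlonglongrightarrow> of_real (- (u\<^sup>2 / 2))"
proof (rule Lim_transform_bound[THEN Lim_null[THEN iffD2]])
 have "(\<lambda>n. \<bar>u\<bar> ^ 3 / 6 * inverse (S n)) \<longlonglongrightarrow> \<bar>u\<bar> ^ 3 / 6 * 0"
  by (intro tendsto_intros tendsto_inverse_0_at_top S)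
 then show "(\<lambda>n. \<bar>u\<bar> ^ 3 / 6 * inverse (S n)) \<longlonglongrightarrow> 0" by simp
 show "eventually (\<lambda>n. norm (of_real ((S n)\<^sup>2) * (iexp (u / S n) - 1) - \<i> * of_real (u * S n) - of_real (- (u\<^sup>2 / 2)))
  \<le> norm (\<bar>u\<bar> ^ 3 / 6 * inverse (S n))) sequentially"
  using filterlim_at_top_dense[THEN iffD1, OF S, rule_format, of 0]
 proof eventually_elim
  case (elim n)
  let ?s = "S n"
  define \<theta> where "\<theta> = u / ?s"
  have u: "u = \<theta> * ?s" using elim by (simp add: \<theta>_def)
  have "cmod (iexp \<theta> - (\<Sum>k \<le> 2. (\<i> * \<theta>)^k / fact k)) \<le> \<bar>\<theta>\<bar>^(Suc 2) / fact (Suc 2)" by (rule iexp_approx1)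
  moreover have "(\<Sum>k \<le> 2. (\<i> * \<theta>)^k / fact k) = 1 + \<i> * of_real \<theta> - of_real (\<theta>\<^sup>2 / 2)"
   by (simp add: eval_nat_numeral power2_eq_square complex_eq_iff)
  ultimately have b: "cmod (iexp \<theta> - (1 + \<i> * of_real \<theta> - of_real (\<theta>\<^sup>2 / 2))) \<le> \<bar>\<theta>\<bar>^3 / 6"
   by (simp add: eval_nat_numeral)
  have e: "of_real (?s\<^sup>2) * (iexp \<theta> - 1) - \<i> * of_real (u * ?s) - of_real (- (u\<^sup>2 / 2))
    = of_real (?s\<^sup>2) * (iexp \<theta> - (1 + \<i> * of_real \<theta> - of_real (\<theta>\<^sup>2 / 2)))"
   unfolding u by (simp add: power2_eq_square algebra_simps)
  have "cmod (of_real (?s\<^sup>2) * (iexp \<theta> - (1 + \<i> * of_real \<theta> - of_real (\<theta>\<^sup>2 / 2)))) \<le> ?s\<^sup>2 * (\<bar>\<theta>\<bar>^3 / 6)"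
   using b by (simp only: norm_mult norm_of_real abs_of_nonneg zero_le_power2) (rule mult_left_mono, assumption, simp)
  also have "?s\<^sup>2 * (\<bar>\<theta>\<bar>^3 / 6) = \<bar>u\<bar> ^ 3 / 6 * inverse ?s"
  proof -
   have "s\<^sup>2 * ((a / s) ^ 3 / 6) = a ^ 3 / 6 * inverse s" if "s > 0" for a s :: real
    using that by (simp add: power_divide field_simps eval_nat_numeral)
   moreover have "\<bar>\<theta>\<bar> = \<bar>u\<bar> / ?s" using elim by (simp add: \<theta>_def)
   ultimately show ?thesis using elim by simp
  qed
  finally have "cmod (of_real (?s\<^sup>2) * (iexp \<theta> - 1) - \<i> * of_real (u * ?s) - of_real (- (u\<^sup>2 / 2))) \<le> \<bar>u\<bar> ^ 3 / 6 * inverse ?s"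
   unfolding e .
  then show ?case using elim unfolding \<theta>_def by simp
 qed
qed

lemma pmf_norm_expectation_le:
 fixes F :: "'a \<Rightarrow> complex"
 assumes "\<And>x. x \<in> set_pmf q \<Longrightarrow> cmod (F x) \<le> g x" "integrable (measure_pmf q) g"
 shows "cmod (\<integral>x. F x \<partial>measure_pmf q) \<le> (\<integral>x. g x \<partial>measure_pmf q)"
proof -
 have i: "integrable (measure_pmf q) F"
  by (rule Bochner_Integration.integrable_bound[OF assms(2)]) (auto simp: AE_measure_pmf_iff intro: order_trans[OF assms(1)])
 have "cmod (\<integral>x. F x \<partial>measure_pmf q) \<le> (\<integral>x. cmod (F x) \<partial>measure_pmf q)" by (rule integral_norm_bound)
 also have "\<dots> \<le> (\<integral>x. g x \<partial>measure_pmf q)"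
  using i assms by (intro integral_mono_AE) (auto simp: AE_measure_pmf_iff)
 finally show ?thesis .
qed

lemma integrable_pmf_bounded:
 fixes F :: "'a \<Rightarrow> 'b :: {banach, second_countable_topology}"
 assumes "\<And>x. x \<in> set_pmf q \<Longrightarrow> norm (F x) \<le> B"
 shows "integrable (measure_pmf q) F"
 using assms by (intro measure_pmf.integrable_const_bound[where B=B]) (auto simp: AE_measure_pmf_iff)

lemma cmod_exp_imag_ln: "Re \<omega> = 0 \<Longrightarrow> cmod (exp (\<omega> * of_real x)) = 1"
 by (simp add: norm_exp)

context fpp_prob
begin

definition EQ :: "real \<Rightarrow> complex \<Rightarrow> nat \<Rightarrow> complex" where
 "EQ l z n = (\<integral>d. Qn l z n (fix_parity n d) \<partial>measure_pmf (degs p n))"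

lemma fix_parity_two: "n \<ge> 3 \<Longrightarrow> fix_parity n d 1 = d 1" "n \<ge> 3 \<Longrightarrow> fix_parity n d 2 = d 2"
 by (auto simp: fix_parity_def)

lemma degs_ge2: "d \<in> set_pmf (degs p n) \<Longrightarrow> v \<in> {1..n} \<Longrightarrow> fix_parity n d v \<ge> 2"
proof -
 assume a: "d \<in> set_pmf (degs p n)" "v \<in> {1..n}"
 have "d v \<in> set_pmf p" using a set_Pi_pmf[of "{1..n}" 0 "\<lambda>_. p"] by (auto simp: PiE_dflt_def)
 then have "d v \<ge> 2" using supp by auto
 then show ?thesis using fix_parity_ge(1)[of d v n] by linarith
qed

lemma norm_Qn: "cmod z \<le> 1 \<Longrightarrow> d \<in> set_pmf (degs p n) \<Longrightarrow> cmod (Qn l z n (fix_parity n d)) \<le> 1"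
 unfolding Qn_def
proof (rule norm_Qf)
 fix v assume "d \<in> set_pmf (degs p n)" "v \<in> {3..n}"
 then show "fix_parity n d v \<ge> 2" by (intro degs_ge2) auto
qed

lemma integrable_Qn: "cmod z \<le> 1 \<Longrightarrow> integrable (measure_pmf (degs p n)) (\<lambda>d. Qn l z n (fix_parity n d))"
 by (rule integrable_pmf_bounded) (rule norm_Qn)

lemma Qn_setup:
 assumes d: "\<forall>v\<in>{1..n}. d v \<ge> (2::nat)" and n: "n \<ge> 3"
 shows "{3..n} \<subseteq> {1..n}" "card ({1..n} - {3..n}) = 2" "d 1 \<ge> 1" "d 2 \<ge> 1"
  "d 1 + d 2 \<le> (\<Sum>v\<in>{1..n} - {3..n}. d v)" "(\<Sum>v\<in>{1..n}. d v) \<ge> 2 * n"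
proof -
 have e: "{1..n} - {3..n} = {1, 2}" using n by auto
 show "{3..n} \<subseteq> {1..n}" by auto
 show "card ({1..n} - {3..n}) = 2" "d 1 + d 2 \<le> (\<Sum>v\<in>{1..n} - {3..n}. d v)" unfolding e by auto
 have "1 \<in> {1..n}" "2 \<in> {1..n}" using n by auto
 then have "d 1 \<ge> 2" "d 2 \<ge> 2" using d by auto
 then show "d 1 \<ge> 1" "d 2 \<ge> 1" by auto
 have "(\<Sum>v\<in>{1..n}. 2) \<le> (\<Sum>v\<in>{1..n}. d v)" using d by (intro sum_mono) auto
 then show "(\<Sum>v\<in>{1..n}. d v) \<ge> 2 * n" by simp
qed

text \<open>\<open>Qf_approx_uniform\<close> started from the two roots, combined with
  \<open>G_near_power\<close>. The error carries the degrees of the roots, which are unbounded but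
  have finite mean.\<close>

lemma Qn_near_power:
 assumes Om: "Om \<ge> 0"
 shows "\<exists>C\<ge>0. \<exists>r. r \<longlonglongrightarrow> 0 \<and> eventually (\<lambda>n. \<forall>d. dgood n d \<longrightarrow> (\<forall>l z \<omega>. cmod z \<le> 1 \<longrightarrow> Re \<omega> \<le> 0 \<longrightarrow>
   of_real cc * \<omega> = of_real (cc + 1) * (z - 1) + \<i> * of_real l \<longrightarrow> cmod \<omega> \<le> Om \<longrightarrow>
   cmod (Qn l z n d - exp (\<omega> * of_real (ln n))) \<le> C * (cmod \<omega> + cmod (z - 1)) * (1 + real (d 1) + real (d 2)) + r n)) sequentially"
proof -
 from Qf_approx_uniform[OF Om] obtain C0 where C0: "C0 \<ge> 0" and
  ex: "\<forall>k. \<exists>r. r \<longlonglongrightarrow> 0 \<and> eventually (\<lambda>n. \<forall>d. dgood n d \<longrightarrow>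
  (\<forall>l z \<omega> U s b M. cmod z \<le> 1 \<longrightarrow> Re \<omega> \<le> 0 \<longrightarrow> of_real cc * \<omega> = of_real (cc + 1) * (z - 1) + \<i> * of_real l \<longrightarrow>
   cmod \<omega> \<le> Om \<longrightarrow> U \<subseteq> {1..n} \<longrightarrow> card ({1..n} - U) \<le> k + 2 \<longrightarrow> s \<ge> 1 \<longrightarrow> b \<ge> 1 \<longrightarrow>
   s + b \<le> (\<Sum>v\<in>{1..n} - U. d v) \<longrightarrow> M \<ge> n \<longrightarrow>
   cmod (Qf d l z M U s b - G \<omega> (cc * deg_sum n d / real b) (real s))
    \<le> C0 * (cmod \<omega> + cmod (z - 1)) * (real s powr (- (\<eta> / 40)) + real b powr (- (\<eta> / 40))) + cmod (z - 1) + r n)) sequentially"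
  by (elim exE conjE)
 from ex[rule_format, of 0] obtain r where r: "r \<longlonglongrightarrow> 0" and
  ev: "eventually (\<lambda>n. \<forall>d. dgood n d \<longrightarrow>
  (\<forall>l z \<omega> U s b M. cmod z \<le> 1 \<longrightarrow> Re \<omega> \<le> 0 \<longrightarrow> of_real cc * \<omega> = of_real (cc + 1) * (z - 1) + \<i> * of_real l \<longrightarrow>
   cmod \<omega> \<le> Om \<longrightarrow> U \<subseteq> {1..n} \<longrightarrow> card ({1..n} - U) \<le> 0 + 2 \<longrightarrow> s \<ge> 1 \<longrightarrow> b \<ge> 1 \<longrightarrow>
   s + b \<le> (\<Sum>v\<in>{1..n} - U. d v) \<longrightarrow> M \<ge> n \<longrightarrow>
   cmod (Qf d l z M U s b - G \<omega> (cc * deg_sum n d / real b) (real s))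
    \<le> C0 * (cmod \<omega> + cmod (z - 1)) * (real s powr (- (\<eta> / 40)) + real b powr (- (\<eta> / 40))) + cmod (z - 1) + r n)) sequentially"
  by (elim exE conjE)
 define J where "J = \<bar>JJ (cc * (2 * \<mu>)) (cc * (\<mu> / 2))\<bar>"
 define C where "C = 2 * C0 + 2 + J"
 have C: "C \<ge> 0" using C0 by (simp add: C_def J_def)
 show ?thesis
 proof (intro exI[of _ C] exI[of _ r] conjI C r)
  show "eventually (\<lambda>n. \<forall>d. dgood n d \<longrightarrow> (\<forall>l z \<omega>. cmod z \<le> 1 \<longrightarrow> Re \<omega> \<le> 0 \<longrightarrow>
   of_real cc * \<omega> = of_real (cc + 1) * (z - 1) + \<i> * of_real l \<longrightarrow> cmod \<omega> \<le> Om \<longrightarrow>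
   cmod (Qn l z n d - exp (\<omega> * of_real (ln n))) \<le> C * (cmod \<omega> + cmod (z - 1)) * (1 + real (d 1) + real (d 2)) + r n)) sequentially"
   using ev dgood_L eventually_ge_at_top[of 3]
  proof eventually_elim
   case (elim n)
   show ?case
   proof (intro allI impI)
    fix d l z \<omega>
    assume d: "dgood n d" and z: "cmod z \<le> 1" and w: "Re \<omega> \<le> 0"
     and eq: "of_real cc * \<omega> = of_real (cc + 1) * (z - 1) + \<i> * of_real l" and om: "cmod \<omega> \<le> Om"
    have d2: "\<forall>v\<in>{1..n}. d v \<ge> 2" using d by (simp add: dgood_def)
    note st = Qn_setup[OF d2 elim(3)]
    define s b where "s = d 1" and "b = d 2"
    define kap where "kap = cmod \<omega> + cmod (z - 1)"
    have sb: "real s \<ge> 1" "real b \<ge> 1" using st(3,4) by (auto simp: s_def b_def)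
    have kap: "kap \<ge> 0" "cmod \<omega> \<le> kap" "cmod (z - 1) \<le> kap" by (auto simp: kap_def)
    have "cmod (Qf d l z (\<Sum>v\<in>{1..n}. d v) {3..n} (d 1) (d 2) - G \<omega> (cc * deg_sum n d / real (d 2)) (real (d 1)))
     \<le> C0 * (cmod \<omega> + cmod (z - 1)) * (real (d 1) powr (- (\<eta> / 40)) + real (d 2) powr (- (\<eta> / 40))) + cmod (z - 1) + r n"
     by (rule elim(1)[rule_format, OF d z w eq om st(1) _ st(3,4,5)]) (use st(2,6) in linarith)+
    then have 1: "cmod (Qn l z n d - G \<omega> (cc * deg_sum n d / b) s)
      \<le> C0 * kap * (real s powr (- (\<eta> / 40)) + real b powr (- (\<eta> / 40))) + cmod (z - 1) + r n"
     by (simp only: Qn_def s_def b_def kap_def)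
    have 2: "C0 * kap * (real s powr (- (\<eta> / 40)) + real b powr (- (\<eta> / 40))) \<le> C0 * kap * 2"
    proof -
     have "real s powr (- (\<eta> / 40)) \<le> 1" "real b powr (- (\<eta> / 40)) \<le> 1"
      using sb \<eta> powr_mono[of "- (\<eta> / 40)" 0 "real s"] powr_mono[of "- (\<eta> / 40)" 0 "real b"] by auto
     then have "real s powr (- (\<eta> / 40)) + real b powr (- (\<eta> / 40)) \<le> 2" by linarith
     then show ?thesis using C0 kap by (intro mult_left_mono) auto
    qed
    have L: "\<mu> / 2 * n \<le> deg_sum n d" "deg_sum n d \<le> 2 * \<mu> * n" using elim(2) d by auto
    have n1: "real n \<ge> 1" using elim(3) by simp
    have 3: "cmod (G \<omega> (cc * deg_sum n d / b) s - exp (\<omega> * of_real (ln n))) \<le> cmod \<omega> * (JJ (cc * (2 * \<mu>)) (cc * (\<mu> / 2)) + s + b)"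
     using \<mu> by (intro G_near_power w cc n1 sb L) auto
    have 4: "cmod \<omega> * (JJ (cc * (2 * \<mu>)) (cc * (\<mu> / 2)) + s + b) \<le> kap * (J + s + b)"
     
    proof -
     have "cmod \<omega> * (JJ (cc * (2 * \<mu>)) (cc * (\<mu> / 2)) + s + b) \<le> cmod \<omega> * (J + s + b)"
      unfolding J_def by (intro mult_left_mono add_right_mono) auto
     also have "\<dots> \<le> kap * (J + s + b)" unfolding J_def by (intro mult_right_mono kap) auto
     finally show ?thesis .
    qed
    have 5: "cmod (Qn l z n d - exp (\<omega> * of_real (ln n))) \<le> cmod (Qn l z n d - G \<omega> (cc * deg_sum n d / b) s)
      + cmod (G \<omega> (cc * deg_sum n d / b) s - exp (\<omega> * of_real (ln n)))"
     using norm_triangle_ineq[of "Qn l z n d - G \<omega> (cc * deg_sum n d / b) s" "G \<omega> (cc * deg_sum n d / b) s - exp (\<omega> * of_real (ln n))"]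
     by simp
    have 6: "C0 * kap * 2 + kap + kap * (J + s + b) \<le> C * kap * (1 + real s + real b)"
    proof -
     have "C * (1 + real s + real b) - (C0 * 2 + 1 + (J + s + b)) = (2 * C0 + 1 + J) * (real s + real b) + 1"
      by (simp add: C_def algebra_simps)
     moreover have "(2 * C0 + 1 + J) * (real s + real b) \<ge> 0" using C0 by (auto simp: J_def intro!: mult_nonneg_nonneg add_nonneg_nonneg)
     ultimately have "C0 * 2 + 1 + (J + s + b) \<le> C * (1 + real s + real b)" by linarith
     then have "kap * (C0 * 2 + 1 + (J + s + b)) \<le> kap * (C * (1 + real s + real b))" using kap by (intro mult_left_mono) auto
     then show ?thesis by (simp only: distrib_left mult_1_right ac_simps)
    qed
    show "cmod (Qn l z n d - exp (\<omega> * of_real (ln n))) \<le> C * (cmod \<omega> + cmod (z - 1)) * (1 + real (d 1) + real (d 2)) + r n"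
     using 1 2 3 4 5 6 kap unfolding kap_def[symmetric] s_def[symmetric] b_def[symmetric] by linarith
   qed
  qed
 qed
qed

text \<open>Bad degree sequences contribute at most twice their probability, since both quantities
  have modulus at most 1; the root degrees contribute through their mean.\<close>

lemma EQ_near_power:
 assumes Om: "Om \<ge> 0"
 shows "\<exists>C\<ge>0. \<exists>r. r \<longlonglongrightarrow> 0 \<and> eventually (\<lambda>n. \<forall>l z \<omega>. cmod z \<le> 1 \<longrightarrow> Re \<omega> \<le> 0 \<longrightarrow>
   of_real cc * \<omega> = of_real (cc + 1) * (z - 1) + \<i> * of_real l \<longrightarrow> cmod \<omega> \<le> Om \<longrightarrow>
   cmod (EQ l z n - exp (\<omega> * of_real (ln n))) \<le> C * (cmod \<omega> + cmod (z - 1)) + r n) sequentially"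
proof -
 from Qn_near_power[OF Om] obtain C r where C: "C \<ge> 0" and r: "r \<longlonglongrightarrow> 0" and
  ev: "eventually (\<lambda>n. \<forall>d. dgood n d \<longrightarrow> (\<forall>l z \<omega>. cmod z \<le> 1 \<longrightarrow> Re \<omega> \<le> 0 \<longrightarrow>
   of_real cc * \<omega> = of_real (cc + 1) * (z - 1) + \<i> * of_real l \<longrightarrow> cmod \<omega> \<le> Om \<longrightarrow>
   cmod (Qn l z n d - exp (\<omega> * of_real (ln n))) \<le> C * (cmod \<omega> + cmod (z - 1)) * (1 + real (d 1) + real (d 2)) + r n)) sequentially"
  by (elim exE conjE)
 define bad where "bad n = {d. \<not> dgood n (fix_parity n d)}" for n
 define r' where "r' n = \<bar>r n\<bar> + 2 * measure_pmf.prob (degs p n) (bad n)" for n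
 have r': "r' \<longlonglongrightarrow> 0" unfolding r'_def bad_def
  by (intro tendsto_add_zero tendsto_mult_right_zero dgood_whp tendsto_rabs_zero r)
 have C': "C * (1 + 2 * \<mu>) \<ge> 0" using C \<mu> by simp
 have ip: "integrable (measure_pmf p) real" using mom_le[of 1] exponents by simp
 show ?thesis
 proof (intro exI[of _ "C * (1 + 2 * \<mu>)"] exI[of _ r'] conjI C' r')
  show "eventually (\<lambda>n. \<forall>l z \<omega>. cmod z \<le> 1 \<longrightarrow> Re \<omega> \<le> 0 \<longrightarrow>
   of_real cc * \<omega> = of_real (cc + 1) * (z - 1) + \<i> * of_real l \<longrightarrow> cmod \<omega> \<le> Om \<longrightarrow>
   cmod (EQ l z n - exp (\<omega> * of_real (ln n))) \<le> C * (1 + 2 * \<mu>) * (cmod \<omega> + cmod (z - 1)) + r' n) sequentially"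
   using ev eventually_ge_at_top[of 3]
  proof eventually_elim
   case (elim n)
   show ?case
   proof (intro allI impI)
    fix l z \<omega>
    assume z: "cmod z \<le> 1" and w: "Re \<omega> \<le> 0"
     and eq: "of_real cc * \<omega> = of_real (cc + 1) * (z - 1) + \<i> * of_real l" and om: "cmod \<omega> \<le> Om"
    let ?X = "exp (\<omega> * of_real (ln n))"
    let ?M = "measure_pmf (degs p n)"
    define kap where "kap = C * (cmod \<omega> + cmod (z - 1))"
    have kap: "kap \<ge> 0" using C by (simp add: kap_def)
    have X: "cmod ?X \<le> 1" using w elim(2) by (simp add: norm_exp mult_nonpos_nonneg)
    let ?g = "\<lambda>d :: nat \<Rightarrow> nat. kap * (1 + real (d 1) + real (d 2)) + \<bar>r n\<bar> + 2 * indicator (bad n) d"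
    have n12: "1 \<in> {1..n}" "2 \<in> {1..n}" using elim(2) by auto
    have ii: "integrable ?M (\<lambda>d. real (d 1))" "integrable ?M (\<lambda>d. real (d 2))"
     using degs_expectation1(2)[OF n12(1), where f=real and p=p] degs_expectation1(2)[OF n12(2), where f=real and p=p] ip by auto
    have ib: "integrable ?M (indicator (bad n) :: _ \<Rightarrow> real)" by (rule integrable_pmf_bounded[where B=1]) (simp add: indicator_def)
    have ig: "integrable ?M ?g"
     by (intro Bochner_Integration.integrable_add Bochner_Integration.integrable_mult_right ii ib) simp_all
    have "EQ l z n - ?X = (\<integral>d. Qn l z n (fix_parity n d) - ?X \<partial>?M)"
     unfolding EQ_def using integrable_Qn[OF z] by (subst Bochner_Integration.integral_diff) auto
    also have "cmod \<dots> \<le> (\<integral>d. ?g d \<partial>?M)"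
    proof (rule pmf_norm_expectation_le[OF _ ig])
     fix d assume d: "d \<in> set_pmf (degs p n)"
     show "cmod (Qn l z n (fix_parity n d) - ?X) \<le> ?g d"
     proof (cases "d \<in> bad n")
      case True
      have "cmod (Qn l z n (fix_parity n d) - ?X) \<le> 1 + 1"
       by (rule order_trans[OF norm_triangle_ineq4 add_mono[OF norm_Qn[OF z d] X]])
      moreover have "0 \<le> kap * (1 + real (d 1) + real (d 2))" using kap by (intro mult_nonneg_nonneg) auto
      ultimately show ?thesis using True by simp
     next
      case False
      then have g: "dgood n (fix_parity n d)" by (simp add: bad_def)
      have "cmod (Qn l z n (fix_parity n d) - ?X) \<le> C * (cmod \<omega> + cmod (z - 1)) * (1 + real (fix_parity n d 1) + real (fix_parity n d 2)) + r n"
       by (rule elim(1)[rule_format, OF g z w eq om])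
      then show ?thesis using False abs_ge_self[of "r n"] unfolding fix_parity_two[OF elim(2)] kap_def[symmetric] by simp
     qed
    qed
    also have "(\<integral>d. ?g d \<partial>?M) = kap * (1 + \<mu> + \<mu>) + r' n"
    proof -
     have "(\<integral>d. ?g d \<partial>?M) = (\<integral>d. kap * (1 + real (d 1) + real (d 2)) \<partial>?M) + \<bar>r n\<bar> + 2 * (\<integral>d. indicator (bad n) d \<partial>?M)"
      using ii ib by (subst Bochner_Integration.integral_add;
       (intro Bochner_Integration.integrable_add Bochner_Integration.integrable_mult_right ii ib)?; simp)+
     moreover have "(\<integral>d. kap * (1 + real (d 1) + real (d 2)) \<partial>?M) = kap * (1 + \<mu> + \<mu>)"
      using ii degs_expectation1(1)[OF n12(1), where f=real and p=p] degs_expectation1(1)[OF n12(2), where f=real and p=p] mean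
      by simp
     ultimately show ?thesis by (simp add: r'_def)
    qed
    finally show "cmod (EQ l z n - ?X) \<le> C * (1 + 2 * \<mu>) * (cmod \<omega> + cmod (z - 1)) + r' n"
     by (simp add: kap_def algebra_simps)
   qed
  qed
 qed
qed

lemma zero_notin_support: "0 \<notin> set_pmf p" using supp by auto

lemma EQ_eq: "n \<ge> 3 \<Longrightarrow> cmod z \<le> 1 \<Longrightarrow>
 (\<integral>x. lexval l z (costs (snd x) (Pth n (fst x))) \<partial>weighted_CM n p) = EQ l z n"
 unfolding EQ_def by (rule expectation_lexval[OF _ _ zero_notin_support])

text \<open>The case l = 0, z = 1, \<omega> = 0, in which the main error term vanishes.\<close>

lemma prob_conn_lim: "(\<lambda>n. measure (weighted_CM n p) (conn_event n p)) \<longlonglongrightarrow> 1"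
proof -
 from EQ_near_power[of 0] obtain C r where C: "C \<ge> (0::real)" and r: "r \<longlonglongrightarrow> 0" and
  ev: "eventually (\<lambda>n. \<forall>l z \<omega>. cmod z \<le> 1 \<longrightarrow> Re \<omega> \<le> 0 \<longrightarrow>
   of_real cc * \<omega> = of_real (cc + 1) * (z - 1) + \<i> * of_real l \<longrightarrow> cmod \<omega> \<le> 0 \<longrightarrow>
   cmod (EQ l z n - exp (\<omega> * of_real (ln n))) \<le> C * (cmod \<omega> + cmod (z - 1)) + r n) sequentially"
  by auto
 have "eventually (\<lambda>n. norm (measure (weighted_CM n p) (conn_event n p) - 1) \<le> r n) sequentially"
  using ev eventually_ge_at_top[of 3]
 proof eventually_elim
  case (elim n)
  have "cmod (EQ 0 1 n - 1) \<le> r n" using elim(1)[rule_format, of 1 0 0] by simp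
  moreover have "EQ 0 1 n = complex_of_real (measure (weighted_CM n p) (conn_event n p))"
   using prob_conn[of n p] EQ_eq[OF elim(2), of 1 0] by simp
  ultimately have "cmod (of_real (measure (weighted_CM n p) (conn_event n p) - 1)) \<le> r n" by simp
  then show ?case by (simp only: norm_of_real real_norm_def)
 qed
 then have "(\<lambda>n. measure (weighted_CM n p) (conn_event n p) - 1) \<longlonglongrightarrow> 0"
  by (rule Lim_null_comparison[OF _ r])
 then show ?thesis by (simp add: LIM_zero_iff)
qed

text \<open>As z tends to 1, so do \<omega> and z - 1 to 0, and \<open>EQ\<close> is n^\<omega> up
  to a vanishing error. With \<omega> = \<alpha> (z - 1) this is the transform of a Poisson variable
  of mean S^2.\<close>

lemma hop_limit:
 fixes u :: real
 defines "\<alpha> \<equiv> (cc + 1) / cc"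
 defines "S \<equiv> \<lambda>n. sqrt (\<alpha> * ln (real n))"
 shows "(\<lambda>n. iexp (- (u * S n)) * EQ 0 (iexp (u / S n)) n) \<longlonglongrightarrow> exp (of_real (- (u\<^sup>2 / 2)))"
proof -
 have a: "\<alpha> > 0" using cc by (simp add: \<alpha>_def)
 have S: "filterlim S at_top sequentially" unfolding S_def
  by (intro filterlim_compose[OF sqrt_at_top] filterlim_tendsto_pos_mult_at_top[OF tendsto_const a]
    filterlim_compose[OF ln_at_top] filterlim_real_sequentially)
 define z where "z n = iexp (u / S n)" for n
 define \<omega> where "\<omega> n = of_real \<alpha> * (z n - 1)" for n
 from EQ_near_power[of "2 * \<alpha>"] a obtain C r where C: "C \<ge> (0::real)" and r: "r \<longlonglongrightarrow> 0" and
  ev: "eventually (\<lambda>n. \<forall>l z \<omega>. cmod z \<le> 1 \<longrightarrow> Re \<omega> \<le> 0 \<longrightarrow>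
   of_real cc * \<omega> = of_real (cc + 1) * (z - 1) + \<i> * of_real l \<longrightarrow> cmod \<omega> \<le> 2 * \<alpha> \<longrightarrow>
   cmod (EQ l z n - exp (\<omega> * of_real (ln n))) \<le> C * (cmod \<omega> + cmod (z - 1)) + r n) sequentially"
  by auto
 have z1: "cmod (z n) = 1" for n unfolding z_def by (rule norm_exp_i_times)
 have "(\<lambda>n. u * inverse (S n)) \<longlonglongrightarrow> u * 0" by (intro tendsto_intros tendsto_inverse_0_at_top S)
 then have "(\<lambda>n. iexp (u * inverse (S n))) \<longlonglongrightarrow> iexp 0" by (intro tendsto_intros) simp
 then have zlim: "z \<longlonglongrightarrow> 1" unfolding z_def by (simp add: divide_inverse)
 have wlim: "\<omega> \<longlonglongrightarrow> of_real \<alpha> * (1 - 1)" unfolding \<omega>_def by (intro tendsto_intros zlim)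
 have cond: "Re (\<omega> n) \<le> 0" "of_real cc * \<omega> n = of_real (cc + 1) * (z n - 1) + \<i> * of_real 0" "cmod (\<omega> n) \<le> 2 * \<alpha>" for n
 proof -
  have "Re (z n) \<le> 1" using complex_Re_le_cmod[of "z n"] z1 by simp
  then show "Re (\<omega> n) \<le> 0" using a by (simp add: \<omega>_def mult_nonneg_nonpos)
  show "of_real cc * \<omega> n = of_real (cc + 1) * (z n - 1) + \<i> * of_real 0" using cc by (simp add: \<omega>_def \<alpha>_def)
  have "cmod (z n - 1) \<le> 1 + 1" by (rule order_trans[OF norm_triangle_ineq4]) (simp add: z1)
  then have "\<alpha> * cmod (z n - 1) \<le> \<alpha> * 2" using a by (intro mult_left_mono) auto
  then show "cmod (\<omega> n) \<le> 2 * \<alpha>" using a by (simp add: \<omega>_def norm_mult)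
 qed
 have near: "(\<lambda>n. EQ 0 (z n) n - exp (\<omega> n * of_real (ln n))) \<longlonglongrightarrow> 0"
 proof (rule Lim_null_comparison)
  show "eventually (\<lambda>n. norm (EQ 0 (z n) n - exp (\<omega> n * of_real (ln n))) \<le> C * (cmod (\<omega> n) + cmod (z n - 1)) + r n) sequentially"
   using ev
  proof eventually_elim
   case (elim n)
   show ?case by (rule elim[rule_format, OF _ cond]) (simp add: z1)
  qed
  have "(\<lambda>n. C * (cmod (\<omega> n) + cmod (z n - 1)) + r n) \<longlonglongrightarrow> C * (cmod (of_real \<alpha> * (1 - 1)) + cmod (1 - 1)) + 0"
   by (intro tendsto_intros wlim zlim r)
  then show "(\<lambda>n. C * (cmod (\<omega> n) + cmod (z n - 1)) + r n) \<longlonglongrightarrow> 0" by simp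
 qed
 have i1: "cmod (iexp (- (u * S n))) = 1" for n by (rule norm_exp_i_times)
 have "(\<lambda>n. iexp (- (u * S n)) * (EQ 0 (z n) n - exp (\<omega> n * of_real (ln n)))) \<longlonglongrightarrow> 0"
  by (rule Lim_null_comparison[OF _ tendsto_norm_zero[OF near]]) (simp add: norm_mult i1 del: of_real_minus)
 moreover have "(\<lambda>n. iexp (- (u * S n)) * exp (\<omega> n * of_real (ln n))) \<longlonglongrightarrow> exp (of_real (- (u\<^sup>2 / 2)))"
 proof (rule Lim_transform_eventually)
  show "(\<lambda>n. exp (of_real ((S n)\<^sup>2) * (iexp (u / S n) - 1) - \<i> * of_real (u * S n))) \<longlonglongrightarrow> exp (of_real (- (u\<^sup>2 / 2)))"
   by (intro tendsto_exp square_iexp_limit S)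
  show "eventually (\<lambda>n. exp (of_real ((S n)\<^sup>2) * (iexp (u / S n) - 1) - \<i> * of_real (u * S n)) = iexp (- (u * S n)) * exp (\<omega> n * of_real (ln n))) sequentially"
   using eventually_ge_at_top[of 1]
  proof eventually_elim
   case (elim n)
   have "(S n)\<^sup>2 = \<alpha> * ln n" using elim a by (simp add: S_def)
   then show ?case unfolding exp_add[symmetric] \<omega>_def z_def by (simp add: algebra_simps)
  qed
 qed
 ultimately have "(\<lambda>n. iexp (- (u * S n)) * (EQ 0 (z n) n - exp (\<omega> n * of_real (ln n))) + iexp (- (u * S n)) * exp (\<omega> n * of_real (ln n))) \<longlonglongrightarrow> 0 + exp (of_real (- (u\<^sup>2 / 2)))"
  by (rule tendsto_add)
 then show ?thesis by (simp add: right_diff_distrib z_def)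
qed

text \<open>Here \<omega> = i l / c, and the error is linear in l up to o(1), the form in which a
  bound near 0 yields tightness.\<close>

lemma weight_tight:
 "\<exists>C\<ge>0. \<exists>r. r \<longlonglongrightarrow> 0 \<and> eventually (\<lambda>n. \<forall>l::real. \<bar>l\<bar> \<le> 1 \<longrightarrow>
  cmod (iexp (- (l * (ln n / cc))) * EQ l 1 n - 1) \<le> C * \<bar>l\<bar> + r n) sequentially"
proof -
 from EQ_near_power[of "1 / cc"] cc obtain C r where C: "C \<ge> (0::real)" and r: "r \<longlonglongrightarrow> 0" and
  ev: "eventually (\<lambda>n. \<forall>l z \<omega>. cmod z \<le> 1 \<longrightarrow> Re \<omega> \<le> 0 \<longrightarrow>
   of_real cc * \<omega> = of_real (cc + 1) * (z - 1) + \<i> * of_real l \<longrightarrow> cmod \<omega> \<le> 1 / cc \<longrightarrow>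
   cmod (EQ l z n - exp (\<omega> * of_real (ln n))) \<le> C * (cmod \<omega> + cmod (z - 1)) + r n) sequentially"
  by auto
 show ?thesis
 proof (intro exI[of _ "C / cc"] exI[of _ r] conjI r)
  show "C / cc \<ge> 0" using C cc by simp
  show "eventually (\<lambda>n. \<forall>l::real. \<bar>l\<bar> \<le> 1 \<longrightarrow>
  cmod (iexp (- (l * (ln n / cc))) * EQ l 1 n - 1) \<le> C / cc * \<bar>l\<bar> + r n) sequentially"
   using ev
  proof eventually_elim
   case (elim n)
   show ?case
   proof (intro allI impI)
    fix l :: real assume l: "\<bar>l\<bar> \<le> 1"
    define w where "w = \<i> * of_real (l / cc)"
    have nw: "cmod w = \<bar>l\<bar> / cc" using cc by (simp add: w_def norm_mult norm_divide)
    have "cmod (EQ l 1 n - exp (w * of_real (ln n))) \<le> C * (cmod w + cmod (1 - 1)) + r n"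
    proof (rule elim[rule_format])
     show "of_real cc * w = of_real (cc + 1) * (1 - 1) + \<i> * of_real l" using cc by (simp add: w_def)
     show "cmod w \<le> 1 / cc" unfolding nw using l cc by (intro divide_right_mono) auto
    qed (auto simp: w_def)
    then have 1: "cmod (EQ l 1 n - exp (w * of_real (ln n))) \<le> C / cc * \<bar>l\<bar> + r n" unfolding nw by simp
    have e: "iexp (- (l * (ln n / cc))) * exp (w * of_real (ln n)) = 1"
     unfolding exp_add[symmetric] w_def by (simp add: algebra_simps)
    have "iexp (- (l * (ln n / cc))) * EQ l 1 n - 1 = iexp (- (l * (ln n / cc))) * (EQ l 1 n - exp (w * of_real (ln n)))"
     unfolding right_diff_distrib e ..
    then have "cmod (iexp (- (l * (ln n / cc))) * EQ l 1 n - 1) = cmod (EQ l 1 n - exp (w * of_real (ln n)))"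
     by (simp only: norm_mult norm_exp_i_times mult_1_left)
    then show "cmod (iexp (- (l * (ln n / cc))) * EQ l 1 n - 1) \<le> C / cc * \<bar>l\<bar> + r n" using 1 by simp
   qed
  qed
 qed
qed

end

section \<open>Convergence of the weight transform by finitely many exact steps\<close>

text \<open>Compares an average over the unexplored stubs with a size-biased expectation: degrees
  above \<open>K\<close> are dropped, \<open>q\<close> is replaced by its limit, frequencies by
  probabilities, and the tail of the limit is restored. The error \<open>\<Xi>\<close> is kept as an
  expectation and not as a supremum, so that it can be iterated.\<close>

lemma frequency_average:
 fixes q \<Psi> :: "nat \<Rightarrow> complex" and \<Xi> :: "nat \<Rightarrow> real" and d :: "nat \<Rightarrow> nat" and L \<mu> :: real
 assumes U: "finite U" and L: "L > 0" "(\<Sum>v\<in>U. real (d v)) \<le> L" and \<mu>: "\<mu> > 0"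
  and q: "\<And>v. v \<in> U \<Longrightarrow> cmod (q v) \<le> 1" and Psi: "\<And>i. cmod (\<Psi> i) \<le> 1" and Xi: "\<And>i. 0 \<le> \<Xi> i" "\<And>i. \<Xi> i \<le> B"
  and near: "\<And>v. v \<in> U \<Longrightarrow> d v \<le> K \<Longrightarrow> cmod (q v - \<Psi> (d v)) \<le> \<Xi> (d v) + \<epsilon>"
  and tail: "(\<Sum>v\<in>{v\<in>U. K < d v}. real (d v)) / L \<le> \<epsilon>"
  and freq: "\<And>i. i \<le> K \<Longrightarrow> \<bar>i * real (card {v\<in>U. d v = i}) / L - i * pmf p i / \<mu>\<bar> \<le> \<epsilon> / (real K + 1)"
  and ip: "integrable (measure_pmf p) real" and ptail: "(\<integral>i. real i / \<mu> * indicator {K<..} i \<partial>measure_pmf p) \<le> \<epsilon>"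
  and eps: "\<epsilon> \<ge> 0"
 shows "cmod ((\<Sum>v\<in>U. of_nat (d v) * q v) / of_real L - (\<integral>i. of_real (real i / \<mu>) * \<Psi> i \<partial>measure_pmf p))
  \<le> (\<integral>i. real i / \<mu> * \<Xi> i \<partial>measure_pmf p) + \<epsilon> * (4 + B)"
proof -
 define U0 U1 where "U0 = {v\<in>U. d v \<le> K}" and "U1 = {v\<in>U. K < d v}"
 have fin: "finite U0" "finite U1" using U by (auto simp: U0_def U1_def)
 have UU: "U = U0 \<union> U1" "U0 \<inter> U1 = {}" by (auto simp: U0_def U1_def)
 have B: "B \<ge> 0" using Xi[of 0] by linarith
 define N where "N i = real (card {v\<in>U. d v = i})" for i
 define w where "w i = pmf p i * (real i / \<mu>)" for i
 have fr: "\<bar>i * N i / L - w i\<bar> \<le> \<epsilon> / (real K + 1)" if "i \<le> K" for i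
  using freq[OF that] by (simp add: N_def w_def mult.commute)
 have grp: "(\<Sum>v\<in>U0. F (d v)) = (\<Sum>i\<le>K. of_real (N i) * F i)" for F :: "nat \<Rightarrow> 'z :: real_normed_algebra_1"
 proof -
  have "(\<Sum>v\<in>U0. F (d v)) = (\<Sum>i\<in>{..K}. \<Sum>v\<in>{v\<in>U0. d v = i}. F (d v))"
   by (rule sum.group[symmetric]) (use fin in \<open>auto simp: U0_def\<close>)
  also have "\<dots> = (\<Sum>i\<in>{..K}. of_real (N i) * F i)"
  proof (rule sum.cong[OF refl])
   fix i assume i: "i \<in> {..K}"
   then have e: "{v\<in>U0. d v = i} = {v\<in>U. d v = i}" by (auto simp: U0_def)
   show "(\<Sum>v\<in>{v\<in>U0. d v = i}. F (d v)) = of_real (N i) * F i" unfolding e N_def by simp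
  qed
  finally show ?thesis .
 qed
 have sumle: "(\<Sum>i\<le>K. \<bar>i * N i / L - w i\<bar>) \<le> \<epsilon>"
 proof -
  have "(\<Sum>i\<le>K. \<bar>i * N i / L - w i\<bar>) \<le> (\<Sum>i\<le>K. \<epsilon> / (real K + 1))" by (intro sum_mono fr) simp
  also have "\<dots> = \<epsilon>" by (simp add: field_simps)
  finally show ?thesis .
 qed
 define S1 where "S1 = (\<Sum>v\<in>U0. of_nat (d v) * q v) / of_real L"
 define S2 where "S2 = (\<Sum>v\<in>U0. of_nat (d v) * \<Psi> (d v)) / of_real L"
 define S3 where "S3 = (\<Sum>i\<le>K. of_real (w i) * \<Psi> i)"
 define X3 where "X3 = (\<Sum>i\<le>K. w i * \<Xi> i)"
 have t1: "cmod ((\<Sum>v\<in>U. of_nat (d v) * q v) / of_real L - S1) \<le> \<epsilon>"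
 proof -
  have "(\<Sum>v\<in>U. of_nat (d v) * q v) / of_real L - S1 = (\<Sum>v\<in>U1. of_nat (d v) * q v) / of_real L"
   unfolding S1_def UU(1) by (subst sum.union_disjoint[OF fin UU(2)]) (simp add: add_divide_distrib)
  also have "cmod \<dots> \<le> (\<Sum>v\<in>U1. real (d v)) / L"
  proof -
   have "cmod (\<Sum>v\<in>U1. of_nat (d v) * q v) \<le> (\<Sum>v\<in>U1. real (d v))"
    using q by (intro sum_norm_le) (auto simp: U1_def norm_mult intro!: mult_left_le)
   then show ?thesis using L by (simp add: norm_divide divide_right_mono)
  qed
  finally show ?thesis using tail by (simp add: U1_def)
 qed
 have t2: "cmod (S1 - S2) \<le> X3 + \<epsilon> * B + \<epsilon>"
 proof -
  have "S1 - S2 = (\<Sum>v\<in>U0. of_nat (d v) * (q v - \<Psi> (d v))) / of_real L"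
   unfolding S1_def S2_def by (simp add: diff_divide_distrib sum_subtractf right_diff_distrib)
  also have "cmod \<dots> \<le> (\<Sum>v\<in>U0. real (d v) * (\<Xi> (d v) + \<epsilon>)) / L"
  proof -
   have "cmod (\<Sum>v\<in>U0. of_nat (d v) * (q v - \<Psi> (d v))) \<le> (\<Sum>v\<in>U0. real (d v) * (\<Xi> (d v) + \<epsilon>))"
    using near by (intro sum_norm_le) (auto simp: U0_def norm_mult intro!: mult_left_mono)
   then show ?thesis using L by (simp add: norm_divide divide_right_mono)
  qed
  also have "\<dots> = (\<Sum>v\<in>U0. real (d v) * \<Xi> (d v)) / L + \<epsilon> * ((\<Sum>v\<in>U0. real (d v)) / L)"
   by (simp add: distrib_left sum.distrib add_divide_distrib sum_distrib_right[symmetric])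
  also have "\<epsilon> * ((\<Sum>v\<in>U0. real (d v)) / L) \<le> \<epsilon> * 1"
  proof (rule mult_left_mono[OF _ eps])
   have "(\<Sum>v\<in>U0. real (d v)) \<le> (\<Sum>v\<in>U. real (d v))" using U by (intro sum_mono2) (auto simp: U0_def)
   then show "(\<Sum>v\<in>U0. real (d v)) / L \<le> 1" using L by simp
  qed
  also have "(\<Sum>v\<in>U0. real (d v) * \<Xi> (d v)) / L = (\<Sum>i\<le>K. (i * N i / L) * \<Xi> i)"
   unfolding grp[of "\<lambda>i. real i * \<Xi> i"] sum_divide_distrib by (simp add: ac_simps)
  also have "\<dots> = X3 + (\<Sum>i\<le>K. (i * N i / L - w i) * \<Xi> i)"
   by (simp add: X3_def left_diff_distrib sum_subtractf)
  also have "(\<Sum>i\<le>K. (i * N i / L - w i) * \<Xi> i) \<le> (\<Sum>i\<le>K. \<bar>i * N i / L - w i\<bar> * B)"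
   using Xi B by (intro sum_mono mult_mono abs_ge_self) auto
  also have "\<dots> \<le> \<epsilon> * B" unfolding sum_distrib_right[symmetric] using sumle B by (rule mult_right_mono)
  finally show ?thesis by simp
 qed
 have t3: "cmod (S2 - S3) \<le> \<epsilon>"
 proof -
  have "S2 = (\<Sum>i\<le>K. of_real (i * N i / L) * \<Psi> i)"
   unfolding S2_def grp[of "\<lambda>i. of_nat i * \<Psi> i"] sum_divide_distrib by (simp add: ac_simps)
  then have "S2 - S3 = (\<Sum>i\<le>K. of_real (i * N i / L - w i) * \<Psi> i)"
   by (simp only: S3_def sum_subtractf left_diff_distrib of_real_diff)
  also have "cmod \<dots> \<le> (\<Sum>i\<le>K. \<bar>i * N i / L - w i\<bar>)"
   using Psi by (intro sum_norm_le) (simp only: norm_mult norm_of_real, rule mult_left_le, auto)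
  finally show ?thesis using sumle by simp
 qed
 have split: "(\<integral>i. f i \<partial>measure_pmf p) = (\<Sum>i\<le>K. pmf p i *\<^sub>R f i) + (\<integral>i. indicator {K<..} i *\<^sub>R f i \<partial>measure_pmf p)"
  if f: "integrable (measure_pmf p) f" for f :: "nat \<Rightarrow> 'z :: {banach, second_countable_topology}"
 proof -
  have i: "integrable (measure_pmf p) (\<lambda>i. indicator A i *\<^sub>R f i)" for A :: "nat set"
   using f by (intro integrable_mult_indicator) auto
  have "(\<integral>i. f i \<partial>measure_pmf p) = (\<integral>i. indicator {..K} i *\<^sub>R f i + indicator {K<..} i *\<^sub>R f i \<partial>measure_pmf p)"
   by (intro Bochner_Integration.integral_cong) (auto simp: indicator_def)
  also have "\<dots> = (\<integral>i. indicator {..K} i *\<^sub>R f i \<partial>measure_pmf p) + (\<integral>i. indicator {K<..} i *\<^sub>R f i \<partial>measure_pmf p)"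
   by (rule Bochner_Integration.integral_add) (rule i)+
  also have "(\<integral>i. indicator {..K} i *\<^sub>R f i \<partial>measure_pmf p) = (\<Sum>i\<in>{..K}. pmf p i *\<^sub>R (indicator {..K} i *\<^sub>R f i))"
   by (rule integral_measure_pmf) (auto simp: indicator_def split: if_splits)
  also have "\<dots> = (\<Sum>i\<in>{..K}. pmf p i *\<^sub>R f i)" by (intro sum.cong) auto
  finally show ?thesis .
 qed
 have iP: "integrable (measure_pmf p) (\<lambda>i. of_real (real i / \<mu>) * \<Psi> i)"
 proof (rule Bochner_Integration.integrable_bound)
  show "integrable (measure_pmf p) (\<lambda>i. real i / \<mu>)" using ip by simp
  show "AE i in measure_pmf p. norm (of_real (real i / \<mu>) * \<Psi> i) \<le> norm (real i / \<mu>)"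
   using Psi by (intro always_eventually allI) (simp only: norm_mult norm_of_real real_norm_def, rule mult_left_le, auto)
 qed simp
 have iX: "integrable (measure_pmf p) (\<lambda>i. real i / \<mu> * \<Xi> i)"
 proof (rule Bochner_Integration.integrable_bound)
  show "integrable (measure_pmf p) (\<lambda>i. real i / \<mu> * B)" using ip by simp
  show "AE i in measure_pmf p. norm (real i / \<mu> * \<Xi> i) \<le> norm (real i / \<mu> * B)"
   using Xi \<mu> B by (intro always_eventually allI) (simp add: abs_mult mult_left_mono divide_right_mono)
 qed simp
 have t4: "cmod (S3 - (\<integral>i. of_real (real i / \<mu>) * \<Psi> i \<partial>measure_pmf p)) \<le> \<epsilon>"
 proof -
  have "(\<integral>i. of_real (real i / \<mu>) * \<Psi> i \<partial>measure_pmf p) = S3 + (\<integral>i. indicator {K<..} i *\<^sub>R (of_real (real i / \<mu>) * \<Psi> i) \<partial>measure_pmf p)"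
   unfolding split[OF iP] S3_def w_def by (simp add: scaleR_conv_of_real ac_simps)
  then have "cmod (S3 - (\<integral>i. of_real (real i / \<mu>) * \<Psi> i \<partial>measure_pmf p)) = cmod (\<integral>i. indicator {K<..} i *\<^sub>R (of_real (real i / \<mu>) * \<Psi> i) \<partial>measure_pmf p)"
   by simp
  also have "\<dots> \<le> (\<integral>i. real i / \<mu> * indicator {K<..} i \<partial>measure_pmf p)"
  proof (rule pmf_norm_expectation_le)
   show "integrable (measure_pmf p) (\<lambda>i. real i / \<mu> * indicator {K<..} i)"
    using integrable_mult_indicator[of "{K<..}" "measure_pmf p" "\<lambda>i. real i / \<mu>"] ip by (simp add: mult.commute)
   fix i
   have "real i / \<mu> * cmod (\<Psi> i) \<le> real i / \<mu>" using \<mu> Psi by (intro mult_left_le) auto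
   then show "cmod (indicator {K<..} i *\<^sub>R (of_real (real i / \<mu>) * \<Psi> i)) \<le> real i / \<mu> * indicator {K<..} i"
    using \<mu> by (simp add: indicator_def norm_mult norm_divide)
  qed
  finally show ?thesis using ptail by simp
 qed
 have t5: "X3 \<le> (\<integral>i. real i / \<mu> * \<Xi> i \<partial>measure_pmf p)"
 proof -
  have "(\<integral>i. indicator {K<..} i *\<^sub>R (real i / \<mu> * \<Xi> i) \<partial>measure_pmf p) \<ge> 0"
   using Xi \<mu> by (intro Bochner_Integration.integral_nonneg) (auto simp: indicator_def)
  then show ?thesis unfolding split[OF iX] X3_def w_def by (simp add: ac_simps)
 qed
 have tri: "cmod (a - e) \<le> cmod (a - b) + cmod (b - c) + cmod (c - f) + cmod (f - e)" for a b c f e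
  using norm_triangle_ineq[of "a - b" "b - c"] norm_triangle_ineq[of "a - c" "c - f"] norm_triangle_ineq[of "a - f" "f - e"] by simp
 have "\<epsilon> * (4 + B) = \<epsilon> + \<epsilon> + \<epsilon> + \<epsilon> + \<epsilon> * B" by (simp add: algebra_simps)
 then show ?thesis using tri[of "(\<Sum>v\<in>U. of_nat (d v) * q v) / of_real L" "\<integral>i. of_real (real i / \<mu>) * \<Psi> i \<partial>measure_pmf p" S1 S2 S3] t1 t2 t3 t4 t5
  by linarith
qed

context fpp_prob
begin

lemma integrable_id: "integrable (measure_pmf p) real" using mom_le[of 1] exponents by simp

lemma size_biased_tail:
 assumes "\<epsilon> > 0"
 shows "eventually (\<lambda>K. (\<integral>i. real i / \<mu> * indicator {K<..} i \<partial>measure_pmf p) \<le> \<epsilon>) sequentially"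
proof -
 have "(\<lambda>K. \<integral>i. real i / \<mu> * indicator {K<..} i \<partial>measure_pmf p) \<longlonglongrightarrow> (\<integral>i. 0 \<partial>measure_pmf p)"
 proof (rule integral_dominated_convergence)
  show "integrable (measure_pmf p) (\<lambda>i. real i / \<mu>)" using integrable_id by simp
  show "AE i in measure_pmf p. (\<lambda>K. real i / \<mu> * indicator {K<..} i) \<longlonglongrightarrow> 0"
  proof (intro always_eventually allI)
   fix i :: nat
   have "eventually (\<lambda>K. real i / \<mu> * indicator {K<..} i = 0) sequentially"
    using eventually_ge_at_top[of i] by eventually_elim simp
   then show "(\<lambda>K. real i / \<mu> * indicator {K<..} i) \<longlonglongrightarrow> 0" by (rule tendsto_eventually)
  qed
  show "AE i in measure_pmf p. norm (real i / \<mu> * indicator {K<..} i) \<le> real i / \<mu>" for K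
   using \<mu> by (auto simp: indicator_def)
 qed auto
 then show ?thesis using assms by (auto dest!: order_tendstoD(2)[where a=\<epsilon>] elim: eventually_mono)
qed

text \<open>With t the total number of free stubs, \<open>L\<close> is the number of possible
  partners of a ringing stub. \<open>K\<close> comes from the second moment, as degrees above
  \<open>K\<close> carry at most (m2 + 1) n / K stubs; \<open>J\<close> is chosen after
  \<open>K\<close>, fine enough for frequencies weighted by degrees up to \<open>K\<close>.\<close>

lemma frequencies:
 fixes t :: real
 assumes eps: "\<epsilon> > 0" and t: "t \<ge> 0"
 shows "\<exists>K. (\<integral>i. real i / \<mu> * indicator {K<..} i \<partial>measure_pmf p) \<le> \<epsilon> \<and> (\<exists>J. eventually (\<lambda>n. \<forall>d U. dgood n d \<longrightarrow> fgood J n d \<longrightarrow>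
  U \<subseteq> {1..n} \<longrightarrow> card ({1..n} - U) \<le> j + 2 \<longrightarrow> (let L = t + (\<Sum>v\<in>U. real (d v)) - 1 in
   L > 0 \<and> t / L \<le> \<epsilon> \<and> (\<Sum>v\<in>{v\<in>U. K < d v}. real (d v)) / L \<le> \<epsilon> \<and>
   (\<forall>i\<le>K. \<bar>i * real (card {v\<in>U. d v = i}) / L - i * pmf p i / \<mu>\<bar> \<le> \<epsilon> / (real K + 1)))) sequentially)"
proof -
 have "eventually (\<lambda>K::nat. 4 * (m2 + 1) / (\<epsilon> * \<mu>) \<le> real K) sequentially"
  using filterlim_real_sequentially by (simp add: filterlim_at_top)
 then obtain K where K: "(\<integral>i. real i / \<mu> * indicator {K<..} i \<partial>measure_pmf p) \<le> \<epsilon>" "4 * (m2 + 1) / (\<epsilon> * \<mu>) \<le> real K"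
  using eventually_happens'[OF sequentially_bot eventually_conj[OF size_biased_tail[OF eps]]] by blast
 define \<epsilon>' where "\<epsilon>' = \<epsilon> / (real K + 1)"
 have eps': "\<epsilon>' > 0" using eps by (simp add: \<epsilon>'_def)
 obtain J where J: "real J \<ge> 16 * (real K + 1) / (\<mu> * \<epsilon>')" "J \<ge> K"
  using real_arch_simple[of "16 * (real K + 1) / (\<mu> * \<epsilon>')"] by (meson max.cobounded1 max.cobounded2 of_nat_mono order_trans)
 define X where "X n = t + 1 + (3 + Kg) * real n powr (1 - \<eta> / 10) + Kg * real n powr (1 - \<eta> / 8)" for n :: nat
 have sub: "eventually (\<lambda>n. X n \<le> \<delta> * n) sequentially" if "\<delta> > 0" for \<delta> :: real
 proof -
  have "eventually (\<lambda>n. 3 * (t + 1) / \<delta> * real n powr 0 \<le> real n powr 1) sequentially"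
   "eventually (\<lambda>n. 3 * (3 + Kg) / \<delta> * real n powr (1 - \<eta> / 10) \<le> real n powr 1) sequentially"
   "eventually (\<lambda>n. 3 * Kg / \<delta> * real n powr (1 - \<eta> / 8) \<le> real n powr 1) sequentially"
   using \<eta> by (intro eventually_powr_le; simp)+
  then show ?thesis using eventually_ge_at_top[of 1]
  proof eventually_elim
   case (elim n)
   have "3 * (t + 1) \<le> \<delta> * n" "3 * ((3 + Kg) * real n powr (1 - \<eta> / 10)) \<le> \<delta> * n" "3 * (Kg * real n powr (1 - \<eta> / 8)) \<le> \<delta> * n"
    using elim that by (auto simp: field_simps)
   moreover have "a + b + c \<le> D" if "3 * a \<le> D" "3 * b \<le> D" "3 * c \<le> D" for a b c D :: real using that by linarith
   ultimately show ?case unfolding X_def by blast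
  qed
 qed
 show ?thesis
 proof (rule exI[of _ K], rule conjI[OF K(1)], rule exI[of _ J])
  show "eventually (\<lambda>n. \<forall>d U. dgood n d \<longrightarrow> fgood J n d \<longrightarrow>
  U \<subseteq> {1..n} \<longrightarrow> card ({1..n} - U) \<le> j + 2 \<longrightarrow> (let L = t + (\<Sum>v\<in>U. real (d v)) - 1 in
   L > 0 \<and> t / L \<le> \<epsilon> \<and> (\<Sum>v\<in>{v\<in>U. K < d v}. real (d v)) / L \<le> \<epsilon> \<and>
   (\<forall>i\<le>K. \<bar>i * real (card {v\<in>U. d v = i}) / L - i * pmf p i / \<mu>\<bar> \<le> \<epsilon> / (real K + 1)))) sequentially"
  proof -
   have evs: "eventually (\<lambda>n. X n \<le> \<mu> / 2 * n) sequentially" "eventually (\<lambda>n. X n \<le> \<epsilon> * (\<mu> / 2) * n) sequentially"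
    "eventually (\<lambda>n. X n \<le> \<mu> * \<mu> * \<epsilon>' / (real K + 1) / 4 * n) sequentially" "eventually (\<lambda>n. X n \<le> 1 * real n) sequentially"
    by (rule sub; use \<mu> eps eps' in simp)+
   have evp: "eventually (\<lambda>n. real j * real n powr 0 \<le> real n powr (3/5)) sequentially"
    "eventually (\<lambda>n. 16 * (real K + 1) * (real j + 2) / (\<mu> * \<epsilon>') * real n powr 0 \<le> real n powr 1) sequentially"
    by (intro eventually_powr_le; simp)+
   from evs evp eventually_ge_at_top[of 1] show ?thesis
  proof eventually_elim
   case (elim n)
   have A1: "X n \<le> \<mu> / 2 * n" using elim(1) \<mu> by simp
   have A2: "X n \<le> \<epsilon> * (\<mu> / 2) * n" using elim(2) \<mu> eps by simp
   define Q where "Q = \<mu> * \<mu> * \<epsilon>' / (real K + 1) * n"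
   have Q0: "Q \<ge> 0" using \<mu> eps' by (simp add: Q_def)
   have A3: "X n \<le> Q / 4" using elim(3) \<mu> eps' unfolding Q_def by simp
   have n1: "n \<ge> 1" by (rule elim)
   have A5: "real j \<le> real n powr (3/5)" using elim(5) n1 by simp
   have A6: "16 * (real K + 1) * (real j + 2) / (\<mu> * \<epsilon>') \<le> n" using elim(6) n1 by simp
   show ?case
   proof (intro allI impI)
    fix d U
    assume d: "dgood n d" and f: "fgood J n d" and U: "U \<subseteq> {1..n}" "card ({1..n} - U) \<le> j + 2"
    define L where "L = t + (\<Sum>v\<in>U. real (d v)) - 1"
    have finU: "finite U" using U finite_subset by blast
    have comp: "\<bar>L - \<mu> * n\<bar> \<le> X n"
    proof -
     have c: "(\<Sum>v\<in>{1..n} - U. real (d v)) \<le> (3 + Kg) * real n powr (1 - \<eta> / 10)"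
      and c0: "(\<Sum>v\<in>{1..n} - U. real (d v)) \<ge> 0"
     proof -
      have "(\<Sum>v\<in>{1..n} - U. real (d v)) \<le> (\<Sum>v\<in>{1..n} - U. (real (d v))\<^sup>2)"
      proof (rule sum_mono)
       fix v
       have "d v \<le> d v * d v" by (cases "d v") auto
       then show "real (d v) \<le> (real (d v))\<^sup>2" unfolding power2_eq_square of_nat_mult[symmetric] by (rule of_nat_mono)
      qed
      also have "\<dots> \<le> (3 + Kg) * real n powr (1 - \<eta> / 10)"
      proof (rule sum_squares_small[OF d _ _ n1])
       have "real (card ({1..n} - U)) \<le> real (j + 2)" using U(2) by (rule of_nat_mono)
       then show "real (card ({1..n} - U)) \<le> real n powr (3/5) + 2" using A5 by simp
      qed auto
      finally show "(\<Sum>v\<in>{1..n} - U. real (d v)) \<le> (3 + Kg) * real n powr (1 - \<eta> / 10)" .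
      show "(\<Sum>v\<in>{1..n} - U. real (d v)) \<ge> 0" by (intro sum_nonneg) simp
     qed
     have "(\<Sum>v\<in>{1..n}. real (d v)) = (\<Sum>v\<in>{1..n} - U. real (d v)) + (\<Sum>v\<in>U. real (d v))"
      using U by (intro sum.subset_diff) auto
     moreover have "deg_sum n d = (\<Sum>v\<in>{1..n}. real (d v))" by (simp add: deg_sum_def)
     moreover have "\<bar>deg_sum n d - \<mu> * n\<bar> \<le> Kg * real n powr (1 - \<eta> / 8)" using d by (simp add: dgood_def)
     ultimately show ?thesis using c c0 t unfolding L_def X_def by linarith
    qed
    have L2: "L \<ge> \<mu> / 2 * n" using comp A1 by (simp add: field_simps)
    have np: "real n > 0" using n1 by simp
    have L0: "L > 0" using L2 \<mu> np by (smt (verit) mult_pos_pos half_gt_zero)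
    have X0: "t \<le> X n" "0 \<le> X n" using Kg t by (auto simp: X_def)
    have g1: "t / L \<le> \<epsilon>"
    proof -
     have "t \<le> \<epsilon> * (\<mu> / 2 * n)" using X0 A2 by (simp add: ac_simps)
     also have "\<dots> \<le> \<epsilon> * L" using L2 eps by (intro mult_left_mono) auto
     finally show ?thesis using L0 by (simp add: divide_le_eq)
    qed
    have K0: "real K > 0"
    proof -
     have "4 * (m2 + 1) / (\<epsilon> * \<mu>) > 0" using m2 \<mu> eps by simp
     then show ?thesis using K(2) by linarith
    qed
    have g2: "(\<Sum>v\<in>{v\<in>U. K < d v}. real (d v)) / L \<le> \<epsilon>"
    proof -
     have "K * (\<Sum>v\<in>{v\<in>U. K < d v}. real (d v)) \<le> (\<Sum>v\<in>{v\<in>U. K < d v}. (real (d v))\<^sup>2)"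
      unfolding sum_distrib_left power2_eq_square by (intro sum_mono mult_right_mono) auto
     also have "\<dots> \<le> (\<Sum>v\<in>{1..n}. (real (d v))\<^sup>2)" using U by (intro sum_mono2) auto
     also have "\<dots> \<le> m2 * n + Kg * real n powr (1 - \<eta> / 8)" using d unfolding dgood_def by linarith
     also have "\<dots> \<le> (m2 + 1) * n"
     proof -
      have "Kg * real n powr (1 - \<eta> / 8) \<le> X n" using Kg t by (simp add: X_def)
      then show ?thesis using elim(4) by (simp add: algebra_simps)
     qed
     finally have h: "K * (\<Sum>v\<in>{v\<in>U. K < d v}. real (d v)) \<le> (m2 + 1) * n" .
     have "4 * (m2 + 1) \<le> K * (\<epsilon> * \<mu>)" using K(2) eps \<mu> by (simp add: divide_le_eq)
     then have "4 * (m2 + 1) * n \<le> K * (\<epsilon> * \<mu>) * n" by (intro mult_right_mono) auto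
     moreover have "K * (\<epsilon> * (\<mu> / 2 * n)) \<le> K * (\<epsilon> * L)" using L2 eps by (intro mult_left_mono) auto
     moreover have "K * (\<epsilon> * (\<mu> / 2 * n)) = K * (\<epsilon> * \<mu>) * n / 2" by simp
     moreover have "(m2 + 1) * n \<ge> 0" using m2 \<mu> by simp
     ultimately have "K * (\<Sum>v\<in>{v\<in>U. K < d v}. real (d v)) \<le> K * (\<epsilon> * L)" using h by linarith
     then have "(\<Sum>v\<in>{v\<in>U. K < d v}. real (d v)) \<le> \<epsilon> * L" using K0 by (rule mult_left_le_imp_le)
     then show ?thesis using L0 by (simp add: divide_le_eq)
    qed
    have g3: "\<bar>i * real (card {v\<in>U. d v = i}) / L - i * pmf p i / \<mu>\<bar> \<le> \<epsilon>'" if i: "i \<le> K" for i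
    proof -
     define N where "N = real (card {v\<in>U. d v = i})"
     have N: "\<bar>N - pmf p i * n\<bar> \<le> n / (real J + 1) + (j + 2)"
     proof -
      have a: "\<bar>real (card {v \<in> {1..n}. d v = i}) - pmf p i * n\<bar> \<le> n / (real J + 1)"
       using f i J(2) unfolding fgood_def by (meson order_trans)
      have b: "card {v\<in>U. d v = i} \<le> card {v \<in> {1..n}. d v = i}" using U by (intro card_mono) auto
      have "card {v \<in> {1..n}. d v = i} \<le> card ({v\<in>U. d v = i} \<union> ({1..n} - U))" using finU by (intro card_mono) auto
      also have "\<dots> \<le> card {v\<in>U. d v = i} + card ({1..n} - U)" by (rule card_Un_le)
      finally have "card {v \<in> {1..n}. d v = i} \<le> card {v\<in>U. d v = i} + (j + 2)" using U(2) by linarith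
      then have "real (card {v \<in> {1..n}. d v = i}) \<le> N + (j + 2)" unfolding N_def by linarith
      moreover have "N \<le> real (card {v \<in> {1..n}. d v = i})" using b by (simp add: N_def)
      ultimately show ?thesis using a by linarith
     qed
     have e: "i * N / L - i * pmf p i / \<mu> = i * (\<mu> * (N - pmf p i * n) - pmf p i * (L - \<mu> * n)) / (\<mu> * L)"
      using L0 \<mu> by (simp add: field_simps)
     have "\<bar>\<mu> * (N - pmf p i * n) - pmf p i * (L - \<mu> * n)\<bar> \<le> \<mu> * (n / (real J + 1) + (j + 2)) + X n"
     proof -
      have "\<bar>\<mu> * (N - pmf p i * n)\<bar> \<le> \<mu> * (n / (real J + 1) + (j + 2))" using N \<mu> by (simp add: abs_mult)
      moreover have "\<bar>pmf p i * (L - \<mu> * n)\<bar> \<le> 1 * X n"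
       unfolding abs_mult using comp by (intro mult_mono) (auto simp: pmf_le_1)
      ultimately show ?thesis by linarith
     qed
     also have "\<dots> \<le> Q / 2"
     proof -
      have K1: "real K + 1 > 0" by simp
      have "16 * (real K + 1) \<le> real J * (\<mu> * \<epsilon>')" using J(1) \<mu> eps' by (simp add: divide_le_eq)
      also have "\<dots> \<le> (real J + 1) * (\<mu> * \<epsilon>')" using \<mu> eps' by (intro mult_right_mono) auto
      finally have j1: "16 * (real K + 1) \<le> (real J + 1) * (\<mu> * \<epsilon>')" .
      have h1: "n / (real J + 1) \<le> n * (\<mu> * \<epsilon>') / (16 * (real K + 1))"
      proof -
       have "n * (16 * (real K + 1)) \<le> n * ((real J + 1) * (\<mu> * \<epsilon>'))" using j1 by (intro mult_left_mono) auto
       then show ?thesis using K1 by (simp add: divide_le_eq le_divide_eq ac_simps)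
      qed
      have h2: "real j + 2 \<le> n * (\<mu> * \<epsilon>') / (16 * (real K + 1))"
      proof -
       have "16 * (real K + 1) * (real j + 2) \<le> n * (\<mu> * \<epsilon>')" using A6 \<mu> eps' by (simp add: divide_le_eq)
       then show ?thesis using K1 by (simp add: le_divide_eq ac_simps)
      qed
      have "\<mu> * (n / (real J + 1) + (j + 2)) \<le> \<mu> * (2 * (n * (\<mu> * \<epsilon>') / (16 * (real K + 1))))"
      proof (rule mult_left_mono)
       show "n / (real J + 1) + (j + 2) \<le> 2 * (n * (\<mu> * \<epsilon>') / (16 * (real K + 1)))"
        using add_mono[OF h1 h2] by (simp only: mult_2 of_nat_add of_nat_numeral)
      qed (use \<mu> in simp)
      moreover have "m * (2 * (x * (m * e) / (16 * k))) = m * m * e / k * x / 8" for m x e k :: real by (simp add: ac_simps)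
      ultimately have "\<mu> * (n / (real J + 1) + (j + 2)) \<le> Q / 8" by (simp only: Q_def)
      then show ?thesis using A3 Q0 by linarith
     qed
     finally have Y: "\<bar>\<mu> * (N - pmf p i * n) - pmf p i * (L - \<mu> * n)\<bar> \<le> Q / 2" .
     have "\<bar>i * N / L - i * pmf p i / \<mu>\<bar> = i * \<bar>\<mu> * (N - pmf p i * n) - pmf p i * (L - \<mu> * n)\<bar> / (\<mu> * L)"
      unfolding e using L0 \<mu> by (simp add: abs_mult)
     also have "\<dots> \<le> (real K + 1) * (Q / 2) / (\<mu> * (\<mu> / 2 * n))"
      using i Y L2 \<mu> np L0 Q0 by (intro frac_le mult_mono) auto
     also have "\<dots> = \<epsilon>'"
     proof -
      have "k * (m * m * e / k * x / 2) / (m * (m / 2 * x)) = e" if "k > 0" "m > 0" "x > 0" for k m e x :: real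
       using that by simp
      from this[of "real K + 1" \<mu> "real n"] show ?thesis using \<mu> np unfolding Q_def by simp
     qed
     finally show ?thesis unfolding N_def .
    qed
    show "let L = t + (\<Sum>v\<in>U. real (d v)) - 1 in
   L > 0 \<and> t / L \<le> \<epsilon> \<and> (\<Sum>v\<in>{v\<in>U. K < d v}. real (d v)) / L \<le> \<epsilon> \<and>
   (\<forall>i\<le>K. \<bar>i * real (card {v\<in>U. d v = i}) / L - i * pmf p i / \<mu>\<bar> \<le> \<epsilon> / (real K + 1))"
     unfolding Let_def L_def[symmetric] using L0 g1 g2 g3 by (auto simp: \<epsilon>'_def)
   qed
  qed
  qed
 qed
qed

end

lemma norm_ratio_le: "cmod (of_nat a / (of_nat a - \<i> * of_real l)) \<le> 1"
proof -
 have "\<bar>Re (of_nat a - \<i> * of_real l)\<bar> \<le> cmod (of_nat a - \<i> * of_real l)" by (rule abs_Re_le_cmod)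
 then have "real a \<le> cmod (of_nat a - \<i> * of_real l)" by simp
 then show ?thesis by (simp add: norm_divide divide_le_eq_1) auto
qed

context fpp_prob
begin

text \<open>The limit of the recursion, unrolled \<open>k\<close> times: for bounded clusters
  collision and cancellation disappear, the absorbed vertex has a size-biased degree, and at the end
  \<open>Psi0\<close> is inserted.\<close>

primrec Psi :: "real \<Rightarrow> nat \<Rightarrow> nat \<Rightarrow> nat \<Rightarrow> complex" where
 "Psi l 0 s b = Psi0 (\<i> * of_real (l / cc)) (cc * \<mu> / (real s * real b))"
| "Psi l (Suc k) s b = of_nat (min s b) / (of_nat (min s b) - \<i> * of_real l)
  * (\<integral>i. of_real (real i / \<mu>) * Psi l k (min s b + i - 2) (max s b) \<partial>measure_pmf p)"

lemma size_biased_total: "(\<integral>i. real i / \<mu> \<partial>measure_pmf p) = 1"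
 using mean \<mu> by simp

lemma norm_Psi: "cmod (Psi l k s b) \<le> 1"
proof (induction k arbitrary: s b)
 case 0
 show ?case unfolding Psi.simps by (rule norm_Psi0) simp
next
 case (Suc k)
 have "cmod (\<integral>i. of_real (real i / \<mu>) * Psi l k (min s b + i - 2) (max s b) \<partial>measure_pmf p) \<le> (\<integral>i. real i / \<mu> \<partial>measure_pmf p)"
 proof (rule pmf_norm_expectation_le)
  fix i show "cmod (of_real (real i / \<mu>) * Psi l k (min s b + i - 2) (max s b)) \<le> real i / \<mu>"
   using \<mu> Suc by (simp only: norm_mult norm_of_real) (simp add: mult_left_le divide_right_mono)
 qed (use integrable_id in simp)
 then have "cmod (\<integral>i. of_real (real i / \<mu>) * Psi l k (min s b + i - 2) (max s b) \<partial>measure_pmf p) \<le> 1"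
  by (simp only: size_biased_total)
 then show ?case unfolding Psi.simps norm_mult by (intro mult_le_one norm_ratio_le) auto
qed

text \<open>The size-biased probability of a degree at least 3, that is, of a step in which the
  cluster really grows.\<close>

definition heavy where "heavy = (\<integral>k. (if k \<ge> 3 then real k else 0) \<partial>measure_pmf p) / \<mu>"

lemma integrable_heavy: "integrable (measure_pmf p) (\<lambda>k. if k \<ge> 3 then real k else 0)"
 by (rule Bochner_Integration.integrable_bound[OF integrable_id]) auto

lemma heavy: "0 < heavy" "heavy \<le> 1"
proof -
 have "(\<integral>k. (if k \<ge> 3 then real k else 0) \<partial>measure_pmf p) > 0"
  using Kg3 Kg by (smt (verit) mult_nonneg_nonpos)
 then show "0 < heavy" using \<mu> by (simp add: heavy_def)
 have "(\<integral>k. (if k \<ge> 3 then real k else 0) \<partial>measure_pmf p) \<le> \<mu>"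
  unfolding mean by (intro integral_mono integrable_heavy integrable_id) auto
 then show "heavy \<le> 1" using \<mu> by (simp add: heavy_def)
qed

text \<open>A supersolution of the limit recursion for the error s^(-\<eta> / 40) + b^(-\<eta> /
  40). The constant term covers sizes from \<open>R\<close> on; the geometric term covers smaller
  sizes and decays with the number of steps.\<close>

definition Xi :: "nat \<Rightarrow> nat \<Rightarrow> nat \<Rightarrow> nat \<Rightarrow> real" where
 "Xi R k s b = 2 * real R powr (- (\<eta> / 40)) + 2 ^ R * (1 - heavy / 4) ^ k * ((1/2) ^ s + (1/2) ^ b)"

text \<open>Below \<open>R\<close> the term 2^R (1/2)^t is at least 1, which exceeds any negative
  power of t; from \<open>R\<close> on the power is monotone.\<close>

lemma Xi_0:
 assumes "R \<ge> 1" "s \<ge> 1" "b \<ge> 1"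
 shows "real s powr (- (\<eta> / 40)) + real b powr (- (\<eta> / 40)) \<le> Xi R 0 s b"
proof -
 have "real t powr (- (\<eta> / 40)) \<le> real R powr (- (\<eta> / 40)) + 2 ^ R * (1/2) ^ t" if t: "t \<ge> 1" for t :: nat
 proof (cases "R \<le> t")
  case True
  then have "real t powr (- (\<eta> / 40)) \<le> real R powr (- (\<eta> / 40))" using assms(1) \<eta> by (intro powr_mono2') auto
  then show ?thesis by (simp add: add_increasing2)
 next
  case False
  have "real t powr (- (\<eta> / 40)) \<le> 1" using t \<eta> powr_mono[of "- (\<eta> / 40)" 0 "real t"] by simp
  also have "1 \<le> (2::real) ^ R * (1/2) ^ t" using False by (simp add: power_divide power_increasing)
  finally show ?thesis by (simp add: add_increasing)
 qed
 from this[OF assms(2)] this[OF assms(3)] show ?thesis by (simp add: Xi_def distrib_left)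
qed

lemma rho: "0 \<le> 1 - heavy / 4" "1 - heavy / 4 < 1" using heavy by auto

lemma Xi_bound: "0 \<le> Xi R k s b" "Xi R k s b \<le> 2 * real R powr (- (\<eta> / 40)) + 2 ^ R * (1 - heavy / 4) ^ k * 2"
proof -
 have h: "(1/2::real) ^ s \<le> 1" "(1/2::real) ^ b \<le> 1" by (auto intro: power_le_one)
 show "0 \<le> Xi R k s b" unfolding Xi_def using rho by (intro add_nonneg_nonneg mult_nonneg_nonneg) auto
 show "Xi R k s b \<le> 2 * real R powr (- (\<eta> / 40)) + 2 ^ R * (1 - heavy / 4) ^ k * 2"
  unfolding Xi_def using rho h by (intro add_left_mono mult_left_mono) auto
qed

lemma Xi_bound': "Xi R k s b \<le> 2 * real R powr (- (\<eta> / 40)) + 2 ^ R * 2"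
proof -
 have "(1 - heavy / 4) ^ k \<le> 1" using rho by (intro power_le_one) auto
 then have "2 ^ R * (1 - heavy / 4) ^ k * 2 \<le> 2 ^ R * 1 * 2" by (intro mult_right_mono mult_left_mono) auto
 then show ?thesis using Xi_bound(2)[of R k s b] by linarith
qed

lemma Xi_small:
 assumes "\<epsilon> > 0"
 shows "\<exists>R\<ge>1. \<exists>k. \<forall>s b. Xi R k s b \<le> \<epsilon>"
proof -
 have lim1: "(\<lambda>R. 2 * real R powr (- (\<eta> / 40))) \<longlonglongrightarrow> 0"
  using \<eta> by (intro tendsto_mult_right_zero tendsto_neg_powr filterlim_real_sequentially) auto
 have "eventually (\<lambda>R. 2 * real R powr (- (\<eta> / 40)) < \<epsilon> / 2) sequentially"
  by (rule order_tendstoD(2)[OF lim1]) (use assms in simp)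
 then obtain R where R: "2 * real R powr (- (\<eta> / 40)) < \<epsilon> / 2" "R \<ge> 1"
  using eventually_happens'[OF sequentially_bot eventually_conj[OF _ eventually_ge_at_top[of 1]]] by blast
 have lim2: "(\<lambda>k. 2 ^ R * (1 - heavy / 4) ^ k * 2) \<longlonglongrightarrow> 2 ^ R * 0 * 2"
  using rho by (intro tendsto_intros LIMSEQ_realpow_zero)
 have "eventually (\<lambda>k. 2 ^ R * (1 - heavy / 4) ^ k * 2 < \<epsilon> / 2) sequentially"
  by (rule order_tendstoD(2)[OF lim2]) (use assms in simp)
 then obtain k where k: "2 ^ R * (1 - heavy / 4) ^ k * 2 < \<epsilon> / 2"
  using eventually_happens'[OF sequentially_bot] by blast
 show ?thesis
 proof (rule exI[of _ R], rule conjI[OF R(2)], rule exI[of _ k], intro allI)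
  fix s b show "Xi R k s b \<le> \<epsilon>" using Xi_bound(2)[of R k s b] R(1) k by linarith
 qed
qed

text \<open>A step of the smaller cluster at least halves (1/2)^lo with size-biased probability
  \<open>heavy\<close>. Since (1/2)^lo is the larger of the two summands, their sum loses at least
  the share heavy / 4.\<close>

lemma Xi_step:
 assumes R: "R \<ge> 1" and s: "s \<ge> 1" "b \<ge> 1"
 shows "(\<integral>i. real i / \<mu> * Xi R k (min s b + i - 2) (max s b) \<partial>measure_pmf p) \<le> Xi R (Suc k) s b"
proof -
 define lo hi where "lo = min s b" and "hi = max s b"
 define A where "A = 2 * real R powr (- (\<eta> / 40))"
 define E where "E = 2 ^ R * (1 - heavy / 4) ^ k"
 define x y where "x = (1/2::real) ^ lo" and "y = (1/2::real) ^ hi"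
 have E: "E \<ge> 0" using rho by (simp add: E_def)
 have xy: "0 \<le> x" "0 \<le> y" "y \<le> x" by (auto simp: x_def y_def lo_def hi_def intro: power_decreasing)
 let ?h = "\<lambda>i. if i \<ge> 3 then real i else 0"
 let ?g = "\<lambda>i. (A + E * (x + y)) * (real i / \<mu>) - E * x / 2 * (?h i / \<mu>)"
 have ig: "integrable (measure_pmf p) ?g" using integrable_id integrable_heavy by simp
 have "(\<integral>i. real i / \<mu> * Xi R k (lo + i - 2) hi \<partial>measure_pmf p) \<le> (\<integral>i. ?g i \<partial>measure_pmf p)"
 proof (rule integral_mono_AE[OF _ ig])
  show "integrable (measure_pmf p) (\<lambda>i. real i / \<mu> * Xi R k (lo + i - 2) hi)"
  proof (rule Bochner_Integration.integrable_bound)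
   show "integrable (measure_pmf p) (\<lambda>i. real i / \<mu> * (2 * real R powr (- (\<eta> / 40)) + 2 ^ R * 2))" using integrable_id by simp
   have "norm (real i / \<mu> * Xi R k (lo + i - 2) hi) \<le> real i / \<mu> * (2 * real R powr (- (\<eta> / 40)) + 2 ^ R * 2)" for i
   proof -
    have "0 \<le> real i / \<mu> * Xi R k (lo + i - 2) hi" using \<mu> Xi_bound(1) by (intro mult_nonneg_nonneg) auto
    then have "norm (real i / \<mu> * Xi R k (lo + i - 2) hi) = real i / \<mu> * Xi R k (lo + i - 2) hi"
     by (simp only: real_norm_def abs_of_nonneg)
    also have "\<dots> \<le> real i / \<mu> * (2 * real R powr (- (\<eta> / 40)) + 2 ^ R * 2)"
     using \<mu> by (intro mult_left_mono Xi_bound') auto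
    finally show ?thesis .
   qed
   note hb = this
   show "AE i in measure_pmf p. norm (real i / \<mu> * Xi R k (lo + i - 2) hi) \<le> norm (real i / \<mu> * (2 * real R powr (- (\<eta> / 40)) + 2 ^ R * 2))"
   proof (rule always_eventually, rule allI)
    fix i
    have "norm (real i / \<mu> * Xi R k (lo + i - 2) hi) \<le> (real i / \<mu> * (2 * real R powr (- (\<eta> / 40)) + 2 ^ R * 2))" by (rule hb)
    also have "(real i / \<mu> * (2 * real R powr (- (\<eta> / 40)) + 2 ^ R * 2)) \<le> norm (real i / \<mu> * (2 * real R powr (- (\<eta> / 40)) + 2 ^ R * 2))" unfolding real_norm_def by (rule abs_ge_self)
    finally show "norm (real i / \<mu> * Xi R k (lo + i - 2) hi) \<le> norm (real i / \<mu> * (2 * real R powr (- (\<eta> / 40)) + 2 ^ R * 2))" .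
   qed
  qed simp
  show "AE i in measure_pmf p. real i / \<mu> * Xi R k (lo + i - 2) hi \<le> ?g i"
  proof (unfold AE_measure_pmf_iff, rule ballI)
   fix i assume "i \<in> set_pmf p"
   then have i: "i \<ge> 2" using supp by auto
   have "(1/2::real) ^ (lo + i - 2) = x * (1/2) ^ (i - 2)" using i by (simp add: x_def power_add[symmetric])
   also have "\<dots> \<le> x * (if i \<ge> 3 then 1/2 else 1)"
    using i xy power_decreasing[of 1 "i - 2" "1/2::real"] by (intro mult_left_mono) auto
   finally have "A + E * ((1/2) ^ (lo + i - 2) + y) \<le> A + E * (x * (if i \<ge> 3 then 1/2 else 1) + y)"
    using E by (intro add_left_mono mult_left_mono) auto
   then have "real i / \<mu> * Xi R k (lo + i - 2) hi \<le> real i / \<mu> * (A + E * (x * (if i \<ge> 3 then 1/2 else 1) + y))"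
    unfolding Xi_def A_def[symmetric] E_def[symmetric] y_def[symmetric] using \<mu> by (intro mult_left_mono) auto
   also have "\<dots> = ?g i" by (cases "i \<ge> 3") (auto simp: algebra_simps)
   finally show "real i / \<mu> * Xi R k (lo + i - 2) hi \<le> ?g i" .
  qed
 qed
 also have "(\<integral>i. ?g i \<partial>measure_pmf p) = (A + E * (x + y)) * (\<integral>i. real i / \<mu> \<partial>measure_pmf p) - E * x / 2 * (\<integral>i. ?h i / \<mu> \<partial>measure_pmf p)"
  using integrable_id integrable_heavy by (subst Bochner_Integration.integral_diff) (simp_all only: integral_mult_right_zero Bochner_Integration.integrable_mult_right Bochner_Integration.integrable_divide)
 also have "\<dots> = (A + E * (x + y)) - E * x / 2 * heavy"
 proof -
  have "(\<integral>i. ?h i / \<mu> \<partial>measure_pmf p) = heavy" unfolding heavy_def by (rule integral_divide_zero)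
  then show ?thesis by (simp only: size_biased_total mult_1_right)
 qed
 also have "\<dots> \<le> A + E * (1 - heavy / 4) * (x + y)"
 proof -
  have "E * (heavy / 4) * y \<le> E * (heavy / 4) * x" using E heavy xy by (intro mult_left_mono) auto
  then show ?thesis by (simp add: algebra_simps)
 qed
 also have "\<dots> = Xi R (Suc k) s b"
 proof -
  have "x + y = (1/2) ^ s + (1/2) ^ b" by (cases "s \<le> b") (auto simp: x_def y_def lo_def hi_def)
  then show ?thesis by (simp add: Xi_def A_def E_def)
 qed
 finally show ?thesis by (simp only: lo_def hi_def)
qed

lemma ln_deg_sum_small:
 "\<exists>t. t \<longlonglongrightarrow> 0 \<and> eventually (\<lambda>n. \<forall>d. dgood n d \<longrightarrow> \<bar>ln (deg_sum n d / (real n * \<mu>))\<bar> \<le> t n) sequentially"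
proof (intro exI conjI)
 define t where "t n = 2 * Kg / \<mu> * real n powr (- (\<eta> / 8))" for n :: nat
 show "t \<longlonglongrightarrow> 0" unfolding t_def using \<eta>
  by (intro tendsto_mult_right_zero tendsto_neg_powr filterlim_real_sequentially) auto
 show "eventually (\<lambda>n. \<forall>d. dgood n d \<longrightarrow> \<bar>ln (deg_sum n d / (real n * \<mu>))\<bar> \<le> t n) sequentially"
  using dgood_L eventually_ge_at_top[of 1]
 proof eventually_elim
  case (elim n)
  show ?case
  proof (intro allI impI)
   fix d assume d: "dgood n d"
   define x where "x = deg_sum n d / (real n * \<mu>)"
   have n: "real n > 0" using elim(2) by simp
   have L: "\<mu> / 2 * n \<le> deg_sum n d" using elim(1) d by auto
   have "1 / 2 \<le> x" using L n \<mu> by (simp add: x_def le_divide_eq ac_simps)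
   have e: "n * real n powr (- (\<eta> / 8)) = real n powr (1 - \<eta> / 8)"
    using powr_minus_mult_self[OF n, of "\<eta> / 8"] by (simp add: mult.commute)
   have "\<bar>x - 1\<bar> = \<bar>deg_sum n d - \<mu> * n\<bar> / (real n * \<mu>)"
    using n \<mu> by (simp add: x_def abs_div field_simps)
   also have "\<dots> \<le> Kg * real n powr (1 - \<eta> / 8) / (real n * \<mu>)"
    using d n \<mu> by (intro divide_right_mono) (auto simp: dgood_def)
   also have "\<dots> = t n / 2" unfolding e[symmetric] t_def using n \<mu> by (simp add: field_simps)
   finally have x1: "\<bar>x - 1\<bar> \<le> t n / 2" .
   have f1: "ln x \<le> x - 1" using \<open>1 / 2 \<le> x\<close> by (intro ln_le_minus_one) auto
   have f2: "- ln x \<le> 2 * \<bar>x - 1\<bar>"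
   proof -
    have "- ln x = ln (1 / x)" using \<open>1 / 2 \<le> x\<close> by (simp add: ln_div)
    also have "\<dots> \<le> 1 / x - 1" using \<open>1 / 2 \<le> x\<close> by (intro ln_le_minus_one) auto
    also have "\<dots> = (1 - x) / x" using \<open>1 / 2 \<le> x\<close> by (simp add: field_simps)
    also have "\<dots> \<le> \<bar>x - 1\<bar> / (1 / 2)" using \<open>1 / 2 \<le> x\<close> by (intro frac_le) auto
    finally show ?thesis by simp
   qed
   have f3: "x - 1 \<le> \<bar>x - 1\<bar>" "\<bar>x - 1\<bar> \<le> 2 * \<bar>x - 1\<bar>" by simp_all
   have f4: "2 * \<bar>x - 1\<bar> \<le> t n" using x1 by simp
   have "ln x \<le> t n" by (rule order_trans[OF f1 order_trans[OF f3(1) order_trans[OF f3(2) f4]]])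
   moreover have "- ln x \<le> t n" by (rule order_trans[OF f2 f4])
   ultimately show "\<bar>ln (deg_sum n d / (real n * \<mu>))\<bar> \<le> t n" unfolding x_def[symmetric] by (rule abs_leI)
  qed
 qed
qed

text \<open>For fixed l the approximation by \<open>G\<close> is accurate only when both clusters
  are large. The sizes therefore stay in the bound, to be improved by exact steps.\<close>

lemma Qf_limit_base:
 fixes l :: real
 defines "w \<equiv> \<i> * of_real (l / cc)"
 shows "\<exists>C\<ge>0. \<forall>s b j. s \<ge> 1 \<longrightarrow> b \<ge> 1 \<longrightarrow> (\<forall>\<epsilon>>0. eventually (\<lambda>n. \<forall>d U M. dgood n d \<longrightarrow>
  U \<subseteq> {1..n} \<longrightarrow> card ({1..n} - U) \<le> j + 2 \<longrightarrow> s + b \<le> (\<Sum>v\<in>{1..n} - U. d v) \<longrightarrow> M \<ge> n \<longrightarrow>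
  cmod (exp (- w * of_real (ln n)) * Qf d l 1 M U s b - Psi l 0 s b)
   \<le> C * (real s powr (- (\<eta> / 40)) + real b powr (- (\<eta> / 40))) + \<epsilon>) sequentially)"
proof -
 have w: "Re w = 0" "of_real cc * w = \<i> * of_real l" using cc by (auto simp: w_def)
 from Qf_approx_uniform[OF norm_ge_zero[of w]] obtain C0 where C0: "C0 \<ge> 0" and
  ex: "\<forall>k. \<exists>r. r \<longlonglongrightarrow> 0 \<and> eventually (\<lambda>n. \<forall>d. dgood n d \<longrightarrow>
  (\<forall>l z \<omega> U s b M. cmod z \<le> 1 \<longrightarrow> Re \<omega> \<le> 0 \<longrightarrow> of_real cc * \<omega> = of_real (cc + 1) * (z - 1) + \<i> * of_real l \<longrightarrow>
   cmod \<omega> \<le> cmod w \<longrightarrow> U \<subseteq> {1..n} \<longrightarrow> card ({1..n} - U) \<le> k + 2 \<longrightarrow> s \<ge> 1 \<longrightarrow> b \<ge> 1 \<longrightarrow>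
   s + b \<le> (\<Sum>v\<in>{1..n} - U. d v) \<longrightarrow> M \<ge> n \<longrightarrow>
   cmod (Qf d l z M U s b - G \<omega> (cc * deg_sum n d / real b) (real s))
    \<le> C0 * (cmod \<omega> + cmod (z - 1)) * (real s powr (- (\<eta> / 40)) + real b powr (- (\<eta> / 40))) + cmod (z - 1) + r n)) sequentially"
  by (elim exE conjE)
 show ?thesis
 proof (intro exI[of _ "C0 * cmod w"] conjI allI impI)
  show "C0 * cmod w \<ge> 0" using C0 by simp
  fix s b j :: nat and \<epsilon> :: real assume sb: "s \<ge> 1" "b \<ge> 1" and eps: "\<epsilon> > 0"
  from ex[rule_format, of j] obtain r where r: "r \<longlonglongrightarrow> 0" and
   ev: "eventually (\<lambda>n. \<forall>d. dgood n d \<longrightarrow>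
   (\<forall>l z \<omega> U s b M. cmod z \<le> 1 \<longrightarrow> Re \<omega> \<le> 0 \<longrightarrow> of_real cc * \<omega> = of_real (cc + 1) * (z - 1) + \<i> * of_real l \<longrightarrow>
   cmod \<omega> \<le> cmod w \<longrightarrow> U \<subseteq> {1..n} \<longrightarrow> card ({1..n} - U) \<le> j + 2 \<longrightarrow> s \<ge> 1 \<longrightarrow> b \<ge> 1 \<longrightarrow>
   s + b \<le> (\<Sum>v\<in>{1..n} - U. d v) \<longrightarrow> M \<ge> n \<longrightarrow>
   cmod (Qf d l z M U s b - G \<omega> (cc * deg_sum n d / real b) (real s))
    \<le> C0 * (cmod \<omega> + cmod (z - 1)) * (real s powr (- (\<eta> / 40)) + real b powr (- (\<eta> / 40))) + cmod (z - 1) + r n)) sequentially"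
   by (elim exE conjE)
  from ln_deg_sum_small obtain t where t: "t \<longlonglongrightarrow> 0" and
   evt: "eventually (\<lambda>n. \<forall>d. dgood n d \<longrightarrow> \<bar>ln (deg_sum n d / (real n * \<mu>))\<bar> \<le> t n) sequentially"
   by (elim exE conjE)
  define I where "I = (\<integral>x. \<bar>x\<bar> powr (-1/2) \<partial>expm)"
  have I: "I \<ge> 0" unfolding I_def by (intro Bochner_Integration.integral_nonneg) simp
  define a where "a n = sqrt (real s * real b / (cc * (\<mu> / 2)) * inverse (real n))" for n :: nat
  have "(\<lambda>n. real s * real b / (cc * (\<mu> / 2)) * inverse (real n)) \<longlonglongrightarrow> 0"
   by (intro tendsto_mult_right_zero tendsto_inverse_0_at_top filterlim_real_sequentially)
  then have a0: "a \<longlonglongrightarrow> 0" unfolding a_def using tendsto_real_sqrt by fastforce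
  have "(\<lambda>n. r n + cmod w * (t n + 2 * a n * I)) \<longlonglongrightarrow> 0 + cmod w * (0 + 2 * 0 * I)"
   by (intro tendsto_intros r t a0)
  then have "eventually (\<lambda>n. r n + cmod w * (t n + 2 * a n * I) < \<epsilon>) sequentially"
   using eps by (intro order_tendstoD) auto
  then show "eventually (\<lambda>n. \<forall>d U M. dgood n d \<longrightarrow>
  U \<subseteq> {1..n} \<longrightarrow> card ({1..n} - U) \<le> j + 2 \<longrightarrow> s + b \<le> (\<Sum>v\<in>{1..n} - U. d v) \<longrightarrow> M \<ge> n \<longrightarrow>
  cmod (exp (- w * of_real (ln n)) * Qf d l 1 M U s b - Psi l 0 s b)
   \<le> C0 * cmod w * (real s powr (- (\<eta> / 40)) + real b powr (- (\<eta> / 40))) + \<epsilon>) sequentially"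
   using ev evt dgood_L eventually_ge_at_top[of 1]
  proof eventually_elim
   case (elim n)
   show ?case
   proof (intro allI impI)
    fix d U M
    assume d: "dgood n d" and U: "U \<subseteq> {1..n}" "card ({1..n} - U) \<le> j + 2" "s + b \<le> (\<Sum>v\<in>{1..n} - U. d v)" "M \<ge> n"
    let ?f = "exp (- w * of_real (ln n))" and ?L = "deg_sum n d"
    let ?G = "G w (cc * ?L / real b) (real s)"
    let ?E = "real s powr (- (\<eta> / 40)) + real b powr (- (\<eta> / 40))"
    have nf: "cmod ?f = 1" using w by (intro cmod_exp_imag_ln) simp
    have "cmod (Qf d l 1 M U s b - ?G) \<le> C0 * (cmod w + cmod (1 - 1)) * ?E + cmod (1 - 1) + r n"
     by (rule elim(2)[rule_format, OF d _ _ _ order_refl U(1,2) sb U(3,4)]) (use w in auto)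
    then have 1: "cmod (Qf d l 1 M U s b - ?G) \<le> C0 * cmod w * ?E + r n" by simp
    have n0: "real n \<ge> 1" using elim(5) by simp
    have L: "\<mu> / 2 * n \<le> ?L" using elim(4) d by auto
    have L0: "?L > 0" using L \<mu> n0 by (smt (verit) mult_pos_pos half_gt_zero)
    have "cmod (?f * ?G - Psi0 w (cc * \<mu> / (real s * real b)))
     \<le> cmod w * (\<bar>ln (?L / (n * \<mu>))\<bar> + 2 * sqrt (real s * real b / (cc * ?L)) * I)"
     unfolding I_def using sb by (intro G_limit w cc n0 L0 \<mu>) auto
    also have "\<dots> \<le> cmod w * (t n + 2 * a n * I)"
    proof (intro mult_left_mono add_mono mult_right_mono I)
     show "\<bar>ln (?L / (n * \<mu>))\<bar> \<le> t n" using elim(3) d by blast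
     have "real s * real b / (cc * ?L) \<le> real s * real b / (cc * (\<mu> / 2 * n))"
      using L cc \<mu> n0 L0 by (intro divide_left_mono mult_left_mono mult_pos_pos) auto
     also have "\<dots> = real s * real b / (cc * (\<mu> / 2)) * inverse (real n)"
      by (simp only: divide_inverse inverse_mult_distrib mult.assoc)
     finally show "sqrt (real s * real b / (cc * ?L)) \<le> a n" unfolding a_def by (rule real_sqrt_le_mono)
    qed auto
    finally have 2: "cmod (?f * ?G - Psi l 0 s b) \<le> cmod w * (t n + 2 * a n * I)" by (simp only: Psi.simps w_def)
    have "cmod (?f * Qf d l 1 M U s b - Psi l 0 s b) \<le> cmod (?f * Qf d l 1 M U s b - ?f * ?G) + cmod (?f * ?G - Psi l 0 s b)"
     using norm_triangle_ineq[of "?f * Qf d l 1 M U s b - ?f * ?G" "?f * ?G - Psi l 0 s b"] by simp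
    also have "cmod (?f * Qf d l 1 M U s b - ?f * ?G) = cmod (Qf d l 1 M U s b - ?G)"
     unfolding right_diff_distrib[symmetric] norm_mult nf by simp
    finally show "cmod (?f * Qf d l 1 M U s b - Psi l 0 s b) \<le> C0 * cmod w * ?E + \<epsilon>" using 1 2 elim(1) by linarith
   qed
  qed
 qed
qed

text \<open>For z = 1 the generation quotient is 1. Collision and cancellation are grouped into one
  term, which is of order 1 / n for bounded clusters.\<close>

lemma Qf_unfold:
 assumes s: "s \<ge> 1" "b \<ge> 1" and U: "finite U" "\<And>v. v \<in> U \<Longrightarrow> d v \<ge> (2::nat)"
 shows "Qf d l 1 (Suc M) U s b = of_nat (min s b) / (of_nat (min s b) - \<i> * of_real l) *
  ((of_nat (max s b) + (of_nat (min s b) - 1) * Qf d l 1 M U (min s b - 2) (max s b))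
   / of_real (real s + real b + (\<Sum>v\<in>U. real (d v)) - 1)
  + (\<Sum>v\<in>U. of_nat (d v) * Qf d l 1 M (U - {v}) (min s b + d v - 2) (max s b))
   / of_real (real s + real b + (\<Sum>v\<in>U. real (d v)) - 1))"
proof -
 define lo hi where "lo = min s b" and "hi = max s b"
 have lo: "lo \<ge> 1" using s by (simp add: lo_def)
 have "real (lo + hi + (\<Sum>v\<in>U. d v) - 1) = real lo + real hi + (\<Sum>v\<in>U. real (d v)) - 1"
  using lo by (simp add: of_nat_diff)
 moreover have "real lo + real hi = real s + real b" by (simp add: lo_def hi_def min_def max_def)
 ultimately have "real (lo + hi + (\<Sum>v\<in>U. d v) - 1) = real s + real b + (\<Sum>v\<in>U. real (d v)) - 1" by linarith
 then have L: "(of_nat (lo + hi + (\<Sum>v\<in>U. d v) - 1) :: complex) = of_real (real s + real b + (\<Sum>v\<in>U. real (d v)) - 1)"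
  by (metis of_real_of_nat_eq)
 have one: "((of_nat lo - 1) + (of_nat (d v) - 1)) / of_nat (lo + d v - 2) = (1::complex)" if "v \<in> U" for v
 proof -
  have dv: "d v \<ge> 2" using U that by auto
  have "(of_nat (lo + d v - 2) :: complex) = of_nat lo + of_nat (d v) - 2" using dv lo by (simp add: of_nat_diff)
  moreover have "(of_nat (lo + d v - 2) :: complex) \<noteq> 0" unfolding of_nat_eq_0_iff using dv lo by linarith
  ultimately show ?thesis by simp
 qed
 have sm: "(\<Sum>v\<in>U. of_nat (d v) * ((of_nat lo - 1) + (of_nat (d v) - 1) * 1) / of_nat (lo + d v - 2)
      * Qf d l 1 M (U - {v}) (lo + d v - 2) hi) = (\<Sum>v\<in>U. of_nat (d v) * Qf d l 1 M (U - {v}) (lo + d v - 2) hi)"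
  by (intro sum.cong refl) (simp only: times_divide_eq_right[symmetric] one mult_1_right)
 have eqn: "Qf d l 1 (Suc M) U s b = of_nat lo / (of_nat lo - \<i> * of_real l) / of_nat (lo + hi + (\<Sum>v\<in>U. d v) - 1) *
   (of_nat hi * 1 + (of_nat lo - 1) * Qf d l 1 M U (lo - 2) hi
    + (\<Sum>v\<in>U. of_nat (d v) * ((of_nat lo - 1) + (of_nat (d v) - 1) * 1) / of_nat (lo + d v - 2)
      * Qf d l 1 M (U - {v}) (lo + d v - 2) hi))"
 proof -
  have "lo \<noteq> 0" using lo by simp
  then show ?thesis by (simp only: Qf.simps(2) Let_def lo_def[symmetric] hi_def[symmetric] if_False)
 qed
 have dist: "a / c * (e * 1 + f + g) = a * ((e + f) / c + g / c)" for a c e f g :: complex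
  by (simp add: add_divide_distrib algebra_simps)
 show ?thesis unfolding eqn sm dist L lo_def[symmetric] hi_def[symmetric] ..
qed

text \<open>Induction on the number of exact steps. Degrees are cut at \<open>K\<close>, so that
  finitely many instances of the induction hypothesis are used and their precisions
  \<open>Jf i\<close> merge; larger degrees are paid for by the size-biased tail. An absorption
  explores one more vertex and consumes one unit of fuel, hence the general \<open>j\<close> and the
  bound \<open>M \<ge> n + k\<close>.\<close>

lemma Qf_limit:
 fixes l :: real
 defines "w \<equiv> \<i> * of_real (l / cc)"
 shows "\<exists>C\<ge>0. \<forall>R k. R \<ge> 1 \<longrightarrow> (\<forall>s b j \<epsilon>. s \<ge> 1 \<longrightarrow> b \<ge> 1 \<longrightarrow> \<epsilon> > 0 \<longrightarrow> (\<exists>J. eventually (\<lambda>n. \<forall>d U M. dgood n d \<longrightarrow> fgood J n d \<longrightarrow>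
  U \<subseteq> {1..n} \<longrightarrow> card ({1..n} - U) \<le> j + 2 \<longrightarrow> s + b \<le> (\<Sum>v\<in>{1..n} - U. d v) \<longrightarrow> M \<ge> n + k \<longrightarrow>
  cmod (exp (- w * of_real (ln n)) * Qf d l 1 M U s b - Psi l k s b) \<le> C * Xi R k s b + \<epsilon>) sequentially))"
proof -
 from Qf_limit_base[of l, folded w_def] obtain C where C: "C \<ge> 0" and
  base: "\<forall>s b j. s \<ge> 1 \<longrightarrow> b \<ge> 1 \<longrightarrow> (\<forall>\<epsilon>>0. eventually (\<lambda>n. \<forall>d U M. dgood n d \<longrightarrow>
  U \<subseteq> {1..n} \<longrightarrow> card ({1..n} - U) \<le> j + 2 \<longrightarrow> s + b \<le> (\<Sum>v\<in>{1..n} - U. d v) \<longrightarrow> M \<ge> n \<longrightarrow>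
  cmod (exp (- w * of_real (ln n)) * Qf d l 1 M U s b - Psi l 0 s b)
   \<le> C * (real s powr (- (\<eta> / 40)) + real b powr (- (\<eta> / 40))) + \<epsilon>) sequentially)"
  by (elim exE conjE)
 have w0: "Re w = 0" by (simp add: w_def)
 show ?thesis
 proof (rule exI[of _ C], rule conjI[OF C], rule allI, rule allI, rule impI)
  fix R k :: nat assume R: "R \<ge> 1"
  show "\<forall>s b j \<epsilon>. s \<ge> 1 \<longrightarrow> b \<ge> 1 \<longrightarrow> \<epsilon> > 0 \<longrightarrow> (\<exists>J. eventually (\<lambda>n. \<forall>d U M. dgood n d \<longrightarrow> fgood J n d \<longrightarrow>
  U \<subseteq> {1..n} \<longrightarrow> card ({1..n} - U) \<le> j + 2 \<longrightarrow> s + b \<le> (\<Sum>v\<in>{1..n} - U. d v) \<longrightarrow> M \<ge> n + k \<longrightarrow>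
  cmod (exp (- w * of_real (ln n)) * Qf d l 1 M U s b - Psi l k s b) \<le> C * Xi R k s b + \<epsilon>) sequentially)"
  proof (induction k)
   case 0
   show ?case
   proof (intro allI impI)
    fix s b j :: nat and \<epsilon> :: real assume a: "s \<ge> 1" "b \<ge> 1" "\<epsilon> > 0"
    show "\<exists>J. eventually (\<lambda>n. \<forall>d U M. dgood n d \<longrightarrow> fgood J n d \<longrightarrow>
     U \<subseteq> {1..n} \<longrightarrow> card ({1..n} - U) \<le> j + 2 \<longrightarrow> s + b \<le> (\<Sum>v\<in>{1..n} - U. d v) \<longrightarrow> M \<ge> n + 0 \<longrightarrow>
     cmod (exp (- w * of_real (ln n)) * Qf d l 1 M U s b - Psi l 0 s b) \<le> C * Xi R 0 s b + \<epsilon>) sequentially"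
    proof (rule exI[of _ 0], rule eventually_mono[OF base[rule_format, OF a, of j]], intro allI impI)
     fix n d U M
     assume h: "\<forall>d U M. dgood n d \<longrightarrow> U \<subseteq> {1..n} \<longrightarrow> card ({1..n} - U) \<le> j + 2 \<longrightarrow> s + b \<le> (\<Sum>v\<in>{1..n} - U. d v) \<longrightarrow> M \<ge> n \<longrightarrow>
       cmod (exp (- w * of_real (ln n)) * Qf d l 1 M U s b - Psi l 0 s b)
       \<le> C * (real s powr (- (\<eta> / 40)) + real b powr (- (\<eta> / 40))) + \<epsilon>"
      and U: "dgood n d" "U \<subseteq> {1..n}" "card ({1..n} - U) \<le> j + 2" "s + b \<le> (\<Sum>v\<in>{1..n} - U. d v)" "n + 0 \<le> M"
     have M: "n \<le> M" using U(5) by simp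
     have "C * (real s powr (- (\<eta> / 40)) + real b powr (- (\<eta> / 40))) \<le> C * Xi R 0 s b"
      by (rule mult_left_mono[OF Xi_0[OF R a(1,2)] C])
     then show "cmod (exp (- w * of_real (ln n)) * Qf d l 1 M U s b - Psi l 0 s b) \<le> C * Xi R 0 s b + \<epsilon>"
      using h[rule_format, OF U(1-4) M] by linarith
    qed
   qed
  next
   case (Suc k)
   show ?case
   proof (intro allI impI)
    fix s b j :: nat and \<epsilon> :: real assume a: "s \<ge> 1" "b \<ge> 1" "\<epsilon> > 0"
    define lo hi where "lo = min s b" and "hi = max s b"
    have lohi: "lo \<ge> 1" "hi \<ge> 1" "lo + hi = s + b" using a by (auto simp: lo_def hi_def)
    define BB where "BB = C * (2 * real R powr (- (\<eta> / 40)) + 2 ^ R * 2)"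
    have BB: "BB \<ge> 0" using C by (simp add: BB_def)
    \<comment> \<open>One share is for collision and cancellation, the other \<open>4 + BB\<close>
      are for \<open>frequency_average\<close>.\<close>
    define \<epsilon>1 where "\<epsilon>1 = \<epsilon> / (5 + BB)"
    have e1: "\<epsilon>1 > 0" "\<epsilon>1 * (5 + BB) = \<epsilon>" using a(3) BB by (auto simp: \<epsilon>1_def)
    define t where "t = real s + real b"
    from frequencies[OF e1(1), of t j] obtain K J0 where
     K: "(\<integral>i. real i / \<mu> * indicator {K<..} i \<partial>measure_pmf p) \<le> \<epsilon>1" and
     fr: "eventually (\<lambda>n. \<forall>d U. dgood n d \<longrightarrow> fgood J0 n d \<longrightarrow>
     U \<subseteq> {1..n} \<longrightarrow> card ({1..n} - U) \<le> j + 2 \<longrightarrow> (let L = t + (\<Sum>v\<in>U. real (d v)) - 1 in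
      L > 0 \<and> t / L \<le> \<epsilon>1 \<and> (\<Sum>v\<in>{v\<in>U. K < d v}. real (d v)) / L \<le> \<epsilon>1 \<and>
      (\<forall>i\<le>K. \<bar>i * real (card {v\<in>U. d v = i}) / L - i * pmf p i / \<mu>\<bar> \<le> \<epsilon>1 / (real K + 1)))) sequentially"
     by (auto simp: t_def)
    have "\<forall>i\<in>{2..K}. \<exists>J. eventually (\<lambda>n. \<forall>d U M. dgood n d \<longrightarrow> fgood J n d \<longrightarrow>
     U \<subseteq> {1..n} \<longrightarrow> card ({1..n} - U) \<le> Suc j + 2 \<longrightarrow> (lo + i - 2) + hi \<le> (\<Sum>v\<in>{1..n} - U. d v) \<longrightarrow> M \<ge> n + k \<longrightarrow>
     cmod (exp (- w * of_real (ln n)) * Qf d l 1 M U (lo + i - 2) hi - Psi l k (lo + i - 2) hi) \<le> C * Xi R k (lo + i - 2) hi + \<epsilon>1) sequentially"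
    proof
     fix i assume "i \<in> {2..K}"
     then have "lo + i - 2 \<ge> 1" using lohi by auto
     from Suc.IH[rule_format, OF this lohi(2) e1(1), of "Suc j"] show "\<exists>J. eventually (\<lambda>n. \<forall>d U M. dgood n d \<longrightarrow> fgood J n d \<longrightarrow>
     U \<subseteq> {1..n} \<longrightarrow> card ({1..n} - U) \<le> Suc j + 2 \<longrightarrow> (lo + i - 2) + hi \<le> (\<Sum>v\<in>{1..n} - U. d v) \<longrightarrow> M \<ge> n + k \<longrightarrow>
     cmod (exp (- w * of_real (ln n)) * Qf d l 1 M U (lo + i - 2) hi - Psi l k (lo + i - 2) hi) \<le> C * Xi R k (lo + i - 2) hi + \<epsilon>1) sequentially" .
    qed
    from bchoice[OF this] obtain Jf where Jf: "\<forall>i\<in>{2..K}. eventually (\<lambda>n. \<forall>d U M. dgood n d \<longrightarrow> fgood (Jf i) n d \<longrightarrow>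
     U \<subseteq> {1..n} \<longrightarrow> card ({1..n} - U) \<le> Suc j + 2 \<longrightarrow> (lo + i - 2) + hi \<le> (\<Sum>v\<in>{1..n} - U. d v) \<longrightarrow> M \<ge> n + k \<longrightarrow>
     cmod (exp (- w * of_real (ln n)) * Qf d l 1 M U (lo + i - 2) hi - Psi l k (lo + i - 2) hi) \<le> C * Xi R k (lo + i - 2) hi + \<epsilon>1) sequentially" ..
    define J where "J = J0 + (\<Sum>i\<in>{2..K}. Jf i)"
    have JJ: "J0 \<le> J" "\<And>i. i \<in> {2..K} \<Longrightarrow> Jf i \<le> J"
    proof -
     show "J0 \<le> J" by (simp add: J_def)
     fix i assume "i \<in> {2..K}"
     then have "Jf i \<le> (\<Sum>i\<in>{2..K}. Jf i)" by (intro member_le_sum) auto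
     then show "Jf i \<le> J" by (simp add: J_def)
    qed
    have evall: "eventually (\<lambda>n. \<forall>i\<in>{2..K}. \<forall>d U M. dgood n d \<longrightarrow> fgood (Jf i) n d \<longrightarrow>
     U \<subseteq> {1..n} \<longrightarrow> card ({1..n} - U) \<le> Suc j + 2 \<longrightarrow> (lo + i - 2) + hi \<le> (\<Sum>v\<in>{1..n} - U. d v) \<longrightarrow> M \<ge> n + k \<longrightarrow>
     cmod (exp (- w * of_real (ln n)) * Qf d l 1 M U (lo + i - 2) hi - Psi l k (lo + i - 2) hi) \<le> C * Xi R k (lo + i - 2) hi + \<epsilon>1) sequentially"
     by (rule eventually_ball_finite[OF _ Jf]) simp
    have "eventually (\<lambda>n. \<forall>d U M. dgood n d \<longrightarrow> fgood J n d \<longrightarrow>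
     U \<subseteq> {1..n} \<longrightarrow> card ({1..n} - U) \<le> j + 2 \<longrightarrow> s + b \<le> (\<Sum>v\<in>{1..n} - U. d v) \<longrightarrow> M \<ge> n + Suc k \<longrightarrow>
     cmod (exp (- w * of_real (ln n)) * Qf d l 1 M U s b - Psi l (Suc k) s b) \<le> C * Xi R (Suc k) s b + \<epsilon>) sequentially"
     using evall fr
    proof eventually_elim
     case (elim n)
     show ?case
     proof (intro allI impI)
      fix d U M
      assume d: "dgood n d" and f: "fgood J n d" and U: "U \<subseteq> {1..n}" "card ({1..n} - U) \<le> j + 2"
       "s + b \<le> (\<Sum>v\<in>{1..n} - U. d v)" and M: "M \<ge> n + Suc k"
      obtain M' where M': "M = Suc M'" "M' \<ge> n + k" using M by (cases M) auto
      have d2: "d v \<ge> 2" if "v \<in> U" for v using d that U by (auto simp: dgood_def)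
      have finU: "finite U" using U finite_subset by blast
      define L where "L = t + (\<Sum>v\<in>U. real (d v)) - 1"
      have fr': "L > 0" "t / L \<le> \<epsilon>1" "(\<Sum>v\<in>{v\<in>U. K < d v}. real (d v)) / L \<le> \<epsilon>1"
       "\<And>i. i \<le> K \<Longrightarrow> \<bar>i * real (card {v\<in>U. d v = i}) / L - i * pmf p i / \<mu>\<bar> \<le> \<epsilon>1 / (real K + 1)"
       using elim(2)[rule_format, OF d fgood_mono[OF f JJ(1)] U(1,2)] unfolding Let_def L_def[symmetric] by blast+
      let ?f = "exp (- w * of_real (ln n))"
      have nf: "cmod ?f = 1" using w0 by (intro cmod_exp_imag_ln) simp
      define q where "q v = ?f * Qf d l 1 M' (U - {v}) (lo + d v - 2) hi" for v
      define Ps where "Ps i = Psi l k (lo + i - 2) hi" for i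
      define Xs where "Xs i = C * Xi R k (lo + i - 2) hi" for i
      have nq: "cmod (Qf d l 1 M' V x y) \<le> 1" if "V \<subseteq> U" for V x y
       using that d2 by (intro norm_Qf) auto
      have near: "cmod (q v - Ps (d v)) \<le> Xs (d v) + \<epsilon>1" if v: "v \<in> U" "d v \<le> K" for v
      proof -
       have i: "d v \<in> {2..K}" using v d2 by auto
       have vn: "v \<in> {1..n}" "v \<notin> {1..n} - U" using v U by auto
       have se: "{1..n} - (U - {v}) = insert v ({1..n} - U)" using vn by blast
       have "card ({1..n} - (U - {v})) \<le> Suc j + 2" unfolding se using U(2) card_insert_le_m1[of "Suc (j + 2)" "{1..n} - U" v] by simp
       moreover have "(lo + d v - 2) + hi \<le> (\<Sum>u\<in>{1..n} - (U - {v}). d u)"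
       proof -
        have "(\<Sum>u\<in>{1..n} - (U - {v}). d u) = d v + (\<Sum>u\<in>{1..n} - U. d u)" unfolding se using vn by (subst sum.insert) auto
        then show ?thesis using U(3) lohi by linarith
       qed
       moreover have "U - {v} \<subseteq> {1..n}" using U by auto
       ultimately show ?thesis unfolding q_def Ps_def Xs_def
        using elim(1)[rule_format, OF i d fgood_mono[OF f JJ(2)[OF i]] _ _ _ M'(2)] by blast
      qed
      have avg: "cmod ((\<Sum>v\<in>U. of_nat (d v) * q v) / of_real L - (\<integral>i. of_real (real i / \<mu>) * Ps i \<partial>measure_pmf p))
       \<le> (\<integral>i. real i / \<mu> * Xs i \<partial>measure_pmf p) + \<epsilon>1 * (4 + BB)"
      proof (rule frequency_average[OF finU fr'(1) _ \<mu>])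
       show "(\<Sum>v\<in>U. real (d v)) \<le> L" using a by (simp add: L_def t_def)
       show "cmod (q v) \<le> 1" for v unfolding q_def norm_mult nf using nq[of "U - {v}" "lo + d v - 2" hi] by auto
       show "cmod (Ps i) \<le> 1" for i unfolding Ps_def by (rule norm_Psi)
       show "0 \<le> Xs i" for i unfolding Xs_def using C Xi_bound(1) by (intro mult_nonneg_nonneg) auto
       show "Xs i \<le> BB" for i unfolding Xs_def BB_def by (rule mult_left_mono[OF Xi_bound' C])
      qed (use near fr' K integrable_id e1 in auto)
      have xs: "(\<integral>i. real i / \<mu> * Xs i \<partial>measure_pmf p) \<le> C * Xi R (Suc k) s b"
      proof -
       have "(\<integral>i. real i / \<mu> * Xs i \<partial>measure_pmf p) = C * (\<integral>i. real i / \<mu> * Xi R k (lo + i - 2) hi \<partial>measure_pmf p)"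
        unfolding Xs_def integral_mult_right_zero[symmetric] by (simp add: ac_simps)
       also have "\<dots> \<le> C * Xi R (Suc k) s b" unfolding lo_def hi_def by (rule mult_left_mono[OF Xi_step[OF R a(1,2)] C])
       finally show ?thesis .
      qed
      define A where "A = (of_nat lo / (of_nat lo - \<i> * of_real l) :: complex)"
      have nA: "cmod A \<le> 1" unfolding A_def by (rule norm_ratio_le)
      define T0 where "T0 = of_nat hi + (of_nat lo - 1) * Qf d l 1 M' U (lo - 2) hi"
      have T0: "cmod (T0 / of_real L) \<le> \<epsilon>1"
      proof -
       have "cmod T0 \<le> hi + (real lo - 1) * 1"
       proof -
        have "cmod (of_nat lo - 1 :: complex) = real lo - 1"
        proof -
         have "(of_nat lo - 1 :: complex) = of_real (real lo - 1)" by simp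
         then show ?thesis using lohi(1) by (simp only: norm_of_real)
        qed
        moreover have "cmod (Qf d l 1 M' U (lo - 2) hi) \<le> 1" by (rule nq) simp
        ultimately have "cmod ((of_nat lo - 1) * Qf d l 1 M' U (lo - 2) hi) \<le> (real lo - 1) * 1"
         using lohi(1) unfolding norm_mult by (intro mult_mono) auto
        then show ?thesis unfolding T0_def by (intro order_trans[OF norm_triangle_ineq] add_mono) auto
       qed
       also have "\<dots> \<le> t"
       proof -
        have "real lo + real hi = real s + real b" unfolding of_nat_add[symmetric] lohi(3) ..
        then show ?thesis unfolding t_def by simp
       qed
       finally have "cmod (T0 / of_real L) \<le> t / L" using fr'(1) by (simp add: norm_divide divide_right_mono)
       then show ?thesis using fr'(2) by linarith
      qed
      have un: "Qf d l 1 M U s b = A * (T0 / of_real L + (\<Sum>v\<in>U. of_nat (d v) * Qf d l 1 M' (U - {v}) (lo + d v - 2) hi) / of_real L)"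
       unfolding M'(1) A_def T0_def L_def t_def lo_def hi_def by (rule Qf_unfold[OF a(1,2) finU d2])
      have sumq: "(\<Sum>v\<in>U. of_nat (d v) * q v) = ?f * (\<Sum>v\<in>U. of_nat (d v) * Qf d l 1 M' (U - {v}) (lo + d v - 2) hi)"
       unfolding q_def sum_distrib_left by (simp add: ac_simps)
      have "?f * Qf d l 1 M U s b - Psi l (Suc k) s b
       = A * (?f * (T0 / of_real L) + ((\<Sum>v\<in>U. of_nat (d v) * q v) / of_real L - (\<integral>i. of_real (real i / \<mu>) * Ps i \<partial>measure_pmf p)))"
       unfolding un Psi.simps lo_def[symmetric] hi_def[symmetric] A_def[symmetric] Ps_def[symmetric] sumq
       by (simp add: algebra_simps)
      also have "cmod \<dots> \<le> 1 * cmod (?f * (T0 / of_real L) + ((\<Sum>v\<in>U. of_nat (d v) * q v) / of_real L - (\<integral>i. of_real (real i / \<mu>) * Ps i \<partial>measure_pmf p)))"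
       unfolding norm_mult[of A] by (rule mult_right_mono[OF nA norm_ge_zero])
      also have "\<dots> \<le> cmod (?f * (T0 / of_real L)) + cmod ((\<Sum>v\<in>U. of_nat (d v) * q v) / of_real L - (\<integral>i. of_real (real i / \<mu>) * Ps i \<partial>measure_pmf p))"
       unfolding mult_1_left by (rule norm_triangle_ineq)
      also have "cmod (?f * (T0 / of_real L)) = cmod (T0 / of_real L)" unfolding norm_mult nf by simp
      finally have "cmod (?f * Qf d l 1 M U s b - Psi l (Suc k) s b) \<le> \<epsilon>1 + (C * Xi R (Suc k) s b + \<epsilon>1 * (4 + BB))"
       using T0 avg xs by linarith
      moreover have "\<epsilon>1 + \<epsilon>1 * (4 + BB) = \<epsilon>" using e1(2) by (simp add: algebra_simps)
      ultimately show "cmod (?f * Qf d l 1 M U s b - Psi l (Suc k) s b) \<le> C * Xi R (Suc k) s b + \<epsilon>" by linarith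
     qed
    qed
    then show "\<exists>J. eventually (\<lambda>n. \<forall>d U M. dgood n d \<longrightarrow> fgood J n d \<longrightarrow>
     U \<subseteq> {1..n} \<longrightarrow> card ({1..n} - U) \<le> j + 2 \<longrightarrow> s + b \<le> (\<Sum>v\<in>{1..n} - U. d v) \<longrightarrow> M \<ge> n + Suc k \<longrightarrow>
     cmod (exp (- w * of_real (ln n)) * Qf d l 1 M U s b - Psi l (Suc k) s b) \<le> C * Xi R (Suc k) s b + \<epsilon>) sequentially" by - (rule exI)
   qed
  qed
 qed
qed

text \<open>The root degrees have the same joint law for every n, so the approximating number in
  \<open>weight_limit\<close> does not depend on n.\<close>

lemma degs_two:
 assumes "n \<ge> 2"
 shows "(\<integral>d. h (d 1) (d 2) \<partial>measure_pmf (degs p n)) = (\<integral>d. h (d 1) (d 2) \<partial>measure_pmf (degs p 2) :: complex)"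
proof -
 have s: "{1..2} \<subseteq> {1..n}" using assms by auto
 have "(\<integral>d. h (d 1) (d 2) \<partial>measure_pmf (degs p 2))
  = (\<integral>d. h (if 1 \<in> {1..2::nat} then d 1 else 0) (if 2 \<in> {1..2::nat} then d 2 else 0) \<partial>measure_pmf (degs p n))"
  unfolding Pi_pmf_subset[OF finite_atLeastAtMost s] integral_map_pmf ..
 then show ?thesis by simp
qed

text \<open>Cauchy criterion: for every precision some number lies close to all late members. It is
  the mean of \<open>Psi l k\<close> at the root degrees, with \<open>R\<close> and \<open>k\<close>
  chosen by \<open>Xi_small\<close>, uniformly in the sizes. Root degrees above \<open>K\<close> and
  bad degree sequences are given up at the cost of their probability.\<close>

lemma weight_limit: "convergent (\<lambda>n. iexp (- (l * (ln n / cc))) * EQ l 1 n)"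
proof -
 define w where "w = \<i> * complex_of_real (l / cc)"
 define x where "x n = exp (- w * of_real (ln (real n))) * EQ l 1 n" for n :: nat
 have w0: "Re w = 0" by (simp add: w_def)
 from Qf_limit[of l, folded w_def] obtain C where C: "C \<ge> 0" and
  lim: "\<forall>R k. R \<ge> 1 \<longrightarrow> (\<forall>s b j \<epsilon>. s \<ge> 1 \<longrightarrow> b \<ge> 1 \<longrightarrow> \<epsilon> > 0 \<longrightarrow> (\<exists>J. eventually (\<lambda>n. \<forall>d U M. dgood n d \<longrightarrow> fgood J n d \<longrightarrow>
  U \<subseteq> {1..n} \<longrightarrow> card ({1..n} - U) \<le> j + 2 \<longrightarrow> s + b \<le> (\<Sum>v\<in>{1..n} - U. d v) \<longrightarrow> M \<ge> n + k \<longrightarrow>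
  cmod (exp (- w * of_real (ln n)) * Qf d l 1 M U s b - Psi l k s b) \<le> C * Xi R k s b + \<epsilon>) sequentially))"
  by (elim exE conjE)
 have near: "\<exists>a. eventually (\<lambda>n. cmod (x n - a) < \<epsilon>) sequentially" if eps: "\<epsilon> > 0" for \<epsilon> :: real
 proof -
  \<comment> \<open>The final bound is 2 e + 2 (e / 4 + e / 4 + e) = 5 e, below 8 e.\<close>
  define e where "e = \<epsilon> / 8"
  have e: "e > 0" using eps by (simp add: e_def)
  from Xi_small[of "e / (C + 1)"] e C obtain R k where R: "R \<ge> 1" and Xs: "\<forall>s b. Xi R k s b \<le> e / (C + 1)" by auto
  have CX: "C * Xi R k s b \<le> e" for s b
  proof -
   have "C * Xi R k s b \<le> C * (e / (C + 1))" by (rule mult_left_mono[OF _ C]) (use Xs in blast)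
   also have "\<dots> \<le> e" using C e by (simp add: field_simps)
   finally show ?thesis .
  qed
  define \<delta> where "\<delta> = e / (4 * \<mu>)"
  have \<delta>: "\<delta> > 0" using e \<mu> by (simp add: \<delta>_def)
  obtain K where K: "(\<integral>i. real i / \<mu> * indicator {K<..} i \<partial>measure_pmf p) \<le> \<delta>"
   using eventually_happens'[OF sequentially_bot size_biased_tail[OF \<delta>]] by blast
  have PK: "(\<integral>i. indicator {K<..} i \<partial>measure_pmf p) \<le> e / 4"
  proof -
   have "(\<integral>i. indicator {K<..} i \<partial>measure_pmf p) \<le> (\<integral>i. \<mu> * (real i / \<mu> * indicator {K<..} i) \<partial>measure_pmf p)"
   proof (rule integral_mono)
    show "integrable (measure_pmf p) (indicator {K<..} :: nat \<Rightarrow> real)"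
     by (rule integrable_pmf_bounded[where B=1]) (simp add: indicator_def)
    show "integrable (measure_pmf p) (\<lambda>i. \<mu> * (real i / \<mu> * indicator {K<..} i))"
     using integrable_mult_indicator[of "{K<..}" "measure_pmf p" "\<lambda>i. real i"] integrable_id \<mu> by (simp add: mult.commute)
    fix i show "indicator {K<..} i \<le> \<mu> * (real i / \<mu> * indicator {K<..} i)" using \<mu> by (auto simp: indicator_def)
   qed
   also have "\<dots> \<le> \<mu> * \<delta>" using K \<mu> by (simp only: integral_mult_right_zero) (rule mult_left_mono, auto)
   also have "\<dots> = e / 4" using \<mu> by (simp add: \<delta>_def)
   finally show ?thesis .
  qed
  let ?Q = "\<lambda>J s b n. \<forall>d U M. dgood n d \<longrightarrow> fgood J n d \<longrightarrow>
  U \<subseteq> {1..n} \<longrightarrow> card ({1..n} - U) \<le> 0 + 2 \<longrightarrow> s + b \<le> (\<Sum>v\<in>{1..n} - U. d v) \<longrightarrow> M \<ge> n + k \<longrightarrow>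
  cmod (exp (- w * of_real (ln n)) * Qf d l 1 M U s b - Psi l k s b) \<le> C * Xi R k s b + e"
  have "\<forall>z\<in>{1..K} \<times> {1..K}. \<exists>J. eventually (\<lambda>n. ?Q J (fst z) (snd z) n) sequentially"
  proof
   fix z assume "z \<in> {1..K} \<times> {1..K}"
   then have z: "fst z \<ge> 1" "snd z \<ge> 1" by auto
   show "\<exists>J. eventually (\<lambda>n. ?Q J (fst z) (snd z) n) sequentially" by (rule lim[rule_format, OF R z e])
  qed
  from bchoice[OF this] obtain Jf where Jf: "\<forall>z\<in>{1..K} \<times> {1..K}. eventually (\<lambda>n. ?Q (Jf z) (fst z) (snd z) n) sequentially" ..
  define J where "J = (\<Sum>z\<in>{1..K} \<times> {1..K}. Jf z)"
  have J: "Jf z \<le> J" if "z \<in> {1..K} \<times> {1..K}" for z unfolding J_def by (rule member_le_sum[OF that]) auto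
  have evall: "eventually (\<lambda>n. \<forall>z\<in>{1..K} \<times> {1..K}. ?Q (Jf z) (fst z) (snd z) n) sequentially"
   by (rule eventually_ball_finite[OF _ Jf]) simp
  define bad where "bad n = {d. \<not> dgood n (fix_parity n d)} \<union> {d. \<not> fgood J n (fix_parity n d)}" for n
  have "(\<lambda>n. measure_pmf.prob (degs p n) {d. \<not> dgood n (fix_parity n d)} + measure_pmf.prob (degs p n) {d. \<not> fgood J n (fix_parity n d)}) \<longlonglongrightarrow> 0"
   by (intro tendsto_add_zero dgood_whp fgood_whp)
  then have evbad: "eventually (\<lambda>n. measure_pmf.prob (degs p n) {d. \<not> dgood n (fix_parity n d)} + measure_pmf.prob (degs p n) {d. \<not> fgood J n (fix_parity n d)} < e) sequentially"
   using e by (intro order_tendstoD) auto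
  define a where "a = (\<integral>d. Psi l k (d 1) (d 2) \<partial>measure_pmf (degs p 2))"
  show ?thesis
  proof (intro exI[of _ a])
   show "eventually (\<lambda>n. cmod (x n - a) < \<epsilon>) sequentially"
    using evall evbad eventually_ge_at_top[of 3] eventually_ge_at_top[of k]
   proof eventually_elim
    case (elim n)
    let ?M = "measure_pmf (degs p n)" and ?f = "exp (- w * of_real (ln n))"
    have nf: "cmod ?f = 1" using w0 by (intro cmod_exp_imag_ln) simp
    have n12: "1 \<in> {1..n}" "2 \<in> {1..n}" using elim(3) by auto
    have a: "a = (\<integral>d. Psi l k (d 1) (d 2) \<partial>?M)" unfolding a_def using elim(3) by (intro degs_two[symmetric]) simp
    let ?ind = "\<lambda>d :: nat \<Rightarrow> nat. indicator {K<..} (d 1) + indicator {K<..} (d 2) + indicator (bad n) d :: real"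
    let ?g = "\<lambda>d. 2 * e + 2 * ?ind d"
    have ib: "integrable ?M (indicator (bad n) :: _ \<Rightarrow> real)" "integrable ?M (\<lambda>d. indicator {K<..} (d 1) :: real)"
     "integrable ?M (\<lambda>d. indicator {K<..} (d 2) :: real)"
     by (rule integrable_pmf_bounded[where B=1]; simp add: indicator_def)+
    have ii: "integrable ?M ?ind" by (intro Bochner_Integration.integrable_add ib)
    have ig: "integrable ?M ?g" by (intro Bochner_Integration.integrable_add Bochner_Integration.integrable_mult_right ii) simp
    have iQ: "integrable ?M (\<lambda>d. Qn l 1 n (fix_parity n d))" by (rule integrable_Qn) simp
    have iPsi: "integrable ?M (\<lambda>d. Psi l k (d 1) (d 2))" by (rule integrable_pmf_bounded[where B=1]) (rule norm_Psi)
    have "x n - a = (\<integral>d. ?f * Qn l 1 n (fix_parity n d) - Psi l k (d 1) (d 2) \<partial>?M)"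
     unfolding x_def EQ_def a integral_mult_right_zero[symmetric]
     by (rule Bochner_Integration.integral_diff[symmetric]) (intro Bochner_Integration.integrable_mult_right iQ iPsi)+
    also have "cmod \<dots> \<le> (\<integral>d. ?g d \<partial>?M)"
    proof (rule pmf_norm_expectation_le[OF _ ig])
     fix d assume d: "d \<in> set_pmf (degs p n)"
     let ?d = "fix_parity n d"
     show "cmod (?f * Qn l 1 n ?d - Psi l k (d 1) (d 2)) \<le> ?g d"
     proof (cases "d 1 \<le> K \<and> d 2 \<le> K \<and> d \<notin> bad n")
      case False
      have "cmod (?f * Qn l 1 n ?d) \<le> 1" unfolding norm_mult nf using norm_Qn[OF _ d, of 1 l] by simp
      then have "cmod (?f * Qn l 1 n ?d - Psi l k (d 1) (d 2)) \<le> 1 + 1"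
       by (intro order_trans[OF norm_triangle_ineq4] add_mono norm_Psi)
      moreover have "2 * 1 \<le> 2 * ?ind d" using False by (intro mult_left_mono) (auto simp: indicator_def)
      moreover have "0 \<le> 2 * e" using e by simp
      ultimately show ?thesis by linarith
     next
      case True
      then have g: "dgood n ?d" "fgood J n ?d" by (auto simp: bad_def)
      have d2: "\<forall>v\<in>{1..n}. ?d v \<ge> 2" using g by (simp add: dgood_def)
      note st = Qn_setup[OF d2 elim(3)]
      have fp: "?d 1 = d 1" "?d 2 = d 2" by (rule fix_parity_two[OF elim(3)])+
      have z: "(d 1, d 2) \<in> {1..K} \<times> {1..K}" using True st(3,4) unfolding fp by auto
      have s5: "d 1 + d 2 \<le> (\<Sum>v\<in>{1..n} - {3..n}. ?d v)" using st(5) unfolding fp .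
      have Mk: "n + k \<le> (\<Sum>v\<in>{1..n}. ?d v)" using st(6) elim(4) by linarith
      have "cmod (?f * Qf ?d l 1 (\<Sum>v\<in>{1..n}. ?d v) {3..n} (d 1) (d 2) - Psi l k (d 1) (d 2)) \<le> C * Xi R k (d 1) (d 2) + e"
       by (rule elim(1)[rule_format, OF z, unfolded fst_conv snd_conv, OF g(1) fgood_mono[OF g(2) J[OF z]] st(1) _ s5 Mk])
        (use st(2) in linarith)
      then have "cmod (?f * Qn l 1 n ?d - Psi l k (d 1) (d 2)) \<le> C * Xi R k (d 1) (d 2) + e" unfolding Qn_def fp .
      moreover have "0 \<le> 2 * ?ind d" by simp
      ultimately show ?thesis using CX[of "d 1" "d 2"] by linarith
     qed
    qed
    also have "(\<integral>d. ?g d \<partial>?M) = 2 * e + 2 * (\<integral>d. ?ind d \<partial>?M)"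
    proof -
     have "(\<integral>d. 2 * e + 2 * F d \<partial>?M) = 2 * e + 2 * (\<integral>d. F d \<partial>?M)" if "integrable ?M F" for F :: "(nat \<Rightarrow> nat) \<Rightarrow> real"
      using that by simp
     from this[OF ii] show ?thesis .
    qed
    also have "(\<integral>d. ?ind d \<partial>?M) = (\<integral>d. indicator {K<..} (d 1) \<partial>?M) + (\<integral>d. indicator {K<..} (d 2) \<partial>?M) + (\<integral>d. indicator (bad n) d \<partial>?M)"
     by (simp only: Bochner_Integration.integral_add Bochner_Integration.integrable_add ib)
    also have "(\<integral>d. indicator {K<..} (d 1) \<partial>?M) = (\<integral>i. indicator {K<..} i \<partial>measure_pmf p :: real)"
     by (rule degs_expectation1(1)[OF n12(1)])
    also have "(\<integral>d. indicator {K<..} (d 2) \<partial>?M) = (\<integral>i. indicator {K<..} i \<partial>measure_pmf p :: real)"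
     by (rule degs_expectation1(1)[OF n12(2)])
    also have "(\<integral>d. indicator (bad n) d \<partial>?M) = measure_pmf.prob (degs p n) (bad n)" by simp
    finally have "cmod (x n - a) \<le> 2 * e + 2 * ((\<integral>i. indicator {K<..} i \<partial>measure_pmf p) + (\<integral>i. indicator {K<..} i \<partial>measure_pmf p) + measure_pmf.prob (degs p n) (bad n))" .
    moreover have "measure_pmf.prob (degs p n) (bad n) < e" unfolding bad_def
     by (rule le_less_trans[OF measure_Un_le elim(2)]) auto
    moreover have "X < 8 * y" if "X \<le> 2 * y + 2 * (a + a + b)" "b < y" "a \<le> y / 4" "0 < y" for X y a b :: real
    proof -
     have "a + a + b \<le> y / 4 + y / 4 + y" by (intro add_mono that(3) less_imp_le[OF that(2)])
     then have "2 * (a + a + b) \<le> 2 * (y / 4 + y / 4 + y)" by (rule mult_left_mono) simp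
     then have "2 * y + 2 * (a + a + b) \<le> 2 * y + 2 * (y / 4 + y / 4 + y)" by (rule add_left_mono)
     from order_trans[OF that(1) this] have "X \<le> 2 * y + 2 * (y / 4 + y / 4 + y)" .
     also have "\<dots> = 5 * y" by simp
     also have "\<dots> < 8 * y" using that(4) by simp
     finally show ?thesis .
    qed
    ultimately have "cmod (x n - a) < 8 * e" using PK e by blast
    then show ?case by (simp add: e_def)
   qed
  qed
 qed
 have "Cauchy x"
 proof (rule metric_CauchyI)
  fix \<epsilon> :: real assume "\<epsilon> > 0"
  then obtain a where "eventually (\<lambda>n. cmod (x n - a) < \<epsilon> / 2) sequentially" using near[of "\<epsilon> / 2"] by auto
  then obtain N where N: "\<And>n. n \<ge> N \<Longrightarrow> cmod (x n - a) < \<epsilon> / 2" unfolding eventually_sequentially by blast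
  show "\<exists>N. \<forall>m\<ge>N. \<forall>n\<ge>N. dist (x m) (x n) < \<epsilon>"
  proof (intro exI[of _ N] allI impI)
   fix m n assume "m \<ge> N" "n \<ge> N"
   then have "dist (x m) a < \<epsilon> / 2" "dist (x n) a < \<epsilon> / 2" using N by (auto simp: dist_norm)
   then show "dist (x m) (x n) < \<epsilon>" by (rule dist_triangle_half_l)
  qed
 qed
 then have "convergent x" by (rule Cauchy_convergent)
 moreover have "x = (\<lambda>n. iexp (- (l * (ln n / cc))) * EQ l 1 n)"
 proof
  fix n
  have "- w * of_real (ln (real n)) = \<i> * of_real (- (l * (ln n / cc)))" by (simp add: w_def)
  then show "x n = iexp (- (l * (ln n / cc))) * EQ l 1 n" by (simp only: x_def)
 qed
 ultimately show ?thesis by simp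
qed

end

section \<open>From characteristic functions to weak convergence\<close>

lemma cdf_limits_eventually:
 fixes V :: "real measure"
 assumes "eventually (\<lambda>n. M n = N n) sequentially" "weak_conv_m N V"
 shows "weak_conv_m M V"
 unfolding weak_conv_m_def weak_conv_def
proof (intro allI impI)
 fix x assume "isCont (cdf V) x"
 then have "(\<lambda>n. cdf (N n) x) \<longlonglongrightarrow> cdf V x" using assms(2) by (simp add: weak_conv_m_def weak_conv_def)
 moreover have "eventually (\<lambda>n. cdf (N n) x = cdf (M n) x) sequentially" using assms(1) by eventually_elim simp
 ultimately show "(\<lambda>n. cdf (M n) x) \<longlonglongrightarrow> cdf V x" by (rule Lim_transform_eventually)
qed

text \<open>The conditional laws are known to be distributions only for large n, once connection has
  positive probability. The remaining ones are replaced by the limit before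
  \<open>levy_continuity\<close> is applied.\<close>

lemma levy_continuity_eventually:
 fixes V :: "real measure"
 assumes ev: "eventually (\<lambda>n. real_distribution (M n)) sequentially" and V: "real_distribution V"
  and lim: "\<And>t. (\<lambda>n. char (M n) t) \<longlonglongrightarrow> char V t"
 shows "weak_conv_m M V"
proof -
 define N where "N n = (if real_distribution (M n) then M n else V)" for n
 have eq: "eventually (\<lambda>n. M n = N n) sequentially" using ev by eventually_elim (simp add: N_def)
 have "weak_conv_m N V"
 proof (rule levy_continuity[OF _ V])
  show "real_distribution (N n)" for n using V by (simp add: N_def)
  show "(\<lambda>n. char (N n) t) \<longlonglongrightarrow> char V t" for t
   by (rule Lim_transform_eventually[OF lim]) (use eq in \<open>eventually_elim, simp\<close>)
 qed
 then show ?thesis by (rule cdf_limits_eventually[OF eq])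
qed

text \<open>Smoothing by an independent Gaussian of variance \<open>u\<^sup>2\<close> turns the bound on the characteristic
 function near 0 into a tail bound.\<close>
lemma tail_from_char:
 assumes M: "real_distribution M" and u: "u > 0" and C: "C \<ge> 0" "r \<ge> 0"
  and bd: "\<forall>l::real. \<bar>l\<bar> \<le> 1 \<longrightarrow> cmod (char M l - 1) \<le> C * \<bar>l\<bar> + r"
 shows "measure M {x. \<bar>x\<bar> \<ge> 1 / u} \<le> 3 * ((C + 2) * u * (\<integral>y. \<bar>y\<bar> \<partial>std_normal_distribution) + r)"
proof -
 let ?N = std_normal_distribution
 interpret M: real_distribution M by (rule M)
 interpret N: real_distribution ?N by (rule real_dist_normal_dist)
 interpret P: pair_prob_space M ?N ..
 let ?f = "\<lambda>x. exp (- (u * x)\<^sup>2 / 2)"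
 have iabs: "integrable ?N (\<lambda>y. \<bar>y\<bar>)"
  using integrable_std_normal_moment_abs[of 1] by (subst integrable_density) auto
 have meas: "(\<lambda>(x, y). iexp (u * x * y)) \<in> borel_measurable (M \<Otimes>\<^sub>M ?N)"
 proof -
  have s: "sets (M \<Otimes>\<^sub>M ?N) = sets (borel \<Otimes>\<^sub>M borel)" by (intro sets_pair_measure_cong) simp_all
  show ?thesis unfolding measurable_cong_sets[OF s refl] by measurable
 qed
 have int: "integrable (M \<Otimes>\<^sub>M ?N) (\<lambda>(x, y). iexp (u * x * y))"
  by (rule P.integrable_const_bound[where B=1]) (use meas in \<open>auto simp: split_beta' simp del: of_real_mult\<close>)
 have "(\<integral>x. complex_of_real (?f x) \<partial>M) = (\<integral>x. (\<integral>y. iexp (u * x * y) \<partial>?N) \<partial>M)"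
 proof (rule Bochner_Integration.integral_cong[OF refl])
  fix x
  have "(\<integral>y. iexp (u * x * y) \<partial>?N) = char ?N (u * x)" unfolding char_def by simp
  then show "complex_of_real (?f x) = (\<integral>y. iexp (u * x * y) \<partial>?N)" by (simp add: char_std_normal_distribution)
 qed
 also have "\<dots> = (\<integral>y. (\<integral>x. iexp (u * x * y) \<partial>M) \<partial>?N)" by (rule P.Fubini_integral[OF int, symmetric])
 also have "\<dots> = (\<integral>y. char M (u * y) \<partial>?N)"
  unfolding char_def by (intro Bochner_Integration.integral_cong refl) (simp add: ac_simps)
 finally have e: "(\<integral>x. complex_of_real (?f x) \<partial>M) = (\<integral>y. char M (u * y) \<partial>?N)" .
 have mc: "(\<lambda>y. char M (u * y)) \<in> borel_measurable borel"
  by (rule measurable_compose[OF _ M.char_measurable]) simp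
 have ic: "integrable ?N (\<lambda>y. char M (u * y))"
  by (rule N.integrable_const_bound[where B=1]) (use mc M.cmod_char_le_1 in auto)
 have fle: "?f x \<le> 1" for x by simp
 have if': "integrable M ?f" by (rule M.integrable_const_bound[where B=1]) auto
 have "(\<integral>x. 1 - ?f x \<partial>M) = 1 - (\<integral>x. ?f x \<partial>M)"
  using if' M.prob_space by (subst Bochner_Integration.integral_diff) auto
 also have "\<dots> \<le> cmod (of_real (1 - (\<integral>x. ?f x \<partial>M)))" unfolding norm_of_real by (rule abs_ge_self)
 also have "complex_of_real (1 - (\<integral>x. ?f x \<partial>M)) = 1 - (\<integral>y. char M (u * y) \<partial>?N)"
  unfolding e[symmetric] of_real_diff integral_complex_of_real by simp
 also have "\<dots> = (\<integral>y. 1 - char M (u * y) \<partial>?N)"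
  using ic N.prob_space by (subst Bochner_Integration.integral_diff) auto
 also have "cmod \<dots> \<le> (\<integral>y. cmod (1 - char M (u * y)) \<partial>?N)" by (rule integral_norm_bound)
 also have "\<dots> \<le> (\<integral>y. (C + 2) * u * \<bar>y\<bar> + r \<partial>?N)"
 proof (rule integral_mono)
  show "integrable ?N (\<lambda>y. cmod (1 - char M (u * y)))" using ic by (intro integrable_norm) simp
  show "integrable ?N (\<lambda>y. (C + 2) * u * \<bar>y\<bar> + r)" using iabs by simp
  fix y
  show "cmod (1 - char M (u * y)) \<le> (C + 2) * u * \<bar>y\<bar> + r"
  proof (cases "\<bar>u * y\<bar> \<le> 1")
   case True
   have "cmod (1 - char M (u * y)) \<le> C * \<bar>u * y\<bar> + r" using bd True by (simp add: norm_minus_commute)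
   also have "\<dots> \<le> (C + 2) * \<bar>u * y\<bar> + r" by (intro add_right_mono mult_right_mono) auto
   finally show ?thesis using u by (simp add: abs_mult ac_simps)
  next
   case False
   have "cmod (1 - char M (u * y)) \<le> 1 + 1"
    by (rule order_trans[OF norm_triangle_ineq4]) (use M.cmod_char_le_1[of "u * y"] in simp)
   also have "\<dots> \<le> 2 * \<bar>u * y\<bar>" using False by simp
   also have "\<dots> \<le> (C + 2) * \<bar>u * y\<bar>" using C by (intro mult_right_mono) auto
   finally show ?thesis using u C by (simp add: abs_mult ac_simps)
  qed
 qed
 also have "\<dots> = (C + 2) * u * (\<integral>y. \<bar>y\<bar> \<partial>?N) + r" using iabs N.prob_space by simp
 finally have up: "(\<integral>x. 1 - ?f x \<partial>M) \<le> (C + 2) * u * (\<integral>y. \<bar>y\<bar> \<partial>?N) + r" .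
 have ms: "{x. \<bar>x\<bar> \<ge> 1 / u} \<in> sets M" by simp
 have "measure M {x. \<bar>x\<bar> \<ge> 1 / u} = (\<integral>x. indicator {x. \<bar>x\<bar> \<ge> 1 / u} x \<partial>M)" using ms by simp
 also have "\<dots> \<le> (\<integral>x. 3 * (1 - ?f x) \<partial>M)"
 proof (rule integral_mono)
  show "integrable M (indicator {x. \<bar>x\<bar> \<ge> 1 / u} :: _ \<Rightarrow> real)"
   using ms by (intro M.integrable_const_bound[where B=1]) (auto simp: indicator_def)
  show "integrable M (\<lambda>x. 3 * (1 - ?f x))" using if' by simp
  fix x
  show "indicator {x. \<bar>x\<bar> \<ge> 1 / u} x \<le> 3 * (1 - ?f x)"
  proof (cases "\<bar>x\<bar> \<ge> 1 / u")
   case True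
   then have "1 \<le> \<bar>u * x\<bar>" using u by (simp add: abs_mult divide_le_eq mult.commute)
   then have "1 \<le> (u * x)\<^sup>2" using one_le_power[of "\<bar>u * x\<bar>" 2] by simp
   then have "?f x \<le> exp (- (1 / 2))" by simp
   also have "\<dots> \<le> 2 / 3" using exp_ge_add_one_self[of "1 / 2"] by (simp add: exp_minus field_simps)
   finally show ?thesis using True by simp
  qed (use fle in simp)
 qed
 also have "\<dots> = 3 * (\<integral>x. 1 - ?f x \<partial>M)" by (rule integral_mult_right_zero)
 finally have fin: "measure M {x. \<bar>x\<bar> \<ge> 1 / u} \<le> 3 * (\<integral>x. 1 - ?f x \<partial>M)" .
 show ?thesis by (rule order_trans[OF fin mult_left_mono[OF up]]) simp
qed

lemma real_distribution_centered:
 assumes "real_distribution M"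
 shows "(\<lambda>K. measure M {- real K<..real K}) \<longlonglongrightarrow> 1"
proof -
 interpret M: real_distribution M by (rule assms)
 have "(\<lambda>K. measure M {- real K<..real K}) \<longlonglongrightarrow> measure M (\<Union>K. {- real K<..real K})"
  by (rule M.finite_Lim_measure_incseq) (auto simp: incseq_def)
 moreover have "(\<Union>K. {- real K<..real K}) = UNIV"
 proof -
  have "\<exists>K. x \<in> {- real K<..real K}" for x
  proof -
   obtain K where "\<bar>x\<bar> < real K" using reals_Archimedean2 by blast
   then show ?thesis by (intro exI[of _ K]) auto
  qed
  then show ?thesis by blast
 qed
 ultimately show ?thesis using M.prob_space M.space_eq_univ by simp
qed

text \<open>Tightness provides a subsequential limit, and its characteristic function must be the
  pointwise limit of the whole sequence, which therefore converges to it. The bound near 0 controls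
  the tails for large n; the finitely many other laws are covered by enlarging the interval.\<close>

lemma weak_limit_exists:
 fixes M :: "nat \<Rightarrow> real measure"
 assumes ev: "eventually (\<lambda>n. real_distribution (M n)) sequentially"
  and conv: "\<And>t. convergent (\<lambda>n. char (M n) t)" and C: "C \<ge> 0" and r: "r \<longlonglongrightarrow> 0"
  and bd: "eventually (\<lambda>n. \<forall>l::real. \<bar>l\<bar> \<le> 1 \<longrightarrow> cmod (char (M n) l - 1) \<le> C * \<bar>l\<bar> + r n) sequentially"
 shows "\<exists>V. real_distribution V \<and> weak_conv_m M V"
proof -
 define N where "N n = (if real_distribution (M n) then M n else std_normal_distribution)" for n
 have eq: "eventually (\<lambda>n. M n = N n) sequentially" using ev by eventually_elim (simp add: N_def)
 have rd: "real_distribution (N n)" for n by (simp add: N_def real_dist_normal_dist)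
 have bdN: "eventually (\<lambda>n. \<forall>l::real. \<bar>l\<bar> \<le> 1 \<longrightarrow> cmod (char (N n) l - 1) \<le> C * \<bar>l\<bar> + \<bar>r n\<bar>) sequentially"
  using bd eq by eventually_elim (auto intro: order_trans[OF _ add_left_mono[OF abs_ge_self]])
 define m where "m = (\<integral>y. \<bar>y\<bar> \<partial>std_normal_distribution)"
 have m: "m \<ge> 0" unfolding m_def by (intro Bochner_Integration.integral_nonneg) simp
 have tight: "tight N" unfolding tight_def
 proof (intro conjI allI impI rd)
  fix \<epsilon> :: real assume eps: "\<epsilon> > 0"
  \<comment> \<open>Makes the linear part of the tail bound at most \<epsilon> / 4; the part from
    \<open>r\<close> is below \<epsilon> / 4 for large n.\<close>
  define u where "u = \<epsilon> / (12 * ((C + 2) * m + 1))"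
  have den: "(C + 2) * m + 1 > 0" using C m by (intro add_nonneg_pos mult_nonneg_nonneg) auto
  have u: "u > 0" using eps den by (simp add: u_def)
  have um: "3 * ((C + 2) * u * m) \<le> \<epsilon> / 4"
  proof -
   have "12 * (e / (12 * D) * D) = e" if "D > 0" for D e :: real using that by simp
   from this[OF den] have "12 * (u * ((C + 2) * m + 1)) = \<epsilon>" unfolding u_def .
   then have "12 * ((C + 2) * u * m) + 12 * u = \<epsilon>" by (simp add: algebra_simps)
   then show ?thesis using u by linarith
  qed
  have "eventually (\<lambda>n. \<bar>r n\<bar> < \<epsilon> / 12) sequentially"
   using tendsto_rabs_zero[OF r] eps by (intro order_tendstoD) auto
  with bdN have "eventually (\<lambda>n. (\<forall>l::real. \<bar>l\<bar> \<le> 1 \<longrightarrow> cmod (char (N n) l - 1) \<le> C * \<bar>l\<bar> + \<bar>r n\<bar>) \<and> \<bar>r n\<bar> < \<epsilon> / 12) sequentially"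
   by (rule eventually_conj)
  then obtain n0 where n0: "\<And>n. n \<ge> n0 \<Longrightarrow> \<forall>l::real. \<bar>l\<bar> \<le> 1 \<longrightarrow> cmod (char (N n) l - 1) \<le> C * \<bar>l\<bar> + \<bar>r n\<bar>"
   "\<And>n. n \<ge> n0 \<Longrightarrow> \<bar>r n\<bar> < \<epsilon> / 12" unfolding eventually_sequentially by blast
  have "\<forall>n\<in>{..<n0}. eventually (\<lambda>K. measure (N n) {- real K<..real K} > 1 - \<epsilon>) sequentially"
   using eps by (intro ballI order_tendstoD(1)[OF real_distribution_centered[OF rd]]) simp
  then have evK: "eventually (\<lambda>K. \<forall>n\<in>{..<n0}. measure (N n) {- real K<..real K} > 1 - \<epsilon>) sequentially"
   by (intro eventually_ball_finite) simp_all
  have "eventually (\<lambda>K. 1 / u \<le> real K) sequentially" using filterlim_real_sequentially by (simp add: filterlim_at_top)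
  then have "eventually (\<lambda>K. (\<forall>n\<in>{..<n0}. measure (N n) {- real K<..real K} > 1 - \<epsilon>) \<and> 1 / u \<le> real K \<and> K \<ge> 1) sequentially"
   using evK eventually_ge_at_top[of 1] by eventually_elim blast
  then obtain K where K: "\<forall>n\<in>{..<n0}. measure (N n) {- real K<..real K} > 1 - \<epsilon>" "1 / u \<le> real K" "K \<ge> 1"
   using eventually_happens'[OF sequentially_bot] by blast
  show "\<exists>a b. a < b \<and> (\<forall>n. measure (N n) {a<..b} > 1 - \<epsilon>)"
  proof (rule exI[of _ "- real K"], rule exI[of _ "real K"], intro conjI allI)
   show "- real K < real K" using K(3) by simp
   fix n
   show "measure (N n) {- real K<..real K} > 1 - \<epsilon>"
   proof (cases "n < n0")
    case True
    then show ?thesis using K(1) by simp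
   next
    case False
    interpret D: real_distribution "N n" by (rule rd)
    have "measure (N n) {x. \<bar>x\<bar> \<ge> 1 / u} \<le> 3 * ((C + 2) * u * m + \<bar>r n\<bar>)"
     unfolding m_def using False by (intro tail_from_char rd u C n0(1)) auto
    then have t: "measure (N n) {x. \<bar>x\<bar> \<ge> 1 / u} < \<epsilon>" using um n0(2)[of n] False eps by simp
    have "1 = measure (N n) ({- real K<..real K} \<union> {x. \<bar>x\<bar> \<ge> 1 / u})"
    proof -
     have "{- real K<..real K} \<union> {x. \<bar>x\<bar> \<ge> 1 / u} = UNIV" using K(2) by auto
     then show ?thesis using D.prob_space D.space_eq_univ by simp
    qed
    also have "\<dots> \<le> measure (N n) {- real K<..real K} + measure (N n) {x. \<bar>x\<bar> \<ge> 1 / u}" by (rule measure_Un_le) auto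
    finally show ?thesis using t by linarith
   qed
  qed
 qed
 from tight_imp_convergent_subsubsequence[OF tight strict_mono_id] obtain q V
  where q: "strict_mono (q :: nat \<Rightarrow> nat)" and V: "real_distribution V" and wc: "weak_conv_m (N \<circ> id \<circ> q) V" by blast
 have "(\<lambda>n. char (M n) t) \<longlonglongrightarrow> char V t" for t
 proof -
  from conv[of t] obtain L where L: "(\<lambda>n. char (M n) t) \<longlonglongrightarrow> L" by (auto simp: convergent_def)
  have "(\<lambda>n. char (N n) t) \<longlonglongrightarrow> L"
   by (rule Lim_transform_eventually[OF L]) (use eq in \<open>eventually_elim, simp\<close>)
  from LIMSEQ_subseq_LIMSEQ[OF this q] have "(\<lambda>k. char (N (q k)) t) \<longlonglongrightarrow> L" by (simp add: o_def)
  moreover have "(\<lambda>k. char ((N \<circ> id \<circ> q) k) t) \<longlonglongrightarrow> char V t" by (rule levy_continuity1[OF _ V wc]) (simp add: rd)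
  then have "(\<lambda>k. char (N (q k)) t) \<longlonglongrightarrow> char V t" by simp
  ultimately have "L = char V t" by (rule LIMSEQ_unique)
  then show ?thesis using L by simp
 qed
 then show ?thesis using V levy_continuity_eventually[OF ev V] by blast
qed

section \<open>The two limit theorems under the degree conditions\<close>

context fpp_prob
begin

lemma prob_conn_half: "eventually (\<lambda>n. measure (weighted_CM n p) (conn_event n p) > 1 / 2) sequentially"
 using prob_conn_lim by (rule order_tendstoD) simp

text \<open>With l = 0 and z = exp (i u / S) the hop count appears as the power z^H, so the
  conditioned characteristic function is the quantity of \<open>hop_limit\<close> divided by the
  probability of connection, which tends to 1.\<close>

theorem hop_count_clt:
 defines "\<alpha> \<equiv> (cc + 1) / cc"
 shows "weak_conv_m (\<lambda>n. distr (condM n p) borel (\<lambda>x. (real (H12 n x) - \<alpha> * ln (real n)) / sqrt (\<alpha> * ln (real n)))) std_normal_distribution"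
proof (rule levy_continuity_eventually[OF _ real_dist_normal_dist])
 let ?X = "\<lambda>n x. (real (H12 n x) - \<alpha> * ln (real n)) / sqrt (\<alpha> * ln (real n))"
 let ?P = "\<lambda>n. measure (weighted_CM n p) (conn_event n p)"
 have a: "\<alpha> > 0" using cc by (simp add: \<alpha>_def)
 have X: "?X n \<in> borel_measurable (weighted_CM n p)" for n
  by (rule measurable_compose[OF measurable_H12, where g="\<lambda>h. (real h - \<alpha> * ln (real n)) / sqrt (\<alpha> * ln (real n))"]) simp
 show "eventually (\<lambda>n. real_distribution (distr (condM n p) borel (?X n))) sequentially"
  using prob_conn_half by eventually_elim (rule real_distribution_cond[OF _ X], linarith)
 fix u :: real
 define S where "S n = sqrt (\<alpha> * ln (real n))" for n :: nat
 have lim: "(\<lambda>n. iexp (- (u * S n)) * EQ 0 (iexp (u / S n)) n / of_real (?P n)) \<longlonglongrightarrow> exp (of_real (- (u\<^sup>2 / 2))) / of_real 1"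
  unfolding S_def \<alpha>_def by (intro tendsto_divide hop_limit tendsto_of_real prob_conn_lim) simp
 have ch: "exp (of_real (- (u\<^sup>2 / 2))) / of_real 1 = char std_normal_distribution u"
  by (simp add: char_std_normal_distribution exp_of_real[symmetric])
 have ev: "eventually (\<lambda>n. iexp (- (u * S n)) * EQ 0 (iexp (u / S n)) n / of_real (?P n) = char (distr (condM n p) borel (?X n)) u) sequentially"
  using prob_conn_half eventually_ge_at_top[of 3]
 proof eventually_elim
  case (elim n)
  have Pn: "?P n > 0" using elim(1) by linarith
  have "ln (real n) > 0" using elim(2) by simp
  then have S: "S n > 0" "\<alpha> * ln (real n) = S n * S n" using a by (auto simp: S_def)
  have "char (distr (condM n p) borel (?X n)) u
   = iexp (- (u * S n)) * (\<integral>x. lexval 0 (iexp (u / S n)) (costs (snd x) (Pth n (fst x))) \<partial>weighted_CM n p) / of_real (?P n)"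
  proof (rule char_cond[OF Pn X])
   fix x
   have e: "u * ?X n x = - (u * S n) + real (H12 n x) * (u / S n)"
    unfolding S_def[symmetric] S(2) using S(1) by (simp add: field_simps)
   have "iexp (u * ?X n x) = iexp (- (u * S n)) * iexp (real (H12 n x) * (u / S n))"
    unfolding e of_real_add distrib_left exp_add ..
   also have "iexp (real (H12 n x) * (u / S n)) = iexp (u / S n) ^ H12 n x"
    unfolding exp_of_nat_mult[symmetric] by (simp add: ac_simps)
   finally show "iexp (u * ?X n x) = iexp (- (u * S n)) * (exp (\<i> * of_real 0 * of_real (W12 n x)) * iexp (u / S n) ^ H12 n x)" by simp
  qed
  moreover have "(\<integral>x. lexval 0 (iexp (u / S n)) (costs (snd x) (Pth n (fst x))) \<partial>weighted_CM n p) = EQ 0 (iexp (u / S n)) n"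
   by (rule EQ_eq[OF elim(2)]) (simp only: norm_exp_i_times order_refl)
  ultimately show ?case by simp
 qed
 show "(\<lambda>n. char (distr (condM n p) borel (?X n)) u) \<longlonglongrightarrow> char std_normal_distribution u"
  by (rule Lim_transform_eventually[OF lim[unfolded ch] ev])
qed

text \<open>Once connection has probability above 1/2, dividing by it at most doubles the bound near
  0 after the deviation of that probability from 1 has been added; this gives the constant
  \<open>2 * C\<close> and the vanishing remainder.\<close>

theorem weight_converges:
 "\<exists>V. real_distribution V \<and> weak_conv_m (\<lambda>n. distr (condM n p) borel (\<lambda>x. W12 n x - ln (real n) / cc)) V"
proof -
 let ?X = "\<lambda>n x. W12 n x - ln (real n) / cc"
 let ?P = "\<lambda>n. measure (weighted_CM n p) (conn_event n p)"
 let ?c = "\<lambda>l n. iexp (- (l * (ln (real n) / cc)))"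
 have X: "?X n \<in> borel_measurable (weighted_CM n p)" for n
  using measurable_W12[of n p] by simp
 have ch: "eventually (\<lambda>n. \<forall>l. char (distr (condM n p) borel (?X n)) l = ?c l n * EQ l 1 n / of_real (?P n)) sequentially"
  using prob_conn_half eventually_ge_at_top[of 3]
 proof eventually_elim
  case (elim n)
  have Pn: "?P n > 0" using elim(1) by linarith
  show ?case
  proof
   fix l
   have "char (distr (condM n p) borel (?X n)) l
    = ?c l n * (\<integral>x. lexval l 1 (costs (snd x) (Pth n (fst x))) \<partial>weighted_CM n p) / of_real (?P n)"
   proof (rule char_cond[OF Pn X])
    fix x
    have e: "l * ?X n x = - (l * (ln (real n) / cc)) + l * W12 n x" by (simp add: algebra_simps)
    show "iexp (l * ?X n x) = ?c l n * (exp (\<i> * of_real l * of_real (W12 n x)) * 1 ^ H12 n x)"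
     unfolding e of_real_add distrib_left exp_add by (simp add: ac_simps)
   qed
   then show "char (distr (condM n p) borel (?X n)) l = ?c l n * EQ l 1 n / of_real (?P n)"
    using EQ_eq[OF elim(2), of 1 l] by simp
  qed
 qed
 from weight_tight obtain C r where C: "C \<ge> 0" and r: "r \<longlonglongrightarrow> 0" and
  bd: "eventually (\<lambda>n. \<forall>l::real. \<bar>l\<bar> \<le> 1 \<longrightarrow> cmod (?c l n * EQ l 1 n - 1) \<le> C * \<bar>l\<bar> + r n) sequentially" by blast
 show ?thesis
 proof (rule weak_limit_exists)
  show "eventually (\<lambda>n. real_distribution (distr (condM n p) borel (?X n))) sequentially"
   using prob_conn_half by eventually_elim (rule real_distribution_cond[OF _ X], linarith)
  show "2 * C \<ge> 0" using C by simp
  have "(\<lambda>n. 2 * (r n + \<bar>1 - ?P n\<bar>)) \<longlonglongrightarrow> 2 * (0 + \<bar>1 - 1\<bar>)" by (intro tendsto_intros r prob_conn_lim)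
  then show "(\<lambda>n. 2 * (r n + \<bar>1 - ?P n\<bar>)) \<longlonglongrightarrow> 0" by simp
  show "convergent (\<lambda>n. char (distr (condM n p) borel (?X n)) l)" for l
  proof -
   from weight_limit[of l] obtain L where "(\<lambda>n. ?c l n * EQ l 1 n) \<longlonglongrightarrow> L" by (auto simp: convergent_def)
   then have "(\<lambda>n. ?c l n * EQ l 1 n / of_real (?P n)) \<longlonglongrightarrow> L / of_real 1"
    by (intro tendsto_divide tendsto_of_real prob_conn_lim) simp_all
   moreover have "eventually (\<lambda>n. ?c l n * EQ l 1 n / of_real (?P n) = char (distr (condM n p) borel (?X n)) l) sequentially"
    using ch by eventually_elim simp
   ultimately have "(\<lambda>n. char (distr (condM n p) borel (?X n)) l) \<longlonglongrightarrow> L / of_real 1" by (rule Lim_transform_eventually)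
   then show ?thesis by (rule convergentI)
  qed
  show "eventually (\<lambda>n. \<forall>l::real. \<bar>l\<bar> \<le> 1 \<longrightarrow> cmod (char (distr (condM n p) borel (?X n)) l - 1) \<le> 2 * C * \<bar>l\<bar> + 2 * (r n + \<bar>1 - ?P n\<bar>)) sequentially"
   using ch bd prob_conn_half
  proof eventually_elim
   case (elim n)
   show ?case
   proof (intro allI impI)
    fix l :: real assume l: "\<bar>l\<bar> \<le> 1"
    define P where "P = ?P n"
    have P: "P > 1 / 2" using elim(3) by (simp add: P_def)
    define E where "E = ?c l n * EQ l 1 n"
    have E: "cmod (E - 1) \<le> C * \<bar>l\<bar> + r n" using elim(2) l by (simp only: E_def)
    have "E / of_real P - 1 = ((E - 1) + of_real (1 - P)) / of_real P" using P by (simp add: field_simps)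
    also have "cmod \<dots> = cmod ((E - 1) + of_real (1 - P)) / P" using P by (simp add: norm_divide)
    also have "\<dots> \<le> (cmod (E - 1) + \<bar>1 - P\<bar>) / (1 / 2)"
    proof (rule frac_le)
     show "cmod ((E - 1) + of_real (1 - P)) \<le> cmod (E - 1) + \<bar>1 - P\<bar>"
      by (rule order_trans[OF norm_triangle_ineq]) (simp only: norm_of_real order_refl)
    qed (use P in auto)
    also have "\<dots> \<le> 2 * C * \<bar>l\<bar> + 2 * (r n + \<bar>1 - P\<bar>)" using E by simp
    finally show "cmod (char (distr (condM n p) borel (?X n)) l - 1) \<le> 2 * C * \<bar>l\<bar> + 2 * (r n + \<bar>1 - ?P n\<bar>)"
     using elim(1) by (simp only: E_def P_def)
   qed
  qed
 qed
qed

end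

section \<open>Verification of the degree conditions\<close>

lemma pmf_expectation_pos:
 assumes f: "integrable (measure_pmf q) f" "\<And>x. x \<in> set_pmf q \<Longrightarrow> f x \<ge> (0::real)" and k: "k \<in> set_pmf q" "f k > 0"
 shows "(\<integral>x. f x \<partial>measure_pmf q) > 0"
proof -
 have nn: "AE x in measure_pmf q. 0 \<le> f x" using f(2) by (simp add: AE_measure_pmf_iff)
 have "(\<integral>x. f x \<partial>measure_pmf q) \<noteq> 0"
 proof
  assume "(\<integral>x. f x \<partial>measure_pmf q) = 0"
  then have "AE x in measure_pmf q. f x = 0" using integral_nonneg_eq_0_iff_AE[OF f(1) nn] by simp
  then show False using k by (auto simp: AE_measure_pmf_iff)
 qed
 moreover have "(\<integral>x. f x \<partial>measure_pmf q) \<ge> 0" by (rule integral_nonneg_AE[OF nn])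
 ultimately show ?thesis by linarith
qed

theorem theorem3p1:
  fixes p :: "nat pmf" and c \<tau> :: real
  assumes support: "set_pmf p \<subseteq> {2..}"
    and nondeg: "\<not> (\<exists>k. set_pmf p = {k})"
    and c_pos: "c > 0" and tau: "\<tau> > 3"
    and tail: "\<And>x. x > 0 \<Longrightarrow> 1 - cdf_pmf p x \<le> c * x powr (-(\<tau> - 1))"
  defines "\<nu> \<equiv> measure_pmf.expectation p (\<lambda>k. real k * (real k - 1)) / measure_pmf.expectation p real"
  defines "\<alpha> \<equiv> \<nu> / (\<nu> - 1)"
  shows "1 < \<alpha>
     \<and> weak_conv_m
         (\<lambda>n. distr (uniform_measure (weighted_CM n p) (conn_event n p)) borel
                 (\<lambda>x. (real (H12 n x) - \<alpha> * ln (real n)) / sqrt (\<alpha> * ln (real n))))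
         std_normal_distribution
     \<and> (\<exists>V. real_distribution V \<and>
          weak_conv_m
            (\<lambda>n. distr (uniform_measure (weighted_CM n p) (conn_event n p)) borel
                    (\<lambda>x. W12 n x - ln (real n) / (\<nu> - 1)))
            V)"
proof -
 \<comment> \<open>Small enough for (2 + \<eta>)(1 + \<eta>) = 2 + 3 \<eta> + \<eta>^2 < \<tau> - 1,
   by 4 \<eta> <= \<tau> - 3 and \<eta>^2 < \<eta>.\<close>
 define \<eta> where "\<eta> = min (1 / 4) ((\<tau> - 3) / 4)"
 have \<eta>: "0 < \<eta>" "\<eta> \<le> 1 / 4" "\<eta> \<le> (\<tau> - 3) / 4"
  unfolding \<eta>_def by (simp add: tau, rule min.cobounded1, rule min.cobounded2)
 have ex: "0 \<le> (2 + \<eta>) * (1 + \<eta>)" "(2 + \<eta>) * (1 + \<eta>) < \<tau> - 1"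
 proof -
  show "0 \<le> (2 + \<eta>) * (1 + \<eta>)" using \<eta> by simp
  have "\<eta> * \<eta> \<le> 1 / 4 * \<eta>" using \<eta> by (intro mult_right_mono) auto
  moreover have "(2 + \<eta>) * (1 + \<eta>) = 2 + 3 * \<eta> + \<eta> * \<eta>" by (simp add: algebra_simps)
  moreover have "1 / 4 * \<eta> < \<eta>" "4 * \<eta> \<le> \<tau> - 3" using \<eta> by simp_all
  ultimately show "(2 + \<eta>) * (1 + \<eta>) < \<tau> - 1" by linarith
 qed
 note moment = finite_moment[OF c_pos tail]
 have mom: "integrable (measure_pmf p) (\<lambda>k. real k powr ((2 + \<eta>) * (1 + \<eta>)))" by (rule moment[OF _ ex]) simp
 have i1: "integrable (measure_pmf p) real"
 proof -
  have "integrable (measure_pmf p) (\<lambda>k. real k powr 1)" by (rule moment) (use tau in auto)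
  then show ?thesis by simp
 qed
 have i2: "integrable (measure_pmf p) (\<lambda>k. (real k)\<^sup>2)"
 proof -
  have "integrable (measure_pmf p) (\<lambda>k. real k powr 2)" by (rule moment) (use tau in auto)
  moreover have "real k powr 2 = (real k)\<^sup>2" for k by (cases "k = 0") auto
  ultimately show ?thesis by simp
 qed
 \<comment> \<open>Nondegeneracy and minimal degree 2 provide a degree at least 3, which makes m2 -
   2 \<mu> positive, that is \<nu> > 1.\<close>
 obtain k3 where k3: "k3 \<in> set_pmf p" "k3 \<ge> 3"
 proof -
  have "\<exists>k\<in>set_pmf p. k \<noteq> 2"
  proof (rule ccontr)
   assume "\<not> (\<exists>k\<in>set_pmf p. k \<noteq> 2)"
   then have "set_pmf p \<subseteq> {2}" by auto
   then have "set_pmf p = {2}" using set_pmf_not_empty[of p] by (simp only: subset_singleton_iff simp_thms)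
   then show False using nondeg by blast
  qed
  then obtain k where k: "k \<in> set_pmf p" "k \<noteq> 2" by blast
  moreover have "k \<ge> 2" using k(1) support by auto
  ultimately show ?thesis using that[of k] by simp
 qed
 define \<mu> where "\<mu> = (\<integral>k. real k \<partial>measure_pmf p)"
 define m2 where "m2 = (\<integral>k. (real k)\<^sup>2 \<partial>measure_pmf p)"
 define m3 where "m3 = (\<integral>k. (if k \<ge> 3 then real k else 0) \<partial>measure_pmf p)"
 define m4 where "m4 = (\<integral>k. real k powr (2 + \<eta>) \<partial>measure_pmf p)"
 have \<mu>: "\<mu> > 0" unfolding \<mu>_def by (rule pmf_expectation_pos[OF i1 _ k3(1)]) (use k3 in auto)
 have "integrable (measure_pmf p) (\<lambda>k. if k \<ge> 3 then real k else 0)"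
  by (rule Bochner_Integration.integrable_bound[OF i1]) auto
 then have m3: "m3 > 0" unfolding m3_def by (rule pmf_expectation_pos[OF _ _ k3(1)]) (use k3 in simp_all)
 have "(\<integral>k. (real k)\<^sup>2 - 2 * real k \<partial>measure_pmf p) > 0"
 proof (rule pmf_expectation_pos[OF _ _ k3(1)])
  show "integrable (measure_pmf p) (\<lambda>k. (real k)\<^sup>2 - 2 * real k)" using i1 i2 by simp
  show "0 \<le> (real k)\<^sup>2 - 2 * real k" if "k \<in> set_pmf p" for k
  proof -
   have "k \<ge> 2" using that support by auto
   then show ?thesis by (simp add: power2_eq_square mult_right_mono)
  qed
  have "2 * real k3 < real k3 * real k3" using k3(2) by (intro mult_strict_right_mono) auto
  then show "0 < (real k3)\<^sup>2 - 2 * real k3" by (simp add: power2_eq_square)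
 qed
 then have m2: "m2 > 2 * \<mu>" using i1 i2 by (simp add: m2_def \<mu>_def)
 define Kg where "Kg = Max {1, 8 * (m4 + 1), 2 + 2 * sqrt (m2 + 1), 2 / m3}"
 have Kg: "Kg \<ge> 1" "Kg \<ge> 8 * (m4 + 1)" "Kg \<ge> 2 + 2 * sqrt (m2 + 1)" "Kg \<ge> 2 / m3"
  unfolding Kg_def by (rule Max_ge; simp)+
 have Kg3: "Kg * m3 \<ge> 2" using Kg(4) m3 by (simp add: divide_le_eq)
 interpret fpp_prob p \<mu> m2 \<eta> Kg
  by unfold_locales (use \<mu> m2 \<eta> Kg support mom Kg3 in \<open>simp_all add: \<mu>_def m2_def m3_def m4_def\<close>)
 have "measure_pmf.expectation p (\<lambda>k. real k * (real k - 1)) = m2 - \<mu>"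
  using i1 i2 by (simp add: m2_def \<mu>_def right_diff_distrib power2_eq_square)
 then have "\<nu> = (m2 - \<mu>) / \<mu>" unfolding \<nu>_def \<mu>_def by simp
 then have nu: "\<nu> = cc + 1" using \<mu> by (simp add: cc_def field_simps)
 have al: "\<alpha> = (cc + 1) / cc" by (simp add: \<alpha>_def nu)
 have "1 < \<alpha>" unfolding al using cc by simp
 moreover have "\<nu> - 1 = cc" by (simp add: nu)
 ultimately show ?thesis using hop_count_clt weight_converges unfolding al condM_def by simp
qed

end
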